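(* Let $\mathfrak{g}$ be the complex simple Lie algebra of type $G_2$. Up to conjugation by the adjoint group of $\mathfrak{g}$ and interchange of the two members, the only semisimple dual pair $(\mathfrak{a},\mathfrak{b})$ in $\mathfrak{g}$ with $\mathfrak{a}$ and $\mathfrak{b}$ nonzero is $(A_1,\tilde{A_1})$, where $A_1\oplus\tilde{A_1}$ is the regular subalgebra of rank $2$ of $\mathfrak{g}$ of type $A_1\oplus A_1$, $A_1$ is its ideal generated by the root spaces of a long root (index $1$) and $\tilde{A_1}$ is its ideal generated by the root spaces of a short root (index $3$).
   Context: All Lie algebras are finite-dimensional over $\mathbb{C}$. A (reductive) dual pair in a reductive Lie algebra $\mathfrak{g}$ is a pair $(\mathfrak{a},\mathfrak{b})$ of subalgebras that are reductive in $\mathfrak{g}$ and satisfy $\mathfrak{a}=\mathfrak{z}_{\mathfrak{g}}(\mathfrak{b})$ and $\mathfrak{b}=\mathfrak{z}_{\mathfrak{g}}(\mathfrak{a})$, where $\mathfrak{z}_{\mathfrak{g}}(\cdot)$ is the centralizer in $\mathfrak{g}$. The dual pair is semisimple if $\mathfrak{a}$ and $\mathfrak{b}$ are semisimple. A subalgebra of $\mathfrak{g}$ is regular if it is invariant under $\mathrm{ad}\,\mathfrak{h}$ for some Cartan subalgebra $\mathfrak{h}$ of $\mathfrak{g}$. Index: for a simple Lie algebra $\mathfrak{g}$ let $(\cdot,\cdot)_{\mathfrak{g}}$ be the invariant symmetric bilinear form normalized so that $(\beta^\vee,\beta^\vee)_{\mathfrak{g}}=2$ for each short coroot $\beta^\vee$.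 The index of a simple subalgebra $\mathfrak{a}\subset\mathfrak{g}$ is the constant $i$ with $(x,y)_{\mathfrak{g}}=i\,(x,y)_{\mathfrak{a}}$ for $x,y\in\mathfrak{a}$. *)

theory Defs
  imports Complex_Main
begin

class complex_space = ab_group_add +
  fixes scaleC :: "complex \<Rightarrow> 'a \<Rightarrow> 'a" (infixr "*\<^sub>C" 75)
  assumes scaleC_add_right: "c *\<^sub>C (x + y) = c *\<^sub>C x + c *\<^sub>C y"
    and scaleC_add_left: "(c + d) *\<^sub>C x = c *\<^sub>C x + d *\<^sub>C x"
    and scaleC_scaleC: "c *\<^sub>C (d *\<^sub>C x) = (c * d) *\<^sub>C x"
    and scaleC_one: "1 *\<^sub>C x = x"

class complex_lie_algebra = complex_space +
  fixes bracket :: "'a \<Rightarrow> 'a \<Rightarrow> 'a"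
  assumes finite_dimensional: "\<exists>B. finite B \<and> (\<forall>x. \<exists>c. x = (\<Sum>b\<in>B. c b *\<^sub>C b))"
    and bracket_add_left: "bracket (x + y) z = bracket x z + bracket y z"
    and bracket_scaleC_left: "bracket (c *\<^sub>C x) y = c *\<^sub>C bracket x y"
    and bracket_add_right: "bracket x (y + z) = bracket x y + bracket x z"
    and bracket_scaleC_right: "bracket x (c *\<^sub>C y) = c *\<^sub>C bracket x y"
    and bracket_self: "bracket x x = 0"
    and jacobi: "bracket x (bracket y z) + bracket y (bracket z x) + bracket z (bracket x y) = 0"

global_interpretation lie: vector_space "scaleC :: complex \<Rightarrow> 'g \<Rightarrow> 'g::complex_lie_algebra"
  by unfold_locales
    (simp_all add: scaleC_add_right scaleC_add_left scaleC_scaleC scaleC_one)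

text \<open>The ambient Lie algebra \<open>\<gg>\<close> is the whole type; subalgebras are sets. Notions that make
  sense for an arbitrary Lie algebra take the underlying subalgebra \<open>L\<close> as an argument, so that
  they apply to \<open>\<gg>\<close> itself (\<open>L = UNIV\<close>) and to its subalgebras.\<close>

definition subalgebra :: "'g::complex_lie_algebra set \<Rightarrow> bool" where
  "subalgebra L \<longleftrightarrow> lie.subspace L \<and> (\<forall>x\<in>L. \<forall>y\<in>L. bracket x y \<in> L)"

definition lie_ideal :: "'g::complex_lie_algebra set \<Rightarrow> 'g set \<Rightarrow> bool" where
  "lie_ideal L I \<longleftrightarrow> lie.subspace I \<and> I \<subseteq> L \<and> (\<forall>x\<in>L. \<forall>y\<in>I. bracket x y \<in> I)"

definition ideal_generated :: "'g::complex_lie_algebra set \<Rightarrow> 'g set \<Rightarrow> 'g set" where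
  "ideal_generated L S = \<Inter> {I. lie_ideal L I \<and> S \<subseteq> I}"

definition direct_sum :: "'g::complex_lie_algebra set \<Rightarrow> 'g set \<Rightarrow> 'g set \<Rightarrow> bool" where
  "direct_sum M A B \<longleftrightarrow> M = {a + b | a b. a \<in> A \<and> b \<in> B} \<and> A \<inter> B = {0}"

definition bracket_span :: "'g::complex_lie_algebra set \<Rightarrow> 'g set \<Rightarrow> 'g set" where
  "bracket_span S T = lie.span {bracket x y | x y. x \<in> S \<and> y \<in> T}"

definition abelian_lie :: "'g::complex_lie_algebra set \<Rightarrow> bool" where
  "abelian_lie L \<longleftrightarrow> (\<forall>x\<in>L. \<forall>y\<in>L. bracket x y = 0)"

definition solvable_lie :: "'g::complex_lie_algebra set \<Rightarrow> bool" where
  "solvable_lie L \<longleftrightarrow> (\<exists>n. ((\<lambda>D. bracket_span D D) ^^ n) L = {0})"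

definition nilpotent_lie :: "'g::complex_lie_algebra set \<Rightarrow> bool" where
  "nilpotent_lie L \<longleftrightarrow> (\<exists>n. (bracket_span L ^^ n) L = {0})"

definition semisimple_lie :: "'g::complex_lie_algebra set \<Rightarrow> bool" where
  "semisimple_lie L \<longleftrightarrow> subalgebra L \<and> (\<forall>I. lie_ideal L I \<and> solvable_lie I \<longrightarrow> I = {0})"

definition simple_lie :: "'g::complex_lie_algebra set \<Rightarrow> bool" where
  "simple_lie L \<longleftrightarrow> subalgebra L \<and> \<not> abelian_lie L \<and>
     (\<forall>I. lie_ideal L I \<longrightarrow> I = {0} \<or> I = L)"


subsection \<open>Dual pairs\<close>

definition centralizer :: "'g::complex_lie_algebra set \<Rightarrow> 'g set" where
  "centralizer S = {x. \<forall>s\<in>S. bracket x s = 0}"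

text \<open>Reductive in \<open>\<gg>\<close>: the adjoint representation of \<open>\<aa>\<close> on \<open>\<gg>\<close> is completely reducible.\<close>

definition reductive_in :: "'g::complex_lie_algebra set \<Rightarrow> bool" where
  "reductive_in \<aa> \<longleftrightarrow> subalgebra \<aa> \<and>
     (\<forall>V. lie.subspace V \<and> (\<forall>x\<in>\<aa>. \<forall>v\<in>V. bracket x v \<in> V) \<longrightarrow>
        (\<exists>W. lie.subspace W \<and> (\<forall>x\<in>\<aa>. \<forall>w\<in>W. bracket x w \<in> W) \<and> direct_sum UNIV V W))"

definition dual_pair :: "'g::complex_lie_algebra set \<Rightarrow> 'g set \<Rightarrow> bool" where
  "dual_pair \<aa> \<bb> \<longleftrightarrow> reductive_in \<aa> \<and> reductive_in \<bb> \<and>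
     \<aa> = centralizer \<bb> \<and> \<bb> = centralizer \<aa>"

definition semisimple_dual_pair :: "'g::complex_lie_algebra set \<Rightarrow> 'g set \<Rightarrow> bool" where
  "semisimple_dual_pair \<aa> \<bb> \<longleftrightarrow> dual_pair \<aa> \<bb> \<and> semisimple_lie \<aa> \<and> semisimple_lie \<bb>"


subsection \<open>Cartan subalgebras, roots and coroots\<close>

definition cartan_subalgebra :: "'g::complex_lie_algebra set \<Rightarrow> 'g set \<Rightarrow> bool" where
  "cartan_subalgebra L H \<longleftrightarrow> subalgebra H \<and> H \<subseteq> L \<and> nilpotent_lie H \<and>
     {x \<in> L. \<forall>h\<in>H. bracket x h \<in> H} = H"

definition has_rank :: "'g::complex_lie_algebra set \<Rightarrow> nat \<Rightarrow> bool" where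
  "has_rank L r \<longleftrightarrow> (\<exists>H. cartan_subalgebra L H \<and> lie.dim H = r)"

text \<open>\<open>\<mm>\<close> is regular if \<open>regular_wrt H \<mm>\<close> holds for some \<open>H\<close>.\<close>

definition regular_wrt :: "'g::complex_lie_algebra set \<Rightarrow> 'g set \<Rightarrow> bool" where
  "regular_wrt H \<mm> \<longleftrightarrow> cartan_subalgebra UNIV H \<and> subalgebra \<mm> \<and>
     (\<forall>h\<in>H. \<forall>x\<in>\<mm>. bracket h x \<in> \<mm>)"

text \<open>Linear forms on \<open>H\<close> are extended by \<open>0\<close> outside \<open>H\<close>, so that equality of functions is
  equality of linear forms.\<close>

definition dual_space :: "'g::complex_lie_algebra set \<Rightarrow> ('g \<Rightarrow> complex) set" where
  "dual_space H = {\<alpha>. (\<forall>x\<in>H. \<forall>y\<in>H. \<alpha> (x + y) = \<alpha> x + \<alpha> y) \<and>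
     (\<forall>c. \<forall>x\<in>H. \<alpha> (c *\<^sub>C x) = c * \<alpha> x) \<and> (\<forall>x. x \<notin> H \<longrightarrow> \<alpha> x = 0)}"

definition root_space ::
    "'g::complex_lie_algebra set \<Rightarrow> 'g set \<Rightarrow> ('g \<Rightarrow> complex) \<Rightarrow> 'g set" where
  "root_space L H \<alpha> = {x \<in> L. \<forall>h\<in>H. bracket h x = \<alpha> h *\<^sub>C x}"

definition roots :: "'g::complex_lie_algebra set \<Rightarrow> 'g set \<Rightarrow> ('g \<Rightarrow> complex) set" where
  "roots L H = {\<alpha> \<in> dual_space H. \<alpha> \<noteq> (\<lambda>_. 0) \<and> root_space L H \<alpha> \<noteq> {0}}"

definition coroot ::
    "'g::complex_lie_algebra set \<Rightarrow> 'g set \<Rightarrow> ('g \<Rightarrow> complex) \<Rightarrow> 'g" where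
  "coroot L H \<alpha> = (THE h.
     h \<in> bracket_span (root_space L H \<alpha>) (root_space L H (\<lambda>x. - \<alpha> x)) \<and> \<alpha> h = 2)"

text \<open>The trace of an endomorphism \<open>f\<close> of the subspace \<open>V\<close>.\<close>

definition trace_on :: "'g::complex_lie_algebra set \<Rightarrow> ('g \<Rightarrow> 'g) \<Rightarrow> complex" where
  "trace_on V f =
     (let B = (SOME B. B \<subseteq> V \<and> lie.independent B \<and> lie.span B = V)
      in \<Sum>b\<in>B. lie.representation B (f b) b)"

definition killing_form :: "'g::complex_lie_algebra set \<Rightarrow> 'g \<Rightarrow> 'g \<Rightarrow> complex" where
  "killing_form L x y = trace_on L (\<lambda>z. bracket x (bracket y z))"

text \<open>Lengths of roots are measured with the form on \<open>H\<^sup>*\<close> induced by the Killing form: \<open>\<alpha>\<close>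
  corresponds to \<open>t\<^sub>\<alpha> \<in> H\<close> with \<open>\<kappa>(t\<^sub>\<alpha>, h) = \<alpha>(h)\<close>. Squared lengths are positive reals, hence the
  use of \<^const>\<open>Re\<close>. If all roots have the same length, all of them are both long and short.\<close>

definition root_sq_length ::
    "'g::complex_lie_algebra set \<Rightarrow> 'g set \<Rightarrow> ('g \<Rightarrow> complex) \<Rightarrow> real" where
  "root_sq_length L H \<alpha> =
     (let t = (THE t. t \<in> H \<and> (\<forall>h\<in>H. killing_form L t h = \<alpha> h)) in Re (killing_form L t t))"

definition long_root ::
    "'g::complex_lie_algebra set \<Rightarrow> 'g set \<Rightarrow> ('g \<Rightarrow> complex) \<Rightarrow> bool" where
  "long_root L H \<alpha> \<longleftrightarrow> \<alpha> \<in> roots L H \<and>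
     (\<forall>\<beta>\<in>roots L H. root_sq_length L H \<beta> \<le> root_sq_length L H \<alpha>)"

definition short_root ::
    "'g::complex_lie_algebra set \<Rightarrow> 'g set \<Rightarrow> ('g \<Rightarrow> complex) \<Rightarrow> bool" where
  "short_root L H \<alpha> \<longleftrightarrow> \<alpha> \<in> roots L H \<and>
     (\<forall>\<beta>\<in>roots L H. root_sq_length L H \<alpha> \<le> root_sq_length L H \<beta>)"

definition short_coroot :: "'g::complex_lie_algebra set \<Rightarrow> 'g set \<Rightarrow> 'g \<Rightarrow> bool" where
  "short_coroot L H c \<longleftrightarrow> c \<in> coroot L H ` roots L H \<and>
     (\<forall>d\<in>coroot L H ` roots L H. Re (killing_form L c c) \<le> Re (killing_form L d d))"


subsection \<open>Type of a semisimple Lie algebra\<close>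

definition simple_system ::
    "'g::complex_lie_algebra set \<Rightarrow> 'g set \<Rightarrow> nat \<Rightarrow> (nat \<Rightarrow> 'g \<Rightarrow> complex) \<Rightarrow> bool" where
  "simple_system L H n \<gamma> \<longleftrightarrow> (\<forall>i<n. \<gamma> i \<in> roots L H) \<and>
     (\<forall>c. (\<forall>x\<in>H. (\<Sum>i<n. c i * \<gamma> i x) = 0) \<longrightarrow> (\<forall>i<n. c i = 0)) \<and>
     (\<forall>\<alpha>\<in>roots L H. \<exists>k::nat \<Rightarrow> nat.
        (\<forall>x\<in>H. \<alpha> x = (\<Sum>i<n. of_nat (k i) * \<gamma> i x)) \<or>
        (\<forall>x\<in>H. \<alpha> x = - (\<Sum>i<n. of_nat (k i) * \<gamma> i x)))"

definition of_type :: "'g::complex_lie_algebra set \<Rightarrow> int list list \<Rightarrow> bool" where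
  "of_type L A \<longleftrightarrow> semisimple_lie L \<and>
     (\<exists>H \<gamma>. cartan_subalgebra L H \<and> simple_system L H (length A) \<gamma> \<and>
        (\<forall>i<length A. \<forall>j<length A. \<gamma> i (coroot L H (\<gamma> j)) = of_int (A ! i ! j)))"

definition type_A1 :: "int list list" where "type_A1 = [[2]]"
definition type_A1_A1 :: "int list list" where "type_A1_A1 = [[2, 0], [0, 2]]"
definition type_G2 :: "int list list" where "type_G2 = [[2, -1], [-3, 2]]"


subsection \<open>Index\<close>

definition invariant_form ::
    "'g::complex_lie_algebra set \<Rightarrow> ('g \<Rightarrow> 'g \<Rightarrow> complex) \<Rightarrow> bool" where
  "invariant_form L B \<longleftrightarrow>
     (\<forall>x\<in>L. \<forall>y\<in>L. \<forall>z\<in>L. B (x + y) z = B x z + B y z) \<and>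
     (\<forall>c. \<forall>x\<in>L. \<forall>y\<in>L. B (c *\<^sub>C x) y = c * B x y) \<and>
     (\<forall>x\<in>L. \<forall>y\<in>L. B x y = B y x) \<and>
     (\<forall>x\<in>L. \<forall>y\<in>L. \<forall>z\<in>L. B (bracket x y) z = B x (bracket y z))"

definition normalized_form ::
    "'g::complex_lie_algebra set \<Rightarrow> ('g \<Rightarrow> 'g \<Rightarrow> complex) \<Rightarrow> bool" where
  "normalized_form L B \<longleftrightarrow> invariant_form L B \<and>
     (\<forall>H c. cartan_subalgebra L H \<and> short_coroot L H c \<longrightarrow> B c c = 2)"

text \<open>For simple \<open>\<gg>\<close> and \<open>\<aa>\<close> the normalized forms exist and are unique on \<open>\<gg>\<close> and \<open>\<aa>\<close>.\<close>

definition has_index :: "'g::complex_lie_algebra set \<Rightarrow> complex \<Rightarrow> bool" where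
  "has_index \<aa> i \<longleftrightarrow> simple_lie \<aa> \<and>
     (\<exists>B C. normalized_form UNIV B \<and> normalized_form \<aa> C \<and> (\<forall>x\<in>\<aa>. \<forall>y\<in>\<aa>. B x y = i * C x y))"


subsection \<open>The adjoint group\<close>

text \<open>\<open>exp(ad x) y = (\<Sum>k. (ad x)\<^sup>k y / k!)\<close>; convergence in the finite-dimensional space \<open>\<gg>\<close> is
  convergence under every linear functional.\<close>

definition exp_ad :: "'g::complex_lie_algebra \<Rightarrow> 'g \<Rightarrow> 'g" where
  "exp_ad x y = (THE z. \<forall>f. Vector_Spaces.linear scaleC (*) f \<longrightarrow>
     (\<lambda>k. f ((bracket x ^^ k) y) / fact k) sums f z)"

text \<open>The group generated by all \<open>exp(ad x)\<close>; it is closed under inverses because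
  \<open>exp(ad x)\<^sup>-\<^sup>1 = exp(ad(-x))\<close>.\<close>

inductive_set adjoint_group :: "('g::complex_lie_algebra \<Rightarrow> 'g) set" where
  one: "id \<in> adjoint_group"
| exp_ad: "\<phi> \<in> adjoint_group \<Longrightarrow> exp_ad x \<circ> \<phi> \<in> adjoint_group"


subsection \<open>The regular subalgebra of type \<open>A\<^sub>1 \<oplus> A\<^sub>1\<close>\<close>

definition regular_A1_A1 :: "'g::complex_lie_algebra set \<Rightarrow> 'g set \<Rightarrow> bool" where
  "regular_A1_A1 H \<mm> \<longleftrightarrow> regular_wrt H \<mm> \<and> has_rank \<mm> 2 \<and> of_type \<mm> type_A1_A1"

text \<open>The root spaces of \<open>\<gg>\<close> belonging to the root \<open>\<alpha>\<close>, i.e. those for \<open>\<alpha>\<close> and \<open>-\<alpha>\<close>.\<close>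

definition root_spaces_pm ::
    "'g::complex_lie_algebra set \<Rightarrow> ('g \<Rightarrow> complex) \<Rightarrow> 'g set" where
  "root_spaces_pm H \<alpha> = root_space UNIV H \<alpha> \<union> root_space UNIV H (\<lambda>x. - \<alpha> x)"

text \<open>\<open>(\<aa>, \<bb>)\<close> is a pair \<open>(A\<^sub>1, A\<^sub>1~)\<close> of ideals of the regular subalgebra \<open>\<mm>\<close>.\<close>

definition long_short_ideals ::
    "'g::complex_lie_algebra set \<Rightarrow> 'g set \<Rightarrow> 'g set \<Rightarrow> 'g set \<Rightarrow> bool" where
  "long_short_ideals H \<mm> \<aa> \<bb> \<longleftrightarrow> regular_A1_A1 H \<mm> \<and> (\<exists>\<alpha> \<beta>.
     long_root UNIV H \<alpha> \<and> root_spaces_pm H \<alpha> \<subseteq> \<mm> \<and>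
     short_root UNIV H \<beta> \<and> root_spaces_pm H \<beta> \<subseteq> \<mm> \<and>
     \<aa> = ideal_generated \<mm> (root_spaces_pm H \<alpha>) \<and>
     \<bb> = ideal_generated \<mm> (root_spaces_pm H \<beta>))"

end

theory Submission
  imports Defs "HOL-Computational_Algebra.Fundamental_Theorem_Algebra"
begin

text \<open>
  Inside \<open>\<gg>\<close> of type \<open>G\<^sub>2\<close> a root \<open>r\<close> spans together with \<open>-r\<close> a subalgebra \<open>slr r\<close> isomorphic to \<open>sl\<^sub>2\<close>.
  The roots orthogonal to \<open>r\<close> are \<open>s\<close> and \<open>-s\<close> for one root \<open>s\<close> of the other length, and
  \<open>r \<plusminus> s\<close> are not roots; hence \<open>slr r\<close> and \<open>slr s\<close> are each other's centralizers
  (\<open>centralizer_slr\<close>). They are reductive in \<open>\<gg>\<close> by complete reducibility for \<open>sl\<^sub>2\<close>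
  (\<open>complement\<close>). The index of \<open>slr r\<close> compares Killing squares of coroots, which for \<open>G\<^sub>2\<close>
  are 16 for long and 48 for short roots (\<open>slr_index\<close>, \<open>\<kappa>_hr\<close>).

  Conversely let \<open>(\<aa>, \<bb>)\<close> be a semisimple dual pair. Because \<open>\<bb>\<close> is reductive in \<open>\<gg>\<close>, the
  Killing form of \<open>\<gg>\<close> is nondegenerate on \<open>\<aa>\<close>, the centralizer of \<open>\<bb>\<close>; and \<open>\<aa>\<close> contains the
  Jordan parts of its elements. So \<open>\<aa>\<close> contains a semisimple \<open>s \<noteq> 0\<close>, since otherwise it would consist
  of nilpotent elements and the form would vanish on it; likewise \<open>t \<in> \<bb>\<close>. The elements \<open>s\<close> and \<open>t\<close>
  commute and are independent, and they lie in a Cartan subalgebra, which has dimension two and is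
  therefore spanned by them. Both \<open>\<aa>\<close> and
  \<open>\<bb>\<close> are stable under it, so each contains some \<open>slr r\<close>, and centralizing shows that the pair is
  \<open>(slr r, slr s)\<close> with \<open>r\<close> and \<open>s\<close> orthogonal (\<open>dual_pair_frame\<close>).

  A regular subalgebra of type \<open>A\<^sub>1 \<oplus> A\<^sub>1\<close> is determined by its part in the Cartan subalgebra and a
  closed set of roots. Semisimplicity makes this set symmetric (\<open>reg_nondeg\<close>), and rank
  and dimension leave only \<open>slr r \<oplus> slr s\<close> with \<open>r, s\<close> orthogonal (\<open>reg_A1_A1\<close>).

  Two facts make everything independent of choices. All Cartan subalgebras are conjugate
  (\<open>cartan_conj\<close>), so each one carries the root system of type \<open>G\<^sub>2\<close>. And any two \<open>sl\<^sub>2\<close>-triples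
  of long root vectors are conjugate (\<open>long_triple_conj\<close>): a long root vector \<open>e\<close> is extremal, that is
  \<open>(ad e)\<^sup>2 \<gg> = \<complex> e\<close>, and two extremal vectors that are not orthogonal for the Killing form span
  an \<open>sl\<^sub>2\<close> in which they are conjugate up to a scalar. Only exponentials of nilpotent elements are used, so
  that \<open>exp_ad\<close> is a finite sum. The structure theory of Cartan subalgebras and roots rests on the
  existence of Jordan parts in a Lie algebra with nondegenerate Killing form (\<open>jordan_part\<close>).
\<close>

text \<open>The bracket as an operator on its second argument.\<close>

abbreviation (input) ad :: "'g::complex_lie_algebra \<Rightarrow> 'g \<Rightarrow> 'g" where "ad \<equiv> bracket"

notation scaleC (infixr "*." 75)

section \<open>Linear algebra in the ambient space\<close>

definition lie_basis :: "'g::complex_lie_algebra set" where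
 "lie_basis = (SOME B. finite B & lie.independent B & lie.span B = UNIV)"

lemma lie_basis_props:
 "finite (lie_basis :: 'g::complex_lie_algebra set)"
 "lie.independent (lie_basis :: 'g set)"
 "lie.span (lie_basis :: 'g set) = UNIV"
proof -
 obtain B0 :: "'g set" where B0: "finite B0" "!!x. EX c. x = (SUM b:B0. c b *. b)"
  using finite_dimensional by blast
 have sp: "lie.span B0 = UNIV"
 proof (intro set_eqI iffI)
  fix x :: 'g
  obtain c where "x = (SUM b:B0. c b *. b)" using B0(2) by blast
  thus "x : lie.span B0"
   by (simp add: lie.span_sum lie.span_scale lie.span_base)
 qed auto
 obtain B where B: "B \<subseteq> B0" "lie.independent B" "B0 \<subseteq> lie.span B"
  using lie.maximal_independent_subset by blast
 have "lie.span B = UNIV" using B(3) sp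
  by (metis lie.span_mono lie.span_span top.extremum_uniqueI)
 hence "EX B :: 'g set. finite B & lie.independent B & lie.span B = UNIV"
  using B(1,2) B0(1) finite_subset by blast
 from someI_ex[OF this]
 show "finite (lie_basis :: 'g set)" "lie.independent (lie_basis :: 'g set)"
  "lie.span (lie_basis :: 'g set) = UNIV"
  unfolding lie_basis_def by blast+
qed

global_interpretation fin: finite_dimensional_vector_space
 "scaleC :: complex => 'g => 'g::complex_lie_algebra" lie_basis
 by unfold_locales (use lie_basis_props in auto)

global_interpretation endo: finite_dimensional_vector_space_pair
 "scaleC :: complex => 'g => 'g::complex_lie_algebra" lie_basis
 "scaleC :: complex => 'g => 'g::complex_lie_algebra" lie_basis
 by unfold_locales

abbreviation lin :: "('g::complex_lie_algebra => 'g) => bool" where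
 "lin f \<equiv> Vector_Spaces.linear scaleC scaleC f"

lemma linI:
 fixes f :: "'g::complex_lie_algebra => 'g"
 assumes "!!x y. f (x + y) = f x + f y" "!!c x. f (c *. x) = c *. f x"
 shows "lin f"
 using assms by (simp add: Vector_Spaces.linear_iff lie.vector_space_axioms)

lemmas scale_simps = scaleC_add_right scaleC_add_left lie.scale_minus_left lie.scale_minus_right
 lie.scale_right_diff_distrib lie.scale_left_diff_distrib scaleC_scaleC scaleC_one

lemma lin_ad: "lin (ad (x :: 'g::complex_lie_algebra))"
 by (rule linI) (simp_all add: bracket_add_right bracket_scaleC_right)

lemma lin_ad_right: "lin (%x. ad x (y :: 'g::complex_lie_algebra))"
 by (rule linI) (simp_all add: bracket_add_left bracket_scaleC_left)

lemma lin_compose: "lin f ==> lin g ==> lin (%x. f (g x))"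
 by (rule linI) (simp_all add: endo.linear_add endo.linear_scale)

lemma lin_add: "lin f ==> lin g ==> lin (%x. f x + g x)"
 by (rule linI) (simp_all add: endo.linear_add endo.linear_scale scale_simps)

lemma lin_diff: "lin f ==> lin g ==> lin (%x. f x - g x)"
 by (rule linI) (simp_all add: endo.linear_add endo.linear_scale scale_simps)

lemma lin_scale: "lin f ==> lin (%x. c *. f x)"
 by (rule linI) (simp_all add: endo.linear_add endo.linear_scale scale_simps mult.commute)

lemma lin_ident: "lin (%x. x)"
 by (rule linI) simp_all

lemma lin_zero: "lin (%x. 0)"
 by (rule linI) simp_all

lemma lin_shift: "lin f ==> lin (%x. f x - c *. x)"
 by (intro lin_diff lin_scale lin_ident)

lemma lin_funpow: "lin f ==> lin (f ^^ n)"
proof (induction n)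
 case 0
 thus ?case by (simp add: id_def lin_ident)
next
 case (Suc n)
 thus ?case using lin_compose[of f "f ^^ n"] by (simp add: o_def)
qed

lemmas lin_intros = lin_ad lin_ad_right lin_add lin_diff lin_scale lin_ident lin_zero
 lin_shift lin_funpow

lemma lin_eq_on_span:
 assumes "lin f" "lin g" "!!b. b : B ==> f b = g b" "x : lie.span B"
 shows "f x = g x"
 using endo.linear_eq_on[OF assms(1,2) assms(4) assms(3)] by blast

lemma lin_span_stable:
 assumes "lin f" "!!b. b : B ==> f b : V" "lie.subspace V" "x : lie.span B"
 shows "f x : V"
 using assms(4)
proof (induction rule: lie.span_induct)
 case base
 show ?case unfolding lie.subspace_def
  using assms(1,3) endo.linear_add[OF assms(1)] endo.linear_scale[OF assms(1)]
  by (auto simp: endo.linear_0 lie.subspace_0 lie.subspace_add lie.subspace_scale)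
qed (use assms in auto)

lemma span_closed:
 assumes "x : lie.span S" "lie.subspace {x. P x}" "!!x. x : S ==> P x"
 shows "P x"
 using lie.span_minimal[of S "{x. P x}"] assms by auto

subsection \<open>The bracket\<close>

lemma bracket_anti: "ad x y = - ad y (x :: 'g::complex_lie_algebra)"
proof -
 have "ad x y + ad y x = 0"
  using bracket_self[of "x + y"] bracket_add_left[of x y "x + y"] bracket_add_right[of x x y]
   bracket_add_right[of y x y] bracket_self[of x] bracket_self[of y] by (metis add_0_left add_0_right)
 thus ?thesis by (simp add: eq_neg_iff_add_eq_0)
qed

lemma bracket_zero_left [simp]: "ad 0 (x :: 'g::complex_lie_algebra) = 0"
 by (metis bracket_scaleC_left lie.scale_zero_left)

lemma bracket_zero_right [simp]: "ad (x :: 'g::complex_lie_algebra) 0 = 0"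
 by (metis bracket_scaleC_right lie.scale_zero_left)

lemma bracket_minus_left: "ad (- x) (y :: 'g::complex_lie_algebra) = - ad x y"
 by (metis bracket_scaleC_left lie.scale_minus_left scaleC_one)

lemma bracket_minus_right: "ad x (- y :: 'g::complex_lie_algebra) = - ad x y"
 by (metis bracket_scaleC_right lie.scale_minus_left scaleC_one)

lemma bracket_diff_left: "ad (x - y) (z :: 'g::complex_lie_algebra) = ad x z - ad y z"
 using bracket_add_left[of x "- y" z] by (simp add: bracket_minus_left)

lemma bracket_diff_right: "ad x (y - z :: 'g::complex_lie_algebra) = ad x y - ad x z"
 using bracket_add_right[of x y "- z"] by (simp add: bracket_minus_right)

lemma bracket_sum_right: "ad (x :: 'g::complex_lie_algebra) (sum f A) = (SUM i:A. ad x (f i))"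
 using endo.linear_sum[OF lin_ad] .

lemma bracket_sum_left: "ad (sum f A) (x :: 'g::complex_lie_algebra) = (SUM i:A. ad (f i) x)"
 using endo.linear_sum[OF lin_ad_right] .

lemmas bracket_simps = bracket_add_left bracket_add_right bracket_scaleC_left bracket_scaleC_right
 bracket_diff_left bracket_diff_right bracket_minus_left bracket_minus_right bracket_self
 bracket_zero_left bracket_zero_right

lemma ad_derivation:
 "ad x (ad y z) = ad (ad x y) z + ad y (ad x (z :: 'g::complex_lie_algebra))"
proof -
 have "ad y (ad z x) = - ad y (ad x z)"
  using bracket_anti[of z x] by (simp add: bracket_minus_right)
 thus ?thesis
  using jacobi[of x y z] bracket_anti[of z "ad x y"] by (simp add: add_eq_0_iff2 algebra_simps)
qed

lemma ad_bracket:
 "ad (ad x y) z = ad x (ad y z) - ad y (ad x (z :: 'g::complex_lie_algebra))"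
 using ad_derivation[of x y z] by simp

subsection \<open>The trace\<close>

abbreviation basis_trace :: "'g::complex_lie_algebra set => ('g => 'g) => complex" where
 "basis_trace B f \<equiv> SUM b:B. lie.representation B (f b) b"

lemma rep_expand:
 assumes "lie.independent (B :: 'g::complex_lie_algebra set)" "v : lie.span B"
 shows "(SUM b:B. lie.representation B v b *. b) = v"
 using lie.sum_representation_eq[OF assms fin.finiteI_independent[OF assms(1)]] by simp

lemma basis_trace_unique:
 fixes B C :: "'g::complex_lie_algebra set"
 assumes B: "lie.independent B" and C: "lie.independent C" and BC: "lie.span B = lie.span C"
  and f: "lin f" and st: "!!v. v : lie.span B ==> f v : lie.span B"
 shows "basis_trace B f = basis_trace C f"
proof -
 let ?r = "lie.representation B" and ?s = "lie.representation C"
 have finB: "finite B" and finC: "finite C" using B C fin.finiteI_independent by auto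
 have b_in: "b : B ==> b : lie.span B" for b by (rule lie.span_base)
 have c_in: "c : C ==> c : lie.span B" for c using BC lie.span_base by auto
 have rsum: "?r (SUM i:A. k i *. w i) b = (SUM i:A. k i * ?r (w i) b)"
  if "!!i. i : A ==> w i : lie.span B" for A :: "'g set" and k w b
  using that B by (simp add: lie.representation_sum lie.span_scale lie.representation_scale)
 have ssum: "?s (SUM i:A. k i *. w i) b = (SUM i:A. k i * ?s (w i) b)"
  if "!!i. i : A ==> w i : lie.span B" for A :: "'g set" and k w b
  using that C BC by (simp add: lie.representation_sum lie.span_scale lie.representation_scale)
 have "basis_trace C f = (SUM c:C. ?s (SUM b:B. ?r c b *. f b) c)"
 proof (rule sum.cong[OF refl])
  fix c assume c: "c : C"
  have "f c = f (SUM b:B. ?r c b *. b)" using rep_expand[OF B c_in[OF c]] by simp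
  also have "... = (SUM b:B. ?r c b *. f b)"
   using f by (simp add: endo.linear_sum endo.linear_scale)
  finally show "?s (f c) c = ?s (SUM b:B. ?r c b *. f b) c" by simp
 qed
 also have "... = (SUM c:C. SUM b:B. ?r c b * ?s (f b) c)"
  using st b_in by (intro sum.cong refl ssum) auto
 also have "... = (SUM b:B. SUM c:C. ?s (f b) c * ?r c b)"
  by (subst sum.swap) (simp add: mult.commute)
 also have "... = (SUM b:B. ?r (SUM c:C. ?s (f b) c *. c) b)"
  using c_in by (intro sum.cong refl rsum[symmetric]) auto
 also have "... = basis_trace B f"
  using rep_expand[OF C] st b_in BC by (intro sum.cong refl) simp
 finally show ?thesis by simp
qed

lemma trace_on_basis:
 fixes B :: "'g::complex_lie_algebra set"
 assumes B: "lie.independent B" "lie.span B = V" and f: "lin f" and st: "!!v. v : V ==> f v : V"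
 shows "trace_on V f = basis_trace B f"
proof -
 let ?P = "%B. B \<subseteq> V & lie.independent B & lie.span B = V"
 have "?P B" using B lie.span_superset by auto
 hence "?P (SOME B. ?P B)" by (rule someI)
 thus ?thesis unfolding trace_on_def Let_def
  using basis_trace_unique[of "SOME B. ?P B" B f] B f st by auto
qed

lemma obtain_basis:
 assumes "lie.subspace (V :: 'g::complex_lie_algebra set)" "S \<subseteq> V" "V \<subseteq> lie.span S"
 obtains B where "B \<subseteq> S" "lie.independent B" "lie.span B = V" "finite B"
proof -
 obtain B where B: "B \<subseteq> S" "lie.independent B" "S \<subseteq> lie.span B"
  using lie.maximal_independent_subset by blast
 have "lie.span B = V"
  by (meson B(1) B(3) assms lie.span_minimal lie.span_mono order.trans subset_antisym
    lie.subspace_span)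
 thus thesis using that B fin.finiteI_independent by blast
qed

lemma trace_on_cong:
 assumes "lie.subspace (V :: 'g::complex_lie_algebra set)" "!!v. v : V ==> f v = g v"
 shows "trace_on V f = trace_on V g"
proof -
 let ?P = "%B. B \<subseteq> V & lie.independent B & lie.span B = V"
 obtain B where "?P B" using obtain_basis[of V V] assms(1) lie.span_superset by blast
 hence "?P (SOME B. ?P B)" by (rule someI)
 thus ?thesis unfolding trace_on_def Let_def using assms(2)
  by (intro sum.cong refl) auto
qed

context
 fixes V :: "'g::complex_lie_algebra set"
 assumes V: "lie.subspace V"
begin

lemma trace_on_add:
 assumes "lin f" "lin g" "!!v. v : V ==> f v : V" "!!v. v : V ==> g v : V"
 shows "trace_on V (%x. f x + g x) = trace_on V f + trace_on V g"
proof -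
 obtain B where B: "B \<subseteq> V" "lie.independent B" "lie.span B = V"
  using obtain_basis[of V V] V lie.span_superset by blast
 hence Bv: "!!b. b : B ==> b : V" by auto
 show ?thesis
  by (simp add: trace_on_basis[OF B(2,3)] lin_add assms lie.subspace_add[OF V]
    lie.representation_add B Bv sum.distrib)
qed

lemma trace_on_scale:
 assumes "lin f" "!!v. v : V ==> f v : V"
 shows "trace_on V (%x. c *. f x) = c * trace_on V f"
proof -
 obtain B where B: "B \<subseteq> V" "lie.independent B" "lie.span B = V"
  using obtain_basis[of V V] V lie.span_superset by blast
 hence Bv: "!!b. b : B ==> b : V" by auto
 show ?thesis
  by (simp add: trace_on_basis[OF B(2,3)] lin_scale assms lie.subspace_scale[OF V]
    lie.representation_scale B Bv sum_distrib_left)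
qed

lemma trace_on_diff:
 assumes "lin f" "lin g" "!!v. v : V ==> f v : V" "!!v. v : V ==> g v : V"
 shows "trace_on V (%x. f x - g x) = trace_on V f - trace_on V g"
 using trace_on_add[OF assms(1) lin_scale[OF assms(2), of "-1"]] trace_on_scale[OF assms(2), of "-1"]
  assms V by (simp add: scale_simps lie.subspace_neg)

lemma trace_on_commute:
 assumes f: "lin f" and g: "lin g"
  and fV: "!!v. v : V ==> f v : V" and gV: "!!v. v : V ==> g v : V"
 shows "trace_on V (%x. f (g x)) = trace_on V (%x. g (f x))"
proof -
 obtain B where B: "B \<subseteq> V" "lie.independent B" "lie.span B = V"
  using obtain_basis[of V V] V lie.span_superset by blast
 hence Bv: "!!b. b : B ==> b : V" by auto
 let ?r = "lie.representation B"
 have comp: "?r (u (w b)) b = (SUM c:B. ?r (w b) c * ?r (u c) b)"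
  if u: "lin u" and "!!v. v : V ==> u v : V" "!!v. v : V ==> w v : V" "b : B" for u w b
 proof -
  have wb: "w b : lie.span B" using that Bv B by auto
  have "u (w b) = u (SUM c:B. ?r (w b) c *. c)" using rep_expand[OF B(2) wb] by simp
  also have "... = (SUM c:B. ?r (w b) c *. u c)"
   using u by (simp add: endo.linear_sum endo.linear_scale)
  finally have eq: "u (w b) = (SUM c:B. ?r (w b) c *. u c)" .
  have "u c : lie.span B" if "c : B" for c
   using \<open>!!v. v : V ==> u v : V\<close> Bv[OF that] B(3) by simp
  thus ?thesis unfolding eq using B(2)
   by (simp add: lie.representation_sum lie.span_scale lie.representation_scale)
 qed
 have "basis_trace B (%x. f (g x)) = (SUM b:B. SUM c:B. ?r (g b) c * ?r (f c) b)"
  using comp f g fV gV by (intro sum.cong refl) auto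
 also have "... = (SUM b:B. SUM c:B. ?r (f b) c * ?r (g c) b)"
  by (subst sum.swap) (simp add: mult.commute)
 also have "... = basis_trace B (%x. g (f x))"
  using comp f g fV gV by (intro sum.cong refl) auto
 finally show ?thesis
  by (simp add: trace_on_basis[OF B(2,3)] lin_compose f g fV gV)
qed

lemma trace_on_eigenbasis:
 assumes B: "lie.independent B" "lie.span B = V" and f: "lin f"
  and eig: "!!b. b : B ==> f b = c b *. b"
 shows "trace_on V f = (SUM b:B. c b)"
proof -
 have st: "f v : V" if "v : V" for v
 proof (rule lin_span_stable[OF f _ V])
  show "v : lie.span B" using that B by simp
  show "f b : V" if "b : B" for b
   using eig[OF that] B(2) lie.span_scale[OF lie.span_base[OF that]] by simp
 qed
 have "basis_trace B f = (SUM b:B. c b)"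
 proof (rule sum.cong[OF refl])
  fix b assume b: "b : B"
  thus "lie.representation B (f b) b = c b"
   unfolding eig[OF b] lie.representation_scale[OF B(1) lie.span_base[OF b]]
    lie.representation_basis[OF B(1) b] by simp
 qed
 thus ?thesis using trace_on_basis[OF B f st] by simp
qed

lemma trace_on_ident: "trace_on V (%x. x) = of_nat (lie.dim V)"
proof -
 obtain B where B: "B \<subseteq> V" "lie.independent B" "lie.span B = V"
  using obtain_basis[of V V] V lie.span_superset by blast
 have "lie.dim V = card B" using B lie.dim_eq_card_independent lie.dim_span by metis
 thus ?thesis using trace_on_eigenbasis[OF B(2,3) lin_ident, of "%_. 1"] by simp
qed

end

text \<open>The image of a nilpotent map on a nonzero space is a proper stable subspace which carries
 the whole trace, so induction on the dimension applies.\<close>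

lemma trace_on_nilpotent_uniform:
 fixes V :: "'g::complex_lie_algebra set"
 assumes "lie.subspace V" "lin f" "!!v. v : V ==> f v : V" "!!v. v : V ==> (f ^^ k) v = 0"
 shows "trace_on V f = 0"
 using assms
proof (induction "lie.dim V" arbitrary: V rule: less_induct)
 case (less V)
 note f = less.prems(2)
 show ?case
 proof (cases "V = {0}")
  case True
  thus ?thesis
   using trace_on_basis[OF lie.independent_empty, of V f] less.prems by simp
 next
  case False
  let ?W = "f ` V"
  have W: "lie.subspace ?W" using endo.linear_subspace_image f less.prems(1) by blast
  have WV: "?W \<subseteq> V" using less.prems(3) by auto
  have "?W ~= V"
  proof
   assume eq: "f ` V = V"
   have "(f ^^ n) ` V = V" for n
   proof (induction n)
    case (Suc n)
    have "(f ^^ Suc n) ` V = f ` ((f ^^ n) ` V)" unfolding funpow.simps image_comp ..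
    thus ?case unfolding Suc.IH eq .
   qed simp
   hence "V = (f ^^ k) ` V" by simp
   also have "... \<subseteq> {0}" using less.prems(4) by auto
   finally show False using False less.prems(1) lie.subspace_0 by auto
  qed
  hence dW: "lie.dim ?W < lie.dim V"
   using fin.dim_psubset[of ?W V] W WV less.prems(1)
   by (metis lie.span_eq_iff psubsetI)
  have IH: "trace_on ?W f = 0"
   using less.hyps[OF dW W f] less.prems(3,4) by auto
  obtain B where B: "B \<subseteq> ?W" "lie.independent B" "lie.span B = ?W" "finite B"
   by (rule obtain_basis[OF W subset_refl lie.span_superset])
  obtain C where C: "B \<subseteq> C" "C \<subseteq> V" "lie.independent C" "V \<subseteq> lie.span C"
   using lie.maximal_independent_subset_extend[OF order.trans[OF B(1) WV] B(2)] by metis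
  have spC: "lie.span C = V" by (rule lie.span_subspace[OF C(2,4) less.prems(1)])
  have finC: "finite C" using C fin.finiteI_independent by auto
  have eq: "lie.representation C (f c) = lie.representation B (f c)" if "c : C" for c
   using lie.representation_extend[OF C(3) _ C(1), of "f c"] that C B(3) by auto
  have "trace_on V f = (SUM c:C. lie.representation B (f c) c)"
   using trace_on_basis[OF C(3) spC f less.prems(3)] eq by simp
  also have "... = (SUM c:B. lie.representation B (f c) c)"
   using lie.representation_ne_zero[of B] C finC by (intro sum.mono_neutral_right) auto
  also have "... = trace_on ?W f"
   by (rule trace_on_basis[OF B(2,3) f, symmetric]) (use less.prems(3) in auto)
  finally show ?thesis using IH by simp
 qed
qed

lemma funpow_zero_mono:
 assumes "lin f" "(f ^^ m) v = 0" "m <= n"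
 shows "(f ^^ n) v = 0"
proof -
 have "(f ^^ n) v = (f ^^ (n - m)) ((f ^^ m) v)"
  using assms(3) by (metis funpow_add o_apply le_add_diff_inverse2)
 thus ?thesis using assms endo.linear_0[OF lin_funpow[OF assms(1)]] by simp
qed

lemma subspace_nilpotent_vectors:
 assumes "lin f"
 shows "lie.subspace {v. EX k. (f ^^ k) v = 0}"
proof -
 have "EX k. (f ^^ k) (x + y) = 0" if "(f ^^ i) x = 0" "(f ^^ j) y = 0" for x y i j
  using funpow_zero_mono[OF assms that(1), of "i + j"] funpow_zero_mono[OF assms that(2), of "i + j"]
   endo.linear_add[OF lin_funpow[OF assms]] by (intro exI[of _ "i + j"]) simp
 moreover have "EX k. (f ^^ k) (c *. x) = 0" if "(f ^^ i) x = 0" for c x i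
  using that endo.linear_scale[OF lin_funpow[OF assms]] by (intro exI[of _ i]) simp
 ultimately show ?thesis
  unfolding lie.subspace_def by (auto intro: exI[of _ 0])
qed

lemma nilpotent_uniform:
 fixes V :: "'g::complex_lie_algebra set"
 assumes "lie.subspace V" "lin f" "!!v. v : V ==> EX k. (f ^^ k) v = 0"
 obtains k where "!!v. v : V ==> (f ^^ k) v = 0"
proof -
 obtain B where B: "B \<subseteq> V" "lie.independent B" "lie.span B = V" "finite B"
  using obtain_basis[of V V] assms(1) lie.span_superset by blast
 have "EX k. ALL b:B. (f ^^ k) b = 0"
  using B(4) B(1)
 proof (induction B rule: finite_induct)
  case (insert b F)
  then obtain k where "ALL b:F. (f ^^ k) b = 0" by auto
  moreover obtain j where "(f ^^ j) b = 0" using insert.prems assms(3) by blast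
  ultimately have "ALL x:insert b F. (f ^^ (k + j)) x = 0"
   using funpow_zero_mono[OF assms(2)] by (metis insert_iff le_add1 le_add2)
  thus ?case by blast
 qed auto
 then obtain k where k: "!!b. b : B ==> (f ^^ k) b = 0" by blast
 have "(f ^^ k) v = 0" if "v : V" for v
  using lin_eq_on_span[OF lin_funpow[OF assms(2)] lin_zero k] that B(3) by blast
 thus thesis using that by blast
qed

lemma trace_on_nilpotent:
 fixes V :: "'g::complex_lie_algebra set"
 assumes "lie.subspace V" "lin f" "!!v. v : V ==> f v : V" "!!v. v : V ==> EX k. (f ^^ k) v = 0"
 shows "trace_on V f = 0"
proof -
 obtain k where "!!v. v : V ==> (f ^^ k) v = 0"
  using nilpotent_uniform[OF assms(1,2,4)] by blast
 with assms show ?thesis by (intro trace_on_nilpotent_uniform[of V f k]) auto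
qed

section \<open>Generalized eigenvectors\<close>

definition gen_eig :: "('g::complex_lie_algebra => 'g) => complex => 'g => bool" where
 "gen_eig A c v \<longleftrightarrow> (EX k. ((%w. A w - c *. w) ^^ k) v = 0)"

lemma subspace_gen_eig: "lin A ==> lie.subspace {v. gen_eig A c v}"
 unfolding gen_eig_def by (intro subspace_nilpotent_vectors lin_intros)

lemma gen_eig_zero: "lin A ==> gen_eig A c 0"
 using lie.subspace_0[OF subspace_gen_eig[of A c]] by simp

lemma gen_eig_add: "lin A ==> gen_eig A c v ==> gen_eig A c w ==> gen_eig A c (v + w)"
 using lie.subspace_add[OF subspace_gen_eig[of A c]] by simp

lemma gen_eig_diff: "lin A ==> gen_eig A c v ==> gen_eig A c w ==> gen_eig A c (v - w)"
 using lie.subspace_diff[OF subspace_gen_eig[of A c]] by simp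

lemma gen_eig_scale: "lin A ==> gen_eig A c v ==> gen_eig A c (d *. v)"
 using lie.subspace_scale[OF subspace_gen_eig[of A c]] by simp

lemma gen_eig_sum: "lin A ==> (!!i. i : I ==> gen_eig A c (f i)) ==> gen_eig A c (sum f I)"
 using lie.subspace_sum[OF subspace_gen_eig[of A c], of I f] by simp

lemma gen_eig_shift_iff: "gen_eig A c (A v - c *. v) \<longleftrightarrow> gen_eig A c v" if "lin A"
proof
 assume "gen_eig A c (A v - c *. v)"
 then obtain k where "((%w. A w - c *. w) ^^ k) (A v - c *. v) = 0" unfolding gen_eig_def by blast
 hence "((%w. A w - c *. w) ^^ Suc k) v = 0"
  unfolding funpow_Suc_right o_apply .
 thus "gen_eig A c v" unfolding gen_eig_def by blast
next
 assume "gen_eig A c v"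
 then obtain k where k: "((%w. A w - c *. w) ^^ k) v = 0" unfolding gen_eig_def by blast
 have "((%w. A w - c *. w) ^^ Suc k) v = 0"
  by (rule funpow_zero_mono[OF lin_shift[OF that] k]) simp
 hence "((%w. A w - c *. w) ^^ k) (A v - c *. v) = 0" unfolding funpow_Suc_right o_apply .
 thus "gen_eig A c (A v - c *. v)" unfolding gen_eig_def by blast
qed

lemma gen_eig_map: "gen_eig A c (A v)" if "lin A" "gen_eig A c v"
proof -
 have "gen_eig A c ((A v - c *. v) + c *. v)"
  using that by (intro gen_eig_add gen_eig_scale) (simp_all add: gen_eig_shift_iff)
 thus ?thesis by simp
qed

lemma gen_eig_eigenvector: "A v = c *. v ==> gen_eig A c v"
 unfolding gen_eig_def by (rule exI[of _ 1]) simp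

text \<open>\<open>A - d\<close> is injective on the generalized eigenspace for \<open>c \<noteq> d\<close>: a kernel vector is an honest
 eigenvector for \<open>d\<close>, on which \<open>A - c\<close> acts by the nonzero scalar \<open>d - c\<close>.\<close>

lemma gen_eig_shift_inj:
 assumes "lin A" "gen_eig A c w" "A w = d *. w" "c ~= d"
 shows "w = 0"
proof -
 have "((%w. A w - c *. w) ^^ k) w = (d - c) ^ k *. w" for k
 proof (induction k)
  case (Suc k)
  have "((%w. A w - c *. w) ^^ Suc k) w = A ((d - c) ^ k *. w) - c *. (d - c) ^ k *. w"
   using Suc by simp
  also have "... = (d - c) ^ Suc k *. w"
   by (simp add: endo.linear_scale[OF assms(1)] assms(3) scaleC_scaleC algebra_simps
     flip: lie.scale_left_diff_distrib)
  finally show ?case .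
 qed simp
 with assms(2,4) show ?thesis unfolding gen_eig_def by auto
qed

lemma gen_eig_disjoint:
 assumes A: "lin A" and w: "gen_eig A c w" "gen_eig A d w" and "c ~= d"
 shows "w = 0"
proof (rule ccontr)
 assume "w ~= 0"
 let ?B = "%w. A w - d *. w"
 obtain k where "(?B ^^ k) w = 0" using w(2) unfolding gen_eig_def by blast
 then obtain j where j: "(?B ^^ j) w = 0" "!!i. i < j ==> (?B ^^ i) w ~= 0"
  using exists_least_iff[of "%k. (?B ^^ k) w = 0"] by blast
 then obtain i where i: "j = Suc i" using \<open>w ~= 0\<close> by (cases j) auto
 let ?u = "(?B ^^ i) w"
 have "gen_eig A c ((?B ^^ n) w)" for n
  using w(1) A by (induction n) (auto intro!: gen_eig_diff gen_eig_scale gen_eig_map)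
 moreover have "A ?u = d *. ?u" using j(1) i by simp
 ultimately have "?u = 0" using gen_eig_shift_inj[OF A] \<open>c ~= d\<close> by blast
 thus False using j(2) i by simp
qed

lemma gen_eig_independent:
 assumes A: "lin A" and "finite C" "!!c. c : C ==> gen_eig A c (w c)" "(SUM c:C. w c) = 0" "c : C"
 shows "w c = 0"
 using assms(2-)
proof (induction C arbitrary: w c rule: finite_induct)
 case (insert a C)
 obtain k where k: "((%w. A w - a *. w) ^^ k) (w a) = 0"
  using insert.prems(1)[of a] unfolding gen_eig_def by auto
 let ?B = "(%w. A w - a *. w) ^^ k"
 have B: "lin ?B" by (intro lin_intros A)
 have Bge: "gen_eig A c (((%w. A w - a *. w) ^^ n) v)" if "gen_eig A c v" for c v n
  using that A by (induction n) (auto intro!: gen_eig_diff gen_eig_scale gen_eig_map)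
 have "(SUM c:C. ?B (w c)) = ?B (SUM c:insert a C. w c)"
  using insert.hyps k by (simp add: endo.linear_add[OF B] endo.linear_sum[OF B])
 also have "... = 0" using insert.prems(2) endo.linear_0[OF B] by simp
 finally have s0: "(SUM c:C. ?B (w c)) = 0" .
 have "?B (w c) = 0" if "c : C" for c
 proof (rule insert.IH[of "%c. ?B (w c)", OF _ s0 that])
  fix c assume "c : C"
  thus "gen_eig A c (?B (w c))" by (intro Bge insert.prems(1)) simp
 qed
 hence "gen_eig A a (w c)" if "c : C" for c using that unfolding gen_eig_def by blast
 hence z: "w c = 0" if "c : C" for c
  using gen_eig_disjoint[OF A _ _ , of c "w c" a] that insert.prems(1) insert.hyps by auto
 hence "w a = 0" using insert.prems(2) insert.hyps by simp
 thus ?case using z insert.prems(3) by auto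
qed simp

text \<open>For \<open>d \<noteq> c\<close> the map \<open>A - c\<close> is bijective on the generalized eigenspace for \<open>d\<close>; the inverse is
 built by induction on the nilpotency degree of \<open>A - d\<close>.\<close>

lemma gen_eig_shift_surj:
 assumes A: "lin A" and V: "lie.subspace V" "!!v. v : V ==> A v : V"
  and w: "w : V" "gen_eig A d w" and "c ~= d"
 shows "EX u:V. gen_eig A d u & A u - c *. u = w"
proof -
 obtain k where "((%w. A w - d *. w) ^^ k) w = 0" using w(2) unfolding gen_eig_def by blast
 thus ?thesis using w(1)
 proof (induction k arbitrary: w)
  case 0
  thus ?case
   using lie.subspace_0[OF V(1)] endo.linear_0[OF A] gen_eig_zero[OF A] by (intro bexI[of _ 0]) auto
 next
  case (Suc k)
  let ?w' = "A w - d *. w"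
  have "?w' : V" using Suc.prems(2) V by (simp add: lie.subspace_diff lie.subspace_scale)
  moreover have "((%w. A w - d *. w) ^^ k) ?w' = 0"
   using Suc.prems(1) unfolding funpow_Suc_right o_apply .
  ultimately obtain u where u: "u : V" "gen_eig A d u" "A u - c *. u = ?w'"
   using Suc.IH by blast
  have gw: "gen_eig A d w" using Suc.prems(1) unfolding gen_eig_def by blast
  let ?u = "(1 / (d - c)) *. (w - u)"
  have "A (w - u) - c *. (w - u) = (d - c) *. w"
   using u(3) by (simp add: endo.linear_diff[OF A] scale_simps algebra_simps)
  moreover have "A ?u - c *. ?u = (1 / (d - c)) *. (A (w - u) - c *. (w - u))"
   unfolding endo.linear_scale[OF A] lie.scale_right_diff_distrib[of "1 / (d - c)" "A (w - u)"]
   by (simp add: scaleC_scaleC mult.commute)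
  ultimately have "A ?u - c *. ?u = w"
   using \<open>c ~= d\<close> by (simp add: scaleC_scaleC)
  moreover have "?u : V" using u Suc.prems V by (simp add: lie.subspace_diff lie.subspace_scale)
  moreover have "gen_eig A d ?u" using u gw A by (intro gen_eig_scale gen_eig_diff) auto
  ultimately show ?case by blast
 qed
qed

definition poly_act :: "complex poly => ('g::complex_lie_algebra => 'g) => 'g => 'g" where
 "poly_act p A v = (SUM i<=degree p. coeff p i *. (A ^^ i) v)"

lemma poly_act_bound: "degree p <= n ==> poly_act p A v = (SUM i<=n. coeff p i *. (A ^^ i) v)"
 unfolding poly_act_def by (rule sum.mono_neutral_left) (auto simp: coeff_eq_0)

lemma poly_act_linear_factor:
 assumes A: "lin A"
 shows "poly_act ([:- c, 1:] * q) A v = poly_act q A (A v - c *. v)"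
proof -
 let ?n = "degree q"
 have "degree ([:- c, 1:] * q) <= Suc ?n"
  using degree_mult_le[of "[:- c, 1:]" q] by simp
 hence "poly_act ([:- c, 1:] * q) A v
   = (SUM i<=Suc ?n. coeff ([:- c, 1:] * q) i *. (A ^^ i) v)" by (rule poly_act_bound)
 also have "... = (SUM i<=Suc ?n. coeff (pCons 0 q) i *. (A ^^ i) v) - (SUM i<=Suc ?n. (c * coeff q i) *. (A ^^ i) v)"
  by (simp add: scale_simps flip: sum_subtractf)
 also have "(SUM i<=Suc ?n. coeff (pCons 0 q) i *. (A ^^ i) v) = (SUM i<=?n. coeff q i *. (A ^^ i) (A v))"
  by (subst sum.atMost_Suc_shift) (simp add: funpow_swap1)
 also have "(SUM i<=Suc ?n. (c * coeff q i) *. (A ^^ i) v) = (SUM i<=?n. coeff q i *. (A ^^ i) (c *. v))"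
  by (simp add: coeff_eq_0 endo.linear_scale[OF lin_funpow[OF A]] scaleC_scaleC mult.commute)
 finally show ?thesis
  by (simp add: poly_act_def endo.linear_diff[OF lin_funpow[OF A]] scale_simps sum_subtractf)
qed

lemma poly_act_kernel_span:
 assumes A: "lin A" and V: "lie.subspace V" "!!v. v : V ==> A v : V"
 shows "p ~= 0 ==> poly_act p A v = 0 ==> v : V ==> v : lie.span {w : V. EX c. gen_eig A c w}"
proof (induction "degree p" arbitrary: p v)
 case 0
 then obtain a where "p = [:a:]" "a ~= 0" by (metis degree_eq_zeroE pCons_0_0)
 hence "v = 0" using 0 by (simp add: poly_act_def)
 thus ?case by (simp add: lie.span_zero)
next
 case (Suc n)
 let ?S = "{w : V. EX c. gen_eig A c w}"
 have "~ constant (poly p)" using Suc.hyps(2) constant_degree by force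
 then obtain c where "poly p c = 0" using fundamental_theorem_of_algebra by blast
 then obtain q where q: "p = [:- c, 1:] * q" using poly_eq_0_iff_dvd by blast
 have "q ~= 0" using q Suc.prems(1) by auto
 have "degree p = Suc (degree q)"
  using degree_mult_eq[of "[:- c, 1:]" q] \<open>q ~= 0\<close> q by simp
 hence "degree q = n" using Suc.hyps by simp
 let ?w = "A v - c *. v"
 have "?w : V" using Suc.prems V by (simp add: lie.subspace_diff lie.subspace_scale)
 moreover have "poly_act q A ?w = 0" using Suc.prems(2) unfolding q poly_act_linear_factor[OF A] .
 ultimately have "?w : lie.span ?S" using Suc.hyps(1)[of q ?w] \<open>degree q = n\<close> \<open>q ~= 0\<close> by auto
 moreover have "EX u:lie.span ?S. A u - c *. u = w | (gen_eig A c (A u - c *. u - w) )"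
  if "w : lie.span ?S" for w
  using that
 proof (induction rule: lie.span_induct_alt)
  case base
  thus ?case using lie.span_zero endo.linear_0[OF A] by (intro bexI[of _ 0]) auto
 next
  case (step a x y)
  have A0: "gen_eig A c 0" by (rule gen_eig_zero[OF A])
  obtain u where u: "u : lie.span ?S" "gen_eig A c (A u - c *. u - y)"
   using step(2) A0 by fastforce
  obtain d where x: "x : V" "gen_eig A d x" using step(1) by blast
  have "EX z:lie.span ?S. gen_eig A c (A z - c *. z - x)"
  proof (cases "d = c")
   case True
   thus ?thesis
    using x lie.span_zero endo.linear_0[OF A] gen_eig_diff[OF A A0, of x]
    by (intro bexI[of _ 0]) auto
  next
   case False
   then obtain z where "z : V" "gen_eig A d z" "A z - c *. z = x"
    using gen_eig_shift_surj[OF A V x, of c] by auto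
   thus ?thesis using A0 by (intro bexI[of _ z]) (auto intro: lie.span_base)
  qed
  then obtain z where z: "z : lie.span ?S" "gen_eig A c (A z - c *. z - x)" by blast
  have "gen_eig A c (a *. (A z - c *. z - x) + (A u - c *. u - y))"
   using u z A by (intro gen_eig_add gen_eig_scale)
  also have "a *. (A z - c *. z - x) + (A u - c *. u - y)
    = A (a *. z + u) - c *. (a *. z + u) - (a *. x + y)"
   by (simp add: endo.linear_add[OF A] endo.linear_scale[OF A] scale_simps mult.commute)
  finally show ?case using u z by (intro bexI[of _ "a *. z + u"]) (auto intro: lie.span_add lie.span_scale)
 qed
 ultimately obtain u where u: "u : lie.span ?S" "gen_eig A c (A u - c *. u - ?w)"
  using gen_eig_zero[OF A] by fastforce
 have "A u - c *. u - ?w = A (u - v) - c *. (u - v)"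
  by (simp add: endo.linear_diff[OF A] scale_simps)
 hence "gen_eig A c (u - v)" using u(2) gen_eig_shift_iff[OF A] by simp
 moreover have "u - v : V"
 proof (rule lie.subspace_diff[OF V(1) _ Suc.prems(3)])
  have "lie.span ?S \<subseteq> V" by (rule lie.span_minimal[OF _ V(1)]) simp
  thus "u : V" using u(1) by (rule subsetD)
 qed
 ultimately have "u - v : ?S" by blast
 hence "u - (u - v) : lie.span ?S" by (intro lie.span_diff[OF u(1)] lie.span_base)
 thus ?case by simp
qed

lemma poly_act_annihilator:
 assumes "lin (A :: 'g::complex_lie_algebra => 'g)"
 shows "EX p. p ~= 0 & poly_act p A v = 0"
proof -
 let ?n = "card (lie_basis :: 'g set)"
 show ?thesis
 proof (cases "inj_on (%i. (A ^^ i) v) {..?n}")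
  case False
  then obtain i j where ij: "i ~= j" "(A ^^ i) v = (A ^^ j) v" unfolding inj_on_def by blast
  let ?p = "monom 1 i - monom 1 j :: complex poly"
  have "coeff ?p i = 1" using ij by simp
  hence "?p ~= 0" by force
  have "degree ?p <= i + j"
   by (metis degree_diff_le degree_monom_le le_add1 le_add2 order_trans)
  hence "poly_act ?p A v = (SUM k<=i + j. coeff ?p k *. (A ^^ k) v)" by (rule poly_act_bound)
  also have "... = (SUM k<=i + j. (if i = k then (A ^^ k) v else 0)) - (SUM k<=i + j. (if j = k then (A ^^ k) v else 0))"
   unfolding sum_subtractf[symmetric] by (rule sum.cong[OF refl]) (auto simp: scale_simps)
  also have "... = 0" using ij(2) by simp
  finally show ?thesis using \<open>?p ~= 0\<close> by blast
 next
  case True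
  let ?X = "(%i. (A ^^ i) v) ` {..?n}"
  have "card ?X = Suc ?n" using True by (simp add: card_image)
  hence "lie.dependent ?X"
   using fin.independent_card_le_dim[of ?X UNIV] fin.dim_UNIV by auto
  then obtain u where u: "EX w:?X. u w ~= 0" "(SUM w:?X. u w *. w) = 0"
   using lie.dependent_finite[of ?X] by auto
  let ?p = "SUM i<=?n. monom (u ((A ^^ i) v)) i"
  have cf: "coeff ?p k = (if k <= ?n then u ((A ^^ k) v) else 0)" for k
   by (simp add: coeff_sum sum.delta)
  hence "?p ~= 0" using u(1) by (metis (no_types, lifting) atMost_iff coeff_0 image_iff)
  have "degree ?p <= ?n" by (rule degree_le) (use cf in auto)
  hence "poly_act ?p A v = (SUM k<=?n. u ((A ^^ k) v) *. (A ^^ k) v)"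
   by (subst poly_act_bound) (auto simp: cf)
  also have "... = (SUM w:?X. u w *. w)" using True by (simp add: sum.reindex)
  finally show ?thesis using u(2) \<open>?p ~= 0\<close> by auto
 qed
qed

lemma gen_eig_span:
 assumes "lin A" "lie.subspace V" "!!v. v : V ==> A v : V" "v : V"
 shows "v : lie.span {w : V. EX c. gen_eig A c w}"
 using poly_act_annihilator[OF assms(1)] poly_act_kernel_span[OF assms(1-3) _ _ assms(4)] by blast

text \<open>The operator that acts by \<open>\<phi> c\<close> on the generalized eigenspace for \<open>c\<close>. For the identity it is the
 semisimple part of \<open>A\<close>; complex conjugation is what proves the nondegeneracy of the Killing form.\<close>

lemma gen_eig_basis:
 assumes A: "lin A" and V: "lie.subspace V" "!!v. v : V ==> A v : V"
 obtains B ev where "B \<subseteq> V" "lie.independent B" "lie.span B = V" "finite B"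
  "!!b. b : B ==> gen_eig A (ev b) b"
proof -
 obtain B where B: "B \<subseteq> {w : V. EX c. gen_eig A c w}" "lie.independent B" "lie.span B = V" "finite B"
  by (rule obtain_basis[OF V(1), of "{w : V. EX c. gen_eig A c w}"])
   (auto intro: gen_eig_span[OF A V])
 hence "ALL b:B. gen_eig A (SOME c. gen_eig A c b) b" by (metis (mono_tags, lifting) mem_Collect_eq someI subsetD)
 thus thesis using that[of B "%b. SOME c. gen_eig A c b"] B by blast
qed

lemma spectral_operator:
 assumes A: "lin A" and B: "lie.independent B" "finite B"
  and ge: "!!b. b : B ==> gen_eig A (ev b) b"
 obtains S where "lin S" "!!b. b : B ==> S b = \<phi> (ev b) *. b"
  "!!v c. v : lie.span B ==> gen_eig A c v ==> S v = \<phi> c *. v"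
proof -
 obtain S where S: "lin S" "!!b. b : B ==> S b = \<phi> (ev b) *. b"
  using endo.linear_independent_extend[OF B(1), of "%b. \<phi> (ev b) *. b"] by blast
 have "S v = \<phi> c *. v" if v: "v : lie.span B" "gen_eig A c v" for v c
 proof -
  let ?r = "lie.representation B v"
  let ?C = "insert c (ev ` B)"
  define w where "w d = (SUM b:{b:B. ev b = d}. ?r b *. b)" for d
  have "gen_eig A d (w d)" for d
   unfolding w_def using ge A by (intro gen_eig_sum gen_eig_scale) auto
  have "(SUM d:?C. w d) = (SUM b:B. ?r b *. b)"
   unfolding w_def using B(2) by (intro sum.group) auto
  hence sv: "(SUM d:?C. w d) = v" using rep_expand[OF B(1) v(1)] by simp
  let ?u = "%d. if d = c then w d - v else w d"
  have "(SUM d:?C. ?u d) = (SUM d:?C. w d) - (SUM d:?C. if d = c then v else 0)"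
   unfolding sum_subtractf[symmetric] by (rule sum.cong) auto
  also have "... = 0" using B(2) sv by simp
  finally have "?u c = 0"
   using gen_eig_independent[OF A, of ?C ?u c] B(2) \<open>!!d. gen_eig A d (w d)\<close> v(2) gen_eig_diff[OF A]
   by auto
  hence v_eq: "v = (SUM b:{b:B. ev b = c}. ?r b *. b)" unfolding w_def by simp
  have "S v = (SUM b:{b:B. ev b = c}. ?r b *. (\<phi> c *. b))"
   by (subst v_eq) (auto simp: endo.linear_sum[OF S(1)] endo.linear_scale[OF S(1)] S(2) intro!: sum.cong)
  also have "... = \<phi> c *. (SUM b:{b:B. ev b = c}. ?r b *. b)"
   by (simp add: lie.scale_sum_right scaleC_scaleC mult.commute)
  also have "... = \<phi> c *. v" unfolding v_eq[symmetric] ..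
  finally show ?thesis .
 qed
 thus thesis using that S by blast
qed

section \<open>Killing form and Jordan decomposition\<close>

abbreviation normalizes :: "'g::complex_lie_algebra => 'g set => bool" where
 "normalizes x L \<equiv> ALL z:L. ad x z : L"

definition killing_nondeg :: "'g::complex_lie_algebra set => bool" where
 "killing_nondeg L \<longleftrightarrow> subalgebra L & (ALL x:L. (ALL y:L. killing_form L x y = 0) --> x = 0)"

definition ad_nilpotent_on :: "'g::complex_lie_algebra set => 'g => bool" where
 "ad_nilpotent_on L x \<longleftrightarrow> (ALL v:L. EX k. (ad x ^^ k) v = 0)"

definition diagonalizable_on :: "'g::complex_lie_algebra set => 'g => bool" where
 "diagonalizable_on L x \<longleftrightarrow> L \<subseteq> lie.span {w : L. EX c. ad x w = c *. w}"

lemma lin_ad_ad: "lin (%z. ad x (ad y z))"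
 by (rule lin_compose[OF lin_ad lin_ad])

lemma gen_eig_0_iff: "gen_eig (ad x) 0 v \<longleftrightarrow> (EX k. (ad x ^^ k) v = 0)"
 unfolding gen_eig_def by simp

lemma killing_sym:
 assumes "lie.subspace L" "normalizes x L" "normalizes y L"
 shows "killing_form L x y = killing_form L y x"
 unfolding killing_form_def
 by (rule trace_on_commute[OF assms(1) lin_ad lin_ad]) (use assms in auto)

lemma killing_add_left:
 assumes "lie.subspace L" "normalizes x L" "normalizes y L" "normalizes z L"
 shows "killing_form L (x + y) z = killing_form L x z + killing_form L y z"
 unfolding killing_form_def bracket_add_left
 by (rule trace_on_add[OF assms(1) lin_ad_ad lin_ad_ad]) (use assms in auto)

lemma killing_scale_left:
 assumes "lie.subspace L" "normalizes x L" "normalizes y L"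
 shows "killing_form L (c *. x) y = c * killing_form L x y"
 unfolding killing_form_def bracket_scaleC_left
 by (rule trace_on_scale[OF assms(1) lin_ad_ad]) (use assms in auto)

lemma normalizes_add: "lie.subspace L ==> normalizes x L ==> normalizes y L ==> normalizes (x + y) L"
 by (simp add: bracket_add_left lie.subspace_add)

lemma normalizes_scale: "lie.subspace L ==> normalizes x L ==> normalizes (c *. x) L"
 by (simp add: bracket_scaleC_left lie.subspace_scale)

lemma killing_add_right:
 assumes "lie.subspace L" "normalizes x L" "normalizes y L" "normalizes z L"
 shows "killing_form L z (x + y) = killing_form L z x + killing_form L z y"
 using killing_add_left[OF assms] killing_sym[OF assms(1,4)] assms(2,3)
  normalizes_add[OF assms(1-3)] by simp

lemma killing_scale_right:
 assumes "lie.subspace L" "normalizes x L" "normalizes y L"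
 shows "killing_form L y (c *. x) = c * killing_form L y x"
 using killing_scale_left[OF assms, of c] killing_sym[OF assms(1,3)] assms(2)
  normalizes_scale[OF assms(1,2), of c] by simp

lemma killing_invariant:
 assumes L: "lie.subspace L" and N: "normalizes x L" "normalizes y L" "normalizes z L"
 shows "killing_form L (ad x y) z = killing_form L x (ad y z)"
proof -
 note l3 = lin_compose[OF lin_ad lin_ad_ad]
 have "killing_form L (ad x y) z
   = trace_on L (%w. ad x (ad y (ad z w)) - ad y (ad x (ad z w)))"
  unfolding killing_form_def ad_bracket ..
 also have "... = trace_on L (%w. ad x (ad y (ad z w)))
   - trace_on L (%w. ad y (ad x (ad z w)))"
  by (rule trace_on_diff[OF L l3 l3]) (use N in auto)
 also have "trace_on L (%w. ad y (ad x (ad z w)))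
   = trace_on L (%w. ad x (ad z (ad y w)))"
  by (rule trace_on_commute[OF L lin_ad lin_ad_ad]) (use N in auto)
 also have "trace_on L (%w. ad x (ad y (ad z w))) - ...
   = trace_on L (%w. ad x (ad y (ad z w)) - ad x (ad z (ad y w)))"
  by (rule trace_on_diff[OF L l3 l3, symmetric]) (use N in auto)
 also have "... = killing_form L x (ad y z)"
  unfolding killing_form_def ad_bracket bracket_diff_right ..
 finally show ?thesis .
qed

lemma killing_zero_left [simp]: "lie.subspace L ==> killing_form L 0 x = 0"
 unfolding killing_form_def using trace_on_nilpotent_uniform[of L "%x. 0" 1]
 by (simp add: lin_zero lie.subspace_0)

lemma killing_zero_right [simp]: "lie.subspace L ==> killing_form L x 0 = 0"
 unfolding killing_form_def using trace_on_nilpotent_uniform[of L "%x. 0" 1]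
 by (simp add: lin_zero lie.subspace_0)

lemma subalgebraD:
 assumes "subalgebra L"
 shows "lie.subspace L" "!!x y. x : L ==> y : L ==> ad x y : L" "!!x. x : L ==> normalizes x L"
 using assms unfolding subalgebra_def by auto

lemma killing_bilinear:
 assumes "subalgebra L" "x : L" "y : L" "z : L"
 shows "killing_form L (x + y) z = killing_form L x z + killing_form L y z"
  "killing_form L (x - y) z = killing_form L x z - killing_form L y z"
  "killing_form L (- x) z = - killing_form L x z"
  "killing_form L (c *. x) z = c * killing_form L x z"
  "killing_form L z (x + y) = killing_form L z x + killing_form L z y"
  "killing_form L z (x - y) = killing_form L z x - killing_form L z y"
  "killing_form L z (- x) = - killing_form L z x"
  "killing_form L z (c *. x) = c * killing_form L z x"
proof -
 note N = subalgebraD[OF assms(1)]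
 have 1: "killing_form L (u + v) w = killing_form L u w + killing_form L v w" if "u : L" "v : L" "w : L" for u v w
  using that N by (intro killing_add_left) auto
 have 2: "killing_form L (c *. u) w = c * killing_form L u w" if "u : L" "w : L" for u w c
  using that N by (intro killing_scale_left) auto
 have m: "killing_form L (- u) w = - killing_form L u w" if "u : L" "w : L" for u w
  using 2[OF that, of "-1"] by (simp add: scale_simps)
 have sym: "killing_form L u w = killing_form L w u" if "u : L" "w : L" for u w
  using that N by (intro killing_sym) auto
 note closed = assms(2-4) lie.subspace_add[OF N(1)] lie.subspace_diff[OF N(1)] lie.subspace_neg[OF N(1)] lie.subspace_scale[OF N(1)]
 show l: "killing_form L (x + y) z = killing_form L x z + killing_form L y z"
  "killing_form L (x - y) z = killing_form L x z - killing_form L y z"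
  "killing_form L (- x) z = - killing_form L x z"
  "killing_form L (c *. x) z = c * killing_form L x z"
  using 1[of x y z] 1[of x "- y" z] m[of y z] m[of x z] 2[of x z c] closed by simp_all
 show "killing_form L z (x + y) = killing_form L z x + killing_form L z y"
  "killing_form L z (x - y) = killing_form L z x - killing_form L z y"
  "killing_form L z (- x) = - killing_form L z x"
  "killing_form L z (c *. x) = c * killing_form L z x"
  using l sym[of z "x + y"] sym[of z "x - y"] sym[of z "- x"] sym[of z "c *. x"] sym[of z x] sym[of z y]
   closed by simp_all
qed

lemma eigen_span_stable:
 assumes "lin S" "!!b. b : B ==> S b = c b *. b" "v : lie.span B"
 shows "S v : lie.span B"
proof (rule lin_span_stable[OF assms(1) _ lie.subspace_span assms(3)])
 fix b assume "b : B"
 thus "S b : lie.span B" using assms(2) by (simp add: lie.span_scale lie.span_base)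
qed

lemma killing_zero_subspace:
 assumes L: "subalgebra L" and "x : L" "S \<subseteq> L" "!!y. y : S ==> killing_form L x y = 0"
  and "y : lie.span S"
 shows "killing_form L x y = 0"
proof -
 note N = subalgebraD[OF L]
 have "lie.subspace {y : L. killing_form L x y = 0}"
  unfolding lie.subspace_def using N assms(2)
  by (auto simp: killing_add_right killing_scale_right lie.subspace_add lie.subspace_scale lie.subspace_0)
 hence "lie.span S \<subseteq> {y : L. killing_form L x y = 0}"
  using assms(3,4) by (intro lie.span_minimal) auto
 thus ?thesis using assms(5) by auto
qed

lemma gen_eig_bracket:
 assumes A: "lin A" and der: "!!u v. u : L ==> v : L ==> A (ad u v) = ad (A u) v + ad u (A v)"
  and L: "lie.subspace L" "!!v. v : L ==> A v : L"
  and uv: "u : L" "v : L" "gen_eig A c u" "gen_eig A d v"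
 shows "gen_eig A (c + d) (ad u v)"
proof -
 obtain j k where "((%w. A w - c *. w) ^^ j) u = 0" "((%w. A w - d *. w) ^^ k) v = 0"
  using uv unfolding gen_eig_def by blast
 thus ?thesis using uv(1,2)
 proof (induction "j + k" arbitrary: j k u v rule: less_induct)
  case less
  show ?case
  proof (cases "j = 0 | k = 0")
   case True
   hence "ad u v = 0" using less.prems by auto
   thus ?thesis using gen_eig_zero[OF A] by simp
  next
   case False
   then obtain j' k' where jk: "j = Suc j'" "k = Suc k'" by (metis not0_implies_Suc)
   let ?u = "A u - c *. u" and ?v = "A v - d *. v"
   have mem: "?u : L" "?v : L" using less.prems L by (auto intro!: lie.subspace_diff lie.subspace_scale)
   have z: "((%w. A w - c *. w) ^^ j') ?u = 0" "((%w. A w - d *. w) ^^ k') ?v = 0"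
    using less.prems(1,2) unfolding jk funpow_Suc_right o_apply .
   have "gen_eig A (c + d) (ad ?u v)"
    by (rule less.hyps[OF _ z(1) less.prems(2) mem(1) less.prems(4)]) (simp add: jk)
   moreover have "gen_eig A (c + d) (ad u ?v)"
    by (rule less.hyps[OF _ less.prems(1) z(2) less.prems(3) mem(2)]) (simp add: jk)
   ultimately have "gen_eig A (c + d) (ad ?u v + ad u ?v)" by (rule gen_eig_add[OF A])
   also have "ad ?u v + ad u ?v = A (ad u v) - (c + d) *. ad u v"
    using der[OF less.prems(3,4)] by (simp add: bracket_simps scale_simps)
   finally show ?thesis using gen_eig_shift_iff[OF A] by blast
  qed
 qed
qed

lemma gen_eig_ad_bracket:
 assumes "gen_eig (ad x) c u" "gen_eig (ad x) d v"
 shows "gen_eig (ad x) (c + d) (ad u v)"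
 by (rule gen_eig_bracket[OF lin_ad ad_derivation lie.subspace_UNIV]) (use assms in auto)

text \<open>Invariance makes \<open>ad h\<close> skew for the Killing form, so generalized eigenspaces pair
 trivially unless their eigenvalues cancel.\<close>

lemma killing_gen_orth:
 assumes L: "subalgebra L" and h: "h : L" and uv: "u : L" "v : L"
  and ge: "gen_eig (ad h) c u" "gen_eig (ad h) d v" and "c + d ~= 0"
 shows "killing_form L u v = 0"
proof -
 note N = subalgebraD[OF L]
 obtain j k where "((%w. ad h w - c *. w) ^^ j) u = 0" "((%w. ad h w - d *. w) ^^ k) v = 0"
  using ge unfolding gen_eig_def by blast
 thus ?thesis using uv
 proof (induction "j + k" arbitrary: j k u v rule: less_induct)
  case less
  show ?case
  proof (cases "j = 0 | k = 0")
   case True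
   hence "u = 0 | v = 0" using less.prems by auto
   thus ?thesis using N(1) by auto
  next
   case False
   then obtain j' k' where jk: "j = Suc j'" "k = Suc k'" by (metis not0_implies_Suc)
   let ?u = "ad h u - c *. u" and ?v = "ad h v - d *. v"
   have mem: "?u : L" "?v : L" "ad h u : L" "ad h v : L"
    using less.prems N h by (auto intro!: lie.subspace_diff lie.subspace_scale)
   have z: "((%w. ad h w - c *. w) ^^ j') ?u = 0" "((%w. ad h w - d *. w) ^^ k') ?v = 0"
    using less.prems(1,2) unfolding jk funpow_Suc_right o_apply .
   have k1: "killing_form L ?u v = 0"
    by (rule less.hyps[OF _ z(1) less.prems(2) mem(1) less.prems(4)]) (simp add: jk)
   have k2: "killing_form L u ?v = 0"
    by (rule less.hyps[OF _ less.prems(1) z(2) less.prems(3) mem(2)]) (simp add: jk)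
   have cu: "c *. u : L" "d *. v : L" using less.prems N(1) lie.subspace_scale by auto
   have e1: "killing_form L (ad h u) v = c * killing_form L u v"
    using k1 killing_bilinear(2)[OF L mem(3) cu(1) less.prems(4)]
     killing_bilinear(4)[OF L less.prems(3,3,4), of c] by simp
   have e2: "killing_form L u (ad h v) = d * killing_form L u v"
    using k2 killing_bilinear(6)[OF L mem(4) cu(2) less.prems(3)]
     killing_bilinear(8)[OF L less.prems(4,4,3), of d] by simp
   have "killing_form L (ad u h) v = killing_form L u (ad h v)"
    using N h less.prems by (intro killing_invariant) auto
   moreover have "killing_form L (ad u h) v = - killing_form L (ad h u) v"
    using killing_bilinear(3)[OF L mem(3) mem(3) less.prems(4)] bracket_anti[of u h] by simp
   ultimately have "d * killing_form L u v = - (c * killing_form L u v)" using e1 e2 by simp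
   hence "(c + d) * killing_form L u v = 0" by (simp add: distrib_right)
   thus ?thesis using \<open>c + d ~= 0\<close> by simp
  qed
 qed
qed

lemma killing_center:
 assumes "killing_nondeg L" "x : L" "!!y. y : L ==> ad x y = 0"
 shows "x = 0"
proof -
 have L: "subalgebra L" using assms(1) unfolding killing_nondeg_def by blast
 note N = subalgebraD[OF L]
 have "killing_form L x y = 0" if "y : L" for y
  unfolding killing_form_def
  using trace_on_nilpotent_uniform[OF N(1) lin_ad_ad, of x y 1] assms(3) N that lie.subspace_0[OF N(1)]
  by simp
 thus ?thesis using assms(1,2) unfolding killing_nondeg_def by blast
qed

text \<open>A nondegenerate form on a finite-dimensional space represents every linear functional.\<close>

lemma killing_represent:
 assumes nd: "killing_nondeg L"
  and add: "!!x y. x : L ==> y : L ==> \<phi> (x + y) = \<phi> x + \<phi> y"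
  and scale: "!!c x. x : L ==> \<phi> (c *. x) = c * \<phi> x"
 obtains s where "s : L" "!!y. y : L ==> killing_form L s y = \<phi> y"
proof -
 have L: "subalgebra L" using nd unfolding killing_nondeg_def by blast
 note N = subalgebraD[OF L]
 obtain B where B: "B \<subseteq> L" "lie.independent B" "lie.span B = L" "finite B"
  by (rule obtain_basis[OF N(1) subset_refl lie.span_superset])
 obtain \<Psi> where \<Psi>: "lin \<Psi>" "!!x. x : B ==> \<Psi> x = (SUM b:B. killing_form L x b *. b)"
  using endo.linear_independent_extend[OF B(2), of "%x. SUM b:B. killing_form L x b *. b"] by metis
 have \<Psi>L: "\<Psi> x = (SUM b:B. killing_form L x b *. b)" if "x : L" for x
 proof -
  have "lie.subspace {x : L. \<Psi> x = (SUM b:B. killing_form L x b *. b)}"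
   unfolding lie.subspace_def using N B(1)
   by (auto simp: endo.linear_0[OF \<Psi>(1)] endo.linear_add[OF \<Psi>(1)] endo.linear_scale[OF \<Psi>(1)]
     killing_add_left killing_scale_left subset_iff lie.subspace_add lie.subspace_scale
     lie.subspace_0 scale_simps sum.distrib lie.scale_sum_right)
  hence "lie.span B \<subseteq> {x : L. \<Psi> x = (SUM b:B. killing_form L x b *. b)}"
   using B(1) \<Psi>(2) by (intro lie.span_minimal) auto
  thus ?thesis using that B(3) by auto
 qed
 have coeffs: "(SUM b:B. f b *. b) = (SUM b:B. g b *. b) ==> b : B ==> f b = g b" for f g b
 proof -
  assume "(SUM b:B. f b *. b) = (SUM b:B. g b *. b)" and b: "b : B"
  hence "(SUM b:B. (f b - g b) *. b) = 0" by (simp add: scale_simps sum_subtractf)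
  thus "f b = g b" using lie.independentD[OF B(2,4) subset_refl _ b, of "%b. f b - g b"] by simp
 qed
 have "inj_on \<Psi> L"
 proof (rule inj_onI)
  fix x y assume xy: "x : L" "y : L" "\<Psi> x = \<Psi> y"
  have d: "x - y : L" using xy N(1) lie.subspace_diff by blast
  have "(SUM b:B. killing_form L (x - y) b *. b) = (SUM b:B. 0 *. b)"
   using \<Psi>L[OF d] xy(3) by (simp add: endo.linear_diff[OF \<Psi>(1)])
  hence "killing_form L (x - y) b = 0" if "b : B" for b
   using coeffs[of "killing_form L (x - y)" "%_. 0"] that by blast
  hence "killing_form L (x - y) z = 0" if "z : L" for z
   using killing_zero_subspace[OF L d B(1)] that B(3) by blast
  hence "x - y = 0" using nd d unfolding killing_nondeg_def by blast
  thus "x = y" by simp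
 qed
 hence "lie.dim (\<Psi> ` L) = lie.dim L"
  using endo.dim_image_eq[OF \<Psi>(1), of L] N(1) by (simp add: lie.span_eq_iff[THEN iffD2])
 moreover have "\<Psi> ` L \<subseteq> L"
  using \<Psi>L B(1) N(1) by (auto intro!: lie.subspace_sum lie.subspace_scale)
 ultimately have "\<Psi> ` L = L"
  using fin.subspace_dim_equal[of "\<Psi> ` L" L] endo.linear_subspace_image[OF \<Psi>(1) N(1)] N(1) by simp
 moreover have "(SUM b:B. \<phi> b *. b) : L"
  using B(1) N(1) by (auto intro!: lie.subspace_sum lie.subspace_scale)
 ultimately obtain s where s: "s : L" "\<Psi> s = (SUM b:B. \<phi> b *. b)" by (metis imageE)
 have sb: "killing_form L s b = \<phi> b" if "b : B" for b
  using coeffs[of "killing_form L s" \<phi> b] s \<Psi>L[OF s(1)] that by simp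
 have "lie.subspace {y : L. killing_form L s y = \<phi> y}"
  unfolding lie.subspace_def using N s(1) scale[of 0 0]
  by (auto simp: killing_add_right killing_scale_right lie.subspace_add lie.subspace_scale
    lie.subspace_0 add scale)
 hence "lie.span B \<subseteq> {y : L. killing_form L s y = \<phi> y}"
  using sb B(1) by (intro lie.span_minimal) auto
 thus thesis using that[OF s(1)] B(3) by auto
qed

lemma derivation_inner:
 assumes nd: "killing_nondeg L" and D: "lin D" "!!v. v : L ==> D v : L"
  and der: "!!u v. u : L ==> v : L ==> D (ad u v) = ad (D u) v + ad u (D v)"
 obtains s where "s : L" "!!v. v : L ==> D v = ad s v"
proof -
 have L: "subalgebra L" using nd unfolding killing_nondeg_def by blast
 note N = subalgebraD[OF L]
 note lD = lin_compose[OF D(1) lin_ad]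
 obtain s where s: "s : L" "!!y. y : L ==> killing_form L s y = trace_on L (%z. D (ad y z))"
 proof (rule killing_represent[OF nd])
  fix x y assume "x : L" "y : L"
  thus "trace_on L (%z. D (ad (x + y) z)) = trace_on L (%z. D (ad x z)) + trace_on L (%z. D (ad y z))"
   unfolding bracket_add_left endo.linear_add[OF D(1)]
   by (intro trace_on_add[OF N(1) lD lD]) (use N D in auto)
 next
  fix c x assume "x : L"
  thus "trace_on L (%z. D (ad (c *. x) z)) = c * trace_on L (%z. D (ad x z))"
   unfolding bracket_scaleC_left endo.linear_scale[OF D(1)]
   by (intro trace_on_scale[OF N(1) lD]) (use N D in auto)
 qed blast
 define E where "E v = D v - ad s v" for v
 have E: "lin E" unfolding E_def by (rule lin_diff[OF D(1) lin_ad])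
 have EL: "E v : L" if "v : L" for v unfolding E_def using that D(2) s(1) N by (simp add: lie.subspace_diff)
 have Eder: "E (ad u v) = ad (E u) v + ad u (E v)" if "u : L" "v : L" for u v
  unfolding E_def der[OF that] ad_derivation[of s] by (simp add: bracket_simps)
 note lE = lin_compose[OF E lin_ad]
 have tr0: "trace_on L (%z. E (ad y z)) = 0" if y: "y : L" for y
 proof -
  have "trace_on L (%z. E (ad y z)) = trace_on L (%z. D (ad y z)) - trace_on L (%z. ad s (ad y z))"
   unfolding E_def by (rule trace_on_diff[OF N(1) lD lin_ad_ad]) (use N D s y in auto)
  thus ?thesis using s(2)[OF y] unfolding killing_form_def by simp
 qed
 have "E x = 0" if x: "x : L" for x
 proof -
  have "killing_form L (E x) y = 0" if y: "y : L" for y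
  proof -
   note l3 = lin_compose[OF E lin_ad_ad] and l3' = lin_compose[OF lin_ad lE]
   have "killing_form L (E x) y = trace_on L (%z. E (ad x (ad y z)) - ad x (E (ad y z)))"
    unfolding killing_form_def using Eder x y N by (intro trace_on_cong) auto
   also have "... = trace_on L (%z. E (ad x (ad y z))) - trace_on L (%z. ad x (E (ad y z)))"
    by (rule trace_on_diff[OF N(1) l3 l3']) (use x y N EL in auto)
   also have "trace_on L (%z. ad x (E (ad y z))) = trace_on L (%z. E (ad y (ad x z)))"
    by (rule trace_on_commute[OF N(1) lin_ad lE]) (use x y N EL in auto)
   also have "trace_on L (%z. E (ad x (ad y z))) - ...
     = trace_on L (%z. E (ad x (ad y z)) - E (ad y (ad x z)))"
    by (rule trace_on_diff[OF N(1) l3 l3, symmetric]) (use x y N EL in auto)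
   also have "... = trace_on L (%z. E (ad (ad x y) z))"
    unfolding ad_bracket endo.linear_diff[OF E] ..
   also have "... = 0" using x y N by (intro tr0) auto
   finally show ?thesis .
  qed
  thus ?thesis using nd EL[OF x] unfolding killing_nondeg_def by blast
 qed
 thus thesis using that[OF s(1)] unfolding E_def by simp
qed

text \<open>An additive function of the eigenvalues turns \<open>ad x\<close> into a derivation, because brackets add
 generalized eigenvalues.\<close>

lemma spectral_operator_derivation:
 assumes L: "subalgebra L" and A: "lin A" "!!v. v : L ==> A v : L"
  and der: "!!u v. u : L ==> v : L ==> A (ad u v) = ad (A u) v + ad u (A v)"
  and B: "lie.span B = L" "!!b. b : B ==> gen_eig A (ev b) b"
  and S: "lin S" "!!v c. v : L ==> gen_eig A c v ==> S v = \<phi> c *. v"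
  and add: "!!c d. \<phi> (c + d) = \<phi> c + \<phi> d"
  and uv: "u : L" "v : L"
 shows "S (ad u v) = ad (S u) v + ad u (S v)"
proof -
 note N = subalgebraD[OF L]
 have BL: "b : L" if "b : B" for b using B(1) lie.span_base[OF that] by simp
 have BB: "S (ad b b') = ad (S b) b' + ad b (S b')" if "b : B" "b' : B" for b b'
 proof -
  have "gen_eig A (ev b + ev b') (ad b b')"
   by (rule gen_eig_bracket[OF A(1) der N(1) A(2)]) (use that B BL in auto)
  hence "S (ad b b') = (\<phi> (ev b) + \<phi> (ev b')) *. ad b b'"
   using S(2)[of "ad b b'"] N(2) BL that add by simp
  thus ?thesis using S(2)[OF BL B(2)] that by (simp add: bracket_simps scale_simps)
 qed
 have Bv: "S (ad b v) = ad (S b) v + ad b (S v)" if "b : B" for b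
 proof (rule span_closed[of v B])
  show "v : lie.span B" using uv B by simp
  show "lie.subspace {v. S (ad b v) = ad (S b) v + ad b (S v)}"
   unfolding lie.subspace_def
   by (auto simp: endo.linear_0[OF S(1)] endo.linear_add[OF S(1)] endo.linear_scale[OF S(1)]
     bracket_simps scale_simps)
 qed (use BB that in auto)
 show ?thesis
 proof (rule span_closed[of u B])
  show "u : lie.span B" using uv B by simp
  show "lie.subspace {u. S (ad u v) = ad (S u) v + ad u (S v)}"
   unfolding lie.subspace_def
   by (auto simp: endo.linear_0[OF S(1)] endo.linear_add[OF S(1)] endo.linear_scale[OF S(1)]
     bracket_simps scale_simps)
 qed (use Bv in auto)
qed

lemma jordan_part:
 assumes nd: "killing_nondeg L" and x: "x : L"
 obtains s where "s : L" "!!c v. v : L ==> gen_eig (ad x) c v ==> ad s v = c *. v"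
proof -
 have L: "subalgebra L" using nd unfolding killing_nondeg_def by blast
 note N = subalgebraD[OF L]
 have st: "!!v. v : L ==> ad x v : L" using x N by blast
 obtain B ev where B: "B \<subseteq> L" "lie.independent B" "lie.span B = L" "finite B"
  "!!b. b : B ==> gen_eig (ad x) (ev b) b"
  using gen_eig_basis[OF lin_ad N(1) st] by metis
 obtain S where S: "lin S" "!!b. b : B ==> S b = ev b *. b"
  "!!v c. v : L ==> gen_eig (ad x) c v ==> S v = c *. v"
  using spectral_operator[OF lin_ad[of x] B(2,4,5), of "%c. c"] unfolding B(3) by metis
 have SL: "S v : L" if "v : L" for v
  using eigen_span_stable[OF S(1), of B ev v] S(2) that B(3) by simp
 have Sder: "S (ad u v) = ad (S u) v + ad u (S v)" if "u : L" "v : L" for u v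
  by (rule spectral_operator_derivation[OF L lin_ad st ad_derivation B(3,5) S(1), of "%c. c"])
   (use S(3) that in auto)
 obtain s where "s : L" "!!v. v : L ==> S v = ad s v"
  using derivation_inner[OF nd S(1) SL Sder] by metis
 thus thesis using that S(3) by metis
qed

text \<open>Cartan's criterion in the form needed here. If the Killing form of a perfect \<open>L\<close> vanished, the
 derivation acting by the complex conjugate of the eigenvalues of \<open>ad x\<close> would satisfy
 \<open>tr (D \<circ> ad x) = 0\<close>; but this trace is the sum of the \<open>|c|\<^sup>2\<close>, so \<open>ad x\<close> would be nilpotent.\<close>

lemma killing_nondeg_simple:
 assumes simple: "simple_lie L"
  and xv: "x : L" "v : L" "v ~= 0" "ad x v = a *. v" "a ~= 0"
 shows "killing_nondeg L"
proof -
 have L: "subalgebra L" using simple unfolding simple_lie_def by blast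
 note N = subalgebraD[OF L]
 let ?R = "{x : L. ALL y:L. killing_form L x y = 0}"
 have "lie_ideal L ?R"
 proof -
  have "lie.subspace ?R" unfolding lie.subspace_def using N
   by (auto simp: killing_add_left killing_scale_left lie.subspace_add lie.subspace_scale lie.subspace_0)
  moreover have "ad y z : ?R" if y: "y : L" and z: "z : ?R" for y z
  proof -
   have "killing_form L (ad y z) w = 0" if w: "w : L" for w
   proof -
    have "killing_form L (ad z y) w = killing_form L z (ad y w)"
     using N y z w by (intro killing_invariant) auto
    hence "killing_form L (ad z y) w = 0" using N y z w by auto
    moreover have "killing_form L (ad y z) w = - killing_form L (ad z y) w"
     using killing_scale_left[of L "ad z y" w "-1"] N y z w bracket_anti[of y z]
     by (simp add: scale_simps)
    ultimately show ?thesis by simp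
   qed
   thus ?thesis using N y z by auto
  qed
  ultimately show ?thesis unfolding lie_ideal_def by auto
 qed
 then consider "?R = {0}" | "?R = L" using simple unfolding simple_lie_def by blast
 thus ?thesis
 proof cases
  case 1
  hence "ALL x:L. (ALL y:L. killing_form L x y = 0) --> x = 0" by blast
  thus ?thesis using L unfolding killing_nondeg_def by blast
 next
  case 2
  hence k0: "!!y z. y : L ==> z : L ==> killing_form L y z = 0" by auto
  have sub: "bracket_span L L \<subseteq> L" unfolding bracket_span_def
   by (rule lie.span_minimal[OF _ N(1)]) (use N in auto)
  have "lie_ideal L (bracket_span L L)"
   unfolding lie_ideal_def using sub
   by (auto simp: bracket_span_def intro!: lie.span_base)
  moreover have "bracket_span L L ~= {0}"
  proof
   assume "bracket_span L L = {0}"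
   hence "ad y z = 0" if "y : L" "z : L" for y z
    using lie.span_base[of "ad y z" "{ad x y |x y. x : L & y : L}"] that
    unfolding bracket_span_def by auto
   thus False using simple unfolding simple_lie_def abelian_lie_def by blast
  qed
  ultimately have perfect: "bracket_span L L = L" using simple unfolding simple_lie_def by blast
  have st: "!!v. v : L ==> ad x v : L" using xv(1) N by blast
  obtain B ev where B: "B \<subseteq> L" "lie.independent B" "lie.span B = L" "finite B"
   "!!b. b : B ==> gen_eig (ad x) (ev b) b"
   using gen_eig_basis[OF lin_ad N(1) st] by metis
  obtain S where S: "lin S" "!!b. b : B ==> S b = ev b *. b"
   "!!v c. v : L ==> gen_eig (ad x) c v ==> S v = c *. v"
   using spectral_operator[OF lin_ad[of x] B(2,4,5), of "%c. c"] unfolding B(3) by metis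
  obtain D where D: "lin D" "!!b. b : B ==> D b = cnj (ev b) *. b"
   "!!v c. v : L ==> gen_eig (ad x) c v ==> D v = cnj c *. v"
   using spectral_operator[OF lin_ad[of x] B(2,4,5), of cnj] unfolding B(3) by metis
  have SL: "S v : L" if "v : L" for v
   using eigen_span_stable[OF S(1), of B ev v] S(2) that B(3) by simp
  have DL: "D v : L" if "v : L" for v
   using eigen_span_stable[OF D(1), of B "%b. cnj (ev b)" v] D(2) that B(3) by simp
  have Dder: "D (ad u v) = ad (D u) v + ad u (D v)" if "u : L" "v : L" for u v
   by (rule spectral_operator_derivation[OF L lin_ad st ad_derivation B(3,5) D(1), of cnj])
    (use D(3) that in auto)
  note lD = lin_compose[OF D(1) lin_ad]
  have tr_bracket: "trace_on L (%w. D (ad (ad y z) w)) = 0" if y: "y : L" and z: "z : L" for y z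
  proof -
   note l3 = lin_compose[OF D(1) lin_ad_ad] and l3' = lin_compose[OF lin_ad lD]
   have "trace_on L (%w. D (ad (ad y z) w))
     = trace_on L (%w. D (ad y (ad z w)) - D (ad z (ad y w)))"
    unfolding ad_bracket endo.linear_diff[OF D(1)] ..
   also have "... = trace_on L (%w. D (ad y (ad z w))) - trace_on L (%w. D (ad z (ad y w)))"
    by (rule trace_on_diff[OF N(1) l3 l3]) (use y z N DL in auto)
   also have "trace_on L (%w. D (ad z (ad y w))) = trace_on L (%w. ad y (D (ad z w)))"
    by (rule trace_on_commute[OF N(1) lD lin_ad]) (use y z N DL in auto)
   also have "trace_on L (%w. D (ad y (ad z w))) - ...
     = trace_on L (%w. D (ad y (ad z w)) - ad y (D (ad z w)))"
    by (rule trace_on_diff[OF N(1) l3 l3', symmetric]) (use y z N DL in auto)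
   also have "... = killing_form L (D y) z"
    unfolding killing_form_def using Dder y z N by (intro trace_on_cong) auto
   also have "... = 0" by (rule k0[OF DL[OF y] z])
   finally show ?thesis .
  qed
  have tr0: "trace_on L (%w. D (ad x w)) = 0"
  proof -
   have "lie.subspace {y : L. trace_on L (%w. D (ad y w)) = 0}"
   proof -
    have "trace_on L (%w. D (ad (y + z) w)) = trace_on L (%w. D (ad y w)) + trace_on L (%w. D (ad z w))"
     if "y : L" "z : L" for y z
     unfolding bracket_add_left endo.linear_add[OF D(1)]
     by (intro trace_on_add[OF N(1) lD lD]) (use N DL that in auto)
    moreover have "trace_on L (%w. D (ad (c *. y) w)) = c * trace_on L (%w. D (ad y w))"
     if "y : L" for c y
     unfolding bracket_scaleC_left endo.linear_scale[OF D(1)]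
     by (intro trace_on_scale[OF N(1) lD]) (use N DL that in auto)
    moreover have "trace_on L (%w. D (ad 0 w)) = 0"
     using trace_on_nilpotent_uniform[OF N(1) lin_zero, of 1] lie.subspace_0[OF N(1)]
     by (simp add: endo.linear_0[OF D(1)])
    ultimately show ?thesis unfolding lie.subspace_def
     using lie.subspace_0[OF N(1)] lie.subspace_add[OF N(1)] lie.subspace_scale[OF N(1)] by auto
   qed
   hence "bracket_span L L \<subseteq> {y : L. trace_on L (%w. D (ad y w)) = 0}"
    unfolding bracket_span_def using tr_bracket N by (intro lie.span_minimal) auto
   thus ?thesis using perfect xv(1) by auto
  qed
  let ?N = "%w. ad x w - S w"
  have lN: "lin ?N" by (rule lin_diff[OF lin_ad S(1)])
  have lDN: "lin (%w. D (?N w))" by (rule lin_compose[OF D(1) lN])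
  have NL: "?N w : L" if "w : L" for w using st SL that N(1) lie.subspace_diff by blast
  have nil: "((%w. D (?N w)) ^^ k) w = 0"
   if "w : L" "gen_eig (ad x) c w" "((%w. ad x w - c *. w) ^^ k) w = 0" for k w c
   using that
  proof (induction k arbitrary: w)
   case (Suc k)
   let ?u = "ad x w - c *. w"
   have uL: "?u : L" using Suc.prems(1) st N(1) by (simp add: lie.subspace_diff lie.subspace_scale)
   have ug: "gen_eig (ad x) c ?u" using Suc.prems(2) by (simp add: gen_eig_shift_iff lin_ad)
   have "?N w = ?u" using S(3) Suc.prems(1,2) by simp
   hence DN: "D (?N w) = cnj c *. ?u" using D(3)[OF uL ug] by simp
   have "((%w. ad x w - c *. w) ^^ k) ?u = 0"
    using Suc.prems(3) unfolding funpow_Suc_right o_apply .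
   from Suc.IH[OF uL ug this] have "((%w. D (?N w)) ^^ k) (D (?N w)) = 0"
    unfolding DN endo.linear_scale[OF lin_funpow[OF lDN]] by simp
   thus ?case unfolding funpow_Suc_right o_apply .
  qed simp
  have "trace_on L (%w. D (?N w)) = 0"
  proof (rule trace_on_nilpotent[OF N(1) lDN])
   show "D (?N w) : L" if "w : L" for w using DL NL that by blast
   fix w assume "w : L"
   hence "w : lie.span B" using B(3) by simp
   thus "EX k. ((%w. D (?N w)) ^^ k) w = 0"
   proof (rule span_closed[OF _ subspace_nilpotent_vectors[OF lDN]])
    fix b assume "b : B"
    then obtain k where "((%w. ad x w - ev b *. w) ^^ k) b = 0" "b : L" "gen_eig (ad x) (ev b) b"
     using B(1,5) unfolding gen_eig_def by blast
    thus "EX k. ((%w. D (?N w)) ^^ k) b = 0" using nil by blast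
   qed
  qed
  moreover have "trace_on L (%w. D (?N w)) = trace_on L (%w. D (ad x w)) - trace_on L (%w. D (S w))"
   unfolding endo.linear_diff[OF D(1)]
   by (rule trace_on_diff[OF N(1) lD lin_compose[OF D(1) S(1)]]) (use DL SL st in auto)
  ultimately have "trace_on L (%w. D (S w)) = 0" using tr0 by simp
  moreover have "trace_on L (%w. D (S w)) = (SUM b:B. ev b * cnj (ev b))"
   by (rule trace_on_eigenbasis[OF N(1) B(2,3) lin_compose[OF D(1) S(1)]])
    (simp add: S(2) D(2) endo.linear_scale[OF D(1)] scaleC_scaleC)
  ultimately have "(SUM b:B. ev b * cnj (ev b)) = 0" by simp
  hence "(SUM b:B. (cmod (ev b))\<^sup>2) = 0"
   by (simp add: complex_norm_square[symmetric] flip: of_real_power of_real_sum)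
  hence ev0: "ev b = 0" if "b : B" for b
   using sum_nonneg_eq_0_iff[OF B(4), of "%b. (cmod (ev b))\<^sup>2"] that by simp
  have "S v = 0"
   by (rule lin_eq_on_span[OF S(1) lin_zero, of B v]) (use S(2) ev0 B(3) xv(2) in auto)
  moreover have "S v = a *. v" using S(3) xv gen_eig_eigenvector by metis
  ultimately show ?thesis using xv by simp
 qed
qed

section \<open>Joint weight spaces, Cartan subalgebras and toral subalgebras\<close>

definition joint_gen :: "'g::complex_lie_algebra set => ('g => complex) => 'g set => 'g set" where
 "joint_gen H \<mu> V = {v : V. ALL h:H. gen_eig (ad h) (\<mu> h) v}"

lemma joint_gen_subspace: "lie.subspace V ==> lie.subspace (joint_gen H \<mu> V)"
 unfolding joint_gen_def lie.subspace_def
 by (auto intro: gen_eig_zero gen_eig_add gen_eig_scale lin_ad)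

lemma joint_gen_stable:
 assumes "!!h. h : H ==> gen_eig (ad h) 0 x" "normalizes x V" "v : joint_gen H \<mu> V"
 shows "ad x v : joint_gen H \<mu> V"
 using assms gen_eig_ad_bracket[of _ 0 x _ v] unfolding joint_gen_def by auto

lemma gen_eig_sub_stable:
 assumes "!!h. h : H ==> gen_eig (ad h') 0 h" "!!h v. h : H ==> v : V ==> ad h v : V"
  "h : H" "v : {v : V. gen_eig (ad h') c v}"
 shows "ad h v : {v : V. gen_eig (ad h') c v}"
 using assms gen_eig_ad_bracket[of h' 0 h c v] by auto

text \<open>If some \<open>h\<close> has several eigenvalues on \<open>V\<close>, split \<open>V\<close> along them; the pieces have smaller
 dimension and are stable under \<open>H\<close> because \<open>H\<close> consists of generalized null vectors of \<open>ad h\<close>.\<close>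

lemma joint_gen_span:
 assumes H: "!!h h'. h : H ==> h' : H ==> gen_eig (ad h) 0 h'"
  and "lie.subspace V" "!!h v. h : H ==> v : V ==> ad h v : V"
 shows "V \<subseteq> lie.span (\<Union>\<mu>. joint_gen H \<mu> V)"
 using assms(2,3)
proof (induction "lie.dim V" arbitrary: V rule: less_induct)
 case less
 define E where "E h c = {v : V. gen_eig (ad h) c v}" for h c
 show ?case
 proof (cases "ALL h:H. EX c. V = E h c")
  case True
  from bchoice[OF this] obtain \<mu> where \<mu>: "ALL h:H. V = E h (\<mu> h)" ..
  have "v : joint_gen H \<mu> V" if "v : V" for v
   unfolding joint_gen_def using \<mu> that unfolding E_def by blast
  hence "V \<subseteq> (\<Union>\<mu>. joint_gen H \<mu> V)" by blast
  thus ?thesis using lie.span_superset by (rule order_trans)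
 next
  case False
  then obtain h where h: "h : H" "!!c. V ~= E h c" by blast
  have sub: "lie.subspace (E h c)" for c
   using lie.subspace_inter[OF less.prems(1) subspace_gen_eig[OF lin_ad, of h c]]
   unfolding E_def by (simp add: Int_def)
  have piece: "E h c \<subseteq> lie.span (\<Union>\<mu>. joint_gen H \<mu> V)" for c
  proof -
   have "E h c \<subset> V" using h(2)[of c] unfolding E_def by blast
   hence dl: "lie.dim (E h c) < lie.dim V"
    using fin.dim_psubset[of "E h c" V] sub[of c] less.prems(1) by (metis lie.span_eq_iff)
   have st: "!!h' v. h' : H ==> v : E h c ==> ad h' v : E h c"
    unfolding E_def by (rule gen_eig_sub_stable[OF H[OF h(1)] less.prems(2)])
   have "E h c \<subseteq> lie.span (\<Union>\<mu>. joint_gen H \<mu> (E h c))"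
    by (rule less.hyps[OF dl sub st])
   also have "... \<subseteq> lie.span (\<Union>\<mu>. joint_gen H \<mu> V)"
    by (rule lie.span_mono) (auto simp: joint_gen_def E_def)
   finally show ?thesis .
  qed
  have "V \<subseteq> lie.span {w : V. EX c. gen_eig (ad h) c w}"
   using gen_eig_span[OF lin_ad less.prems(1) less.prems(2)[OF h(1)]] by blast
  also have "... \<subseteq> lie.span (\<Union>\<mu>. joint_gen H \<mu> V)"
  proof (rule lie.span_minimal[OF _ lie.subspace_span], rule subsetI)
   fix w assume "w : {w : V. EX c. gen_eig (ad h) c w}"
   then obtain c where "w : E h c" unfolding E_def by blast
   thus "w : lie.span (\<Union>\<mu>. joint_gen H \<mu> V)" using piece by (rule subsetD[rotated])
  qed
  finally show ?thesis .
 qed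
qed

lemma trace_on_single_eig:
 assumes W: "lie.subspace W" and A: "lin A" "!!w. w : W ==> A w : W" "!!w. w : W ==> gen_eig A a w"
 shows "trace_on W A = a * of_nat (lie.dim W)"
proof -
 have st: "!!w. w : W ==> A w - a *. w : W"
  using A(2) W by (simp add: lie.subspace_diff lie.subspace_scale)
 have "trace_on W (%w. A w - a *. w) = 0"
  by (rule trace_on_nilpotent[OF W lin_shift[OF A(1)] st]) (use A(3) in \<open>auto simp: gen_eig_def\<close>)
 moreover have "trace_on W (%w. A w - a *. w) = trace_on W A - trace_on W (%w. a *. w)"
  by (rule trace_on_diff[OF W A(1) lin_scale[OF lin_ident]]) (use A(2) W in \<open>auto intro: lie.subspace_scale\<close>)
 moreover have "trace_on W (%w. a *. w) = a * trace_on W (%w. w)"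
  by (rule trace_on_scale[OF W lin_ident]) simp
 ultimately show ?thesis using trace_on_ident[OF W] by simp
qed

lemma dim_pos:
 assumes "lie.subspace (W :: 'g::complex_lie_algebra set)" "W ~= {0}"
 shows "of_nat (lie.dim W) ~= (0 :: complex)"
 using assms lie.subspace_0[OF assms(1)] by (auto simp: fin.dim_eq_0)

text \<open>Taking traces shows that a single eigenvalue depends additively on the operator, whether or not
 the operators commute.\<close>

lemma single_eig_add:
 assumes W: "lie.subspace W" "W ~= {0}" and st: "normalizes x W" "normalizes y W"
  and ge: "!!w. w : W ==> gen_eig (ad x) a w" "!!w. w : W ==> gen_eig (ad y) b w"
   "!!w. w : W ==> gen_eig (ad (x + y)) c w"
 shows "c = a + b"
proof -
 have "ad (x + y) = (%w. ad x w + ad y w)" by (simp add: fun_eq_iff bracket_add_left)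
 hence "trace_on W (ad (x + y)) = trace_on W (ad x) + trace_on W (ad y)"
  using trace_on_add[OF W(1) lin_ad lin_ad, of x y] st by simp
 moreover have "trace_on W (ad x) = a * of_nat (lie.dim W)"
  by (rule trace_on_single_eig[OF W(1) lin_ad _ ge(1)]) (use st in auto)
 moreover have "trace_on W (ad y) = b * of_nat (lie.dim W)"
  by (rule trace_on_single_eig[OF W(1) lin_ad _ ge(2)]) (use st in auto)
 moreover have "trace_on W (ad (x + y)) = c * of_nat (lie.dim W)"
  by (rule trace_on_single_eig[OF W(1) lin_ad _ ge(3)])
   (use normalizes_add[OF W(1) st] in auto)
 ultimately have "c * of_nat (lie.dim W) = (a + b) * of_nat (lie.dim W)"
  by (simp add: distrib_right)
 thus ?thesis using dim_pos[OF W] by simp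
qed

lemma single_eig_scale:
 assumes W: "lie.subspace W" "W ~= {0}" and st: "normalizes x W"
  and ge: "!!w. w : W ==> gen_eig (ad x) a w" "!!w. w : W ==> gen_eig (ad (k *. x)) c w"
 shows "c = k * a"
proof -
 have "ad (k *. x) = (%w. k *. ad x w)" by (simp add: fun_eq_iff bracket_scaleC_left)
 hence "trace_on W (ad (k *. x)) = k * trace_on W (ad x)"
  using trace_on_scale[OF W(1) lin_ad, of x k] st by simp
 moreover have "trace_on W (ad x) = a * of_nat (lie.dim W)"
  by (rule trace_on_single_eig[OF W(1) lin_ad _ ge(1)]) (use st in auto)
 moreover have "trace_on W (ad (k *. x)) = c * of_nat (lie.dim W)"
  by (rule trace_on_single_eig[OF W(1) lin_ad _ ge(2)])
   (use normalizes_scale[OF W(1) st] in auto)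
 ultimately have "c * of_nat (lie.dim W) = (k * a) * of_nat (lie.dim W)" by simp
 thus ?thesis using dim_pos[OF W] by simp
qed

lemma ad_nilpotent_on_span:
 assumes "L \<subseteq> lie.span S" "!!v. v : S ==> EX k. (ad x ^^ k) v = 0"
 shows "ad_nilpotent_on L x"
 unfolding ad_nilpotent_on_def
proof
 fix v assume "v : L"
 hence "v : lie.span S" using assms(1) by blast
 thus "EX k. (ad x ^^ k) v = 0"
  by (rule span_closed[OF _ subspace_nilpotent_vectors[OF lin_ad] assms(2)])
qed

lemma funpow_commute_on:
 assumes L: "!!v. v : L ==> A v : L" "!!v. v : L ==> B v : L"
  and AB: "!!v. v : L ==> A (B v) = B (A v)" and v: "v : L"
 shows "((%w. A (B w)) ^^ k) v = (A ^^ k) ((B ^^ k) v)"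
proof -
 have Ak: "(A ^^ k) w : L" "(B ^^ k) w : L" if "w : L" for k w
  using that L by (induction k) auto
 have comm: "B ((A ^^ k) w) = (A ^^ k) (B w)" if "w : L" for k w
  using that
 proof (induction k)
  case (Suc k)
  have "B ((A ^^ Suc k) w) = A (B ((A ^^ k) w))" using AB[OF Ak(1)[OF Suc.prems]] by simp
  thus ?case using Suc by simp
 qed simp
 show ?thesis using v
 proof (induction k)
  case (Suc k)
  have "((%w. A (B w)) ^^ Suc k) v = A (B ((A ^^ k) ((B ^^ k) v)))" using Suc by simp
  also have "... = A ((A ^^ k) (B ((B ^^ k) v)))" using comm[OF Ak(2)[OF Suc.prems]] by simp
  finally show ?case by simp
 qed simp
qed

lemma killing_commuting_nilpotent:
 assumes L: "subalgebra L" "n : L" "s : L" "ad s n = 0" "ad_nilpotent_on L n"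
 shows "killing_form L n s = 0"
 unfolding killing_form_def
proof (rule trace_on_nilpotent[OF subalgebraD(1)[OF L(1)] lin_ad_ad])
 note N = subalgebraD[OF L(1)]
 show "ad n (ad s v) : L" if "v : L" for v using that N L by auto
 have comm: "ad s (ad n v) = ad n (ad s v)" for v
  using ad_derivation[of s n v] L(4) by simp
 fix v assume v: "v : L"
 then obtain k where k: "(ad n ^^ k) v = 0" using L(5) unfolding ad_nilpotent_on_def by blast
 have "((%w. ad s (ad n w)) ^^ k) v = (ad s ^^ k) ((ad n ^^ k) v)"
  by (rule funpow_commute_on[of L]) (use N L v comm in auto)
 also have "... = 0" unfolding k by (rule endo.linear_0[OF lin_funpow[OF lin_ad]])
 finally show "EX k. ((%w. ad n (ad s w)) ^^ k) v = 0" unfolding comm by blast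
qed

text \<open>Polarization of \<open>tr (ad n)\<^sup>2 = 0\<close>.\<close>

lemma killing_nilpotent_sum:
 assumes L: "subalgebra L" "n : L" "n' : L"
  and nil: "ad_nilpotent_on L n" "ad_nilpotent_on L n'" "ad_nilpotent_on L (n + n')"
 shows "killing_form L n n' = 0"
proof -
 note N = subalgebraD[OF L(1)]
 have sq: "killing_form L m m = 0" if "m : L" "ad_nilpotent_on L m" for m
  using killing_commuting_nilpotent[OF L(1) that(1,1) bracket_self that(2)] .
 have s: "n + n' : L" using L N lie.subspace_add by blast
 have "killing_form L (n + n') (n + n') = killing_form L n (n + n') + killing_form L n' (n + n')"
  by (rule killing_bilinear(1)[OF L(1-3) s])
 also have "... = killing_form L n n + killing_form L n n' + (killing_form L n' n + killing_form L n' n')"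
  using killing_bilinear(5)[OF L(1,2,3,2)] killing_bilinear(5)[OF L(1,2,3,3)] by simp
 also have "killing_form L n' n = killing_form L n n'" using N L by (intro killing_sym) auto
 finally show ?thesis using sq[OF L(2) nil(1)] sq[OF L(3) nil(2)] sq[OF s nil(3)] by simp
qed

lemma nilpotent_part:
 assumes nd: "killing_nondeg L" and x: "x : L"
  and s: "s : L" "!!c v. v : L ==> gen_eig (ad x) c v ==> ad s v = c *. v"
 shows "ad_nilpotent_on L (x - s)"
proof (rule ad_nilpotent_on_span[of L "{w : L. EX c. gen_eig (ad x) c w}"])
 have L: "subalgebra L" using nd unfolding killing_nondeg_def by blast
 note N = subalgebraD[OF L]
 have st: "!!v. v : L ==> ad x v : L" using x N by blast
 show "L \<subseteq> lie.span {w : L. EX c. gen_eig (ad x) c w}"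
  using gen_eig_span[OF lin_ad N(1) st] by blast
 fix v assume "v : {w : L. EX c. gen_eig (ad x) c w}"
 then obtain c k where v: "v : L" "((%w. ad x w - c *. w) ^^ k) v = 0"
  unfolding gen_eig_def by blast
 hence "(ad (x - s) ^^ k) v = 0"
 proof (induction k arbitrary: v)
  case (Suc k)
  have g: "gen_eig (ad x) c v" using Suc.prems(2) unfolding gen_eig_def by blast
  let ?u = "ad x v - c *. v"
  have uL: "?u : L" using Suc.prems(1) st N(1) by (simp add: lie.subspace_diff lie.subspace_scale)
  have eq: "ad (x - s) v = ?u" using s(2)[OF Suc.prems(1) g] by (simp add: bracket_diff_left)
  have "((%w. ad x w - c *. w) ^^ k) ?u = 0"
   using Suc.prems(2) unfolding funpow_Suc_right o_apply .
  from Suc.IH[OF uL this] show ?case unfolding funpow_Suc_right o_apply eq .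
 qed simp
 thus "EX k. (ad (x - s) ^^ k) v = 0" by blast
qed

lemma diagonalizable_jordan_part:
 assumes nd: "killing_nondeg L" and x: "x : L" "diagonalizable_on L x"
  and s: "s : L" "!!c v. v : L ==> gen_eig (ad x) c v ==> ad s v = c *. v"
 shows "s = x"
proof -
 have L: "subalgebra L" using nd unfolding killing_nondeg_def by blast
 have "ad s v = ad x v" if v: "v : L" for v
 proof (rule lin_eq_on_span[OF lin_ad lin_ad])
  show "v : lie.span {w : L. EX c. ad x w = c *. w}"
   using v x(2) unfolding diagonalizable_on_def by blast
  fix b assume "b : {w : L. EX c. ad x w = c *. w}"
  thus "ad s b = ad x b" using s(2) gen_eig_eigenvector by fastforce
 qed
 hence "s - x = 0"
  using killing_center[OF nd, of "s - x"] lie.subspace_diff[OF subalgebraD(1)[OF L] s(1) x(1)]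
  by (simp add: bracket_diff_left)
 thus ?thesis by simp
qed

lemma diagonalizable_gen_eig:
 assumes nd: "killing_nondeg L" and x: "x : L" "diagonalizable_on L x"
  and v: "v : L" "gen_eig (ad x) c v"
 shows "ad x v = c *. v"
proof -
 obtain s where s: "s : L" "!!c v. v : L ==> gen_eig (ad x) c v ==> ad s v = c *. v"
  using jordan_part[OF nd x(1)] by metis
 thus ?thesis using diagonalizable_jordan_part[OF nd x s] v by simp
qed

lemma jordan_part_diagonalizable:
 assumes L: "subalgebra L" and x: "x : L"
  and s: "!!c v. v : L ==> gen_eig (ad x) c v ==> ad s v = c *. v"
 shows "diagonalizable_on L s"
proof -
 note N = subalgebraD[OF L]
 have st: "!!v. v : L ==> ad x v : L" using x N by blast
 have "L \<subseteq> lie.span {w : L. EX c. gen_eig (ad x) c w}"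
  using gen_eig_span[OF lin_ad N(1) st] by blast
 also have "... \<subseteq> lie.span {w : L. EX c. ad s w = c *. w}"
  by (rule lie.span_mono) (use s in blast)
 finally show ?thesis unfolding diagonalizable_on_def .
qed

subsection \<open>Cartan subalgebras\<close>

lemma cartan_nil:
 assumes "cartan_subalgebra L H" "h : H" "h' : H"
 shows "gen_eig (ad h) 0 h'"
proof -
 obtain n where n: "(bracket_span H ^^ n) H = {0}"
  using assms(1) unfolding cartan_subalgebra_def nilpotent_lie_def by blast
 have "(ad h ^^ k) h' : (bracket_span H ^^ k) H" for k
 proof (induction k)
  case (Suc k)
  thus ?case using assms(2) by (auto simp: bracket_span_def intro!: lie.span_base)
 qed (use assms in auto)
 thus ?thesis using n unfolding gen_eig_0_iff by (metis singletonD)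
qed

text \<open>Engel's argument: a minimal \<open>H\<close>-stable space \<open>W\<close> strictly between \<open>H\<close> and the generalized null
 space would be mapped into \<open>H\<close> by every term of the lower central series, hence normalize \<open>H\<close>.\<close>

lemma cartan_null_space:
 assumes L: "subalgebra L" and C: "cartan_subalgebra L H"
 shows "joint_gen H (%_. 0) L \<subseteq> H"
proof (rule ccontr)
 let ?V = "joint_gen H (%_. 0) L"
 assume "~ ?V \<subseteq> H"
 note N = subalgebraD[OF L]
 have H: "subalgebra H" "H \<subseteq> L" "{x : L. ALL h:H. ad x h : H} = H"
  using C unfolding cartan_subalgebra_def by auto
 note NH = subalgebraD[OF H(1)]
 obtain n where n: "(bracket_span H ^^ n) H = {0}"
  using C unfolding cartan_subalgebra_def nilpotent_lie_def by blast
 let ?D = "%i. (bracket_span H ^^ i) H"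
 let ?P = "%W. lie.subspace W & H \<subset> W & W \<subseteq> ?V & (ALL h:H. ALL w:W. ad h w : W)"
 have HV: "H \<subseteq> ?V" using cartan_nil[OF C] H(2) unfolding joint_gen_def by blast
 have "?P ?V"
 proof (intro conjI ballI)
  show "lie.subspace ?V" by (rule joint_gen_subspace[OF N(1)])
  show "H \<subset> ?V" using HV \<open>~ ?V \<subseteq> H\<close> by blast
  fix h w assume "h : H" "w : ?V"
  thus "ad h w : ?V" using cartan_nil[OF C] H(2) N(3) by (intro joint_gen_stable) auto
 qed simp
 then obtain W where W: "?P W" and Wmin: "!!W'. ?P W' ==> lie.dim W <= lie.dim W'"
  using ex_has_least_nat[of ?P ?V lie.dim] by blast
 have Dsub: "?D i \<subseteq> H" for i
 proof (induction i)
  case (Suc i)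
  have "{ad x y |x y. x : H & y : ?D i} \<subseteq> H" using Suc NH(2) by blast
  hence "bracket_span H (?D i) \<subseteq> H"
   unfolding bracket_span_def by (rule lie.span_minimal[OF _ NH(1)])
  thus ?case by simp
 qed simp
 have main: "i <= n ==> ALL x:?D (n - i). ALL w:W. ad x w : H" for i
 proof (induction i)
  case 0
  thus ?case using n lie.subspace_0[OF NH(1)] by simp
 next
  case (Suc i)
  hence IH: "!!x w. x : ?D (n - i) ==> w : W ==> ad x w : H" by auto
  have ni: "n - i = Suc (n - Suc i)" using Suc.prems by simp
  show ?case
  proof (intro ballI)
   fix x w assume x: "x : ?D (n - Suc i)" and w: "w : W"
   have xH: "x : H" using x Dsub by blast
   let ?W = "{w : W. ad x w : H}"
   have "?P ?W"
   proof (intro conjI ballI)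
    show "lie.subspace ?W" unfolding lie.subspace_def using W NH(1)
     by (auto simp: bracket_simps lie.subspace_0 lie.subspace_add lie.subspace_scale)
    show "?W \<subseteq> ?V" using W by blast
    show "H \<subset> ?W"
    proof
     show "H \<subseteq> ?W" using W NH(2) xH by auto
     obtain u where u: "u : W" "u ~: H" using W by blast
     then obtain k where "(ad x ^^ k) u = 0"
      using W xH unfolding joint_gen_def gen_eig_0_iff by blast
     hence "(ad x ^^ k) u : H" using lie.subspace_0[OF NH(1)] by simp
     then obtain j where j: "(ad x ^^ j) u : H" "!!i. i < j ==> (ad x ^^ i) u ~: H"
      using exists_least_iff[of "%k. (ad x ^^ k) u : H"] by blast
     then obtain i where i: "j = Suc i" using u by (cases j) auto
     have "(ad x ^^ i) u : W" for i using W xH u(1) by (induction i) auto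
     hence "(ad x ^^ i) u : ?W" using j(1) i by simp
     moreover have "(ad x ^^ i) u ~: H" using j(2) i by simp
     ultimately show "H ~= ?W" by blast
    qed
    fix h v assume h: "h : H" and v: "v : ?W"
    have "ad h x : ?D (n - i)"
     unfolding ni using h x by (auto simp: bracket_span_def intro!: lie.span_base)
    hence "ad (ad h x) v : H" using IH v by blast
    moreover have "ad h (ad x v) : H" using NH(2) h v by blast
    moreover have "ad x (ad h v) = ad h (ad x v) - ad (ad h x) v"
     by (simp add: ad_bracket)
    ultimately have "ad x (ad h v) : H" using NH(1) by (simp add: lie.subspace_diff)
    thus "ad h v : ?W" using W h v by blast
   qed
   hence "lie.dim W <= lie.dim ?W" by (rule Wmin)
   moreover have "lie.subspace ?W" "?W \<subseteq> W" using \<open>?P ?W\<close> by auto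
   ultimately have "?W = W" using fin.subspace_dim_equal[of ?W W] W by simp
   thus "ad x w : H" using w by blast
  qed
 qed
 obtain w where w: "w : W" "w ~: H" using W by blast
 have "ad w h : H" if h: "h : H" for h
 proof -
  have "ad h w : H" using main[of n] h w by simp
  thus ?thesis using bracket_anti[of w h] lie.subspace_neg[OF NH(1)] by simp
 qed
 moreover have "w : L" using w W unfolding joint_gen_def by blast
 ultimately show False using w(2) H(3) by blast
qed

definition weight_form :: "'g::complex_lie_algebra set => ('g => complex) => ('g => complex)" where
 "weight_form H \<mu> = (%x. if x : H then \<mu> x else 0)"

lemma joint_gen_additive:
 assumes L: "lie.subspace L" and H: "lie.subspace H" "!!h h'. h : H ==> h' : H ==> gen_eig (ad h) 0 h'"
  "!!h. h : H ==> normalizes h L" and ne: "joint_gen H \<mu> L ~= {0}"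
 shows "weight_form H \<mu> : dual_space H"
proof -
 note W = joint_gen_subspace[OF L, of H \<mu>] ne
 have st: "normalizes h (joint_gen H \<mu> L)" if "h : H" for h
  using joint_gen_stable[of H h L _ \<mu>] H(2,3) that by blast
 have ge: "gen_eig (ad h) (\<mu> h) w" if "h : H" "w : joint_gen H \<mu> L" for h w
  using that unfolding joint_gen_def by blast
 have "\<mu> (x + y) = \<mu> x + \<mu> y" if "x : H" "y : H" for x y
  by (rule single_eig_add[OF W st[OF that(1)] st[OF that(2)] ge[OF that(1)] ge[OF that(2)] ge])
   (use that H(1) lie.subspace_add in auto)
 moreover have "\<mu> (c *. x) = c * \<mu> x" if "x : H" for x c
  by (rule single_eig_scale[OF W st[OF that] ge[OF that] ge])
   (use that H(1) lie.subspace_scale in auto)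
 ultimately show ?thesis unfolding dual_space_def weight_form_def using H(1)
  by (auto simp: lie.subspace_add lie.subspace_scale)
qed

theorem cartan_toral:
 assumes nd: "killing_nondeg L" and C: "cartan_subalgebra L H"
 shows "!!h h'. h : H ==> h' : H ==> ad h h' = 0"
  and "L \<subseteq> lie.span (UN \<mu>:dual_space H. root_space L H \<mu>)"
  and "root_space L H (%_. 0) = H"
proof -
 have L: "subalgebra L" using nd unfolding killing_nondeg_def by blast
 note N = subalgebraD[OF L]
 have H: "subalgebra H" "H \<subseteq> L" "{x : L. ALL h:H. ad x h : H} = H"
  using C unfolding cartan_subalgebra_def by auto
 note NH = subalgebraD[OF H(1)]
 note nil = cartan_nil[OF C]
 have HL: "h : H ==> h : L" for h using H(2) by blast
 have null: "joint_gen H (%_. 0) L \<subseteq> H" by (rule cartan_null_space[OF L C])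
 have span: "L \<subseteq> lie.span (\<Union>\<mu>. joint_gen H \<mu> L)"
  by (rule joint_gen_span[OF nil N(1)]) (use N(2) HL in auto)
 have "EX s. ALL x:L. s x : L & (ALL c. ALL v:L. gen_eig (ad x) c v --> ad (s x) v = c *. v)"
  by (rule bchoice) (use jordan_part[OF nd] in metis)
 then obtain s where sL: "!!x. x : L ==> s x : L"
  and s: "!!x c v. x : L ==> v : L ==> gen_eig (ad x) c v ==> ad (s x) v = c *. v" by blast
 have s_comm: "ad (s x) h = 0" if "x : H" "h : H" for x h
  using s[OF HL[OF that(1)] HL[OF that(2)] nil[OF that]] by simp
 have sH: "s x : H" if "x : H" for x
  using H(3) s_comm[OF that] sL[OF HL[OF that]] lie.subspace_0[OF NH(1)] by auto
 let ?n = "%x. x - s x"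
 have nH: "?n x : H" if "x : H" for x using that sH NH(1) lie.subspace_diff by blast
 have nnil: "ad_nilpotent_on L (?n x)" if "x : H" for x
  by (rule nilpotent_part[OF nd HL[OF that] sL[OF HL[OF that]] s[OF HL[OF that]]])
 have nsum: "ad_nilpotent_on L (?n x + ?n y)" if "x : H" "y : H" for x y
 proof (rule ad_nilpotent_on_span[OF span])
  fix v assume "v : (\<Union>\<mu>. joint_gen H \<mu> L)"
  then obtain \<mu> where v: "v : joint_gen H \<mu> L" by auto
  hence vL: "v : L" unfolding joint_gen_def by blast
  have ge: "gen_eig (ad h) (\<mu> h) v" if "h : H" for h
   using v that unfolding joint_gen_def by blast
  show "EX k. (ad (?n x + ?n y) ^^ k) v = 0"
  proof (cases "v = 0")
   case True
   thus ?thesis by (intro exI[of _ 0]) simp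
  next
   case False
   have z: "\<mu> (?n x) = 0" if "x : H" for x
   proof (rule ccontr)
    assume "\<mu> (?n x) ~= 0"
    moreover have "gen_eig (ad (?n x)) 0 v"
     using nnil[OF that] vL unfolding ad_nilpotent_on_def gen_eig_0_iff by blast
    ultimately show False using gen_eig_disjoint[OF lin_ad ge[OF nH[OF that]]] False by blast
   qed
   have "weight_form H \<mu> : dual_space H"
    using joint_gen_additive[OF N(1) NH(1) nil, of \<mu>] HL N(3) v False by blast
   hence "weight_form H \<mu> (?n x + ?n y) = weight_form H \<mu> (?n x) + weight_form H \<mu> (?n y)"
    unfolding dual_space_def using nH that by blast
   hence "\<mu> (?n x + ?n y) = 0"
    using nH[OF that(1)] nH[OF that(2)] lie.subspace_add[OF NH(1)] z that
    unfolding weight_form_def by simp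
   thus ?thesis
    using ge[of "?n x + ?n y"] lie.subspace_add[OF NH(1) nH[OF that(1)] nH[OF that(2)]]
    unfolding gen_eig_0_iff[symmetric] by simp
  qed
 qed
 have n0: "?n x = 0" if x: "x : H" for x
 proof -
  have "killing_form L (?n x) y = 0" if y0: "y : (\<Union>\<mu>. joint_gen H \<mu> L)" for y
  proof -
   obtain \<mu> where y: "y : joint_gen H \<mu> L" using y0 by blast
   hence yL: "y : L" unfolding joint_gen_def by blast
   show ?thesis
   proof (cases "ALL h:H. \<mu> h = 0")
    case True
    hence yH: "y : H" using y null unfolding joint_gen_def by auto
    have "killing_form L (?n x) (s y + ?n y) = killing_form L (?n x) (s y) + killing_form L (?n x) (?n y)"
     using HL[OF sH[OF yH]] HL[OF nH[OF yH]] HL[OF nH[OF x]] by (intro killing_bilinear(5)[OF L])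
    also have "killing_form L (?n x) (s y) = 0"
     by (rule killing_commuting_nilpotent[OF L HL[OF nH[OF x]] HL[OF sH[OF yH]] _ nnil[OF x]])
      (rule s_comm[OF yH nH[OF x]])
    also have "killing_form L (?n x) (?n y) = 0"
     by (rule killing_nilpotent_sum[OF L HL[OF nH[OF x]] HL[OF nH[OF yH]] nnil[OF x] nnil[OF yH] nsum[OF x yH]])
    finally show ?thesis by simp
   next
    case False
    then obtain h where h: "h : H" "\<mu> h ~= 0" by blast
    show ?thesis
     by (rule killing_gen_orth[OF L HL[OF h(1)] HL[OF nH[OF x]] yL nil[OF h(1) nH[OF x]], of "\<mu> h"])
      (use y h in \<open>auto simp: joint_gen_def\<close>)
   qed
  qed
  hence "killing_form L (?n x) y = 0" if "y : L" for y
   using killing_zero_subspace[OF L HL[OF nH[OF x]], of "\<Union>\<mu>. joint_gen H \<mu> L" y] span that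
   unfolding joint_gen_def by blast
  thus ?thesis using nd HL[OF nH[OF x]] unfolding killing_nondeg_def by blast
 qed
 hence sx: "s x = x" if "x : H" for x using that by simp
 show ab: "ad h h' = 0" if "h : H" "h' : H" for h h' using s_comm[OF that] sx[OF that(1)] by simp
 have root: "joint_gen H \<mu> L \<subseteq> root_space L H (weight_form H \<mu>)" for \<mu>
  unfolding joint_gen_def root_space_def weight_form_def using s sx HL by fastforce
 show "L \<subseteq> lie.span (UN \<mu>:dual_space H. root_space L H \<mu>)"
 proof -
  have "joint_gen H \<mu> L \<subseteq> lie.span (UN \<mu>:dual_space H. root_space L H \<mu>)" for \<mu>
  proof (cases "joint_gen H \<mu> L = {0}")
   case True
   thus ?thesis by (simp add: lie.span_zero)
  next
   case False
   hence "weight_form H \<mu> : dual_space H"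
    using joint_gen_additive[OF N(1) NH(1) nil, of \<mu>] HL N(3) by blast
   hence "root_space L H (weight_form H \<mu>) \<subseteq> (UN \<mu>:dual_space H. root_space L H \<mu>)"
    by (rule UN_upper)
   from order_trans[OF order_trans[OF root this] lie.span_superset] show ?thesis .
  qed
  hence "lie.span (\<Union>\<mu>. joint_gen H \<mu> L) \<subseteq> lie.span (UN \<mu>:dual_space H. root_space L H \<mu>)"
   by (intro lie.span_minimal lie.subspace_span) blast
  thus ?thesis using span by blast
 qed
 show "root_space L H (%_. 0) = H"
 proof
  show "H \<subseteq> root_space L H (%_. 0)" unfolding root_space_def using ab HL by auto
  show "root_space L H (%_. 0) \<subseteq> H"
   using null gen_eig_eigenvector[of "ad _" _ 0] unfolding root_space_def joint_gen_def
   by fastforce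
 qed
qed

text \<open>A subalgebra that is maximal among the commuting families of diagonalizable elements equals its
 centralizer: the nilpotent parts of the centralizer form a space on which the Killing form
 vanishes.\<close>

theorem maximal_toral_cartan:
 assumes nd: "killing_nondeg L" and T: "lie.subspace T" "T \<subseteq> L"
  and ab: "!!t t'. t : T ==> t' : T ==> ad t t' = 0"
  and diag: "!!t. t : T ==> diagonalizable_on L t"
  and maximal: "!!s. s : L ==> diagonalizable_on L s ==> (!!t. t : T ==> ad s t = 0) ==> s : T"
 shows "cartan_subalgebra L T"
proof -
 have L: "subalgebra L" using nd unfolding killing_nondeg_def by blast
 note N = subalgebraD[OF L]
 have TL: "t : T ==> t : L" for t using T(2) by blast
 have nil: "gen_eig (ad t) 0 t'" if "t : T" "t' : T" for t t'
  using ab[OF that] gen_eig_eigenvector[of "ad t" t' 0] by simp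
 have span: "L \<subseteq> lie.span (\<Union>\<mu>. joint_gen T \<mu> L)"
  by (rule joint_gen_span[OF nil N(1)]) (use N(2) TL in auto)
 have act: "ad t v = \<mu> t *. v" if "v : joint_gen T \<mu> L" "t : T" for v \<mu> t
  using diagonalizable_gen_eig[OF nd TL[OF that(2)] diag[OF that(2)]] that unfolding joint_gen_def by blast
 let ?C = "{x : L. ALL t:T. ad t x = 0}"
 have Csub: "lie.subspace ?C" unfolding lie.subspace_def using N(1)
  by (auto simp: bracket_simps lie.subspace_0 lie.subspace_add lie.subspace_scale)
 have "EX s. ALL x:L. s x : L & (ALL c. ALL v:L. gen_eig (ad x) c v --> ad (s x) v = c *. v)"
  by (rule bchoice) (use jordan_part[OF nd] in metis)
 then obtain s where sL: "!!x. x : L ==> s x : L"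
  and s: "!!x c v. x : L ==> v : L ==> gen_eig (ad x) c v ==> ad (s x) v = c *. v" by blast
 have sT: "s x : T" if x: "x : ?C" for x
 proof (rule maximal)
  show "s x : L" using sL x by blast
  show "diagonalizable_on L (s x)" by (rule jordan_part_diagonalizable[OF L, of x]) (use s x in auto)
  fix t assume t: "t : T"
  hence "ad x t = 0" using x bracket_anti[of x t] by simp
  thus "ad (s x) t = 0"
   using s[of x t 0] x TL[OF t] gen_eig_eigenvector[of "ad x" t 0] by simp
 qed
 let ?n = "%x. x - s x"
 have TC: "T \<subseteq> ?C" using ab TL by blast
 have nC: "?n x : ?C" if "x : ?C" for x using lie.subspace_diff[OF Csub that] sT[OF that] TC by blast
 have nnil: "ad_nilpotent_on L (?n x)" if "x : ?C" for x
  by (rule nilpotent_part[OF nd _ sL s]) (use that in auto)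
 have s_nil: "s x = 0" if "x : ?C" "ad_nilpotent_on L x" for x
  using s[of x _ 0] that killing_center[OF nd sL[of x]]
  unfolding ad_nilpotent_on_def gen_eig_0_iff by simp
 have st: "normalizes x (joint_gen T \<mu> L)" if "x : ?C" for x \<mu>
 proof
  fix v assume v: "v : joint_gen T \<mu> L"
  show "ad x v : joint_gen T \<mu> L"
   by (rule joint_gen_stable[OF _ _ v])
    (use that N in \<open>auto intro: gen_eig_eigenvector[of "ad _" x 0, simplified]\<close>)
 qed
 have single: "gen_eig (ad x) (\<mu> (s x)) v" if x: "x : ?C" and v: "v : joint_gen T \<mu> L" for x v \<mu>
 proof -
  let ?W = "joint_gen T \<mu> L"
  have stx: "!!w. w : ?W ==> ad x w : ?W" using st[OF x] by blast
  have "v : lie.span {w : ?W. EX c. gen_eig (ad x) c w}"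
   by (rule gen_eig_span[OF lin_ad joint_gen_subspace[OF N(1)] stx v])
  thus ?thesis
  proof (rule span_closed[OF _ subspace_gen_eig[OF lin_ad]])
   fix w assume "w : {w : ?W. EX c. gen_eig (ad x) c w}"
   then obtain c where w: "w : ?W" "gen_eig (ad x) c w" by blast
   hence "w : L" unfolding joint_gen_def by blast
   hence "ad (s x) w = c *. w" using s[of x w c] x w by blast
   moreover have "ad (s x) w = \<mu> (s x) *. w" by (rule act[OF w(1) sT[OF x]])
   ultimately have "c = \<mu> (s x) | w = 0" by (metis lie.scale_right_imp_eq)
   thus "gen_eig (ad x) (\<mu> (s x)) w" using w(2) gen_eig_zero[OF lin_ad] by auto
  qed
 qed
 have sadd: "s (x + y) = s x + s y" if x: "x : ?C" and y: "y : ?C" for x y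
 proof -
  have xy: "x + y : ?C" by (rule lie.subspace_add[OF Csub x y])
  let ?d = "s (x + y) - (s x + s y)"
  have "ad ?d v = 0" if "v : joint_gen T \<mu> L" for v \<mu>
  proof (cases "v = 0")
   case False
   hence ne: "joint_gen T \<mu> L ~= {0}" using that by blast
   have "\<mu> (s (x + y)) = \<mu> (s x) + \<mu> (s y)"
    by (rule single_eig_add[OF joint_gen_subspace[OF N(1)] ne st[OF x] st[OF y]
       single[OF x] single[OF y] single[OF xy]])
   thus ?thesis
    using act[OF that sT[OF x]] act[OF that sT[OF y]] act[OF that sT[OF xy]]
    by (simp add: bracket_simps scale_simps)
  qed simp
  hence "ad ?d v = 0" if "v : L" for v
   using lin_eq_on_span[OF lin_ad lin_zero, of "\<Union>\<mu>. joint_gen T \<mu> L" ?d v] span that by blast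
  moreover have "?d : L"
   using sL[of x] sL[of y] sL[of "x + y"] x y xy N(1) by (auto intro!: lie.subspace_diff lie.subspace_add)
  ultimately have "?d = 0" using killing_center[OF nd] by blast
  thus ?thesis by simp
 qed
 have nsum: "ad_nilpotent_on L (?n x + ?n y)" if x: "x : ?C" and y: "y : ?C" for x y
 proof -
  have "s (?n x + ?n y) = 0"
   using sadd[OF nC[OF x] nC[OF y]] s_nil[OF nC[OF x] nnil[OF x]] s_nil[OF nC[OF y] nnil[OF y]] by simp
  thus ?thesis using nnil[OF lie.subspace_add[OF Csub nC[OF x] nC[OF y]]] by simp
 qed
 have n0: "?n x = 0" if x: "x : ?C" for x
 proof -
  have nL: "?n x : L" using nC[OF x] by blast
  have "killing_form L (?n x) y = 0" if y0: "y : (\<Union>\<mu>. joint_gen T \<mu> L)" for y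
  proof -
   obtain \<mu> where y: "y : joint_gen T \<mu> L" using y0 by blast
   hence yL: "y : L" unfolding joint_gen_def by blast
   show ?thesis
   proof (cases "ALL t:T. \<mu> t = 0")
    case True
    hence yC: "y : ?C" using act[OF y] yL by simp
    have nyL: "?n y : L" "s y : L" using nC[OF yC] sL[OF yL] by auto
    have "killing_form L (?n x) (s y + ?n y) = killing_form L (?n x) (s y) + killing_form L (?n x) (?n y)"
     by (rule killing_bilinear(5)[OF L nyL(2,1) nL])
    also have "killing_form L (?n x) (s y) = 0"
     by (rule killing_commuting_nilpotent[OF L nL nyL(2) _ nnil[OF x]])
      (use nC[OF x] sT[OF yC] in auto)
    also have "killing_form L (?n x) (?n y) = 0"
     by (rule killing_nilpotent_sum[OF L nL nyL(1) nnil[OF x] nnil[OF yC] nsum[OF x yC]])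
    finally show ?thesis by simp
   next
    case False
    then obtain t where t: "t : T" "\<mu> t ~= 0" by blast
    have "gen_eig (ad t) 0 (?n x)"
     using nC[OF x] t(1) gen_eig_eigenvector[of "ad t" "?n x" 0] by simp
    thus ?thesis
     by (rule killing_gen_orth[OF L TL[OF t(1)] nL yL, of _ "\<mu> t"])
      (use y t in \<open>auto simp: joint_gen_def\<close>)
   qed
  qed
  hence "killing_form L (?n x) y = 0" if "y : L" for y
   using killing_zero_subspace[OF L nL, of "\<Union>\<mu>. joint_gen T \<mu> L" y] span that
   unfolding joint_gen_def by blast
  thus ?thesis using nd nL unfolding killing_nondeg_def by blast
 qed
 have CT: "?C = T"
 proof
  show "?C \<subseteq> T" using n0 sT by fastforce
 qed (rule TC)
 have "bracket_span T T = {0}"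
 proof -
  have "{ad x y |x y. x : T & y : T} \<subseteq> {0}" using ab by auto
  hence "bracket_span T T \<subseteq> {0}" unfolding bracket_span_def by (rule lie.span_minimal) simp
  thus ?thesis using lie.span_zero unfolding bracket_span_def by blast
 qed
 hence "nilpotent_lie T" unfolding nilpotent_lie_def by (intro exI[of _ 1]) simp
 moreover have "subalgebra T" unfolding subalgebra_def using T(1) ab lie.subspace_0[OF T(1)] by simp
 moreover have "{x : L. ALL t:T. ad x t : T} = T"
 proof
  show "T \<subseteq> {x : L. ALL t:T. ad x t : T}" using ab TL lie.subspace_0[OF T(1)] by auto
  show "{x : L. ALL t:T. ad x t : T} \<subseteq> T"
  proof
   fix x assume x: "x : {x : L. ALL t:T. ad x t : T}"
   have "ad t x = 0" if t: "t : T" for t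
   proof -
    have "ad x t : T" using x t by blast
    hence "ad t (ad t x) = 0"
     using ab[OF t] bracket_anti[of t x] by (simp add: bracket_minus_right)
    hence "gen_eig (ad t) 0 x" unfolding gen_eig_0_iff
     by (intro exI[of _ 2]) (simp add: numeral_2_eq_2)
    thus ?thesis using diagonalizable_gen_eig[OF nd TL[OF t] diag[OF t], of x 0] x by simp
   qed
   thus "x : T" using CT x by blast
  qed
 qed
 ultimately show ?thesis unfolding cartan_subalgebra_def using T(2) by blast
qed

section \<open>Representations of \<open>sl\<^sub>2\<close> inside the Lie algebra\<close>

lemma finite_eigenvalues:
 assumes "lin (A :: 'g::complex_lie_algebra => 'g)"
 shows "finite {c. EX v. v ~= 0 & A v = c *. v}"
proof -
 obtain B ev where B: "B \<subseteq> UNIV" "lie.independent B" "lie.span B = UNIV" "finite B"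
  "!!b. b : B ==> gen_eig A (ev b) b"
  using gen_eig_basis[OF assms lie.subspace_UNIV] by (metis UNIV_I)
 have "c : ev ` B" if v: "v ~= 0" "A v = c *. v" for c v
 proof (rule ccontr)
  assume c: "c ~: ev ` B"
  obtain S where S: "lin S" "!!b. b : B ==> S b = (if ev b = c then 1 else 0) *. b"
   "!!v d. v : lie.span B ==> gen_eig A d v ==> S v = (if d = c then 1 else 0) *. v"
   using spectral_operator[OF assms B(2,4,5), of "%d. if d = c then 1 else 0"] by metis
  have "S v = 0"
   by (rule lin_eq_on_span[OF S(1) lin_zero, of B v]) (use S(2) c B(3) in auto)
  moreover have "S v = v" using S(3)[of v c] gen_eig_eigenvector[of A v c] v(2) B(3) by simp
  ultimately show False using v by simp
 qed
 hence "{c. EX v. v ~= 0 & A v = c *. v} \<subseteq> ev ` B" by blast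
 thus ?thesis using B(4) finite_surj by blast
qed

lemma eigen_chain_terminates:
 assumes "!!k. ad h (u k) = (c + d * of_nat k) *. u k" "d ~= 0"
 shows "EX k. u k = (0 :: 'g::complex_lie_algebra)"
proof (rule ccontr)
 assume "\<nexists>k. u k = 0"
 hence "range (%k::nat. c + d * of_nat k) \<subseteq> {c. EX v. v ~= 0 & ad h v = c *. v}"
  using assms(1) by blast
 hence "finite (range (%k::nat. c + d * of_nat k))"
  using finite_eigenvalues[OF lin_ad] finite_subset by blast
 moreover have "inj (%k::nat. c + d * of_nat k)" using assms(2) by (auto simp: inj_def)
 ultimately show False using finite_imageD by blast
qed

lemma sums_stable:
 assumes "lin A" "!!v. v : V ==> A v : V" "!!w. w : W ==> A w : W"
  "u : {v + w | v w. v : V & w : W}"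
 shows "A u : {v + w | v w. v : V & w : W}"
proof -
 obtain v w where vw: "u = v + w" "v : V" "w : W" using assms(4) by blast
 have "A u = A v + A w" using vw(1) endo.linear_add[OF assms(1)] by simp
 thus ?thesis using assms(2)[OF vw(2)] assms(3)[OF vw(3)] by blast
qed

lemma sums_superset:
 assumes "lie.subspace V" "lie.subspace W"
 shows "V \<subseteq> {v + w | v w. v : V & w : W}" "W \<subseteq> {v + w | v w. v : V & w : W}"
proof -
 have "v + 0 : {v + w | v w. v : V & w : W}" if "v : V" for v
  using that lie.subspace_0[OF assms(2)] by blast
 thus "V \<subseteq> {v + w | v w. v : V & w : W}" by auto
 have "0 + w : {v + w | v w. v : V & w : W}" if "w : W" for w
  using that lie.subspace_0[OF assms(1)] by blast
 thus "W \<subseteq> {v + w | v w. v : V & w : W}" by auto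
qed

locale sl2 =
 fixes e h f :: "'g::complex_lie_algebra"
 assumes he: "ad h e = 2 *. e"
  and hf: "ad h f = (- 2) *. f"
  and ef: "ad e f = h"
begin

lemma dual: "sl2 f (- h) e"
 by unfold_locales (use he hf ef bracket_anti[of f e] in \<open>simp_all add: bracket_simps scale_simps\<close>)

lemma fe: "ad f e = - h"
 using ef bracket_anti[of f e] by simp

lemma weight_e: "ad h v = c *. v ==> ad h (ad e v) = (c + 2) *. ad e v"
 using ad_derivation[of h e v] he by (simp add: bracket_simps scale_simps add.commute)

lemma weight_f: "ad h v = c *. v ==> ad h (ad f v) = (c - 2) *. ad f v"
 using ad_derivation[of h f v] hf by (simp add: bracket_simps scale_simps)

lemma weight_e_pow:
 "ad h v = c *. v ==> ad h ((ad e ^^ k) v) = (c + 2 * of_nat k) *. (ad e ^^ k) v"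
proof (induction k)
 case (Suc k)
 thus ?case using weight_e[of "(ad e ^^ k) v" "c + 2 * of_nat k"] by (simp add: algebra_simps)
qed simp

lemma weight_f_pow:
 "ad h v = c *. v ==> ad h ((ad f ^^ k) v) = (c - 2 * of_nat k) *. (ad f ^^ k) v"
proof (induction k)
 case (Suc k)
 thus ?case using weight_f[of "(ad f ^^ k) v" "c - 2 * of_nat k"] by (simp add: algebra_simps)
qed simp

lemma e_nilpotent: "ad h v = c *. v ==> EX k. (ad e ^^ k) v = 0"
 using eigen_chain_terminates[of h "%k. (ad e ^^ k) v" c 2] weight_e_pow by simp

lemma f_nilpotent: "ad h v = c *. v ==> EX k. (ad f ^^ k) v = 0"
 using eigen_chain_terminates[of h "%k. (ad f ^^ k) v" c "-2"] weight_f_pow by simp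

lemma e_f: "ad h v = c *. v ==> ad e (ad f v) = c *. v + ad f (ad e v)"
 using ad_derivation[of e f v] ef by simp

lemma highest_weight_step:
 assumes "ad h w = c *. w" "ad e w = 0"
 shows "ad e ((ad f ^^ Suc k) w) = (of_nat (Suc k) * (c - of_nat k)) *. (ad f ^^ k) w"
proof (induction k)
 case 0
 thus ?case using e_f[OF assms(1)] assms(2) by simp
next
 case (Suc k)
 let ?u = "(ad f ^^ Suc k) w"
 have "ad e ((ad f ^^ Suc (Suc k)) w) = ad e (ad f ?u)" by simp
 also have "... = (c - 2 * of_nat (Suc k)) *. ?u + ad f (ad e ?u)"
  by (rule e_f[OF weight_f_pow[OF assms(1)]])
 also have "ad f (ad e ?u) = (of_nat (Suc k) * (c - of_nat k)) *. ?u"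
  unfolding Suc.IH by (simp add: bracket_scaleC_right)
 also have "(c - 2 * of_nat (Suc k)) *. ?u + (of_nat (Suc k) * (c - of_nat k)) *. ?u
   = (of_nat (Suc (Suc k)) * (c - of_nat (Suc k))) *. ?u"
  unfolding scaleC_add_left[symmetric] by (rule arg_cong[of _ _ "%a. a *. ?u"]) (simp add: algebra_simps)
 finally show ?case .
qed

lemma highest_weight_nat:
 assumes w: "w ~= 0" "ad h w = c *. w" "ad e w = 0"
 obtains N where "c = of_nat N" "!!k. k <= N ==> (ad f ^^ k) w ~= 0" "(ad f ^^ Suc N) w = 0"
proof -
 obtain j where j: "(ad f ^^ j) w = 0" "!!i. i < j ==> (ad f ^^ i) w ~= 0"
  using f_nilpotent[OF w(2)] exists_least_iff[of "%k. (ad f ^^ k) w = 0"] by blast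
 then obtain N where N: "j = Suc N" using w(1) by (cases j) auto
 have "(of_nat (Suc N) * (c - of_nat N)) *. (ad f ^^ N) w = 0"
  using highest_weight_step[OF w(2,3), of N] j(1) N by simp
 hence "c = of_nat N" using j(2)[of N] N by (auto simp del: of_nat_Suc)
 thus thesis using that j N by auto
qed

lemma highest_vector:
 assumes v: "v ~= 0" "ad h v = c *. v"
 obtains j where "(ad e ^^ j) v ~= 0" "ad e ((ad e ^^ j) v) = 0"
proof -
 obtain j where j: "(ad e ^^ j) v = 0" "!!i. i < j ==> (ad e ^^ i) v ~= 0"
  using e_nilpotent[OF v(2)] exists_least_iff[of "%k. (ad e ^^ k) v = 0"] by blast
 then obtain i where "j = Suc i" using v(1) by (cases j) auto
 thus thesis using that[of i] j by auto
qed

lemma weight_integral: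
 assumes v: "v ~= 0" "ad h v = c *. v"
 obtains k :: int where "c = of_int k"
proof -
 obtain j where j: "(ad e ^^ j) v ~= 0" "ad e ((ad e ^^ j) v) = 0"
  using highest_vector[OF v] by blast
 obtain N where "c + 2 * of_nat j = of_nat N"
  using highest_weight_nat[OF j(1) weight_e_pow[OF v(2)] j(2)] by blast
 hence "c = of_int (int N - 2 * int j)" by (simp add: eq_diff_eq)
 thus thesis by (rule that)
qed

text \<open>Going up to the highest weight vector and down again reaches the opposite weight.\<close>

lemma opposite_weight:
 assumes v: "v ~= 0" "ad h v = of_nat n *. v"
 shows "EX j. (ad f ^^ (n + j)) ((ad e ^^ j) v) ~= 0"
proof -
 obtain j where j: "(ad e ^^ j) v ~= 0" "ad e ((ad e ^^ j) v) = 0"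
  using highest_vector[OF v] by blast
 obtain N where N: "of_nat n + 2 * of_nat j = (of_nat N :: complex)"
  "!!k. k <= N ==> (ad f ^^ k) ((ad e ^^ j) v) ~= 0"
  using highest_weight_nat[OF j(1) weight_e_pow[OF v(2)] j(2)] by metis
 from N(1) have "of_nat (n + 2 * j) = (of_nat N :: complex)" by simp
 hence "n + 2 * j = N" by (simp only: of_nat_eq_iff)
 thus ?thesis using N(2)[of "n + j"] by auto
qed

lemma e_injective:
 assumes "ad h v = c *. v" "ad e v = 0" "c ~: \<nat>"
 shows "v = 0"
 using highest_weight_nat[of v c] assms by (metis of_nat_in_Nats)

lemma f_injective:
 assumes "ad h v = c *. v" "ad f v = 0" "- c ~: \<nat>"
 shows "v = 0"
 using sl2.e_injective[OF dual, of v "- c"] assms by (simp add: bracket_simps scale_simps)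

lemma e_pow_f:
 assumes "ad h v = m *. v"
 shows "(ad e ^^ Suc k) (ad f v)
  = ad f ((ad e ^^ Suc k) v) + (of_nat (Suc k) * (m + of_nat k)) *. (ad e ^^ k) v"
proof (induction k)
 case 0
 thus ?case using e_f[OF assms] by (simp add: add.commute)
next
 case (Suc k)
 let ?x = "(ad e ^^ Suc k) v"
 have "(ad e ^^ Suc (Suc k)) (ad f v) = ad e ((ad e ^^ Suc k) (ad f v))" by simp
 also have "... = ad e (ad f ?x) + (of_nat (Suc k) * (m + of_nat k)) *. ?x"
  unfolding Suc.IH by (simp add: bracket_simps)
 also have "ad e (ad f ?x) = (m + 2 * of_nat (Suc k)) *. ?x + ad f (ad e ?x)"
  by (rule e_f[OF weight_e_pow[OF assms]])
 also have "(m + 2 * of_nat (Suc k)) *. ?x + ad f (ad e ?x) + (of_nat (Suc k) * (m + of_nat k)) *. ?x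
   = ad f (ad e ?x) + ((m + 2 * of_nat (Suc k)) + of_nat (Suc k) * (m + of_nat k)) *. ?x"
  by (simp add: scaleC_add_left)
 also have "(m + 2 * of_nat (Suc k)) + of_nat (Suc k) * (m + of_nat k) = of_nat (Suc (Suc k)) * (m + of_nat (Suc k))"
  by (simp add: algebra_simps)
 finally show ?case by simp
qed

text \<open>In positive weights \<open>e\<close> is onto: \<open>e f\<close> differs from a nonzero scalar by a map that lowers the
 nilpotency degree of \<open>e\<close>.\<close>

lemma e_surjective:
 assumes M: "lie.subspace M" "!!v. v : M ==> ad e v : M" "!!v. v : M ==> ad f v : M"
  and m: "!!j::nat. m + of_nat j ~= 0" and v: "v : M" "ad h v = m *. v"
 shows "EX u:M. ad h u = (m - 2) *. u & ad e u = v"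
proof -
 obtain j where "(ad e ^^ j) v = 0" using e_nilpotent[OF v(2)] by blast
 thus ?thesis using v
 proof (induction j arbitrary: v)
  case 0
  thus ?case using lie.subspace_0[OF M(1)] by (intro bexI[of _ 0]) auto
 next
  case (Suc j)
  let ?c = "of_nat (Suc j) * (m + of_nat j)"
  have c0: "?c ~= 0" using m[of j] by (simp del: of_nat_Suc)
  let ?u = "ad e (ad f v) - ?c *. v"
  have fv: "ad h (ad f v) = (m - 2) *. ad f v" by (rule weight_f[OF Suc.prems(3)])
  have wu: "ad h ?u = m *. ?u"
   using weight_e[OF fv] Suc.prems(3) by (simp add: bracket_simps scale_simps mult.commute)
  have uM: "?u : M" using Suc.prems(2) M by (simp add: lie.subspace_diff lie.subspace_scale)
  have "(ad e ^^ j) (ad e (ad f v)) = (ad e ^^ Suc j) (ad f v)"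
   by (simp add: funpow_swap1)
  also have "... = ad f ((ad e ^^ Suc j) v) + ?c *. (ad e ^^ j) v"
   by (rule e_pow_f[OF Suc.prems(3)])
  also have "... = ?c *. (ad e ^^ j) v" unfolding Suc.prems(1) by simp
  finally have "(ad e ^^ j) ?u = 0"
   by (simp add: endo.linear_diff[OF lin_funpow[OF lin_ad]] endo.linear_scale[OF lin_funpow[OF lin_ad]] del: of_nat_Suc)
  from Suc.IH[OF this uM wu] obtain u1 where u1: "u1 : M" "ad h u1 = (m - 2) *. u1" "ad e u1 = ?u"
   by blast
  let ?w = "(1 / ?c) *. (ad f v - u1)"
  have "?w : M" using u1 Suc.prems(2) M by (simp add: lie.subspace_diff lie.subspace_scale)
  moreover have "ad h ?w = (m - 2) *. ?w"
   using fv u1(2) by (simp add: bracket_scaleC_right bracket_diff_right scaleC_scaleC mult.commute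
     flip: lie.scale_right_diff_distrib)
  moreover have "ad e ?w = v"
  proof -
   have "ad e ?w = (1 / ?c) *. (?c *. v)"
    unfolding bracket_scaleC_right bracket_diff_right u1(3) by simp
   thus ?thesis using c0 by (simp add: scaleC_scaleC del: of_nat_Suc)
  qed
  ultimately show ?case by blast
 qed
qed

lemma f_surjective:
 assumes M: "lie.subspace M" "!!v. v : M ==> ad e v : M" "!!v. v : M ==> ad f v : M"
  and m: "!!j::nat. - m + of_nat j ~= 0" and v: "v : M" "ad h v = m *. v"
 shows "EX u:M. ad h u = (m + 2) *. u & ad f u = v"
proof -
 have "EX u:M. ad (- h) u = (- m - 2) *. u & ad f u = v"
  by (rule sl2.e_surjective[OF dual M(1,3,2) m v(1)]) (use v(2) in \<open>simp_all add: bracket_simps scale_simps\<close>)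
 then obtain u where u: "u : M" "- ad h u = - (m *. u) - 2 *. u" "ad f u = v"
  by (auto simp: bracket_simps scale_simps)
 hence "- ad h u = - (m *. u + 2 *. u)" by simp
 hence "ad h u = m *. u + 2 *. u" by (simp only: neg_equal_iff_equal)
 thus ?thesis using u by (auto simp: scale_simps)
qed

lemma e_pow_f_pow:
 assumes w: "ad h w = of_nat N *. w" "ad e w = 0" and "k <= N"
 obtains a where "a ~= 0" "(ad e ^^ k) ((ad f ^^ k) w) = a *. w"
 using assms(3)
proof (induction k arbitrary: thesis)
 case 0
 thus ?case using "0.prems"(1)[of 1] by simp
next
 case (Suc k)
 obtain a where a: "a ~= 0" "(ad e ^^ k) ((ad f ^^ k) w) = a *. w"
  using Suc.IH Suc.prems(2) by auto
 let ?b = "of_nat (Suc k) * (of_nat N - of_nat k) :: complex"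
 have "(ad e ^^ Suc k) ((ad f ^^ Suc k) w) = (ad e ^^ k) (ad e ((ad f ^^ Suc k) w))"
  unfolding funpow_Suc_right o_apply ..
 also have "... = ?b *. (a *. w)"
  unfolding highest_weight_step[OF w] endo.linear_scale[OF lin_funpow[OF lin_ad]] a(2) ..
 finally have "(ad e ^^ Suc k) ((ad f ^^ Suc k) w) = (?b * a) *. w" by (simp add: scaleC_scaleC)
 moreover have "of_nat N ~= (of_nat k :: complex)" using Suc.prems(2) by simp
 hence "?b * a ~= 0" using a(1) by (simp del: of_nat_Suc)
 ultimately show ?case using Suc.prems(1) by blast
qed

text \<open>Complete reducibility. A stable \<open>W\<close> of maximal dimension with \<open>V \<inter> W = 0\<close> is a complement:
 otherwise a vector of maximal weight outside \<open>V + W\<close> can be corrected, by surjectivity of \<open>e\<close> on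
 \<open>V + W\<close>, to a highest weight vector, and it generates a submodule that can be added to \<open>W\<close>.\<close>

theorem complement:
 assumes diag: "diagonalizable_on UNIV h"
  and V: "lie.subspace V" "!!v. v : V ==> ad e v : V" "!!v. v : V ==> ad h v : V"
   "!!v. v : V ==> ad f v : V"
 shows "EX W. lie.subspace W & (ALL w:W. ad e w : W & ad h w : W & ad f w : W) &
  direct_sum UNIV V W"
proof -
 define P where "P W \<longleftrightarrow> lie.subspace W & (ALL w:W. ad e w : W & ad h w : W & ad f w : W) &
  V \<inter> W = {0}" for W
 have "P {0}" unfolding P_def using lie.subspace_0[OF V(1)] by auto
 moreover have "ALL W. P W --> lie.dim W < Suc (lie.dim (UNIV :: 'g set))"
 proof (intro allI impI)
  fix W :: "'g set"
  have "lie.dim W <= lie.dim (UNIV :: 'g set)" by (rule fin.dim_subset[OF subset_UNIV])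
  thus "lie.dim W < Suc (lie.dim (UNIV :: 'g set))" by simp
 qed
 ultimately obtain W where W: "P W" and Wmax: "!!W'. P W' ==> lie.dim W' <= lie.dim W"
  using ex_has_greatest_nat[of P "{0}" lie.dim] by blast
 define M where "M = {v + w | v w. v : V & w : W}"
 have W0: "lie.subspace W" "!!w. w : W ==> ad e w : W" "!!w. w : W ==> ad h w : W"
  "!!w. w : W ==> ad f w : W" "V \<inter> W = {0}"
  using W unfolding P_def by auto
 have Msub: "lie.subspace M" unfolding M_def by (rule lie.subspace_sums[OF V(1) W0(1)])
 have Mst: "ad e u : M" "ad h u : M" "ad f u : M" if "u : M" for u
  using sums_stable[OF lin_ad V(2) W0(2)] sums_stable[OF lin_ad V(3) W0(3)]
   sums_stable[OF lin_ad V(4) W0(4)] that unfolding M_def by blast+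
 have WM: "W \<subseteq> M" unfolding M_def by (rule sums_superset(2)[OF V(1) W0(1)])
 have "M = UNIV"
 proof (rule ccontr)
  assume ne: "M ~= UNIV"
  let ?E = "{w. EX c. ad h w = c *. w}"
  have "~ ?E \<subseteq> M"
  proof
   assume "?E \<subseteq> M"
   hence "lie.span ?E \<subseteq> M" by (rule lie.span_minimal[OF _ Msub])
   thus False using diag ne unfolding diagonalizable_on_def by auto
  qed
  let ?C = "{c. EX x. x ~: M & ad h x = c *. x}"
  have "?C \<subseteq> {c. EX v. v ~= 0 & ad h v = c *. v}"
  proof
   fix c assume "c : ?C"
   then obtain x where x: "x ~: M" "ad h x = c *. x" by blast
   hence "x ~= 0" using lie.subspace_0[OF Msub] by blast
   thus "c : {c. EX v. v ~= 0 & ad h v = c *. v}" using x by blast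
  qed
  hence "finite ?C" by (rule finite_subset[OF _ finite_eigenvalues[OF lin_ad]])
  moreover have "?C ~= {}" using \<open>~ ?E \<subseteq> M\<close> by blast
  ultimately have fR: "finite (Re ` ?C)" "Re ` ?C ~= {}" by simp_all
  then obtain c where c: "c : ?C" "Re c = Max (Re ` ?C)" using Max_in[OF fR] by (elim imageE) simp
  have cmax: "Re d <= Re c" if "d : ?C" for d
   unfolding c(2) by (rule Max_ge[OF fR(1)]) (rule imageI[OF that])
  from c(1)
  obtain x where x: "x ~: M" "ad h x = c *. x" by blast
  have up: "u : M" if "ad h u = (c + 2) *. u" for u
  proof (rule ccontr)
   assume "u ~: M"
   hence "c + 2 : ?C" using that by blast
   thus False using cmax[of "c + 2"] by simp
  qed
  have "c : \<nat>"
  proof (rule ccontr)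
   assume "c ~: \<nat>"
   hence nz: "- c + of_nat j ~= 0" for j :: nat by (metis add.commute add.right_neutral add_minus_cancel of_nat_in_Nats)
   obtain u where "ad h u = (c + 2) *. u" "ad f u = x"
    using f_surjective[OF lie.subspace_UNIV _ _ nz _ x(2)] by auto
   thus False using up[of u] Mst(3)[of u] x(1) by simp
  qed
  then obtain N0 where N0: "c = of_nat N0" by (auto elim: Nats_cases)
  have ex: "ad h (ad e x) = (c + 2) *. ad e x" by (rule weight_e[OF x(2)])
  have "c + 2 + of_nat j ~= 0" for j :: nat
  proof -
   have "c + 2 + of_nat j = of_nat (N0 + 2 + j)" using N0 by simp
   thus ?thesis by (metis add_is_0 of_nat_eq_0_iff zero_neq_numeral)
  qed
  then obtain y where y: "y : M" "ad h y = (c + 2 - 2) *. y" "ad e y = ad e x"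
   using e_surjective[OF Msub Mst(1,3) _ up[OF ex] ex] by blast
  let ?w = "x - y"
  have wM: "?w ~: M"
  proof
   assume "?w : M"
   hence "?w + y : M" using y(1) by (rule lie.subspace_add[OF Msub])
   thus False using x(1) by simp
  qed
  hence w0: "?w ~= 0" using lie.subspace_0[OF Msub] by metis
  have hw: "ad h ?w = c *. ?w" using x(2) y(2) by (simp add: bracket_simps scale_simps)
  have ew: "ad e ?w = 0" using y(3) by (simp add: bracket_simps)
  obtain N where N: "c = of_nat N" "(ad f ^^ Suc N) ?w = 0"
   using highest_weight_nat[OF w0 hw ew] by metis
  define X where "X K = lie.span ((%k. (ad f ^^ k) ?w) ` {..<K})" for K
  have triv: "K <= Suc N ==> u : X K ==> u : M ==> u = 0" for K u
  proof (induction K arbitrary: u)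
   case 0
   thus ?case unfolding X_def by simp
  next
   case (Suc K)
   have "X (Suc K) = lie.span (insert ((ad f ^^ K) ?w) ((%k. (ad f ^^ k) ?w) ` {..<K}))"
    unfolding X_def by (simp add: lessThan_Suc)
   then obtain a where a: "u - a *. (ad f ^^ K) ?w : X K"
    using Suc.prems(2) lie.span_breakdown_eq unfolding X_def by blast
   have kill: "(ad e ^^ K) z = 0" if "z : X K" for z
   proof (rule lin_eq_on_span[OF lin_funpow[OF lin_ad] lin_zero _ that[unfolded X_def]])
    fix b assume "b : (%k. (ad f ^^ k) ?w) ` {..<K}"
    then obtain k where k: "k < K" "b = (ad f ^^ k) ?w" by blast
    obtain a where "(ad e ^^ k) ((ad f ^^ k) ?w) = a *. ?w"
     using e_pow_f_pow[of ?w N k] hw ew N(1) k(1) Suc.prems(1) by auto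
    hence "(ad e ^^ Suc k) b = 0" using ew k(2) by (simp add: bracket_scaleC_right)
    thus "(ad e ^^ K) b = 0" by (rule funpow_zero_mono[OF lin_ad]) (use k in simp)
   qed
   obtain b where b: "b ~= 0" "(ad e ^^ K) ((ad f ^^ K) ?w) = b *. ?w"
    using e_pow_f_pow[of ?w N K] hw ew N(1) Suc.prems(1) by auto
   have "(ad e ^^ K) u = (a * b) *. ?w"
    using kill[OF a] b(2) by (simp add: endo.linear_diff[OF lin_funpow[OF lin_ad]]
      endo.linear_scale[OF lin_funpow[OF lin_ad]] scaleC_scaleC)
   moreover have "(ad e ^^ i) u : M" for i
   proof (induction i)
    case (Suc i)
    hence "ad e ((ad e ^^ i) u) : M" by (rule Mst(1))
    thus ?case by simp
   qed (use Suc.prems(3) in simp)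
   ultimately have "(a * b) *. ?w : M" by metis
   hence "a = 0"
   proof (rule contrapos_pp)
    assume "a ~= 0"
    show "(a * b) *. ?w ~: M"
    proof
     assume "(a * b) *. ?w : M"
     hence "(1 / (a * b)) *. ((a * b) *. ?w) : M" by (rule lie.subspace_scale[OF Msub])
     thus False using wM \<open>a ~= 0\<close> b(1) by (simp add: scaleC_scaleC)
    qed
   qed
   hence "u : X K" using a by simp
   thus ?case using Suc.IH Suc.prems by simp
  qed
  let ?X = "X (Suc N)"
  have Xsub: "lie.subspace ?X" unfolding X_def by simp
  have gen: "(ad f ^^ k) ?w : ?X" if "k <= N" for k
   unfolding X_def using that by (intro lie.span_base) auto
  have fX: "ad f u : ?X" if "u : ?X" for u
  proof (rule lin_span_stable[OF lin_ad _ Xsub that[unfolded X_def]])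
   fix b assume "b : (%k. (ad f ^^ k) ?w) ` {..<Suc N}"
   then obtain k where "k < Suc N" and kb: "b = (ad f ^^ k) ?w" by blast
   hence k: "k <= N" "b = (ad f ^^ k) ?w" by (simp_all only: less_Suc_eq_le)
   hence fb: "ad f b = (ad f ^^ Suc k) ?w" by simp
   show "ad f b : ?X"
   proof (cases "k = N")
    case True
    thus ?thesis using fb N(2) lie.subspace_0[OF Xsub] by simp
   next
    case False
    thus ?thesis unfolding fb using k by (intro gen) simp
   qed
  qed
  have hX: "ad h u : ?X" if "u : ?X" for u
  proof (rule lin_span_stable[OF lin_ad _ Xsub that[unfolded X_def]])
   fix b assume "b : (%k. (ad f ^^ k) ?w) ` {..<Suc N}"
   then obtain k where "k < Suc N" and kb: "b = (ad f ^^ k) ?w" by blast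
   hence k: "k <= N" "b = (ad f ^^ k) ?w" by (simp_all only: less_Suc_eq_le)
   show "ad h b : ?X"
    unfolding k(2) weight_f_pow[OF hw] by (rule lie.subspace_scale[OF Xsub gen[OF k(1)]])
  qed
  have eX: "ad e u : ?X" if "u : ?X" for u
  proof (rule lin_span_stable[OF lin_ad _ Xsub that[unfolded X_def]])
   fix b assume "b : (%k. (ad f ^^ k) ?w) ` {..<Suc N}"
   then obtain k where "k < Suc N" and kb: "b = (ad f ^^ k) ?w" by blast
   hence k: "k <= N" "b = (ad f ^^ k) ?w" by (simp_all only: less_Suc_eq_le)
   show "ad e b : ?X"
   proof (cases k)
    case 0
    thus ?thesis using k ew lie.subspace_0[OF Xsub] by simp
   next
    case (Suc i)
    show ?thesis unfolding k(2) Suc highest_weight_step[OF hw ew]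
     using k(1) Suc by (intro lie.subspace_scale[OF Xsub] gen) simp
   qed
  qed
  let ?W = "{w + x | w x. w : W & x : ?X}"
  have "V \<inter> ?W = {0}"
  proof
   show "V \<inter> ?W \<subseteq> {0}"
   proof
    fix v assume v: "v : V \<inter> ?W"
    then obtain w x where wx: "v = w + x" "w : W" "x : ?X" by blast
    have "v + (- w) : M" unfolding M_def using v lie.subspace_neg[OF W0(1) wx(2)] by blast
    moreover have "x = v + (- w)" using wx(1) by simp
    ultimately have "x : M" by simp
    hence "x = 0" using triv[of "Suc N" x] wx(3) by simp
    hence "v : V \<inter> W" using v wx by simp
    thus "v : {0}" using W0(5) by simp
   qed
   show "{0} \<subseteq> V \<inter> ?W"
    using lie.subspace_0[OF V(1)] subsetD[OF sums_superset(1)[OF W0(1) Xsub] lie.subspace_0[OF W0(1)]]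
    by blast
  qed
  hence "P ?W"
   unfolding P_def using lie.subspace_sums[OF W0(1) Xsub] sums_stable[OF lin_ad W0(2) eX]
    sums_stable[OF lin_ad W0(3) hX] sums_stable[OF lin_ad W0(4) fX] by blast
  hence dl: "lie.dim ?W <= lie.dim W" by (rule Wmax)
  have sub: "W \<subseteq> ?W" by (rule sums_superset(1)[OF W0(1) Xsub])
  have Weq: "W = ?W"
   by (rule fin.subspace_dim_equal[OF W0(1) lie.subspace_sums[OF W0(1) Xsub] sub dl])
  have "?w : ?X" using gen[of 0] by simp
  hence "?w : ?W" using sums_superset(2)[OF W0(1) Xsub] by blast
  hence "?w : W" using Weq by simp
  thus False using wM WM by blast
 qed
 hence "direct_sum UNIV V W" unfolding direct_sum_def using W0(5) M_def by simp
 thus ?thesis using W0 by blast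
qed

end

section \<open>Roots\<close>

text \<open>A stable subspace contains the weight components of its elements: applying \<open>h - \<alpha> h\<close> removes the
 component of weight \<open>\<alpha>\<close>.\<close>

lemma joint_component:
 assumes "finite F" "!!\<alpha> \<beta>. \<alpha> : F ==> \<beta> : F ==> \<alpha> ~= \<beta> ==> EX h:H. wt \<alpha> h ~= wt \<beta> h"
  "!!\<alpha> h. \<alpha> : F ==> h : H ==> ad h (v \<alpha>) = (wt \<alpha> h :: complex) *. v \<alpha>"
  and U: "lie.subspace U" "!!h u. h : H ==> u : U ==> ad h u : U"
  and "(SUM \<alpha>:F. v \<alpha>) : U" "\<alpha> : F"
 shows "v \<alpha> : U"
 using assms(1-3,6,7)
proof (induction F arbitrary: v \<alpha> rule: finite_induct)
 case (insert a F)
 have F: "v \<beta> : U" if b: "\<beta> : F" for \<beta>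
 proof -
  have "a ~= \<beta>" using b insert.hyps by blast
  then obtain h where h: "h : H" "wt a h ~= wt \<beta> h" using insert.prems(1)[of a \<beta>] b by blast
  let ?w = "%\<gamma>. (wt \<gamma> h - wt a h) *. v \<gamma>"
  let ?s = "SUM \<gamma>:insert a F. v \<gamma>"
  have "ad h ?s - wt a h *. ?s = (SUM \<gamma>:insert a F. ?w \<gamma>)"
   unfolding bracket_sum_right lie.scale_sum_right sum_subtractf[symmetric]
   by (rule sum.cong[OF refl]) (simp add: insert.prems(2) h(1) scale_simps)
  also have "... = (SUM \<gamma>:F. ?w \<gamma>)" using insert.hyps by simp
  finally have "(SUM \<gamma>:F. ?w \<gamma>) = ad h ?s - wt a h *. ?s" ..
  also have "... : U"
   by (intro lie.subspace_diff[OF U(1)] lie.subspace_scale[OF U(1)] U(2)[OF h(1)] insert.prems(3))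
  finally have s: "(SUM \<gamma>:F. ?w \<gamma>) : U" .
  have "?w \<beta> : U"
  proof (rule insert.IH[OF _ _ s b])
   fix \<gamma> h' assume "\<gamma> : F" "h' : H"
   thus "ad h' (?w \<gamma>) = wt \<gamma> h' *. ?w \<gamma>"
    using insert.prems(2)[of \<gamma> h'] by (simp add: bracket_scaleC_right scaleC_scaleC mult.commute)
  qed (use insert.prems(1) in auto)
  hence "(1 / (wt \<beta> h - wt a h)) *. ?w \<beta> : U" by (rule lie.subspace_scale[OF U(1)])
  thus ?thesis using h(2) by (simp add: scaleC_scaleC)
 qed
 have "v a = (SUM \<gamma>:insert a F. v \<gamma>) - (SUM \<gamma>:F. v \<gamma>)" using insert.hyps by simp
 also have "... : U"
  by (rule lie.subspace_diff[OF U(1) insert.prems(3)]) (rule lie.subspace_sum[OF U(1) F])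
 finally show ?case using F insert.prems(4) by blast
qed simp

lemma span_weight_sum:
 assumes "x : lie.span (UN \<alpha>:D. R \<alpha>)" "!!\<alpha>. \<alpha> : D ==> lie.subspace (R \<alpha>)"
 shows "EX F v. finite F & F \<subseteq> D & (ALL \<alpha>:F. v \<alpha> : R \<alpha>) & x = (SUM \<alpha>:F. v \<alpha>)"
 using assms(1)
proof (induction rule: lie.span_induct_alt)
 case base
 show ?case by (intro exI[of _ "{}"]) simp
next
 case (step c x y)
 obtain a where a: "a : D" "x : R a" using step(1) by blast
 obtain F v where F: "finite F" "F \<subseteq> D" "ALL \<alpha>:F. v \<alpha> : R \<alpha>" "y = (SUM \<alpha>:F. v \<alpha>)" using step(2) by blast
 define w where "w \<alpha> = (if \<alpha> = a then c *. x else 0) + (if \<alpha> : F then v \<alpha> else 0)" for \<alpha>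
 have fin: "finite (insert a F)" using F(1) by simp
 have "w \<alpha> : R \<alpha>" if "\<alpha> : insert a F" for \<alpha>
 proof -
  have R: "lie.subspace (R \<alpha>)" using that a(1) F(2) assms(2) by blast
  show ?thesis unfolding w_def
   by (rule lie.subspace_add[OF R]) (use a F(3) R in \<open>auto intro: lie.subspace_scale lie.subspace_0\<close>)
 qed
 moreover have "(SUM \<alpha>:insert a F. w \<alpha>) = c *. x + y"
 proof -
  have "(SUM \<alpha>:insert a F. w \<alpha>) = (SUM \<alpha>:insert a F. if \<alpha> = a then c *. x else 0) + (SUM \<alpha>:insert a F. if \<alpha> : F then v \<alpha> else 0)"
   unfolding w_def by (rule sum.distrib)
  also have "(SUM \<alpha>:insert a F. if \<alpha> = a then c *. x else 0) = c *. x" using fin by simp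
  also have "(SUM \<alpha>:insert a F. if \<alpha> : F then v \<alpha> else 0) = (SUM \<alpha>:F. v \<alpha>)"
   using F(1) by (intro sum.mono_neutral_cong_right) auto
  finally show ?thesis using F(4) by simp
 qed
 ultimately show ?case using fin F(2) a(1) by (intro exI[of _ "insert a F"] exI[of _ w]) auto
qed

lemma root_space_subspace: "lie.subspace L ==> lie.subspace (root_space L H \<alpha>)"
 unfolding root_space_def lie.subspace_def
 by (auto simp: bracket_simps scale_simps mult.commute)

lemma eigenspace_subspace:
 "lie.subspace L ==> lie.subspace {v : L. ad t v = c *. v}"
 unfolding lie.subspace_def by (auto simp: bracket_simps scale_simps mult.commute)

lemma dual_space_eqI:
 assumes "\<alpha> : dual_space H" "\<beta> : dual_space H" "!!h. h : H ==> \<alpha> h = \<beta> h"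
 shows "\<alpha> = \<beta>"
proof
 fix x show "\<alpha> x = \<beta> x" using assms unfolding dual_space_def by (cases "x : H") auto
qed

lemma dual_space_combine:
 assumes "\<alpha> : dual_space H" "\<beta> : dual_space H"
 shows "(%x. a * \<alpha> x + b * \<beta> x) : dual_space H"
 using assms unfolding dual_space_def by (auto simp: algebra_simps)

lemma dual_space_zero: "(%_. 0) : dual_space H"
 unfolding dual_space_def by simp

lemma dual_space_uminus: "\<alpha> : dual_space H ==> (%x. - \<alpha> x) : dual_space H"
 unfolding dual_space_def by auto

locale cartan_pair =
 fixes L H :: "'g::complex_lie_algebra set"
 assumes nondeg: "killing_nondeg L" and cartan: "cartan_subalgebra L H"
begin

abbreviation "\<kappa> \<equiv> killing_form L"
abbreviation "RS \<equiv> root_space L H"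
abbreviation "neg \<alpha> \<equiv> (%x. - \<alpha> x :: complex)"

lemma L: "subalgebra L" using nondeg unfolding killing_nondeg_def by blast
lemma H: "subalgebra H" "H \<subseteq> L" using cartan unfolding cartan_subalgebra_def by auto
lemmas N = subalgebraD[OF L]
lemmas NH = subalgebraD[OF H(1)]
lemmas RS_sub = root_space_subspace[OF N(1), of H]
lemma HL: "h : H ==> h : L" using H(2) by blast
lemma RSL: "x : RS \<alpha> ==> x : L" unfolding root_space_def by blast
lemma RSD: "x : RS \<alpha> ==> h : H ==> ad h x = \<alpha> h *. x" unfolding root_space_def by blast

lemmas abelian = cartan_toral(1)[OF nondeg cartan]
lemmas spanning = cartan_toral(2)[OF nondeg cartan]
lemmas RS_zero = cartan_toral(3)[OF nondeg cartan]

lemma RS_bracket: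
 assumes "x : RS \<alpha>" "y : RS \<beta>" shows "ad x y : RS (%h. \<alpha> h + \<beta> h)"
proof -
 have "ad h (ad x y) = (\<alpha> h + \<beta> h) *. ad x y" if "h : H" for h
  using ad_derivation[of h x y] RSD[OF assms(1) that] RSD[OF assms(2) that]
  by (simp add: bracket_simps scale_simps)
 thus ?thesis unfolding root_space_def using N(2) RSL assms by blast
qed

lemma RS_bracket':
 "x : RS \<alpha> ==> y : RS \<beta> ==> (!!h. h : H ==> \<gamma> h = \<alpha> h + \<beta> h) ==> ad x y : RS \<gamma>"
 using RS_bracket[of x \<alpha> y \<beta>] unfolding root_space_def by auto

lemma separate: "\<alpha> : dual_space H ==> \<beta> : dual_space H ==> \<alpha> ~= \<beta> ==> EX h:H. \<alpha> h ~= \<beta> h"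
 using dual_space_eqI by blast

lemma \<kappa>_sym: "x : L ==> y : L ==> \<kappa> x y = \<kappa> y x"
 using killing_sym[OF N(1)] N(3) by blast

lemma \<kappa>_inv: "x : L ==> y : L ==> z : L ==> \<kappa> (ad x y) z = \<kappa> x (ad y z)"
 using killing_invariant[OF N(1)] N(3) by blast

lemma \<kappa>_orth:
 assumes "x : RS \<alpha>" "y : RS \<beta>" "h : H" "\<alpha> h + \<beta> h ~= 0"
 shows "\<kappa> x y = 0"
 by (rule killing_gen_orth[OF L HL[OF assms(3)] RSL[OF assms(1)] RSL[OF assms(2)]
    gen_eig_eigenvector gen_eig_eigenvector assms(4)])
  (use RSD assms in auto)

lemma \<kappa>_zeroI:
 assumes x: "x : L" and "!!\<alpha> y. \<alpha> : dual_space H ==> y : RS \<alpha> ==> \<kappa> x y = 0"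
 shows "x = 0"
proof -
 have "\<kappa> x y = 0" if "y : L" for y
  by (rule killing_zero_subspace[OF L x, of "UN \<alpha>:dual_space H. RS \<alpha>"])
   (use spanning that assms(2) RSL in auto)
 thus ?thesis using nondeg x unfolding killing_nondeg_def by blast
qed

lemma H_RS0: "h : H ==> h : RS (%_. 0)" using RS_zero by simp

lemma \<kappa>_H_nondeg:
 assumes h: "h : H" and "!!h'. h' : H ==> \<kappa> h h' = 0"
 shows "h = 0"
proof (rule \<kappa>_zeroI[OF HL[OF h]])
 fix \<alpha> y assume \<alpha>: "\<alpha> : dual_space H" and y: "y : RS \<alpha>"
 show "\<kappa> h y = 0"
 proof (cases "\<alpha> = (%_. 0)")
  case True
  thus ?thesis using y RS_zero assms(2) by simp
 next
  case False
  then obtain h' where "h' : H" "\<alpha> h' ~= 0" using separate[OF \<alpha> dual_space_zero] by auto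
  thus ?thesis using \<kappa>_orth[OF H_RS0[OF h] y] by simp
 qed
qed

lemma roots_dual: "\<alpha> : roots L H ==> \<alpha> : dual_space H" unfolding roots_def by blast

lemma root_nonzero: "\<alpha> : roots L H ==> EX h:H. \<alpha> h ~= 0"
 using separate[OF roots_dual dual_space_zero, of \<alpha>] unfolding roots_def by auto

lemma rootI: "\<alpha> : dual_space H ==> x : RS \<alpha> ==> x ~= 0 ==> h : H ==> \<alpha> h ~= 0 ==> \<alpha> : roots L H"
 unfolding roots_def by auto

lemma root_vector: "\<alpha> : roots L H ==> EX x:RS \<alpha>. x ~= 0"
 using lie.subspace_0[OF RS_sub] unfolding roots_def by blast

lemma dual_vector:
 assumes \<alpha>: "\<alpha> : dual_space H" and e: "e : RS \<alpha>" "e ~= 0"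
 obtains f where "f : RS (neg \<alpha>)" "\<kappa> e f ~= 0"
proof (rule ccontr)
 assume "~ thesis"
 hence no: "!!f. f : RS (neg \<alpha>) ==> \<kappa> e f = 0" using that by blast
 have "e = 0"
 proof (rule \<kappa>_zeroI[OF RSL[OF e(1)]])
  fix \<beta> y assume \<beta>: "\<beta> : dual_space H" and y: "y : RS \<beta>"
  show "\<kappa> e y = 0"
  proof (cases "\<beta> = neg \<alpha>")
   case True
   thus ?thesis using no y by simp
  next
   case False
   then obtain h where "h : H" "\<beta> h ~= - \<alpha> h" using separate[OF \<beta> dual_space_uminus[OF \<alpha>]] by auto
   thus ?thesis using \<kappa>_orth[OF e(1) y] by (metis add.inverse_unique neg_equal_iff_equal add_eq_0_iff)
  qed
 qed
 thus False using e(2) by simp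
qed

lemma neg_root: "\<alpha> : roots L H ==> neg \<alpha> : roots L H"
proof -
 assume \<alpha>: "\<alpha> : roots L H"
 obtain e where e: "e : RS \<alpha>" "e ~= 0" using root_vector[OF \<alpha>] by blast
 obtain f where f: "f : RS (neg \<alpha>)" "\<kappa> e f ~= 0" using dual_vector[OF roots_dual[OF \<alpha>] e] by blast
 hence "f ~= 0" using N(1) by auto
 thus ?thesis using rootI[OF dual_space_uminus[OF roots_dual[OF \<alpha>]] f(1)] root_nonzero[OF \<alpha>] by auto
qed

lemma bracket_opposite:
 assumes e: "e : RS \<alpha>" and f: "f : RS (neg \<alpha>)"
 shows "ad e f : H" "h : H ==> \<kappa> (ad e f) h = \<alpha> h * \<kappa> e f"
proof -
 have "ad e f : RS (%_. 0)" by (rule RS_bracket'[OF e f]) simp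
 thus ef: "ad e f : H" using RS_zero by simp
 assume h: "h : H"
 have "\<kappa> (ad e f) h = \<kappa> h (ad e f)" by (rule \<kappa>_sym[OF HL[OF ef] HL[OF h]])
 also have "... = \<kappa> (ad h e) f" by (rule \<kappa>_inv[OF HL[OF h] RSL[OF e] RSL[OF f], symmetric])
 also have "... = \<alpha> h * \<kappa> e f"
  unfolding RSD[OF e h] by (rule killing_bilinear(4)[OF L RSL[OF e] RSL[OF e] RSL[OF f]])
 finally show "\<kappa> (ad e f) h = \<alpha> h * \<kappa> e f" .
qed

definition troot :: "('g => complex) => 'g" where
 "troot \<alpha> = (SOME t. t : H & (ALL h:H. \<kappa> t h = \<alpha> h))"

lemma \<kappa>_H_unique:
 assumes "t : H" "t' : H" "!!h. h : H ==> \<kappa> t h = \<kappa> t' h" shows "t = t'"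
proof -
 have "\<kappa> (t - t') h = 0" if "h : H" for h
  using killing_bilinear(2)[OF L HL[OF assms(1)] HL[OF assms(2)] HL[OF that]] assms(3)[OF that] by simp
 hence "t - t' = 0" using \<kappa>_H_nondeg lie.subspace_diff[OF NH(1) assms(1,2)] by blast
 thus ?thesis by simp
qed

lemma troot:
 assumes \<alpha>: "\<alpha> : roots L H"
 shows "troot \<alpha> : H" "h : H ==> \<kappa> (troot \<alpha>) h = \<alpha> h"
proof -
 obtain e where e: "e : RS \<alpha>" "e ~= 0" using root_vector[OF \<alpha>] by blast
 obtain f where f: "f : RS (neg \<alpha>)" "\<kappa> e f ~= 0" using dual_vector[OF roots_dual[OF \<alpha>] e] by blast
 let ?t = "(1 / \<kappa> e f) *. ad e f"
 note b = bracket_opposite[OF e(1) f(1)]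
 have "?t : H & (ALL h:H. \<kappa> ?t h = \<alpha> h)"
  using b f(2) lie.subspace_scale[OF NH(1) b(1)] killing_bilinear(4)[OF L HL[OF b(1)] HL[OF b(1)] HL] by simp
 hence "troot \<alpha> : H & (ALL h:H. \<kappa> (troot \<alpha>) h = \<alpha> h)" unfolding troot_def by (rule someI)
 thus "troot \<alpha> : H" "h : H ==> \<kappa> (troot \<alpha>) h = \<alpha> h" by auto
qed

lemma bracket_troot:
 assumes \<alpha>: "\<alpha> : roots L H" and e: "e : RS \<alpha>" and f: "f : RS (neg \<alpha>)"
 shows "ad e f = \<kappa> e f *. troot \<alpha>"
proof (rule \<kappa>_H_unique)
 note t = troot[OF \<alpha>]
 show "ad e f : H" by (rule bracket_opposite(1)[OF e f])
 show "\<kappa> e f *. troot \<alpha> : H" by (rule lie.subspace_scale[OF NH(1) t(1)])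
 fix h assume h: "h : H"
 show "\<kappa> (ad e f) h = \<kappa> (\<kappa> e f *. troot \<alpha>) h"
  using bracket_opposite(2)[OF e f h] killing_bilinear(4)[OF L HL[OF t(1)] HL[OF t(1)] HL[OF h]] t(2)[OF h]
  by simp
qed

lemma central_in_H:
 assumes t: "t : H" and z: "!!\<beta>. \<beta> : dual_space H ==> RS \<beta> ~= {0} ==> \<beta> t = 0"
 shows "t = 0"
proof (rule killing_center[OF nondeg HL[OF t]])
 fix y assume "y : L"
 hence "y : lie.span (UN \<alpha>:dual_space H. RS \<alpha>)" using spanning by blast
 thus "ad t y = 0"
 proof (rule lin_eq_on_span[OF lin_ad lin_zero, rotated])
  fix b assume "b : (UN \<alpha>:dual_space H. RS \<alpha>)"
  then obtain \<beta> where "\<beta> : dual_space H" "b : RS \<beta>" by blast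
  thus "ad t b = 0" using z[of \<beta>] RSD[of b \<beta> t] t by (cases "RS \<beta> = {0}") auto
 qed
qed

text \<open>If \<open>\<alpha>\<close> vanished on \<open>t\<^sub>\<alpha> = [e, f]\<close>, each eigenspace of \<open>t\<^sub>\<alpha>\<close> would be stable under \<open>e\<close> and \<open>f\<close>, so
 its eigenvalue would be the trace of a commutator up to a factor.\<close>

lemma root_troot_nonzero:
 assumes \<alpha>: "\<alpha> : roots L H" shows "\<alpha> (troot \<alpha>) ~= 0"
proof
 assume z: "\<alpha> (troot \<alpha>) = 0"
 note t = troot[OF \<alpha>]
 obtain e where e: "e : RS \<alpha>" "e ~= 0" using root_vector[OF \<alpha>] by blast
 obtain f where f: "f : RS (neg \<alpha>)" "\<kappa> e f ~= 0" using dual_vector[OF roots_dual[OF \<alpha>] e] by blast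
 define tt where "tt = \<kappa> e f *. troot \<alpha>"
 have ef: "ad e f = tt" unfolding tt_def by (rule bracket_troot[OF \<alpha> e(1) f(1)])
 have tH: "tt : H" unfolding tt_def by (rule lie.subspace_scale[OF NH(1) t(1)])
 have \<alpha>t: "\<alpha> tt = 0" using z t(1) roots_dual[OF \<alpha>] unfolding dual_space_def tt_def by simp
 have te: "ad tt e = 0" "ad tt f = 0" using RSD[OF e(1) tH] RSD[OF f(1) tH] \<alpha>t by simp_all
 have "\<beta> tt = 0" if "\<beta> : dual_space H" and ne: "RS \<beta> ~= {0}" for \<beta>
 proof -
  let ?c = "\<beta> tt"
  let ?W = "{v : L. ad tt v = ?c *. v}"
  have W: "lie.subspace ?W" by (rule eigenspace_subspace[OF N(1)])
  have st: "ad x v : ?W" if "v : ?W" "x : L" "ad tt x = 0" for x v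
   using that ad_derivation[of tt x v] N(2) by (simp add: bracket_simps)
  have stt: "!!v. v : ?W ==> ad tt v : ?W" by (rule st[OF _ HL[OF tH] bracket_self])
  have "ad tt = (%v. ad e (ad f v) - ad f (ad e v))"
   unfolding ef[symmetric] fun_eq_iff by (simp add: ad_bracket)
  hence "trace_on ?W (ad tt) = trace_on ?W (%v. ad e (ad f v) - ad f (ad e v))"
   by (rule arg_cong)
  also have "... = trace_on ?W (%v. ad e (ad f v)) - trace_on ?W (%v. ad f (ad e v))"
   by (rule trace_on_diff[OF W lin_ad_ad lin_ad_ad]) (intro st RSL[OF e(1)] RSL[OF f(1)] te, assumption)+
  also have "trace_on ?W (%v. ad f (ad e v)) = trace_on ?W (%v. ad e (ad f v))"
   by (rule trace_on_commute[OF W lin_ad lin_ad]) (intro st RSL[OF e(1)] RSL[OF f(1)] te, assumption)+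
  finally have "trace_on ?W (ad tt) = 0" by simp
  moreover have "trace_on ?W (ad tt) = ?c * of_nat (lie.dim ?W)"
   by (rule trace_on_single_eig[OF W lin_ad stt]) (auto intro: gen_eig_eigenvector)
  moreover have "?W ~= {0}"
  proof -
   obtain v where "v : RS \<beta>" "v ~= 0" using ne lie.subspace_0[OF RS_sub[of \<beta>]] by blast
   hence "v : ?W" using RSL RSD tH by blast
   thus ?thesis using \<open>v ~= 0\<close> by blast
  qed
  ultimately show ?thesis using dim_pos[OF W] by simp
 qed
 hence "tt = 0" by (rule central_in_H[OF tH])
 hence "troot \<alpha> = 0" using f(2) unfolding tt_def by simp
 hence "\<alpha> h = 0" if "h : H" for h using t(2)[OF that] N(1) by simp
 thus False using root_nonzero[OF \<alpha>] by blast
qed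

definition hroot :: "('g => complex) => 'g" where
 "hroot \<alpha> = (2 / \<alpha> (troot \<alpha>)) *. troot \<alpha>"

lemma root_scale: "\<alpha> : dual_space H ==> h : H ==> \<alpha> (c *. h) = c * \<alpha> h"
 unfolding dual_space_def by auto

lemma root_add: "\<alpha> : dual_space H ==> h : H ==> h' : H ==> \<alpha> (h + h') = \<alpha> h + \<alpha> h'"
 unfolding dual_space_def by auto

lemma hroot:
 assumes \<alpha>: "\<alpha> : roots L H"
 shows "hroot \<alpha> : H" "\<alpha> (hroot \<alpha>) = 2"
 unfolding hroot_def
 using troot[OF \<alpha>] root_troot_nonzero[OF \<alpha>] root_scale[OF roots_dual[OF \<alpha>] troot(1)[OF \<alpha>]]
  lie.subspace_scale[OF NH(1) troot(1)[OF \<alpha>]] by simp_all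

lemma \<kappa>_hroot:
 assumes \<alpha>: "\<alpha> : roots L H" and h: "h : H"
 shows "2 * \<kappa> (hroot \<alpha>) h = \<alpha> h * \<kappa> (hroot \<alpha>) (hroot \<alpha>)"
proof -
 note t = troot[OF \<alpha>]
 have k: "\<kappa> (hroot \<alpha>) h = 2 / \<alpha> (troot \<alpha>) * \<alpha> h" if "h : H" for h
  unfolding hroot_def
  using killing_bilinear(4)[OF L HL[OF t(1)] HL[OF t(1)] HL[OF that]] t(2)[OF that] by simp
 show ?thesis using k[OF h] k[OF hroot(1)[OF \<alpha>]] hroot(2)[OF \<alpha>] by simp
qed

lemma triple:
 assumes \<alpha>: "\<alpha> : roots L H" and e: "e : RS \<alpha>" "e ~= 0"
 obtains f where "f : RS (neg \<alpha>)" "sl2 e (hroot \<alpha>) f" "\<kappa> e f ~= 0"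
proof -
 obtain f where f: "f : RS (neg \<alpha>)" "\<kappa> e f ~= 0" using dual_vector[OF roots_dual[OF \<alpha>] e] by blast
 let ?f = "(2 / (\<alpha> (troot \<alpha>) * \<kappa> e f)) *. f"
 have fR: "?f : RS (neg \<alpha>)" by (rule lie.subspace_scale[OF RS_sub f(1)])
 have "ad e ?f = hroot \<alpha>"
  unfolding hroot_def bracket_scaleC_right bracket_troot[OF \<alpha> e(1) f(1)] scaleC_scaleC
  using f(2) by simp
 moreover have "ad (hroot \<alpha>) e = 2 *. e" using RSD[OF e(1) hroot(1)[OF \<alpha>]] hroot(2)[OF \<alpha>] by simp
 moreover have "ad (hroot \<alpha>) ?f = (- 2) *. ?f" using RSD[OF fR hroot(1)[OF \<alpha>]] hroot(2)[OF \<alpha>] by simp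
 ultimately have "sl2 e (hroot \<alpha>) ?f" by unfold_locales
 moreover have "\<kappa> e ?f ~= 0"
  using killing_bilinear(8)[OF L RSL[OF f(1)] RSL[OF f(1)] RSL[OF e(1)]] f(2) root_troot_nonzero[OF \<alpha>] by simp
 ultimately show thesis using that fR by blast
qed

lemma RS_one_dim:
 assumes \<alpha>: "\<alpha> : roots L H" and e: "e : RS \<alpha>" "e ~= 0" and x: "x : RS \<alpha>"
 shows "EX c. x = c *. e"
proof -
 obtain f where f: "f : RS (neg \<alpha>)" "sl2 e (hroot \<alpha>) f" "\<kappa> e f ~= 0" using triple[OF \<alpha> e] by blast
 interpret s: sl2 e "hroot \<alpha>" f by (rule f(2))
 let ?c = "\<kappa> x f / \<kappa> e f"
 let ?y = "x - ?c *. e"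
 have ce: "?c *. e : RS \<alpha>" by (rule lie.subspace_scale[OF RS_sub e(1)])
 have y: "?y : RS \<alpha>" by (rule lie.subspace_diff[OF RS_sub x ce])
 have "\<kappa> ?y f = \<kappa> x f - \<kappa> (?c *. e) f" by (rule killing_bilinear(2)[OF L RSL[OF x] RSL[OF ce] RSL[OF f(1)]])
 also have "... = 0" using killing_bilinear(4)[OF L RSL[OF e(1)] RSL[OF e(1)] RSL[OF f(1)]] f(3) by simp
 finally have "ad ?y f = 0" using bracket_troot[OF \<alpha> y f(1)] by simp
 hence fy: "ad f ?y = 0" using bracket_anti[of f ?y] by simp
 have hy: "ad (hroot \<alpha>) ?y = 2 *. ?y" using RSD[OF y hroot(1)[OF \<alpha>]] hroot(2)[OF \<alpha>] by simp
 have two: "- 2 ~: (\<nat> :: complex set)"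
 proof
  assume "- 2 : (\<nat> :: complex set)"
  then obtain n where "- 2 = (of_nat n :: complex)" by (auto elim: Nats_cases)
  hence "Re (- 2) = Re (of_nat n)" by (rule arg_cong)
  thus False by simp
 qed
 have "?y = 0" by (rule s.f_injective[OF hy fy two])
 thus ?thesis by (intro exI[of _ ?c]) simp
qed

lemma coroot_eq:
 assumes \<alpha>: "\<alpha> : roots L H"
 shows "coroot L H \<alpha> = hroot \<alpha>"
 unfolding coroot_def
proof (rule the_equality)
 obtain e where e: "e : RS \<alpha>" "e ~= 0" using root_vector[OF \<alpha>] by blast
 obtain f where f: "f : RS (neg \<alpha>)" "sl2 e (hroot \<alpha>) f" "\<kappa> e f ~= 0" using triple[OF \<alpha> e] by blast
 have "ad e f : {ad x y |x y. x : RS \<alpha> & y : RS (neg \<alpha>)}"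
  using e(1) f(1) by blast
 hence "hroot \<alpha> : {ad x y |x y. x : RS \<alpha> & y : RS (neg \<alpha>)}"
  unfolding sl2.ef[OF f(2)] .
 thus "hroot \<alpha> : bracket_span (RS \<alpha>) (RS (neg \<alpha>)) & \<alpha> (hroot \<alpha>) = 2"
  unfolding bracket_span_def using hroot(2)[OF \<alpha>] by (intro conjI lie.span_base)
 fix h assume h: "h : bracket_span (RS \<alpha>) (RS (neg \<alpha>)) & \<alpha> h = 2"
 have "{ad x y |x y. x : RS \<alpha> & y : RS (neg \<alpha>)} \<subseteq> lie.span {troot \<alpha>}"
 proof
  fix z assume "z : {ad x y |x y. x : RS \<alpha> & y : RS (neg \<alpha>)}"
  then obtain x y where "z = ad x y" "x : RS \<alpha>" "y : RS (neg \<alpha>)" by blast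
  thus "z : lie.span {troot \<alpha>}"
   using bracket_troot[OF \<alpha>] by (simp add: lie.span_base lie.span_scale)
 qed
 hence "h : lie.span {troot \<alpha>}"
  using h subsetD[OF lie.span_minimal[OF _ lie.subspace_span]] unfolding bracket_span_def by blast
 then obtain k where k: "h = k *. troot \<alpha>" using lie.span_singleton by auto
 hence "k * \<alpha> (troot \<alpha>) = 2" using h root_scale[OF roots_dual[OF \<alpha>] troot(1)[OF \<alpha>]] by simp
 hence "k = 2 / \<alpha> (troot \<alpha>)" using root_troot_nonzero[OF \<alpha>] by (simp add: field_simps)
 thus "h = hroot \<alpha>" using k unfolding hroot_def by simp
qed

lemma RS_e_pow: "e : RS \<alpha> ==> v : RS \<beta> ==> (ad e ^^ k) v : RS (%h. \<beta> h + of_nat k * \<alpha> h)"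
proof (induction k)
 case (Suc k)
 show ?case using RS_bracket'[OF Suc.prems(1) Suc.IH[OF Suc.prems]] by (simp add: algebra_simps)
qed simp

lemma root_integral:
 assumes \<alpha>: "\<alpha> : roots L H" and \<beta>: "RS \<beta> ~= {0}"
 obtains k :: int where "\<beta> (hroot \<alpha>) = of_int k"
proof -
 obtain e where e: "e : RS \<alpha>" "e ~= 0" using root_vector[OF \<alpha>] by blast
 obtain f where f: "f : RS (neg \<alpha>)" "sl2 e (hroot \<alpha>) f" "\<kappa> e f ~= 0" using triple[OF \<alpha> e] by blast
 obtain v where "v : RS \<beta>" "v ~= 0" using \<beta> lie.subspace_0[OF RS_sub[of \<beta>]] by blast
 thus thesis using sl2.weight_integral[OF f(2), of v] RSD hroot(1)[OF \<alpha>] that by metis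
qed

lemma RS_cong: "(!!h. h : H ==> \<alpha> h = \<beta> h) ==> RS \<alpha> = RS \<beta>"
 unfolding root_space_def by auto

lemma reflection:
 assumes \<alpha>: "\<alpha> : roots L H" and \<beta>: "\<beta> : roots L H"
 shows "(%h. \<beta> h - \<beta> (hroot \<alpha>) * \<alpha> h) : roots L H"
proof -
 obtain e where e: "e : RS \<alpha>" "e ~= 0" using root_vector[OF \<alpha>] by blast
 obtain f where f: "f : RS (neg \<alpha>)" "sl2 e (hroot \<alpha>) f" "\<kappa> e f ~= 0" using triple[OF \<alpha> e] by blast
 interpret s: sl2 e "hroot \<alpha>" f by (rule f(2))
 interpret d: sl2 f "- hroot \<alpha>" e by (rule s.dual)
 obtain v where v: "v : RS \<beta>" "v ~= 0" using root_vector[OF \<beta>] by blast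
 have wv: "ad (hroot \<alpha>) v = \<beta> (hroot \<alpha>) *. v" by (rule RSD[OF v(1) hroot(1)[OF \<alpha>]])
 obtain k :: int where k: "\<beta> (hroot \<alpha>) = of_int k" using s.weight_integral[OF v(2) wv] by blast
 let ?\<gamma> = "%h. \<beta> h - of_int k * \<alpha> h"
 have "EX w:RS ?\<gamma>. w ~= 0"
 proof (cases "k >= 0")
  case True
  then obtain n where n: "k = int n" using nonneg_int_cases by blast
  have "ad (hroot \<alpha>) v = of_nat n *. v" using wv k n by simp
  then obtain j where j: "(ad f ^^ (n + j)) ((ad e ^^ j) v) ~= 0"
   using s.opposite_weight[OF v(2)] by blast
  have "(ad f ^^ (n + j)) ((ad e ^^ j) v) : RS (%h. (\<beta> h + of_nat j * \<alpha> h) + of_nat (n + j) * - \<alpha> h)"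
   by (rule RS_e_pow[OF f(1) RS_e_pow[OF e(1) v(1)]])
  also have "... = RS ?\<gamma>" by (rule RS_cong) (simp add: n algebra_simps)
  finally show ?thesis using j by blast
 next
  case False
  then obtain n where n: "k = - int n" using nonpos_int_cases[of k] by auto
  have "ad (- hroot \<alpha>) v = of_nat n *. v" using wv k n by (simp add: bracket_simps scale_simps)
  then obtain j where j: "(ad e ^^ (n + j)) ((ad f ^^ j) v) ~= 0"
   using d.opposite_weight[OF v(2)] by blast
  have "(ad e ^^ (n + j)) ((ad f ^^ j) v) : RS (%h. (\<beta> h + of_nat j * - \<alpha> h) + of_nat (n + j) * \<alpha> h)"
   by (rule RS_e_pow[OF e(1) RS_e_pow[OF f(1) v(1)]])
  also have "... = RS ?\<gamma>" by (rule RS_cong) (simp add: n algebra_simps)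
  finally show ?thesis using j by blast
 qed
 then obtain w where w: "w : RS ?\<gamma>" "w ~= 0" by blast
 have dual: "?\<gamma> : dual_space H"
  using dual_space_combine[OF roots_dual[OF \<beta>] roots_dual[OF \<alpha>], of 1 "- of_int k"] by simp
 have "EX h:H. ?\<gamma> h ~= 0"
 proof (rule ccontr)
  assume "~ ?thesis"
  hence eq: "\<beta> h = of_int k * \<alpha> h" if "h : H" for h using that by auto
  have "of_int k = (of_int k * 2 :: complex)" using eq[OF hroot(1)[OF \<alpha>]] k hroot(2)[OF \<alpha>] by simp
  hence "k = 0" by simp
  thus False using eq root_nonzero[OF \<beta>] by auto
 qed
 thus ?thesis using rootI[OF dual w] k by auto
qed

text \<open>If \<open>\<alpha> + \<beta>\<close> is a weight, descend from the top of its \<open>\<alpha>\<close>-string: the vector reached in weight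
 \<open>\<beta>\<close> is a multiple of the given one and is not killed by \<open>e\<close>.\<close>

lemma bracket_root_vectors:
 assumes \<alpha>: "\<alpha> : roots L H" and e: "e : RS \<alpha>" "e ~= 0" and \<beta>: "\<beta> : roots L H" and v: "v : RS \<beta>" "v ~= 0"
  and y: "y : RS (%h. \<alpha> h + \<beta> h)" "y ~= 0"
 shows "ad e v ~= 0"
proof
 assume ev: "ad e v = 0"
 obtain f where f: "f : RS (neg \<alpha>)" "sl2 e (hroot \<alpha>) f" "\<kappa> e f ~= 0" using triple[OF \<alpha> e] by blast
 interpret s: sl2 e "hroot \<alpha>" f by (rule f(2))
 have wv: "ad (hroot \<alpha>) v = \<beta> (hroot \<alpha>) *. v" by (rule RSD[OF v(1) hroot(1)[OF \<alpha>]])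
 obtain n where n: "\<beta> (hroot \<alpha>) = of_nat n" using s.highest_weight_nat[OF v(2) wv ev] by metis
 have wy: "ad (hroot \<alpha>) y = (2 + of_nat n) *. y"
  using RSD[OF y(1) hroot(1)[OF \<alpha>]] hroot(2)[OF \<alpha>] n by simp
 obtain j where j: "(ad e ^^ j) y ~= 0" "ad e ((ad e ^^ j) y) = 0"
  using s.highest_vector[OF y(2) wy] by blast
 let ?w = "(ad e ^^ j) y"
 have ww: "ad (hroot \<alpha>) ?w = (2 + of_nat n + 2 * of_nat j) *. ?w" by (rule s.weight_e_pow[OF wy])
 obtain N where N: "2 + of_nat n + 2 * of_nat j = (of_nat N :: complex)"
  "!!k. k <= N ==> (ad f ^^ k) ?w ~= 0"
  using s.highest_weight_nat[OF j(1) ww j(2)] by metis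
 from N(1) have "of_nat (2 + n + 2 * j) = (of_nat N :: complex)" by (simp add: add.assoc)
 hence NN: "N = 2 + n + 2 * j" by (simp only: of_nat_eq_iff)
 have "(ad f ^^ Suc j) ?w : RS (%h. (\<alpha> h + \<beta> h) + of_nat j * \<alpha> h + of_nat (Suc j) * - \<alpha> h)"
  by (rule RS_e_pow[OF f(1) RS_e_pow[OF e(1) y(1)]])
 also have "... = RS \<beta>" by (rule RS_cong) (simp add: algebra_simps)
 finally obtain c where c: "(ad f ^^ Suc j) ?w = c *. v" using RS_one_dim[OF \<beta> v] by blast
 have "ad e ((ad f ^^ Suc j) ?w) = 0" unfolding c bracket_scaleC_right ev by simp
 hence "(of_nat (Suc j) * ((2 + of_nat n + 2 * of_nat j) - of_nat j)) *. (ad f ^^ j) ?w = 0"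
  unfolding s.highest_weight_step[OF ww j(2)] .
 moreover have eq: "of_nat (Suc j) * ((2 + of_nat n + 2 * of_nat j) - of_nat j) = (of_nat (Suc j * (2 + n + j)) :: complex)"
  by (simp add: algebra_simps)
 ultimately have "(of_nat (Suc j * (2 + n + j)) :: complex) *. (ad f ^^ j) ?w = 0"
  unfolding eq by blast
 hence "(ad f ^^ j) ?w = 0" unfolding lie.scale_eq_0_iff of_nat_eq_0_iff by simp
 thus False using N(2)[of j] NN by simp
qed

lemma double_not_root:
 assumes \<alpha>: "\<alpha> : roots L H" shows "RS (%h. 2 * \<alpha> h) = {0}"
proof (rule ccontr)
 assume "RS (%h. 2 * \<alpha> h) ~= {0}"
 then obtain y where y0: "y : RS (%h. 2 * \<alpha> h)" "y ~= 0"
  using lie.subspace_0[OF RS_sub[of "%h. 2 * \<alpha> h"]] by blast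
 have y: "y : RS (%h. \<alpha> h + \<alpha> h)" using y0(1) unfolding mult_2 .
 obtain e where e: "e : RS \<alpha>" "e ~= 0" using root_vector[OF \<alpha>] by blast
 show False using bracket_root_vectors[OF \<alpha> e \<alpha> e y y0(2)] bracket_self[of e] by simp
qed

lemma proportional_roots:
 assumes \<alpha>: "\<alpha> : roots L H" and \<beta>: "\<beta> : roots L H" and c: "!!h. h : H ==> \<beta> h = c * \<alpha> h"
 shows "\<beta> = \<alpha> | \<beta> = neg \<alpha>"
proof -
 have RS0: "RS \<gamma> ~= {0}" if "\<gamma> : roots L H" for \<gamma> using that unfolding roots_def by blast
 obtain m :: int where m: "\<beta> (hroot \<alpha>) = of_int m" using root_integral[OF \<alpha> RS0[OF \<beta>]] by blast
 obtain n :: int where n: "\<alpha> (hroot \<beta>) = of_int n" using root_integral[OF \<beta> RS0[OF \<alpha>]] by blast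
 have m': "of_int m = c * 2" using m c[OF hroot(1)[OF \<alpha>]] hroot(2)[OF \<alpha>] by simp
 have n': "2 = c * of_int n" using n c[OF hroot(1)[OF \<beta>]] hroot(2)[OF \<beta>] by simp
 have "of_int (m * n) = (4 :: complex)" using m' n' by simp
 hence mn: "m * n = 4" by (metis of_int_eq_numeral_iff)
 hence "m dvd 4" by (metis dvd_triv_left)
 hence "\<bar>m\<bar> <= 4" by (rule zdvd_imp_le[of "\<bar>m\<bar>", simplified]) simp
 hence "m : {-4,-3,-2,-1,0,1,2,3,4}" by auto
 hence cases: "m = 2 | m = -2 | m = 4 | m = -4 | m = 1 | m = -1" using mn by auto presburger+
 have no: False if "\<gamma> : roots L H" "\<delta> : roots L H" "!!h. h : H ==> \<delta> h = 2 * \<gamma> h" for \<gamma> \<delta>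
  using double_not_root[OF that(1)] RS0[OF that(2)] RS_cong[OF that(3)] by simp
 have cm: "c = of_int m / 2" using m' by simp
 consider "c = 1" | "c = -1" | "c = 2" | "c = -2" | "c = 1/2" | "c = -1/2"
  using cases cm by fastforce
 thus ?thesis
 proof cases
  case 1
  hence "\<beta> = \<alpha>" using dual_space_eqI[OF roots_dual[OF \<beta>] roots_dual[OF \<alpha>]] c by simp
  thus ?thesis ..
 next
  case 2
  hence "\<beta> = neg \<alpha>" using dual_space_eqI[OF roots_dual[OF \<beta>] roots_dual[OF neg_root[OF \<alpha>]]] c by simp
  thus ?thesis ..
 next
  case 3
  have False by (rule no[OF \<alpha> \<beta>]) (simp add: c 3)
  thus ?thesis ..
 next
  case 4
  have False by (rule no[OF neg_root[OF \<alpha>] \<beta>]) (simp add: c 4)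
  thus ?thesis ..
 next
  case 5
  have False by (rule no[OF \<beta> \<alpha>]) (simp add: c 5)
  thus ?thesis ..
 next
  case 6
  have False by (rule no[OF neg_root[OF \<beta>] \<alpha>]) (simp add: c 6)
  thus ?thesis ..
 qed
qed

lemma weights_dichotomy: "\<alpha> : dual_space H ==> RS \<alpha> ~= {0} ==> \<alpha> = (%_. 0) | \<alpha> : roots L H"
 unfolding roots_def by blast

lemma span_H_roots: "L \<subseteq> lie.span (H \<union> (UN \<alpha>:roots L H. RS \<alpha>))"
proof -
 have "(UN \<alpha>:dual_space H. RS \<alpha>) \<subseteq> lie.span (H \<union> (UN \<alpha>:roots L H. RS \<alpha>))"
 proof
  fix x assume "x : (UN \<alpha>:dual_space H. RS \<alpha>)"
  then obtain \<alpha> where \<alpha>: "\<alpha> : dual_space H" "x : RS \<alpha>" by blast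
  show "x : lie.span (H \<union> (UN \<alpha>:roots L H. RS \<alpha>))"
  proof (cases "x = 0")
   case False
   then consider "\<alpha> = (%_. 0)" | "\<alpha> : roots L H" using weights_dichotomy[OF \<alpha>(1)] \<alpha>(2) by blast
   hence "x : H \<union> (UN \<alpha>:roots L H. RS \<alpha>)" by cases (use \<alpha>(2) RS_zero in auto)
   thus ?thesis by (rule lie.span_base)
  qed (simp add: lie.span_zero)
 qed
 hence "lie.span (UN \<alpha>:dual_space H. RS \<alpha>) \<subseteq> lie.span (H \<union> (UN \<alpha>:roots L H. RS \<alpha>))"
  by (rule lie.span_minimal) simp
 thus ?thesis using spanning by blast
qed

lemma roots_separate_H:
 assumes "h : H" "!!\<alpha>. \<alpha> : roots L H ==> \<alpha> h = 0" shows "h = 0"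
proof (rule central_in_H[OF assms(1)])
 fix \<beta> assume "\<beta> : dual_space H" "RS \<beta> ~= {0}"
 thus "\<beta> h = 0" using weights_dichotomy[of \<beta>] assms(2) by auto
qed

text \<open>The Killing form on \<open>H\<close> as a sum over a basis of weight vectors.\<close>

lemma \<kappa>_sum:
 obtains B :: "'g set" and wt where "lie.independent B" "finite B" "!!b. b : B ==> b : RS (wt b)"
  "!!b. b : B ==> wt b : insert (%_. 0) (roots L H)"
  "!!\<alpha>. \<alpha> : roots L H ==> \<alpha> : wt ` B"
  "!!h h'. h : H ==> h' : H ==> \<kappa> h h' = (SUM b:B. wt b h * wt b h')"
proof -
 let ?S = "H \<union> (UN \<alpha>:roots L H. RS \<alpha>)"
 have "?S \<subseteq> L" using H(2) RSL by blast
 obtain B where B: "B \<subseteq> ?S" "lie.independent B" "lie.span B = L" "finite B"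
  by (rule obtain_basis[OF N(1) \<open>?S \<subseteq> L\<close> span_H_roots])
 have "ALL b:B. EX \<alpha>. \<alpha> : insert (%_. 0) (roots L H) & b : RS \<alpha>"
  using B(1) RS_zero by blast
 from bchoice[OF this] obtain wt where wt: "ALL b:B. wt b : insert (%_. 0) (roots L H) & b : RS (wt b)" ..
 have wtd: "wt b : dual_space H" if "b : B" for b
 proof -
  have "wt b : insert (%_. 0) (roots L H)" using wt that by blast
  thus ?thesis using dual_space_zero[of H] roots_dual by auto
 qed
 have "\<kappa> h h' = (SUM b:B. wt b h * wt b h')" if "h : H" "h' : H" for h h'
  unfolding killing_form_def
 proof (rule trace_on_eigenbasis[OF N(1) B(2,3) lin_ad_ad])
  fix b assume "b : B"
  hence "b : RS (wt b)" using wt by blast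
  thus "ad h (ad h' b) = (wt b h * wt b h') *. b"
   using RSD that by (simp add: bracket_scaleC_right scaleC_scaleC mult.commute)
 qed
 moreover have "\<alpha> : wt ` B" if \<alpha>: "\<alpha> : roots L H" for \<alpha>
 proof (rule ccontr)
  assume no: "\<alpha> ~: wt ` B"
  obtain x where x: "x : RS \<alpha>" "x ~= 0" using root_vector[OF \<alpha>] by blast
  let ?r = "lie.representation B x"
  define w where "w \<beta> = (SUM b:{b:B. wt b = \<beta>}. ?r b *. b)" for \<beta>
  have wR: "w \<beta> : RS \<beta>" for \<beta>
   unfolding w_def using wt by (intro lie.subspace_sum[OF RS_sub] lie.subspace_scale[OF RS_sub]) auto
  have "(SUM \<beta>:wt ` B. w \<beta>) = (SUM b:B. ?r b *. b)"
   unfolding w_def using B(4) by (intro sum.group) auto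
  also have "... = x" using rep_expand[OF B(2)] B(3) RSL[OF x(1)] by simp
  finally have sx: "(SUM \<beta>:wt ` B. w \<beta>) = x" .
  define u where "u \<beta> = (if \<beta> = \<alpha> then x else - w \<beta>)" for \<beta>
  have "(SUM \<beta>:insert \<alpha> (wt ` B). u \<beta>) = u \<alpha> + (SUM \<beta>:wt ` B. u \<beta>)" using no B(4) by simp
  also have "(SUM \<beta>:wt ` B. u \<beta>) = (SUM \<beta>:wt ` B. - w \<beta>)"
   using no by (intro sum.cong refl) (auto simp: u_def)
  also have "u \<alpha> + ... = 0" using sx by (simp add: u_def sum_negf)
  finally have s0: "(SUM \<beta>:insert \<alpha> (wt ` B). u \<beta>) : {0}" by simp
  have "u \<alpha> : {0}"
  proof (rule joint_component[where wt = "%\<alpha>. \<alpha>" and H = H, OF _ _ _ _ _ s0])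
   fix \<beta> \<gamma> assume "\<beta> : insert \<alpha> (wt ` B)" "\<gamma> : insert \<alpha> (wt ` B)" "\<beta> ~= \<gamma>"
   thus "EX h:H. \<beta> h ~= \<gamma> h" using wtd roots_dual[OF \<alpha>] by (intro separate) auto
  next
   fix \<beta> h assume "h : H"
   thus "ad h (u \<beta>) = \<beta> h *. u \<beta>"
    using RSD[OF wR[of \<beta>]] RSD[OF x(1)] unfolding u_def by (simp add: bracket_simps scale_simps)
  qed (use B(4) in auto)
  thus False using x(2) unfolding u_def by simp
 qed
 ultimately show thesis using that[of B wt] B(2,4) wt by blast
qed

text \<open>The zero weight does not contribute, and each root occurs once.\<close>

lemma \<kappa>_roots:
 assumes h: "h : H" "h' : H"
 shows "\<kappa> h h' = (SUM \<alpha>:roots L H. \<alpha> h * \<alpha> h')"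
proof -
 obtain B :: "'g set" and wt where B: "lie.independent B" "finite B" "!!b. b : B ==> b : RS (wt b)"
  "!!b. b : B ==> wt b : insert (%_. 0) (roots L H)" "!!\<alpha>. \<alpha> : roots L H ==> \<alpha> : wt ` B"
  "!!h h'. h : H ==> h' : H ==> \<kappa> h h' = (SUM b:B. wt b h * wt b h')"
  by (rule \<kappa>_sum) (assumption | blast)+
 let ?B = "{b : B. wt b : roots L H}"
 have inj: "inj_on wt ?B"
 proof (rule inj_onI, rule ccontr)
  fix b b' assume b: "b : ?B" "b' : ?B" "wt b = wt b'" "b ~= b'"
  have "b ~= 0" using b(1) B(1) lie.dependent_zero by blast
  then obtain c where "b' = c *. b"
   using RS_one_dim[of "wt b" b b'] b B(3) by fastforce
  hence "b' : lie.span (B - {b'})" using b by (auto intro: lie.span_scale lie.span_base)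
  thus False using B(1) b(2) lie.dependent_def by blast
 qed
 have img: "wt ` ?B = roots L H" using B(5) by blast
 have "\<kappa> h h' = (SUM b:?B. wt b h * wt b h')"
  unfolding B(6)[OF h]
 proof (rule sum.mono_neutral_right[OF B(2)])
  show "ALL b:B - ?B. wt b h * wt b h' = 0"
  proof
   fix b assume "b : B - ?B"
   hence "wt b = (%_. 0)" using B(4)[of b] by blast
   thus "wt b h * wt b h' = 0" by simp
  qed
 qed blast
 also have "... = (SUM \<alpha>:wt ` ?B. \<alpha> h * \<alpha> h')" by (rule sum.reindex[OF inj, symmetric, unfolded o_def])
 finally show ?thesis unfolding img .
qed

lemma finite_roots: "finite (roots L H)"
proof -
 obtain B :: "'g set" and wt where "finite B" "!!\<alpha>. \<alpha> : roots L H ==> \<alpha> : wt ` B"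
  by (rule \<kappa>_sum) (assumption | blast)+
 thus ?thesis by (meson finite_imageI finite_subset subsetI)
qed

text \<open>An eigenvector of \<open>ad t\<close> is a sum of root vectors for the roots taking that value at \<open>t\<close>.\<close>

lemma eigenvector_in_root_space:
 assumes t: "t : H" and v: "v : L" "ad t v = c *. v" and \<theta>: "\<theta> : dual_space H"
  and uniq: "!!\<beta>. \<beta> : dual_space H ==> RS \<beta> ~= {0} ==> \<beta> t = c ==> \<beta> = \<theta>"
 shows "v : RS \<theta>"
proof -
 have "v : lie.span (UN \<alpha>:dual_space H. RS \<alpha>)" using spanning v(1) by blast
 from span_weight_sum[OF this RS_sub] obtain F w where F: "finite F" "F \<subseteq> dual_space H"
  "ALL \<alpha>:F. w \<alpha> : RS \<alpha>" "v = (SUM \<alpha>:F. w \<alpha>)" by blast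
 let ?U = "{v : L. ad t v = c *. v}"
 have "w \<beta> : RS \<theta>" if b: "\<beta> : F" for \<beta>
 proof -
  have "w \<beta> : ?U"
  proof (rule joint_component[where wt = "%\<alpha>. \<alpha>" and H = H and F = F])
   show "lie.subspace ?U" by (rule eigenspace_subspace[OF N(1)])
   show "(SUM \<alpha>:F. w \<alpha>) : ?U" using v F(4) by simp
   fix h u assume h: "h : H" and u: "u : ?U"
   have "ad t (ad h u) = ad h (ad t u)"
    using ad_derivation[of t h u] abelian[OF t h] by simp
   thus "ad h u : ?U" using u N(2) HL[OF h] by (simp add: bracket_scaleC_right)
  qed (use F b separate RSD in \<open>auto simp: subset_iff\<close>)
  hence e: "ad t (w \<beta>) = c *. w \<beta>" by blast
  have wR: "w \<beta> : RS \<beta>" using F(3) b by blast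
  show ?thesis
  proof (cases "w \<beta> = 0")
   case True
   thus ?thesis using lie.subspace_0[OF RS_sub] by simp
  next
   case False
   have "\<beta> t *. w \<beta> = c *. w \<beta>" by (rule trans[OF RSD[OF wR t, symmetric] e])
   from lie.scale_right_imp_eq[OF False this] have "\<beta> t = c" .
   hence "\<beta> = \<theta>" using uniq[of \<beta>] F(2) b wR False by blast
   thus ?thesis using wR by simp
  qed
 qed
 thus ?thesis unfolding F(4) by (rule lie.subspace_sum[OF RS_sub])
qed

lemma diagonalizable: "h : H ==> diagonalizable_on L h"
 unfolding diagonalizable_on_def
proof -
 assume h: "h : H"
 have "(UN \<alpha>:dual_space H. RS \<alpha>) \<subseteq> {w : L. EX c. ad h w = c *. w}" using RSD h RSL by blast
 hence "lie.span (UN \<alpha>:dual_space H. RS \<alpha>) \<subseteq> lie.span {w : L. EX c. ad h w = c *. w}"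
  by (rule lie.span_mono)
 thus "L \<subseteq> lie.span {w : L. EX c. ad h w = c *. w}" using spanning by (rule order_trans[rotated])
qed

text \<open>Two elements of \<open>H\<close> that represent multiples of the same root agree once the root takes the value
 2 on both.\<close>

lemma hroot_eqI:
 assumes \<alpha>: "\<alpha> : roots L H" and h: "h : H" "\<alpha> h = 2" and c: "!!x. x : H ==> \<kappa> h x = c * \<alpha> x"
 shows "h = hroot \<alpha>"
proof (rule \<kappa>_H_unique[OF h(1) hroot(1)[OF \<alpha>]])
 let ?k = "\<kappa> (hroot \<alpha>) (hroot \<alpha>)"
 have "c * 2 = \<kappa> (hroot \<alpha>) h"
  using c[OF hroot(1)[OF \<alpha>]] hroot(2)[OF \<alpha>] \<kappa>_sym[OF HL[OF h(1)] HL[OF hroot(1)[OF \<alpha>]]] by simp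
 hence ck: "c * 2 = ?k" using \<kappa>_hroot[OF \<alpha> h(1)] h(2) by simp
 fix x assume x: "x : H"
 show "\<kappa> h x = \<kappa> (hroot \<alpha>) x" using \<kappa>_hroot[OF \<alpha> x] c[OF x] ck[symmetric] by simp
qed

end

section \<open>Exponentials of nilpotent derivations\<close>

definition ad_nilpotent :: "'g::complex_lie_algebra => bool" where
 "ad_nilpotent x \<longleftrightarrow> (EX N. ALL y. (ad x ^^ N) y = 0)"

definition lie_aut :: "('g::complex_lie_algebra => 'g) => bool" where
 "lie_aut \<phi> \<longleftrightarrow> lin \<phi> & bij \<phi> & (ALL x y. \<phi> (ad x y) = ad (\<phi> x) (\<phi> y))"

lemma ad_nilpotent_spanning:
 assumes "UNIV \<subseteq> lie.span S" "!!v. v : S ==> EX k. (ad x ^^ k) v = 0"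
 shows "ad_nilpotent (x :: 'g::complex_lie_algebra)"
proof -
 have *: "!!v :: 'g. v : UNIV ==> EX k. (ad x ^^ k) v = 0"
  using ad_nilpotent_on_span[OF assms] unfolding ad_nilpotent_on_def by blast
 show ?thesis
  by (rule nilpotent_uniform[OF lie.subspace_UNIV lin_ad *]) (auto simp: ad_nilpotent_def)
qed

lemma funpow_ad_scale: "(ad (t *. x) ^^ k) y = t ^ k *. (ad x ^^ k) (y :: 'g::complex_lie_algebra)"
proof (induction k)
 case (Suc k)
 have "(ad (t *. x) ^^ Suc k) y = ad (t *. x) ((ad (t *. x) ^^ k) y)" by simp
 also have "... = t ^ Suc k *. (ad x ^^ Suc k) y"
  unfolding Suc.IH by (simp add: bracket_scaleC_left bracket_scaleC_right scaleC_scaleC)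
 finally show ?case .
qed simp

lemma ad_nilpotent_scale: "ad_nilpotent x ==> ad_nilpotent (c *. x)"
 unfolding ad_nilpotent_def funpow_ad_scale by auto

lemma ad_nilpotent_minus: "ad_nilpotent x ==> ad_nilpotent (- x)"
 using ad_nilpotent_scale[of x "-1"] by (simp add: scale_simps)

lemma exp_ad_finite:
 assumes "(ad x ^^ N) y = (0 :: 'g::complex_lie_algebra)"
 shows "exp_ad x y = (\<Sum>k<N. (1 / fact k) *. (ad x ^^ k) y)"
 unfolding exp_ad_def
proof (rule the_equality)
 let ?z = "\<Sum>k<N. (1 / fact k) *. (ad x ^^ k) y"
 have sums: "(%k. f ((ad x ^^ k) y) / fact k) sums f ?z"
  if "Vector_Spaces.linear scaleC (*) f" for f :: "'g => complex"
 proof -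
  interpret f: Vector_Spaces.linear scaleC "(*)" f by (rule that)
  have "f ?z = (\<Sum>k<N. f ((ad x ^^ k) y) / fact k)" by (simp add: f.sum f.scale)
  moreover have "(%k. f ((ad x ^^ k) y) / fact k) sums (\<Sum>k<N. f ((ad x ^^ k) y) / fact k)"
  proof (rule sums_finite)
   fix k assume "k ~: {..<N}"
   hence "(ad x ^^ k) y = 0" using funpow_zero_mono[OF lin_ad assms, of k] by simp
   thus "f ((ad x ^^ k) y) / fact k = 0" by simp
  qed simp
  ultimately show ?thesis by simp
 qed
 thus "ALL f. Vector_Spaces.linear scaleC (*) f --> (%k. f ((ad x ^^ k) y) / fact k) sums f ?z"
  by blast
 fix z assume z: "ALL f. Vector_Spaces.linear scaleC (*) f --> (%k. f ((ad x ^^ k) y) / fact k) sums f z"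
 have eq: "f z = f ?z" if "Vector_Spaces.linear scaleC (*) f" for f :: "'g => complex"
  using sums_unique2 sums[OF that] z that by blast
 have "lie.representation lie_basis z b = lie.representation lie_basis ?z b" for b
  by (rule eq[OF lie.linear_representation]) (use lie_basis_props in auto)
 hence "(SUM b:lie_basis. lie.representation lie_basis z b *. b)
   = (SUM b:lie_basis. lie.representation lie_basis ?z b *. b)" by simp
 moreover have "(SUM b:lie_basis. lie.representation lie_basis w b *. b) = w" for w :: 'g
  by (rule rep_expand[OF lie_basis_props(2)]) (simp add: lie_basis_props(3))
 ultimately show "z = ?z" by simp
qed

lemma exp_ad_fixed: "ad x y = 0 ==> exp_ad x y = y"
 using exp_ad_finite[of 1 x y] by simp

lemma exp_ad_two: "ad x (ad x y) = 0 ==> exp_ad x y = y + ad x y"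
 using exp_ad_finite[of 2 x y] by (simp add: numeral_2_eq_2)

lemma exp_ad_three:
 "ad x (ad x (ad x y)) = 0 ==> exp_ad x y = y + ad x y + (1/2) *. ad x (ad x y)"
 using exp_ad_finite[of 3 x y] by (simp add: numeral_3_eq_3 numeral_2_eq_2)

lemma exp_ad_lin:
 assumes "ad_nilpotent x" shows "lin (exp_ad x)"
proof -
 obtain N where N: "!!y. (ad x ^^ N) y = 0" using assms unfolding ad_nilpotent_def by blast
 note f = lin_funpow[OF lin_ad[of x]]
 show ?thesis
  by (rule linI) (simp_all add: exp_ad_finite[OF N] endo.linear_add[OF f] endo.linear_scale[OF f]
    scale_simps sum.distrib lie.scale_sum_right mult.commute)
qed

text \<open>Leibniz' rule for divided powers.\<close>

lemma divided_power_leibniz: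
 fixes x y z :: "'g::complex_lie_algebra"
 defines "d \<equiv> %n w. (1 / fact n) *. (ad x ^^ n) w"
 shows "d n (ad y z) = (SUM i<=n. ad (d i y) (d (n - i) z))"
proof (induction n)
 case 0
 thus ?case unfolding d_def by simp
next
 case (Suc n)
 have dS: "ad x (d i w) = of_nat (Suc i) *. d (Suc i) w" for i w
  unfolding d_def by (simp add: bracket_scaleC_right scaleC_scaleC divide_simps del: of_nat_Suc)
 let ?F = "%i j. ad (d i y) (d j z)"
 have "of_nat (Suc n) *. d (Suc n) (ad y z) = ad x (SUM i<=n. ?F i (n - i))"
  unfolding dS[symmetric] Suc.IH ..
 also have "... = (SUM i<=n. of_nat (Suc i) *. ?F (Suc i) (n - i)) + (SUM i<=n. of_nat (Suc (n - i)) *. ?F i (Suc (n - i)))"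
  unfolding bracket_sum_right sum.distrib[symmetric]
  by (rule sum.cong[OF refl]) (simp add: ad_derivation[of x] dS bracket_scaleC_left bracket_scaleC_right del: of_nat_Suc)
 also have "(SUM i<=n. of_nat (Suc i) *. ?F (Suc i) (n - i)) = (SUM i<=Suc n. of_nat i *. ?F i (Suc n - i))"
  by (subst sum.atMost_Suc_shift) (simp del: of_nat_Suc)
 also have "(SUM i<=n. of_nat (Suc (n - i)) *. ?F i (Suc (n - i))) = (SUM i<=Suc n. of_nat (Suc n - i) *. ?F i (Suc n - i))"
  unfolding sum.atMost_Suc diff_self_eq_0 of_nat_0 lie.scale_zero_left add_0_right
  by (rule sum.cong[OF refl]) (simp only: atMost_iff Suc_diff_le)
 also have "(SUM i<=Suc n. of_nat i *. ?F i (Suc n - i)) + ... = (SUM i<=Suc n. of_nat (Suc n) *. ?F i (Suc n - i))"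
  unfolding sum.distrib[symmetric] scaleC_add_left[symmetric] of_nat_add[symmetric]
  by (rule sum.cong[OF refl]) simp
 also have "... = of_nat (Suc n) *. (SUM i<=Suc n. ?F i (Suc n - i))" by (rule lie.scale_sum_right[symmetric])
 finally show ?case by (simp del: of_nat_Suc sum.atMost_Suc)
qed

lemma exp_ad_bracket:
 assumes "ad_nilpotent x" shows "exp_ad x (ad y z) = ad (exp_ad x y) (exp_ad x z)"
proof -
 obtain N where N: "!!y. (ad x ^^ N) y = 0" using assms unfolding ad_nilpotent_def by blast
 have N2: "(ad x ^^ (N + N)) w = 0" for w by (rule funpow_zero_mono[OF lin_ad N]) simp
 let ?d = "%n w. (1 / fact n) *. (ad x ^^ n) w"
 let ?F = "%i j. ad (?d i y) (?d j z)"
 have z: "?F i j = 0" if "N <= i | N <= j" for i j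
  using that funpow_zero_mono[OF lin_ad N] by auto
 have z': "i < N" "j < N" if "?F i j ~= 0" for i j
  using that z[of i j] by (metis not_le)+
 have "exp_ad x (ad y z) = (\<Sum>n<N + N. ?d n (ad y z))" by (rule exp_ad_finite[OF N2])
 also have "... = (\<Sum>n<N + N. SUM i<=n. ?F i (n - i))" unfolding divided_power_leibniz ..
 also have "... = (SUM (i,j):{(i,j). i + j < N + N}. ?F i j)" by (rule sum.triangle_reindex[symmetric])
 also have "... = (SUM (i,j):{..<N} \<times> {..<N}. ?F i j)"
 proof (rule sum.mono_neutral_right)
  show "finite {(i, j). i + j < N + N}"
   by (rule finite_subset[of _ "{..<N + N} \<times> {..<N + N}"]) auto
 qed (use z' in auto)
 also have "... = (\<Sum>i<N. \<Sum>j<N. ?F i j)" by (rule sum.cartesian_product[symmetric])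
 also have "... = ad (exp_ad x y) (exp_ad x z)"
  unfolding exp_ad_finite[OF N] bracket_sum_left bracket_sum_right by (rule sum.swap)
 finally show ?thesis .
qed

lemma exp_ad_aut:
 assumes simple: "simple_lie (UNIV :: 'g::complex_lie_algebra set)" and x: "ad_nilpotent (x :: 'g)"
 shows "lie_aut (exp_ad x)"
proof -
 note lx = exp_ad_lin[OF x] and bx = exp_ad_bracket[OF x]
 have "inj (exp_ad x)"
 proof (cases "x = 0")
  case True
  have "exp_ad x = (%y. y)" unfolding True fun_eq_iff by (simp add: exp_ad_fixed)
  thus ?thesis by simp
 next
  case False
  let ?K = "{y. exp_ad x y = 0}"
  have "lie_ideal UNIV ?K" unfolding lie_ideal_def
   using endo.linear_subspace_kernel[OF lx] by (simp add: bx)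
  hence "?K = {0} | ?K = UNIV" using simple unfolding simple_lie_def by blast
  moreover have "exp_ad x x = x" by (rule exp_ad_fixed[OF bracket_self])
  hence "x ~: ?K" using False by simp
  hence "?K ~= UNIV" by blast
  ultimately have "?K = {0}" by blast
  thus ?thesis using endo.linear_inj_iff_eq_0[OF lx] by blast
 qed
 moreover from this have "surj (exp_ad x)" using fin.linear_inj_imp_surj[OF lx] by blast
 ultimately show ?thesis unfolding lie_aut_def using lx bx by (simp add: bij_def)
qed

inductive_set nil_group :: "('g::complex_lie_algebra => 'g) set" where
 one: "id : nil_group"
| step: "\<phi> : nil_group ==> ad_nilpotent x ==> exp_ad x \<circ> \<phi> : nil_group"

lemma nil_group_adjoint: "\<phi> : nil_group ==> \<phi> : adjoint_group"
proof (induction rule: nil_group.induct)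
 case one
 show ?case by (rule adjoint_group.one)
next
 case (step \<phi> x)
 show ?case by (rule adjoint_group.exp_ad[OF step.IH])
qed

lemma nil_group_exp: "ad_nilpotent x ==> exp_ad x : nil_group"
 using nil_group.step[OF nil_group.one, of x] by simp

lemma nil_group_comp: "\<psi> : nil_group ==> \<phi> : nil_group ==> \<psi> \<circ> \<phi> : nil_group"
proof (induction rule: nil_group.induct)
 case (step \<psi> x)
 show ?case using nil_group.step[OF step.IH[OF step.prems] step.hyps(2)] unfolding comp_assoc .
qed simp

lemma lie_aut_comp: "lie_aut \<psi> ==> lie_aut \<phi> ==> lie_aut (\<psi> \<circ> \<phi>)"
 unfolding lie_aut_def using lin_compose[of \<psi> \<phi>] bij_comp[of \<phi> \<psi>] by (simp add: o_def)

lemma lie_aut_id: "lie_aut id"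
 unfolding lie_aut_def using lin_ident by (simp only: id_def[symmetric] bij_id id_apply simp_thms)

lemma nil_group_aut:
 assumes "simple_lie (UNIV :: 'g::complex_lie_algebra set)" and "(\<phi> :: 'g => 'g) : nil_group"
 shows "lie_aut \<phi>"
 using assms(2)
proof (induction rule: nil_group.induct)
 case one
 show ?case by (rule lie_aut_id)
next
 case (step \<phi> x)
 show ?case by (rule lie_aut_comp[OF exp_ad_aut[OF assms(1) step.hyps(2)] step.IH])
qed

lemma lie_autD:
 assumes "lie_aut \<phi>"
 shows "lin \<phi>" "bij \<phi>" "\<phi> (ad x y) = ad (\<phi> x) (\<phi> y)" "\<phi> (c *. x) = c *. \<phi> x"
  "\<phi> (x + y) = \<phi> x + \<phi> y" "\<phi> x = 0 \<longleftrightarrow> x = 0" "\<phi> (- x) = - \<phi> x"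
proof -
 show l: "lin \<phi>" and b: "bij \<phi>" and "\<phi> (ad x y) = ad (\<phi> x) (\<phi> y)"
  using assms unfolding lie_aut_def by auto
 show "\<phi> (c *. x) = c *. \<phi> x" "\<phi> (x + y) = \<phi> x + \<phi> y" "\<phi> (- x) = - \<phi> x"
  using l by (simp_all add: endo.linear_add endo.linear_scale endo.linear_neg)
 show "\<phi> x = 0 \<longleftrightarrow> x = 0" using endo.linear_0[OF l] bij_is_inj[OF b] by (metis injD)
qed

lemma lie_aut_inv: "lie_aut \<phi> ==> lie_aut (inv \<phi>)"
proof -
 assume a: "lie_aut \<phi>"
 note d = lie_autD[OF a]
 have i: "inv \<phi> (\<phi> x) = x" "\<phi> (inv \<phi> x) = x" for x
  using d(2) by (simp_all add: bij_is_inj bij_is_surj surj_f_inv_f)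
 have *: "inv \<phi> y = x" if "y = \<phi> x" for x y using that i by simp
 have "lin (inv \<phi>)" by (rule linI) (auto intro!: * simp: d i)
 thus ?thesis unfolding lie_aut_def using bij_imp_bij_inv[OF d(2)] by (auto intro!: * simp: d i)
qed

lemma lie_aut_sl2: "lie_aut \<phi> ==> sl2 e h f ==> sl2 (\<phi> e) (\<phi> h) (\<phi> f)"
 unfolding sl2_def using lie_autD(3,4) by metis

lemma lie_aut_span: "lie_aut \<phi> ==> \<phi> ` lie.span S = lie.span (\<phi> ` S)"
 by (rule endo.linear_span_image[OF lie_autD(1), symmetric])

section \<open>Conjugacy of long-root triples\<close>

text \<open>The \<open>sl\<^sub>2\<close>-triples of long roots, characterized without reference to a Cartan subalgebra.\<close>

definition long_triple :: "'g::complex_lie_algebra => 'g => 'g => bool" where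
 "long_triple e h f \<longleftrightarrow> sl2 e h f & e ~= 0 &
   UNIV \<subseteq> lie.span (UN c:{-2,-1,0,1,2}. {v. ad h v = c *. v}) &
   (ALL v. ad h v = 2 *. v --> (EX c. v = c *. e)) &
   (ALL v. ad h v = (-2) *. v --> (EX c. v = c *. f))"

lemma eigenvalue_spanning:
 assumes "finite C" "UNIV \<subseteq> lie.span (UN c:C. {v. ad h v = c *. v})"
  and v: "ad h v = d *. (v :: 'g::complex_lie_algebra)" "d ~: C"
 shows "v = 0"
proof -
 have sub: "lie.subspace {v. ad h v = c *. v}" for c
  using eigenspace_subspace[OF lie.subspace_UNIV, of h c] by simp
 have "v : lie.span (UN c:C. {v. ad h v = c *. v})" using assms(2) by blast
 from span_weight_sum[OF this sub] obtain F w where F: "finite F" "F \<subseteq> C"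
  "ALL c:F. w c : {v. ad h v = c *. v}" "v = (SUM c:F. w c)" by blast
 let ?w = "%c. if c = d then - v else w c"
 have dF: "d ~: F" using F(2) v(2) by blast
 have "(SUM c:insert d F. ?w c) = - v + (SUM c:F. ?w c)" using F(1) dF by simp
 also have "(SUM c:F. ?w c) = (SUM c:F. w c)" using dF by (intro sum.cong) auto
 finally have s: "(SUM c:insert d F. ?w c) = 0" using F(4) by simp
 have "?w d = 0"
 proof (rule gen_eig_independent[OF lin_ad[of h] _ _ s])
  fix c assume "c : insert d F"
  thus "gen_eig (ad h) c (?w c)"
   using F(3) v(1) by (intro gen_eig_eigenvector) (auto simp: bracket_simps scale_simps)
 qed (use F(1) in auto)
 thus ?thesis by simp
qed

context
 fixes e h f :: "'g::complex_lie_algebra"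
 assumes lt: "long_triple e h f"
begin

lemma long_triple_sl2: "sl2 e h f" using lt unfolding long_triple_def by blast

lemma long_triple_span: "UNIV \<subseteq> lie.span (UN c:{-2,-1,0,1,2}. {v. ad h v = c *. v})"
 using lt unfolding long_triple_def by blast

lemma long_triple_e_nilpotent: "ad_nilpotent e"
 by (rule ad_nilpotent_spanning[OF long_triple_span]) (use sl2.e_nilpotent[OF long_triple_sl2] in blast)

lemma long_triple_weight: "ad h v = d *. v ==> d ~: {-2,-1,0,1,2} ==> v = 0"
 by (rule eigenvalue_spanning[OF _ long_triple_span]) auto

lemma long_triple_decompose:
 obtains v2 v1 v0 w1 w2 where "v = v2 + v1 + v0 + w1 + w2" "ad h v2 = (-2) *. v2" "ad h v1 = (-1) *. v1"
  "ad h v0 = 0" "ad h w1 = w1" "ad h w2 = 2 *. w2"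
proof -
 have sub: "lie.subspace {v. ad h v = c *. v}" for c
  using eigenspace_subspace[OF lie.subspace_UNIV, of h c] by simp
 have "v : lie.span (UN c:{-2,-1,0,1,2}. {v. ad h v = c *. v})" using long_triple_span by blast
 from span_weight_sum[OF this sub] obtain F w where F: "finite F" "F \<subseteq> {-2,-1,0,1,2}"
  "ALL c:F. w c : {v. ad h v = c *. v}" "v = (SUM c:F. w c)" by blast
 define u where "u c = (if c : F then w c else 0)" for c
 have u: "ad h (u c) = c *. u c" for c using F(3) unfolding u_def by auto
 have "v = (SUM c:{-2,-1,0,1,2}. u c)"
  unfolding F(4) u_def using F(1,2) by (intro sum.mono_neutral_cong_left) auto
 hence "v = u (-2) + u (-1) + u 0 + u 1 + u 2" by (simp add: add.assoc)
 thus thesis using that u[of "-2"] u[of "-1"] u[of 0] u[of 1] u[of 2] by simp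
qed

lemma long_triple_scale: "c ~= 0 ==> long_triple (c *. e) h ((1 / c) *. f)"
proof -
 assume c: "c ~= 0"
 have s: "sl2 (c *. e) h ((1 / c) *. f)"
  using long_triple_sl2 c unfolding sl2_def by (simp add: bracket_simps scaleC_scaleC mult.commute)
 have 1: "EX d. v = d *. (c *. e)" if v: "ad h v = 2 *. v" for v
 proof -
  obtain d where "v = d *. e" using lt v unfolding long_triple_def by blast
  hence "v = (d / c) *. (c *. e)" using c by (simp add: scaleC_scaleC)
  thus ?thesis by blast
 qed
 have 2: "EX d. v = d *. ((1 / c) *. f)" if v: "ad h v = (-2) *. v" for v
 proof -
  obtain d where "v = d *. f" using lt v unfolding long_triple_def by blast
  hence "v = (d * c) *. ((1 / c) *. f)" using c by (simp add: scaleC_scaleC)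
  thus ?thesis by blast
 qed
 show ?thesis using s c 1 2 lt unfolding long_triple_def by (simp add: scale_simps)
qed

lemma long_triple_aut:
 assumes \<phi>: "lie_aut \<phi>" shows "long_triple (\<phi> e) (\<phi> h) (\<phi> f)"
proof -
 note d = lie_autD[OF \<phi>]
 have pre: "EX w. v = \<phi> w & ad h w = c *. w" if v: "ad (\<phi> h) v = c *. v" for v c
 proof -
  obtain w where w: "v = \<phi> w" using d(2) by (metis bij_pointE)
  have "\<phi> (ad h w - c *. w) = 0"
   using v unfolding w by (simp add: endo.linear_diff[OF d(1)] d)
  thus ?thesis using w d(6) by auto
 qed
 have "UNIV = \<phi> ` UNIV" using d(2) by (simp add: bij_is_surj)
 also have "... \<subseteq> \<phi> ` lie.span (UN c:{-2,-1,0,1,2}. {v. ad h v = c *. v})"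
  using long_triple_span by (rule image_mono)
 also have "... = lie.span (\<phi> ` (UN c:{-2,-1,0,1,2}. {v. ad h v = c *. v}))"
  by (rule lie_aut_span[OF \<phi>])
 also have "... \<subseteq> lie.span (UN c:{-2,-1,0,1,2}. {v. ad (\<phi> h) v = c *. v})"
 proof (rule lie.span_mono, rule image_subsetI)
  fix v assume "v : (UN c:{-2,-1,0,1,2}. {v. ad h v = c *. v})"
  then obtain c where c: "c : {-2,-1,0,1,2}" "ad h v = c *. v" by blast
  hence "ad (\<phi> h) (\<phi> v) = c *. \<phi> v" using d(3)[of h v] d(4)[of c v] by simp
  thus "\<phi> v : (UN c:{-2,-1,0,1,2}. {v. ad (\<phi> h) v = c *. v})" using c(1) by blast
 qed
 finally have span: "UNIV \<subseteq> lie.span (UN c:{-2,-1,0,1,2}. {v. ad (\<phi> h) v = c *. v})" .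
 have 1: "EX c. v = c *. \<phi> e" if v: "ad (\<phi> h) v = 2 *. v" for v
 proof -
  obtain w where w: "v = \<phi> w" "ad h w = 2 *. w" using pre[OF v] by blast
  then obtain c where "w = c *. e" using lt unfolding long_triple_def by blast
  thus ?thesis using w(1) d(4) by blast
 qed
 have 2: "EX c. v = c *. \<phi> f" if v: "ad (\<phi> h) v = (-2) *. v" for v
 proof -
  obtain w where w: "v = \<phi> w" "ad h w = (-2) *. w" using pre[OF v] by blast
  then obtain c where "w = c *. f" using lt unfolding long_triple_def by blast
  thus ?thesis using w(1) d(4) by blast
 qed
 have "\<phi> e ~= 0" using lt d(6) unfolding long_triple_def by blast
 thus ?thesis unfolding long_triple_def
  using lie_aut_sl2[OF \<phi> long_triple_sl2] span 1 2 by blast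
qed

end

lemma subalgebra_UNIV: "subalgebra (UNIV :: 'g::complex_lie_algebra set)"
 unfolding subalgebra_def by simp

lemmas killing_UNIV = killing_bilinear[OF subalgebra_UNIV UNIV_I UNIV_I UNIV_I]

lemma killing_UNIV_sym: "killing_form UNIV x y = killing_form UNIV y (x :: 'g::complex_lie_algebra)"
 by (rule killing_sym[OF lie.subspace_UNIV]) auto

lemma killing_UNIV_inv: "killing_form UNIV (ad x y) z = killing_form UNIV x (ad y (z :: 'g::complex_lie_algebra))"
 by (rule killing_invariant[OF lie.subspace_UNIV]) auto

text \<open>Long root vectors are extremal: \<open>(ad e)\<^sup>2\<close> has rank one and is given by the Killing form.\<close>

lemma long_triple_extremal:
 assumes nd: "killing_nondeg (UNIV :: 'g::complex_lie_algebra set)" and lt: "long_triple e h (f :: 'g)"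
 shows "killing_form UNIV e f ~= 0"
  and "ad e (ad e y) = (- 2 * killing_form UNIV e y / killing_form UNIV e f) *. e"
proof -
 interpret s: sl2 e h f by (rule long_triple_sl2[OF lt])
 let ?S = "UN c:{-2,-1,0,1,2}. {v. ad h v = c *. v}"
 have orth: "killing_form UNIV e v = 0" if "ad h v = c *. v" "c ~= - 2" for v c
 proof (rule killing_gen_orth[OF subalgebra_UNIV, of h e v 2 c])
  show "2 + c ~= 0" using that(2) by (metis add.commute add_eq_0_iff)
 qed (use that s.he in \<open>auto intro: gen_eig_eigenvector\<close>)
 show ne: "killing_form UNIV e f ~= 0"
 proof
  assume z: "killing_form UNIV e f = 0"
  have "killing_form UNIV e y = 0" for y
  proof (rule killing_zero_subspace[OF subalgebra_UNIV UNIV_I subset_UNIV])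
   show "y : lie.span ?S" using long_triple_span[OF lt] by blast
   fix v assume "v : ?S"
   then obtain c where v: "ad h v = c *. v" by blast
   show "killing_form UNIV e v = 0"
   proof (cases "c = -2")
    case True
    then obtain d where "v = d *. f" using lt v unfolding long_triple_def by blast
    thus ?thesis using z by (simp add: killing_UNIV)
   qed (rule orth[OF v])
  qed
  hence "e = 0" using nd unfolding killing_nondeg_def by blast
  thus False using lt unfolding long_triple_def by blast
 qed
 let ?k = "%y. - 2 * killing_form UNIV e y / killing_form UNIV e f"
 have lr: "lin (%y. ?k y *. e)"
 proof (rule linI)
  fix y z c
  have "?k (y + z) = ?k y + ?k z" by (simp add: killing_UNIV diff_divide_distrib)
  thus "?k (y + z) *. e = ?k y *. e + ?k z *. e" by (simp only: scaleC_add_left)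
  show "?k (c *. y) *. e = c *. ?k y *. e" by (simp add: killing_UNIV scaleC_scaleC)
 qed
 show "ad e (ad e y) = ?k y *. e"
 proof (rule lin_eq_on_span[OF lin_ad_ad lr])
  show "y : lie.span ?S" using long_triple_span[OF lt] by blast
  fix v assume "v : ?S"
  then obtain c where c: "c : {-2,-1,0,1,2}" and v: "ad h v = c *. v" by blast
  show "ad e (ad e v) = ?k v *. e"
  proof (cases "c = -2")
   case True
   then obtain d where d: "v = d *. f" using lt v unfolding long_triple_def by blast
   have "ad e h = (-2) *. e" using s.he bracket_anti[of e h] by (simp add: scale_simps)
   thus ?thesis using ne by (simp add: d bracket_scaleC_right s.ef scaleC_scaleC killing_UNIV mult.commute)
  next
   case False
   have "ad h (ad e (ad e v)) = (c + 2 + 2) *. ad e (ad e v)"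
    by (rule s.weight_e[OF s.weight_e[OF v]])
   moreover have "c + 2 + 2 ~: {-2,-1,0,1,2}" using c False by auto
   ultimately have "ad e (ad e v) = 0" by (rule long_triple_weight[OF lt])
   thus ?thesis using orth[OF v False] by simp
  qed
 qed
qed

lemma extremal_conj:
 assumes nd: "killing_nondeg (UNIV :: 'g::complex_lie_algebra set)"
  and lt: "long_triple e h (f :: 'g)" and lt': "long_triple e' h' (f' :: 'g)"
  and k: "killing_form UNIV e e' ~= 0"
 shows "EX \<phi>:nil_group. EX c. c ~= 0 & \<phi> e = c *. e'"
proof -
 let ?k = "killing_form UNIV"
 note x = long_triple_extremal[OF nd lt] and x' = long_triple_extremal[OF nd lt']
 let ?a = "?k e f / ?k e e'"
 define f1 where "f1 = ?a *. e'"
 define h1 where "h1 = ad e f1"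
 have a0: "?a ~= 0" using x(1) k by simp
 have eh: "ad e h1 = (-2) *. e"
  unfolding h1_def f1_def bracket_scaleC_right x(2) scaleC_scaleC using k x(1) by simp
 have fh: "ad f1 h1 = (2 * ?k e f / ?k e' f') *. f1"
 proof -
  have "ad f1 h1 = - ad f1 (ad f1 e)"
   unfolding h1_def using bracket_anti[of e f1] by (simp add: bracket_minus_right)
  also have "ad f1 (ad f1 e) = (?a * ?a) *. ad e' (ad e' e)"
   unfolding f1_def by (simp add: bracket_scaleC_left bracket_scaleC_right scaleC_scaleC)
  also have "... = (?a * ?a * (- 2 * ?k e e' / ?k e' f')) *. e'"
   unfolding x'(2) scaleC_scaleC killing_UNIV_sym[of e' e] ..
  also have "- ... = (2 * ?k e f / ?k e' f') *. f1"
   unfolding f1_def scaleC_scaleC lie.scale_minus_left[symmetric]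
   by (rule arg_cong[of _ _ "%c. c *. e'"]) (use k in \<open>simp add: field_simps\<close>)
  finally show ?thesis .
 qed
 have kef: "?k e f1 = ?k e f" unfolding f1_def using k by (simp add: killing_UNIV)
 have "?k (ad e h1) f1 = ?k e (ad h1 f1)" by (rule killing_UNIV_inv)
 hence "2 * ?k e f = 2 * ?k e f / ?k e' f' * ?k e f"
  unfolding eh using fh bracket_anti[of h1 f1] kef by (simp add: killing_UNIV)
 hence "(2 * ?k e f / ?k e' f' - 2) * ?k e f = 0" by (simp add: left_diff_distrib)
 hence "2 * ?k e f / ?k e' f' = 2" using x(1) by simp
 hence fh2: "ad f1 h1 = 2 *. f1" using fh by simp
 have fe: "ad f1 e = - h1" unfolding h1_def by (rule bracket_anti)
 have ef: "ad e f1 = h1" unfolding h1_def ..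
 have n: "ad_nilpotent (- e)" "ad_nilpotent f1"
  unfolding f1_def by (intro ad_nilpotent_minus ad_nilpotent_scale long_triple_e_nilpotent[OF lt]
    long_triple_e_nilpotent[OF lt'])+
 have 1: "exp_ad f1 e = e - h1 - f1"
  by (subst exp_ad_three) (simp_all add: fe fh2 bracket_simps scale_simps)
 have 2: "exp_ad (- e) e = e" by (rule exp_ad_fixed) (simp add: bracket_simps)
 have 3: "exp_ad (- e) h1 = h1 + 2 *. e"
  by (subst exp_ad_two) (simp_all add: eh bracket_simps scale_simps)
 have 4: "exp_ad (- e) f1 = f1 - h1 - e"
  by (subst exp_ad_three) (simp_all add: ef eh bracket_simps scale_simps)
 have "exp_ad (- e) (exp_ad f1 e) = e - (h1 + 2 *. e) - (f1 - h1 - e)"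
  unfolding 1 endo.linear_diff[OF exp_ad_lin[OF n(1)]] 2 3 4 ..
 also have "... = (1 - 2 + 1) *. e - f1" unfolding scaleC_add_left lie.scale_left_diff_distrib by simp
 also have "... = (- ?a) *. e'" unfolding f1_def by (simp add: scale_simps)
 finally have "(exp_ad (- e) \<circ> exp_ad f1) e = (- ?a) *. e'" by simp
 moreover have "exp_ad (- e) \<circ> exp_ad f1 : nil_group" using nil_group_exp n nil_group_comp by blast
 ultimately show ?thesis using a0 by (intro bexI exI[of _ "- ?a"]) auto
qed

text \<open>A polynomial with values in a subspace has its coefficients there: \<open>p (2 t) - 2\<^sup>N p t\<close> has
 smaller degree.\<close>

lemma poly_coefficients_subspace:
 assumes U: "lie.subspace U" and "!!t. (\<Sum>k<N. t ^ k *. v k) : U" and "k < N"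
 shows "v k : U"
 using assms(2,3)
proof (induction N arbitrary: v k)
 case (Suc N)
 have *: "v j : U" if j: "j < N" for j
 proof -
  have "(\<Sum>i<N. t ^ i *. ((2 ^ i - 2 ^ N) *. v i)) : U" for t :: complex
  proof -
   have "(\<Sum>i<Suc N. (2 * t) ^ i *. v i) - 2 ^ N *. (\<Sum>i<Suc N. t ^ i *. v i)
     = (\<Sum>i<Suc N. t ^ i *. ((2 ^ i - 2 ^ N) *. v i))"
    unfolding lie.scale_sum_right sum_subtractf[symmetric] scaleC_scaleC lie.scale_left_diff_distrib[symmetric]
    by (rule sum.cong[OF refl]) (simp add: power_mult_distrib algebra_simps)
   also have "... = (\<Sum>i<N. t ^ i *. ((2 ^ i - 2 ^ N) *. v i))" by simp
   finally have eq: "(\<Sum>i<Suc N. (2 * t) ^ i *. v i) - 2 ^ N *. (\<Sum>i<Suc N. t ^ i *. v i)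
     = (\<Sum>i<N. t ^ i *. ((2 ^ i - 2 ^ N) *. v i))" .
   show ?thesis
    unfolding eq[symmetric] by (intro lie.subspace_diff[OF U] lie.subspace_scale[OF U] Suc.prems(1))
  qed
  from Suc.IH[of "%i. (2 ^ i - 2 ^ N) *. v i", OF this j]
  have "(1 / (2 ^ j - 2 ^ N)) *. ((2 ^ j - 2 ^ N) *. v j) : U" by (rule lie.subspace_scale[OF U])
  moreover have "(2 :: complex) ^ j - 2 ^ N ~= 0"
  proof
   assume "(2 :: complex) ^ j - 2 ^ N = 0"
   hence "of_nat (2 ^ j) = (of_nat (2 ^ N) :: complex)" by simp
   hence "(2 :: nat) ^ j = 2 ^ N" by (simp only: of_nat_eq_iff)
   thus False using j by simp
  qed
  ultimately show ?thesis by (simp add: scaleC_scaleC)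
 qed
 have "(\<Sum>i<N. v i) : U" by (rule lie.subspace_sum[OF U]) (simp add: *)
 hence "(\<Sum>i<Suc N. 1 ^ i *. v i) - (\<Sum>i<N. v i) : U"
  by (rule lie.subspace_diff[OF U Suc.prems(1)])
 hence "v N : U" by simp
 thus ?case using * Suc.prems(2) by (cases "k = N") auto
qed simp

definition nil_generated :: "'g::complex_lie_algebra set => bool" where
 "nil_generated L \<longleftrightarrow> (ALL S. subalgebra S & (ALL x. ad_nilpotent x --> x : S) --> S = L)"

text \<open>The span of an orbit is stable under the generators of the Lie algebra, hence an ideal.\<close>

lemma orbit_spans:
 assumes simple: "simple_lie (UNIV :: 'g::complex_lie_algebra set)" and gen: "nil_generated (UNIV :: 'g set)"
  and e: "e ~= (0 :: 'g)"
 shows "lie.span {\<phi> e | \<phi>. \<phi> : nil_group} = UNIV"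
proof -
 let ?U = "lie.span {\<phi> e | \<phi>. \<phi> : nil_group}"
 let ?S = "{x. ALL u:?U. ad x u : ?U}"
 have "subalgebra ?S" unfolding subalgebra_def lie.subspace_def
  by (auto simp: bracket_simps ad_bracket lie.span_zero lie.span_add lie.span_scale lie.span_diff)
 moreover have "x : ?S" if x: "ad_nilpotent x" for x
 proof -
  obtain N where N: "!!y. (ad x ^^ N) y = 0" using x unfolding ad_nilpotent_def by blast
  have N2: "(ad x ^^ (N + 2)) y = 0" for y by (rule funpow_zero_mono[OF lin_ad N]) simp
  have gen_st: "ad x u : ?U" if u: "u : {\<phi> e | \<phi>. \<phi> : nil_group}" for u
  proof -
   obtain \<phi> where \<phi>: "u = \<phi> e" "\<phi> : nil_group" using u by blast
   have "(\<Sum>k<N + 2. t ^ k *. ((1 / fact k) *. (ad x ^^ k) u)) : ?U" for t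
   proof -
    have "(ad (t *. x) ^^ (N + 2)) u = 0" unfolding funpow_ad_scale N2 by simp
    from exp_ad_finite[OF this]
    have A: "exp_ad (t *. x) u = (\<Sum>k<N + 2. t ^ k *. ((1 / fact k) *. (ad x ^^ k) u))"
     unfolding funpow_ad_scale by (simp add: scaleC_scaleC mult.commute)
    have B: "exp_ad (t *. x) u = (exp_ad (t *. x) \<circ> \<phi>) e" using \<phi>(1) by simp
    have "exp_ad (t *. x) \<circ> \<phi> : nil_group"
     by (rule nil_group.step[OF \<phi>(2) ad_nilpotent_scale[OF x]])
    hence "(exp_ad (t *. x) \<circ> \<phi>) e : {\<phi> e | \<phi>. \<phi> : nil_group}" by blast
    thus ?thesis unfolding A[symmetric] B by (rule lie.span_base)
   qed
   from poly_coefficients_subspace[OF lie.subspace_span this, of 1] show ?thesis by simp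
  qed
  have "ad x u : ?U" if "u : ?U" for u
   by (rule lin_span_stable[OF lin_ad gen_st lie.subspace_span that])
  thus ?thesis by blast
 qed
 ultimately have "?S = UNIV" using gen unfolding nil_generated_def by blast
 hence "lie_ideal UNIV ?U" unfolding lie_ideal_def by auto
 hence "?U = {0} | ?U = UNIV" using simple unfolding simple_lie_def by blast
 moreover have "e : ?U" using nil_group.one by (intro lie.span_base) (auto intro!: exI[of _ id])
 ultimately show ?thesis using e by blast
qed

text \<open>Two triples with the same \<open>e\<close>: their \<open>h\<close> differ by an element of positive weight that commutes
 with \<open>e\<close>, and exponentials of such elements move one to the other.\<close>

lemma same_nilpositive_conj:
 assumes simple: "simple_lie (UNIV :: 'g::complex_lie_algebra set)"
  and lt: "long_triple e h (f :: 'g)" and lt': "long_triple e h' f'"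
 shows "EX \<phi>:nil_group. \<phi> e = e & \<phi> h = h' & \<phi> f = f'"
proof -
 interpret s: sl2 e h f by (rule long_triple_sl2[OF lt])
 interpret s': sl2 e h' f' by (rule long_triple_sl2[OF lt'])
 have e0: "e ~= 0" using lt unfolding long_triple_def by blast
 obtain v2 v1 v0 w1 w2 where w: "f' - f = v2 + v1 + v0 + w1 + w2" "ad h v2 = (-2) *. v2" "ad h v1 = (-1) *. v1"
  "ad h v0 = 0" "ad h w1 = w1" "ad h w2 = 2 *. w2"
  by (rule long_triple_decompose[OF lt])
 obtain a where a: "v2 = a *. f" using lt w(2) unfolding long_triple_def by blast
 have "ad h (ad e v0) = 2 *. ad e v0" using s.weight_e[of v0 0] w(4) by simp
 then obtain c where c: "ad e v0 = c *. e" using lt unfolding long_triple_def by blast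
 have z1: "ad e w1 = 0"
  by (rule long_triple_weight[OF lt s.weight_e[of w1 1]]) (use w(5) in auto)
 have z2: "ad e w2 = 0"
  by (rule long_triple_weight[OF lt s.weight_e[of w2 2]]) (use w(6) in auto)
 define u where "u = ad e v1"
 have hu: "ad h u = u" unfolding u_def using s.weight_e[OF w(3)] by simp
 have eu: "ad e u = 0"
  by (rule long_triple_weight[OF lt s.weight_e[of u 1]]) (use hu in auto)
 have eh: "ad e h = (-2) *. e" using s.he bracket_anti[of e h] by (simp add: scale_simps)
 have eh': "ad e h' = (-2) *. e" using s'.he bracket_anti[of e h'] by (simp add: scale_simps)
 have "h' - h = ad e (f' - f)" by (simp add: bracket_diff_right s.ef s'.ef)
 also have "... = a *. h + u + c *. e"
  unfolding w(1) bracket_add_right a bracket_scaleC_right s.ef u_def[symmetric] c z1 z2 by simp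
 finally have d: "h' - h = a *. h + u + c *. e" .
 have "ad e (h' - h) = 0" by (simp add: bracket_diff_right eh eh')
 hence "a * (-2) = 0" unfolding d bracket_add_right bracket_scaleC_right eh eu bracket_self
  using e0 by (simp add: scaleC_scaleC)
 hence "a = 0" by simp
 hence h': "h' = h + u + c *. e" using d by (simp add: algebra_simps)
 have un: "ad_nilpotent u"
 proof (rule ad_nilpotent_spanning[OF long_triple_span[OF lt]])
  fix v assume "v : (UN c:{-2,-1,0,1,2}. {v. ad h v = c *. v})"
  then obtain c where v: "ad h v = c *. v" by blast
  have "ad h ((ad u ^^ k) v) = (c + 1 * of_nat k) *. (ad u ^^ k) v" for k
  proof (induction k)
   case (Suc k)
   have "ad h (ad u ((ad u ^^ k) v)) = ad u ((ad u ^^ k) v) + ad u (ad h ((ad u ^^ k) v))"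
    using ad_derivation[of h u "(ad u ^^ k) v"] hu by simp
   also have "... = (c + 1 * of_nat (Suc k)) *. ad u ((ad u ^^ k) v)"
    unfolding Suc.IH bracket_scaleC_right by (simp add: scaleC_add_left)
   finally show ?case by simp
  qed (use v in simp)
  thus "EX k. (ad u ^^ k) v = 0" by (rule eigen_chain_terminates) simp
 qed
 let ?t = "- c / 2"
 have n: "ad_nilpotent (- u)" "ad_nilpotent (?t *. e)"
  by (intro ad_nilpotent_minus un ad_nilpotent_scale long_triple_e_nilpotent[OF lt])+
 let ?\<phi> = "exp_ad (?t *. e) \<circ> exp_ad (- u)"
 have G: "?\<phi> : nil_group" using nil_group_exp n nil_group_comp by blast
 have uh: "ad u h = - u" using hu bracket_anti[of u h] by simp
 have ue: "ad u e = 0" using eu bracket_anti[of u e] by simp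
 have 1: "exp_ad (- u) h = h + u" by (subst exp_ad_two) (simp_all add: uh bracket_simps)
 have 2: "exp_ad (- u) e = e" by (rule exp_ad_fixed) (simp add: ue bracket_simps)
 have 3: "exp_ad (?t *. e) h = h + c *. e" by (subst exp_ad_two) (simp_all add: eh bracket_simps scale_simps)
 have 4: "exp_ad (?t *. e) u = u" by (rule exp_ad_fixed) (simp add: eu bracket_simps)
 have 5: "exp_ad (?t *. e) e = e" by (rule exp_ad_fixed) (simp add: bracket_simps)
 have \<phi>h: "?\<phi> h = h'" unfolding o_apply 1 endo.linear_add[OF exp_ad_lin[OF n(2)]] 3 4 h' by (simp add: add_ac)
 have \<phi>e: "?\<phi> e = e" unfolding o_apply 2 5 ..
 note d\<phi> = lie_autD[OF nil_group_aut[OF simple G]]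
 have "ad h' (?\<phi> f) = (-2) *. ?\<phi> f" using d\<phi>(3)[of h f] d\<phi>(4)[of "-2" f] \<phi>h s.hf by simp
 then obtain b where b: "?\<phi> f = b *. f'" using lt' unfolding long_triple_def by blast
 have "h' = b *. h'" using d\<phi>(3)[of e f] s.ef \<phi>e \<phi>h b s'.ef by (simp add: bracket_scaleC_right del: o_apply)
 hence "(1 - b) *. h' = 0" by (simp add: scale_simps)
 moreover have "h' ~= 0" using s'.he e0 by auto
 ultimately have "b = 1" by simp
 hence "?\<phi> f = f'" using b by simp
 thus ?thesis using G \<phi>e \<phi>h by blast
qed

theorem long_triple_conj:
 assumes simple: "simple_lie (UNIV :: 'g::complex_lie_algebra set)" and gen: "nil_generated (UNIV :: 'g set)"
  and nd: "killing_nondeg (UNIV :: 'g set)"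
  and lt: "long_triple e h (f :: 'g)" and lt': "long_triple e' h' f'"
 shows "EX \<phi>:nil_group. EX c. c ~= 0 & \<phi> e = c *. e' & \<phi> h = h' & \<phi> f = (1 / c) *. f'"
proof -
 have e0: "e ~= 0" "e' ~= 0" using lt lt' unfolding long_triple_def by auto
 have "EX \<phi>:nil_group. killing_form UNIV (\<phi> e) e' ~= 0"
 proof (rule ccontr)
  assume no: "~ ?thesis"
  have z: "killing_form UNIV e' v = 0" if v: "v : {\<phi> e | \<phi>. \<phi> : nil_group}" for v
  proof -
   obtain \<phi> where "v = \<phi> e" "\<phi> : nil_group" using v by blast
   hence "killing_form UNIV v e' = 0" using no by blast
   thus ?thesis using killing_UNIV_sym[of e' v] by simp
  qed
  have "killing_form UNIV e' y = 0" for y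
   by (rule killing_zero_subspace[OF subalgebra_UNIV UNIV_I subset_UNIV z, of "{\<phi> e | \<phi>. \<phi> : nil_group}"])
    (simp_all only: orbit_spans[OF simple gen e0(1)] UNIV_I)
  thus False using nd e0(2) unfolding killing_nondeg_def by blast
 qed
 then obtain g where g: "g : nil_group" "killing_form UNIV (g e) e' ~= 0" by blast
 have lg: "long_triple (g e) (g h) (g f)" by (rule long_triple_aut[OF lt nil_group_aut[OF simple g(1)]])
 obtain \<psi> c where \<psi>: "\<psi> : nil_group" "c ~= 0" "\<psi> (g e) = c *. e'"
  using extremal_conj[OF nd lg lt' g(2)] by blast
 have "long_triple (\<psi> (g e)) (\<psi> (g h)) (\<psi> (g f))"
  by (rule long_triple_aut[OF lg nil_group_aut[OF simple \<psi>(1)]])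
 hence "long_triple (c *. e') (\<psi> (g h)) (\<psi> (g f))" unfolding \<psi>(3) .
 from same_nilpositive_conj[OF simple this long_triple_scale[OF lt' \<psi>(2)]] obtain \<chi> where
  \<chi>: "\<chi> : nil_group" "\<chi> (c *. e') = c *. e'" "\<chi> (\<psi> (g h)) = h'" "\<chi> (\<psi> (g f)) = (1 / c) *. f'"
  by blast
 have "\<chi> \<circ> (\<psi> \<circ> g) : nil_group" using \<chi>(1) \<psi>(1) g(1) nil_group_comp by blast
 moreover have "(\<chi> \<circ> (\<psi> \<circ> g)) e = c *. e'" "(\<chi> \<circ> (\<psi> \<circ> g)) h = h'" "(\<chi> \<circ> (\<psi> \<circ> g)) f = (1 / c) *. f'"
  using \<chi> \<psi> by simp_all
 ultimately show ?thesis using \<psi>(2) by blast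
qed

subsection \<open>Semisimple elements of \<open>sl\<^sub>2\<close>\<close>

context sl2
begin

lemma comb_bracket:
 "ad (x *. e + y *. h + z *. f) (a *. e + b *. h + c *. f)
  = (2 * (y * a - x * b)) *. e + (x * c - z * a) *. h + (2 * (z * b - y * c)) *. f"
proof -
 have eh: "ad e h = (-2) *. e" using he bracket_anti[of e h] by (simp add: scale_simps)
 have fh: "ad f h = 2 *. f" using hf bracket_anti[of f h] by (simp add: scale_simps)
 show ?thesis
  by (simp add: bracket_simps he hf ef fe eh fh scale_simps algebra_simps)
qed

lemma comb_eq_0:
 assumes "e ~= 0" "x *. e + y *. h + z *. f = 0"
 shows "x = 0" "y = 0" "z = 0"
proof -
 have 1: "ad (x *. e + y *. h + z *. f) (0 *. e + 0 *. h + 1 *. f) = x *. h + (- 2 * y) *. f"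
  unfolding comb_bracket by simp
 hence "ad e (ad e (x *. h + (- 2 * y) *. f)) = 0" using assms(2) by simp
 moreover have eh: "ad e h = (-2) *. e" using he bracket_anti[of e h] by (simp add: scale_simps)
 ultimately have "(4 * y) *. e = 0" by (simp add: bracket_simps ef scaleC_scaleC)
 thus y: "y = 0" using assms(1) by simp
 have h0: "h ~= 0" using he assms(1) by auto
 have "x *. h + (- 2 * y) *. f = 0" using 1 assms(2) by simp
 thus x: "x = 0" using y h0 by simp
 have "z *. f = 0" using assms(2) x y by simp
 hence "ad e (z *. f) = 0" by (simp only: bracket_zero_right)
 thus "z = 0" using h0 by (simp add: bracket_scaleC_right ef)
qed

text \<open>A semisimple element is conjugate into the line of \<open>h\<close>: \<open>exp (t ad e)\<close> removes the coefficient
 of \<open>e\<close> when \<open>t\<close> solves a quadratic equation, \<open>exp (r ad f)\<close> then removes that of \<open>f\<close>.\<close>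

lemma semisimple_conj:
 assumes nd: "killing_nondeg (UNIV :: 'g set)" and e0: "e ~= 0" and nil: "ad_nilpotent e" "ad_nilpotent f"
  and s: "s = x *. e + y *. h + z *. f" "s ~= 0" "diagonalizable_on UNIV s"
 shows "EX \<phi>:nil_group. EX d. d ~= 0 & \<phi> s = d *. h & (ALL w. ad e w = 0 & ad f w = 0 --> \<phi> w = w)"
proof -
 have disc: "y * y + x * z ~= 0"
 proof
  assume z0: "y * y + x * z = 0"
  have "ad s (a *. e + b *. h + c *. f) = 0" for a b c
  proof -
   let ?v = "a *. e + b *. h + c *. f"
   let ?a1 = "2 * (y * a - x * b)" and ?b1 = "x * c - z * a" and ?c1 = "2 * (z * b - y * c)"
   let ?a2 = "2 * (y * ?a1 - x * ?b1)" and ?b2 = "x * ?c1 - z * ?a1" and ?c2 = "2 * (z * ?b1 - y * ?c1)"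
   have "ad s (ad s (ad s ?v))
     = (2 * (y * ?a2 - x * ?b2)) *. e + (x * ?c2 - z * ?a2) *. h + (2 * (z * ?b2 - y * ?c2)) *. f"
    unfolding s(1) comb_bracket ..
   moreover have "2 * (y * ?a2 - x * ?b2) = 0" using z0 by algebra
   moreover have "x * ?c2 - z * ?a2 = 0" using z0 by algebra
   moreover have "2 * (z * ?b2 - y * ?c2) = 0" using z0 by algebra
   ultimately have "ad s (ad s (ad s ?v)) = 0" by simp
   hence "gen_eig (ad s) 0 ?v" unfolding gen_eig_0_iff
    by (intro exI[of _ 3]) (simp add: numeral_3_eq_3)
   thus ?thesis using diagonalizable_gen_eig[OF nd UNIV_I s(3) UNIV_I] by simp
  qed
  from this[of 1 0 0] this[of 0 0 1] have "ad s e = 0" "ad s f = 0" by simp_all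
  moreover have "ad s e = 0 *. e + (- z) *. h + 0 *. f + (2 * y) *. e"
   using comb_bracket[of x y z 1 0 0] unfolding s(1) by (simp add: add_ac)
  moreover have "ad s f = x *. h + (- 2 * y) *. f"
   using comb_bracket[of x y z 0 0 1] unfolding s(1) by simp
  ultimately have A: "(2 * y) *. e + (- z) *. h + 0 *. f = 0"
   and B: "0 *. e + x *. h + (- 2 * y) *. f = 0"
   by (simp_all add: add_ac)
  have "y = 0" "z = 0" "x = 0"
   using comb_eq_0(1,2)[OF e0 A] comb_eq_0(2)[OF e0 B] by simp_all
  thus False using s(1,2) by simp
 qed
 have eh: "ad e h = (-2) *. e" using he bracket_anti[of e h] by (simp add: scale_simps)
 have fh: "ad f h = 2 *. f" using hf bracket_anti[of f h] by (simp add: scale_simps)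
 have ne: "ad_nilpotent (t *. e)" "ad_nilpotent (t *. f)" for t using nil ad_nilpotent_scale by auto
 have expe: "exp_ad (t *. e) (a *. e + b *. h + c *. f)
   = (a - 2 * t * b - t * t * c) *. e + (b + t * c) *. h + c *. f" for t a b c
 proof -
  have 1: "exp_ad (t *. e) e = e" by (rule exp_ad_fixed) (simp add: bracket_simps)
  have 2: "exp_ad (t *. e) h = h + (- 2 * t) *. e"
   by (subst exp_ad_two) (simp_all add: eh bracket_simps scaleC_scaleC mult.commute)
  have 3: "exp_ad (t *. e) f = f + t *. h + (- t * t) *. e"
   by (subst exp_ad_three) (simp_all add: ef eh bracket_simps scaleC_scaleC)
  show ?thesis
   unfolding endo.linear_add[OF exp_ad_lin[OF ne(1)]] endo.linear_scale[OF exp_ad_lin[OF ne(1)]] 1 2 3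
   by (simp add: scale_simps algebra_simps)
 qed
 have expf: "exp_ad (t *. f) (b *. h + c *. f) = b *. h + (c + 2 * t * b) *. f" for t b c
 proof -
  have 1: "exp_ad (t *. f) f = f" by (rule exp_ad_fixed) (simp add: bracket_simps)
  have 2: "exp_ad (t *. f) h = h + (2 * t) *. f"
   by (subst exp_ad_two) (simp_all add: fh bracket_simps scaleC_scaleC mult.commute)
  show ?thesis
   unfolding endo.linear_add[OF exp_ad_lin[OF ne(2)]] endo.linear_scale[OF exp_ad_lin[OF ne(2)]] 1 2
   by (simp add: scale_simps algebra_simps)
 qed
 have fix_e: "exp_ad (t *. e) w = w" if "ad e w = 0" for t w
  by (rule exp_ad_fixed) (simp add: that bracket_simps)
 have fix_f: "exp_ad (t *. f) w = w" if "ad f w = 0" for t w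
  by (rule exp_ad_fixed) (simp add: that bracket_simps)
 show ?thesis
 proof (cases "z = 0")
  case True
  hence y0: "y ~= 0" using disc by auto
  let ?\<phi> = "exp_ad ((x / (2 * y)) *. e)"
  have "?\<phi> s = y *. h" unfolding s(1) expe using True y0 by simp
  moreover have "?\<phi> : nil_group" by (rule nil_group_exp[OF ne(1)])
  ultimately show ?thesis using y0 fix_e by blast
 next
  case False
  define r where "r = csqrt (y * y + x * z)"
  have rr: "r * r = y * y + x * z" unfolding r_def by (metis power2_csqrt power2_eq_square)
  let ?t = "(r - y) / z"
  have "z * (x - 2 * ?t * y - ?t * ?t * z) = x * z - 2 * (r - y) * y - (r - y) * (r - y)"
   using False by (simp add: field_simps)
  also have "... = 0" using rr by algebra
  finally have e1: "x - 2 * ?t * y - ?t * ?t * z = 0" using False by simp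
  have e2: "y + ?t * z = r" using False by simp
  have s1: "exp_ad (?t *. e) s = r *. h + z *. f" unfolding s(1) expe e1 e2 by simp
  have r0: "r ~= 0" using rr disc by auto
  let ?u = "- z / (2 * r)"
  have "exp_ad (?u *. f) (exp_ad (?t *. e) s) = r *. h" unfolding s1 expf using r0 by simp
  hence "(exp_ad (?u *. f) \<circ> exp_ad (?t *. e)) s = r *. h" by simp
  moreover have "exp_ad (?u *. f) \<circ> exp_ad (?t *. e) : nil_group"
   using nil_group_exp ne nil_group_comp by blast
  moreover have "(exp_ad (?u *. f) \<circ> exp_ad (?t *. e)) w = w" if "ad e w = 0" "ad f w = 0" for w
   unfolding o_apply fix_e[OF that(1)] fix_f[OF that(2)] ..
  ultimately show ?thesis using r0 by blast
 qed
qed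

end

section \<open>The root system of type \<open>G\<^sub>2\<close>\<close>

text \<open>The pair \<open>(a, b)\<close> stands for \<open>a \<gamma>\<^sub>0 + b \<gamma>\<^sub>1\<close> with \<open>\<gamma>\<^sub>0\<close> short and \<open>\<gamma>\<^sub>1\<close> long.\<close>

definition g2_roots :: "(int \<times> int) set" where
 "g2_roots = set [(1,0),(0,1),(1,1),(2,1),(3,1),(3,2),(-1,0),(0,-1),(-1,-1),(-2,-1),(-3,-1),(-3,-2)]"

definition g2_pos :: "(int \<times> int) set" where
 "g2_pos = set [(1,0),(0,1),(1,1),(2,1),(3,1),(3,2)]"

text \<open>Squared length, 1 for short and 3 for long roots.\<close>

definition sqlen :: "int \<times> int => int" where
 "sqlen r = fst r * fst r - 3 * fst r * snd r + 3 * snd r * snd r"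

text \<open>Values at the coroots of \<open>\<gamma>\<^sub>0\<close> and \<open>\<gamma>\<^sub>1\<close>.\<close>

definition pair0 :: "int \<times> int => int" where "pair0 r = 2 * fst r - 3 * snd r"
definition pair1 :: "int \<times> int => int" where "pair1 r = 2 * snd r - fst r"

text \<open>Coordinates of the coroot of \<open>r\<close>; the divisions are exact.\<close>

definition co0 :: "int \<times> int => int" where "co0 r = fst r div sqlen r"
definition co1 :: "int \<times> int => int" where "co1 r = (3 * snd r) div sqlen r"

definition cartan_int :: "int \<times> int => int \<times> int => int" where
 "cartan_int r s = co0 r * pair0 s + co1 r * pair1 s"

definition rneg :: "int \<times> int => int \<times> int" where "rneg r = (- fst r, - snd r)"
definition radd :: "int \<times> int => int \<times> int => int \<times> int" where
 "radd r s = (fst r + fst s, snd r + snd s)"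

lemmas g2_defs = g2_roots_def g2_pos_def sqlen_def pair0_def pair1_def co0_def co1_def
 cartan_int_def rneg_def radd_def

lemma g2_basic:
 "ALL r:g2_roots. rneg r : g2_roots & rneg (rneg r) = r & (r : g2_pos | rneg r : g2_pos) &
   ~ (r : g2_pos & rneg r : g2_pos) &
   (sqlen r = 1 | sqlen r = 3) & sqlen (rneg r) = sqlen r & r ~= (0,0) & rneg r ~= r &
   co0 (rneg r) = - co0 r & co1 (rneg r) = - co1 r & cartan_int r r = 2 &
   co0 r * sqlen r = fst r & co1 r * sqlen r = 3 * snd r"
 by code_simp

lemma g2_reflect: "ALL r:g2_roots. (3 * snd r - fst r, snd r) : g2_roots & (fst r, fst r - snd r) : g2_roots"
 by code_simp

lemma g2_long_pairs:
 "ALL r:g2_roots. sqlen r = 3 --> (ALL s:g2_roots. cartan_int r s : set [-2,-1,0,1,2] &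
   (cartan_int r s = 2 --> s = r) & (cartan_int r s = -2 --> s = rneg r))"
 by code_simp

lemma g2_pairs_separate:
 "ALL r:g2_roots. ALL s:g2_roots. pair0 r = pair0 s & pair1 r = pair1 s --> r = s"
 by code_simp

lemma g2_pairs_nonzero: "ALL r:g2_roots. pair0 r ~= 0 | pair1 r ~= 0"
 by code_simp

lemma g2_orthogonal:
 "ALL r:g2_roots. ALL s:g2_roots. cartan_int r s = 0 --> cartan_int s r = 0 & radd r s ~: g2_roots &
   radd r s ~= (0,0) & sqlen r + sqlen s = 4 & co0 r * co1 s - co1 r * co0 s ~= 0 &
   (ALL t:g2_roots. cartan_int r t = 0 --> t = s | t = rneg s)"
 by code_simp

text \<open>The Lie algebra structure attached to a Cartan subalgebra: coroots \<open>h0, h1\<close> of the simple roots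
 and normalized root vectors \<open>E r\<close>.\<close>

definition g2_frame :: "'g::complex_lie_algebra => 'g => (int \<times> int => 'g) => bool" where
 "g2_frame h0 h1 E \<longleftrightarrow> ad h0 h1 = 0 &
   (ALL r:g2_roots. E r ~= 0 & ad h0 (E r) = of_int (pair0 r) *. E r &
    ad h1 (E r) = of_int (pair1 r) *. E r &
    ad (E r) (E (rneg r)) = of_int (co0 r) *. h0 + of_int (co1 r) *. h1) &
   (ALL r:g2_roots. ALL s:g2_roots. radd r s : g2_roots --> ad (E r) (E s) ~= 0) &
   UNIV \<subseteq> lie.span ({h0, h1} \<union> E ` g2_roots)"

lemma g2_frame_aut:
 assumes "g2_frame h0 h1 E" and \<phi>: "lie_aut \<phi>"
 shows "g2_frame (\<phi> h0) (\<phi> h1) (%r. \<phi> (E r))"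
proof -
 note d = lie_autD[OF \<phi>]
 have "UNIV = \<phi> ` UNIV" using d(2) by (simp add: bij_is_surj)
 also have "... \<subseteq> \<phi> ` lie.span ({h0, h1} \<union> E ` g2_roots)"
  using assms(1) unfolding g2_frame_def by (intro image_mono) blast
 also have "... = lie.span (\<phi> ` ({h0, h1} \<union> E ` g2_roots))" by (rule lie_aut_span[OF \<phi>])
 also have "\<phi> ` ({h0, h1} \<union> E ` g2_roots) = {\<phi> h0, \<phi> h1} \<union> (%r. \<phi> (E r)) ` g2_roots" by auto
 finally have "UNIV \<subseteq> lie.span ({\<phi> h0, \<phi> h1} \<union> (%r. \<phi> (E r)) ` g2_roots)" .
 thus ?thesis using assms(1) unfolding g2_frame_def
  by (simp only: d(3)[symmetric] d(4)[symmetric] d(5)[symmetric] d(6)) simp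
qed

lemma span_pair: "v : lie.span {a, b} \<longleftrightarrow> (EX x y. v = x *. a + y *. (b :: 'g::complex_lie_algebra))"
proof
 assume "v : lie.span {a, b}"
 then obtain x where "v - x *. a : lie.span {b}" using lie.span_breakdown_eq by blast
 then obtain y where "v - x *. a = y *. b" using lie.span_singleton by auto
 hence "v = x *. a + y *. b" by (simp add: algebra_simps)
 thus "EX x y. v = x *. a + y *. b" by blast
next
 have "a : lie.span {a, b}" "b : lie.span {a, b}" by (simp_all add: lie.span_base)
 hence "x *. a + y *. b : lie.span {a, b}" for x y by (intro lie.span_add lie.span_scale)
 moreover assume "EX x y. v = x *. a + y *. b"
 ultimately show "v : lie.span {a, b}" by blast
qed

text \<open>From the Cartan matrix to the full structure. The roots are found by reflecting the simple roots;
 conversely a positive root with both coefficients positive is lowered by a simple reflection.\<close>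

theorem g2_frame_exists:
 assumes simple: "simple_lie (UNIV :: 'g::complex_lie_algebra set)"
  and type: "of_type (UNIV :: 'g set) type_G2"
 shows "killing_nondeg (UNIV :: 'g set)"
  and "EX h0 h1 (E :: int \<times> int => 'g). g2_frame h0 h1 E & cartan_subalgebra UNIV (lie.span {h0, h1})"
proof -
 have len: "length type_G2 = 2" by (simp add: type_G2_def)
 obtain H :: "'g set" and \<gamma> where C: "cartan_subalgebra UNIV H" and ss: "simple_system UNIV H 2 \<gamma>"
  and A: "!!i j. i < 2 ==> j < 2 ==> \<gamma> i (coroot UNIV H (\<gamma> j)) = of_int (type_G2 ! i ! j)"
  using type unfolding of_type_def len by blast
 define g0 where "g0 = \<gamma> 0"
 define g1 where "g1 = \<gamma> 1"
 have g: "g0 : roots UNIV H" "g1 : roots UNIV H"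
  using ss unfolding simple_system_def g0_def g1_def by auto
 show nd: "killing_nondeg (UNIV :: 'g set)"
 proof -
  have "g0 : dual_space H" "g0 ~= (%_. 0)" "root_space UNIV H g0 ~= {0}" using g(1) unfolding roots_def by auto
  moreover obtain h where h: "h : H" "g0 h ~= 0"
   using dual_space_eqI[OF calculation(1) dual_space_zero] calculation(2) by blast
  moreover obtain v where "v : root_space UNIV H g0" "v ~= 0"
   using calculation(3) lie.subspace_0[OF root_space_subspace[OF lie.subspace_UNIV, of H g0]] by blast
  ultimately show ?thesis
   using killing_nondeg_simple[OF simple UNIV_I UNIV_I, of v h "g0 h"] unfolding root_space_def by blast
 qed
 interpret c: cartan_pair "UNIV :: 'g set" H by unfold_locales (rule nd, rule C)
 let ?h0 = "c.hroot g0" and ?h1 = "c.hroot g1"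
 have h01: "?h0 : H" "?h1 : H" using c.hroot(1) g by auto
 have v00: "g0 ?h0 = 2" and v11: "g1 ?h1 = 2" by (rule c.hroot(2)[OF g(1)], rule c.hroot(2)[OF g(2)])
 have v01: "g0 ?h1 = - 1" using A[of 0 1] unfolding g0_def[symmetric] g1_def[symmetric] c.coroot_eq[OF g(2)] by (simp add: type_G2_def)
 have v10: "g1 ?h0 = - 3" using A[of 1 0] unfolding g0_def[symmetric] g1_def[symmetric] c.coroot_eq[OF g(1)] by (simp add: type_G2_def)
 define rt where "rt r = (%x. of_int (fst r) * g0 x + of_int (snd r) * g1 x)" for r
 have rt_dual: "rt r : dual_space H" for r
  unfolding rt_def by (rule dual_space_combine[OF c.roots_dual[OF g(1)] c.roots_dual[OF g(2)]])
 have rt0: "rt r ?h0 = of_int (pair0 r)" and rt1: "rt r ?h1 = of_int (pair1 r)" for r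
  unfolding rt_def v00 v01 v10 v11 pair0_def pair1_def by simp_all
 have refl0: "rt (3 * b - a, b) : roots UNIV H" if "rt (a, b) : roots UNIV H" for a b
 proof -
  have "(%h. rt (a, b) h - rt (a, b) ?h0 * g0 h) = rt (3 * b - a, b)"
   unfolding rt0 by (simp add: rt_def pair0_def fun_eq_iff algebra_simps)
  thus ?thesis using c.reflection[OF g(1) that] by simp
 qed
 have refl1: "rt (a, a - b) : roots UNIV H" if "rt (a, b) : roots UNIV H" for a b
 proof -
  have "(%h. rt (a, b) h - rt (a, b) ?h1 * g1 h) = rt (a, a - b)"
   unfolding rt1 by (simp add: rt_def pair1_def fun_eq_iff algebra_simps)
  thus ?thesis using c.reflection[OF g(2) that] by simp
 qed
 have rt_neg: "rt (rneg r) = (%x. - rt r x)" for r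
  by (simp add: rt_def rneg_def fun_eq_iff)
 have rt10: "rt (1, 0) = g0" and rt01: "rt (0, 1) = g1" by (simp_all add: rt_def fun_eq_iff)
 have pos: "rt r : roots UNIV H" if "r : g2_pos" for r
 proof -
  have 1: "rt (1, 0) : roots UNIV H" "rt (0, 1) : roots UNIV H" using g rt10 rt01 by simp_all
  have 2: "rt (1, 1) : roots UNIV H" using refl1[OF 1(1)] by simp
  have 3: "rt (2, 1) : roots UNIV H" using refl0[OF 2] by simp
  have 4: "rt (3, 1) : roots UNIV H" using refl0[OF 1(2)] by simp
  have 5: "rt (3, 2) : roots UNIV H" using refl1[OF 4] by simp
  show ?thesis using that 1 2 3 4 5 unfolding g2_pos_def by auto
 qed
 have isroot: "rt r : roots UNIV H" if r: "r : g2_roots" for r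
 proof (cases "r : g2_pos")
  case False
  hence "rneg r : g2_pos" "rneg (rneg r) = r" using g2_basic r by auto
  thus ?thesis using c.neg_root[OF pos, of "rneg r"] rt_neg[of "rneg r"] by simp
 qed (rule pos)
 have coeffs: "EX k :: nat => nat. (ALL x:H. \<alpha> x = of_nat (k 0) * g0 x + of_nat (k 1) * g1 x) |
   (ALL x:H. \<alpha> x = - (of_nat (k 0) * g0 x + of_nat (k 1) * g1 x))" if "\<alpha> : roots UNIV H" for \<alpha>
  using ss that unfolding simple_system_def by (simp add: numeral_2_eq_2 g0_def g1_def)
 have sign: "(a >= 0 & b >= 0) | (a <= 0 & b <= 0)" if ab: "rt (a, b) : roots UNIV H" for a b
 proof -
  obtain k :: "nat => nat" where k: "(ALL x:H. rt (a, b) x = of_nat (k 0) * g0 x + of_nat (k 1) * g1 x) |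
   (ALL x:H. rt (a, b) x = - (of_nat (k 0) * g0 x + of_nat (k 1) * g1 x))" using coeffs[OF ab] by blast
  let ?k = "(int (k 0), int (k 1))"
  have "(ALL x:H. rt (a, b) x = rt ?k x) | (ALL x:H. rt (a, b) x = rt (rneg ?k) x)"
   using k by (simp add: rt_def rneg_def)
  hence "(pair0 (a, b) = pair0 ?k & pair1 (a, b) = pair1 ?k) |
    (pair0 (a, b) = pair0 (rneg ?k) & pair1 (a, b) = pair1 (rneg ?k))"
   using h01 rt0 rt1 by (metis of_int_eq_iff)
  thus ?thesis unfolding pair0_def pair1_def rneg_def by auto
 qed
 have list: "(a, b) : g2_roots" if "rt (a, b) : roots UNIV H" "a >= 0" "b >= 0" for a b
  using that
 proof (induction "nat (a + b)" arbitrary: a b rule: less_induct)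
  case less
  consider "b = 0" | "a = 0" | "a > 0" "b > 0" using less.prems by linarith
  thus ?case
  proof cases
   case 1
   hence "rt (a, b) = g0 | rt (a, b) = c.neg g0"
    by (intro c.proportional_roots[OF g(1) less.prems(1), of "of_int a"]) (simp add: rt_def)
   hence "rt (a, b) ?h0 = 2 | rt (a, b) ?h0 = - 2" using v00 by auto
   hence "of_int (2 * a) = (of_int 2 :: complex) | of_int (2 * a) = (of_int (-2) :: complex)"
    unfolding rt0 pair0_def using 1 by simp
   hence "a = 1" using less.prems(2) unfolding of_int_eq_iff by auto
   thus ?thesis using 1 by (simp add: g2_roots_def)
  next
   case 2
   hence "rt (a, b) = g1 | rt (a, b) = c.neg g1"
    by (intro c.proportional_roots[OF g(2) less.prems(1), of "of_int b"]) (simp add: rt_def)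
   hence "rt (a, b) ?h1 = 2 | rt (a, b) ?h1 = - 2" using v11 by auto
   hence "of_int (2 * b) = (of_int 2 :: complex) | of_int (2 * b) = (of_int (-2) :: complex)"
    unfolding rt1 pair1_def using 2 by simp
   hence "b = 1" using less.prems(3) unfolding of_int_eq_iff by auto
   thus ?thesis using 2 by (simp add: g2_roots_def)
  next
   case 3
   then consider "2 * a > 3 * b" | "2 * b > a" by linarith
   thus ?thesis
   proof cases
    case 1
    have r: "rt (3 * b - a, b) : roots UNIV H" by (rule refl0[OF less.prems(1)])
    have ge: "3 * b - a >= 0" using sign[OF r] 3 by auto
    have "(3 * b - a, b) : g2_roots" by (rule less.hyps[OF _ r ge]) (use 1 3 ge in auto)
    thus ?thesis using g2_reflect by fastforce
   next
    case 2
    have r: "rt (a, a - b) : roots UNIV H" by (rule refl1[OF less.prems(1)])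
    have ge: "a - b >= 0" using sign[OF r] 3 by auto
    have "(a, a - b) : g2_roots" by (rule less.hyps[OF _ r _ ge]) (use 2 3 ge in auto)
    thus ?thesis using g2_reflect by fastforce
   qed
  qed
 qed
 have all: "EX r:g2_roots. \<alpha> = rt r" if \<alpha>: "\<alpha> : roots UNIV H" for \<alpha>
 proof -
  obtain k :: "nat => nat" where k: "(ALL x:H. \<alpha> x = of_nat (k 0) * g0 x + of_nat (k 1) * g1 x) |
   (ALL x:H. \<alpha> x = - (of_nat (k 0) * g0 x + of_nat (k 1) * g1 x))" using coeffs[OF \<alpha>] by blast
  let ?k = "(int (k 0), int (k 1))"
  from k show ?thesis
  proof
   assume "ALL x:H. \<alpha> x = of_nat (k 0) * g0 x + of_nat (k 1) * g1 x"
   hence "\<alpha> = rt ?k" by (intro dual_space_eqI[OF c.roots_dual[OF \<alpha>] rt_dual]) (simp add: rt_def)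
   thus ?thesis using list[of "int (k 0)" "int (k 1)"] \<alpha> by auto
  next
   assume "ALL x:H. \<alpha> x = - (of_nat (k 0) * g0 x + of_nat (k 1) * g1 x)"
   hence eq: "\<alpha> = rt (rneg ?k)" by (intro dual_space_eqI[OF c.roots_dual[OF \<alpha>] rt_dual]) (simp add: rt_def rneg_def)
   hence "rt ?k : roots UNIV H" using c.neg_root[OF \<alpha>] rt_neg[of ?k] by simp
   hence "?k : g2_roots" using list by simp
   thus ?thesis using eq g2_basic by blast
  qed
 qed
 have Heq: "H = lie.span {?h0, ?h1}"
 proof
  show "lie.span {?h0, ?h1} \<subseteq> H" using h01 by (intro lie.span_minimal c.NH(1)) auto
  show "H \<subseteq> lie.span {?h0, ?h1}"
  proof
   fix h assume h: "h : H"
   let ?x = "2 * g0 h + g1 h" and ?y = "3 * g0 h + 2 * g1 h"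
   let ?d = "h - (?x *. ?h0 + ?y *. ?h1)"
   have dH: "?d : H" using h h01 c.NH(1) by (intro lie.subspace_diff lie.subspace_add lie.subspace_scale)
   have lin: "\<alpha> ?d = \<alpha> h - (?x * \<alpha> ?h0 + ?y * \<alpha> ?h1)" if "\<alpha> : roots UNIV H" for \<alpha>
   proof -
    have s: "?x *. ?h0 : H" "?y *. ?h1 : H"
     by (rule lie.subspace_scale[OF c.NH(1) h01(1)], rule lie.subspace_scale[OF c.NH(1) h01(2)])
    have e: "?d + (?x *. ?h0 + ?y *. ?h1) = h" by (rule diff_add_cancel)
    have "\<alpha> h = \<alpha> ?d + \<alpha> (?x *. ?h0 + ?y *. ?h1)"
     using c.root_add[OF c.roots_dual[OF that] dH lie.subspace_add[OF c.NH(1) s]] unfolding e .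
    also have "\<alpha> (?x *. ?h0 + ?y *. ?h1) = \<alpha> (?x *. ?h0) + \<alpha> (?y *. ?h1)"
     by (rule c.root_add[OF c.roots_dual[OF that] s])
    also have "\<alpha> (?x *. ?h0) = ?x * \<alpha> ?h0" by (rule c.root_scale[OF c.roots_dual[OF that] h01(1)])
    also have "\<alpha> (?y *. ?h1) = ?y * \<alpha> ?h1" by (rule c.root_scale[OF c.roots_dual[OF that] h01(2)])
    finally show ?thesis by simp
   qed
   have "g0 ?d = 0" "g1 ?d = 0" using lin[OF g(1)] lin[OF g(2)] v00 v01 v10 v11 by simp_all
   hence "\<alpha> ?d = 0" if "\<alpha> : roots UNIV H" for \<alpha> using all[OF that] by (auto simp: rt_def)
   hence "?d = 0" by (rule c.roots_separate_H[OF dH])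
   hence "h = ?x *. ?h0 + ?y *. ?h1" by simp
   thus "h : lie.span {?h0, ?h1}" using span_pair by blast
  qed
 qed
 let ?k = "killing_form (UNIV :: 'g set)"
 let ?p0 = "?k ?h0 ?h0 / 2" and ?p1 = "?k ?h1 ?h1 / 2"
 have k0: "?k ?h0 x = ?p0 * g0 x" and k1: "?k ?h1 x = ?p1 * g1 x" if "x : H" for x
  using c.\<kappa>_hroot[OF g(1) that] c.\<kappa>_hroot[OF g(2) that] by (simp_all add: field_simps)
 have "?p0 * (- 1) = ?p1 * (- 3)"
  by (rule trans[OF trans[OF k0[OF h01(2), unfolded v01, symmetric] killing_UNIV_sym]
     k1[OF h01(1), unfolded v10]])
 hence p: "?p0 = 3 * ?p1" by simp
 have hr: "c.hroot (rt r) = of_int (co0 r) *. ?h0 + of_int (co1 r) *. ?h1" if r: "r : g2_roots" for r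
 proof -
  let ?hh = "of_int (co0 r) *. ?h0 + of_int (co1 r) *. ?h1"
  have hH: "?hh : H" using h01 c.NH(1) by (intro lie.subspace_add lie.subspace_scale)
  have co: "co0 r * sqlen r = fst r" "co1 r * sqlen r = 3 * snd r" "cartan_int r r = 2"
   "sqlen r = 1 | sqlen r = 3" using g2_basic r by auto
  have sH: "of_int (co0 r) *. ?h0 : H" "of_int (co1 r) *. ?h1 : H"
   by (rule lie.subspace_scale[OF c.NH(1) h01(1)], rule lie.subspace_scale[OF c.NH(1) h01(2)])
  have "rt r ?hh = of_int (co0 r) * rt r ?h0 + of_int (co1 r) * rt r ?h1"
   using c.root_add[OF rt_dual sH] c.root_scale[OF rt_dual] h01 by simp
  also have "... = of_int (cartan_int r r)" unfolding rt0 rt1 cartan_int_def by simp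
  finally have two: "rt r ?hh = 2" using co(3) by simp
  have e0: "of_int (3 * co0 r) = (3 / of_int (sqlen r) * of_int (fst r) :: complex)"
   unfolding co(1)[symmetric] using co(4) by auto
  have "of_int (co1 r * sqlen r) = (of_int (3 * snd r) :: complex)" using co(2) by simp
  hence e1: "of_int (co1 r) = (3 / of_int (sqlen r) * of_int (snd r) :: complex)"
   using co(4) by (auto simp: field_simps)
  have "?k ?hh x = (?p1 * 3 / of_int (sqlen r)) * rt r x" if x: "x : H" for x
  proof -
   have "?k ?hh x = of_int (co0 r) * (?p0 * g0 x) + of_int (co1 r) * (?p1 * g1 x)"
    unfolding killing_UNIV k0[OF x] k1[OF x] ..
   also have "... = ?p1 * (of_int (3 * co0 r) * g0 x + of_int (co1 r) * g1 x)"
    unfolding p by (simp add: algebra_simps)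
   also have "... = (?p1 * 3 / of_int (sqlen r)) * rt r x"
    unfolding e0 e1 rt_def by (simp add: distrib_left mult.assoc)
   finally show ?thesis .
  qed
  thus ?thesis using c.hroot_eqI[OF isroot[OF r] hH two] by metis
 qed
 have "EX P. ALL r:g2_pos. fst (P r) : c.RS (rt r) & fst (P r) ~= 0 & snd (P r) : c.RS (c.neg (rt r)) &
   sl2 (fst (P r)) (c.hroot (rt r)) (snd (P r)) & snd (P r) ~= 0"
 proof (rule bchoice, rule ballI)
  fix r assume r: "r : g2_pos"
  obtain e where e: "e : c.RS (rt r)" "e ~= 0" using c.root_vector[OF pos[OF r]] by blast
  obtain f where f: "f : c.RS (c.neg (rt r))" "sl2 e (c.hroot (rt r)) f" "?k e f ~= 0"
   using c.triple[OF pos[OF r] e] by blast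
  have "f ~= 0" using f(3) by auto
  thus "EX P. fst P : c.RS (rt r) & fst P ~= 0 & snd P : c.RS (c.neg (rt r)) &
   sl2 (fst P) (c.hroot (rt r)) (snd P) & snd P ~= 0"
   using e f by (intro exI[of _ "(e, f)"]) simp
 qed
 then obtain P where P: "!!r. r : g2_pos ==> fst (P r) : c.RS (rt r) & fst (P r) ~= 0 & snd (P r) : c.RS (c.neg (rt r)) &
   sl2 (fst (P r)) (c.hroot (rt r)) (snd (P r)) & snd (P r) ~= 0" by blast
 have Psl: "sl2 (fst (P r)) (c.hroot (rt r)) (snd (P r))" if "r : g2_pos" for r
  using P[OF that] by blast
 define E where "E r = (if r : g2_pos then fst (P r) else snd (P (rneg r)))" for r
 have ER: "E r : c.RS (rt r) & E r ~= 0" if r: "r : g2_roots" for r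
 proof (cases "r : g2_pos")
  case False
  hence n: "rneg r : g2_pos" "rneg (rneg r) = r" using g2_basic r by auto
  hence "c.neg (rt (rneg r)) = rt r" using rt_neg[of "rneg r"] by simp
  thus ?thesis using P[OF n(1)] False unfolding E_def by simp
 qed (use P in \<open>simp add: E_def\<close>)
 have EE: "ad (E r) (E (rneg r)) = of_int (co0 r) *. ?h0 + of_int (co1 r) *. ?h1" if r: "r : g2_roots" for r
 proof (cases "r : g2_pos")
  case True
  hence "rneg r ~: g2_pos" "rneg (rneg r) = r" using g2_basic r by auto
  hence "ad (E r) (E (rneg r)) = c.hroot (rt r)"
   using sl2.ef[OF Psl[OF True]] unfolding E_def by (simp add: True)
  thus ?thesis using hr[OF r] by simp
 next
  case False
  hence n: "rneg r : g2_pos" "rneg (rneg r) = r" "rneg r : g2_roots"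
   "co0 (rneg r) = - co0 r" "co1 (rneg r) = - co1 r" using g2_basic r by auto
  have "ad (E r) (E (rneg r)) = - c.hroot (rt (rneg r))"
   using sl2.fe[OF Psl[OF n(1)]] False n(1) unfolding E_def by simp
  thus ?thesis unfolding hr[OF n(3)] n(4,5) by (simp add: scale_simps)
 qed
 have "g2_frame ?h0 ?h1 E"
  unfolding g2_frame_def
 proof (intro conjI ballI impI)
  show "ad ?h0 ?h1 = 0" by (rule c.abelian[OF h01])
  fix r assume r: "r : g2_roots"
  show "E r ~= 0" using ER[OF r] by blast
  show "ad ?h0 (E r) = of_int (pair0 r) *. E r" using c.RSD[OF _ h01(1), of "E r"] ER[OF r] rt0 by metis
  show "ad ?h1 (E r) = of_int (pair1 r) *. E r" using c.RSD[OF _ h01(2), of "E r"] ER[OF r] rt1 by metis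
  show "ad (E r) (E (rneg r)) = of_int (co0 r) *. ?h0 + of_int (co1 r) *. ?h1" by (rule EE[OF r])
  fix s assume s: "s : g2_roots" and rs: "radd r s : g2_roots"
  have "E (radd r s) : c.RS (rt (radd r s))" "E (radd r s) ~= 0" using ER[OF rs] by auto
  moreover have "rt (radd r s) = (%h. rt r h + rt s h)" by (simp add: rt_def radd_def fun_eq_iff algebra_simps)
  ultimately show "ad (E r) (E s) ~= 0"
   using c.bracket_root_vectors[OF isroot[OF r] _ _ isroot[OF s]] ER[OF r] ER[OF s] by metis
 next
  have "H \<union> (UN \<alpha>:roots UNIV H. c.RS \<alpha>) \<subseteq> lie.span ({?h0, ?h1} \<union> E ` g2_roots)"
  proof
   fix x assume "x : H \<union> (UN \<alpha>:roots UNIV H. c.RS \<alpha>)"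
   then consider "x : H" | \<alpha> where "\<alpha> : roots UNIV H" "x : c.RS \<alpha>" by blast
   thus "x : lie.span ({?h0, ?h1} \<union> E ` g2_roots)"
   proof cases
    case 1
    hence "x : lie.span {?h0, ?h1}" using Heq by simp
    thus ?thesis using lie.span_mono[of "{?h0, ?h1}" "{?h0, ?h1} \<union> E ` g2_roots"] by blast
   next
    case 2
    obtain r where r: "r : g2_roots" "\<alpha> = rt r" using all[OF 2(1)] by blast
    obtain d where "x = d *. E r" using c.RS_one_dim[OF 2(1) _ _ 2(2), of "E r"] ER[OF r(1)] r(2) by blast
    thus ?thesis using r(1) by (simp add: lie.span_scale lie.span_base)
   qed
  qed
  hence "lie.span (H \<union> (UN \<alpha>:roots UNIV H. c.RS \<alpha>)) \<subseteq> lie.span ({?h0, ?h1} \<union> E ` g2_roots)"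
   by (rule lie.span_minimal) simp
  thus "UNIV \<subseteq> lie.span ({?h0, ?h1} \<union> E ` g2_roots)" using c.span_H_roots by blast
 qed
 thus "EX h0 h1 (E :: int \<times> int => 'g). g2_frame h0 h1 E & cartan_subalgebra UNIV (lie.span {h0, h1})"
  using C Heq by metis
qed

text \<open>A root whose coroot is shortest pairs to \<open>0, 1, -1\<close> with every root other than \<open>\<plusminus>\<close> itself, by
 Cauchy--Schwarz for the Killing form, which is a sum of squares of integers on coroots.\<close>

lemma long_triple_of_cartan:
 assumes nd: "killing_nondeg (UNIV :: 'g::complex_lie_algebra set)" and C: "cartan_subalgebra UNIV (H :: 'g set)"
  and ne: "roots UNIV H ~= {}"
 obtains \<theta> h e f where "h : H" "\<theta> h = 2" "\<theta> : dual_space H" "e : root_space UNIV H \<theta>"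
  "f : root_space UNIV H (%x. - \<theta> x)" "long_triple e h f"
proof -
 interpret c: cartan_pair "UNIV :: 'g set" H by unfold_locales (rule nd, rule C)
 let ?R = "roots UNIV H"
 define n where "n \<beta> \<alpha> = \<lfloor>Re (\<beta> (c.hroot \<alpha>))\<rfloor>" for \<beta> \<alpha>
 have n: "\<beta> (c.hroot \<alpha>) = of_int (n \<beta> \<alpha>)" if ab: "\<alpha> : ?R" "\<beta> : ?R" for \<alpha> \<beta>
 proof -
  have "c.RS \<beta> ~= {0}" using ab(2) unfolding roots_def by blast
  from c.root_integral[OF ab(1) this] obtain k where k: "\<beta> (c.hroot \<alpha>) = of_int k" by blast
  hence "n \<beta> \<alpha> = k" unfolding n_def by simp
  thus ?thesis using k by simp
 qed
 define X where "X \<alpha> \<beta> = (SUM \<gamma>:?R. n \<gamma> \<alpha> * n \<gamma> \<beta>)" for \<alpha> \<beta>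
 have kX: "c.\<kappa> (c.hroot \<alpha>) (c.hroot \<beta>) = of_int (X \<alpha> \<beta>)" if "\<alpha> : ?R" "\<beta> : ?R" for \<alpha> \<beta>
  unfolding c.\<kappa>_roots[OF c.hroot(1)[OF that(1)] c.hroot(1)[OF that(2)]] X_def of_int_sum
  by (rule sum.cong[OF refl]) (simp add: n that)
 have Xn: "2 * X \<alpha> \<beta> = n \<alpha> \<beta> * X \<alpha> \<alpha>" if "\<alpha> : ?R" "\<beta> : ?R" for \<alpha> \<beta>
 proof -
  have "(of_int (2 * X \<alpha> \<beta>) :: complex) = of_int (n \<alpha> \<beta> * X \<alpha> \<alpha>)"
   using c.\<kappa>_hroot[OF that(1) c.hroot(1)[OF that(2)]] kX[OF that] kX[OF that(1,1)] n[OF that(2,1)] by simp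
  thus ?thesis by (simp only: of_int_eq_iff)
 qed
 have Xsym: "X \<alpha> \<beta> = X \<beta> \<alpha>" for \<alpha> \<beta> unfolding X_def by (simp add: mult.commute)
 have naa: "n \<alpha> \<alpha> = 2" if "\<alpha> : ?R" for \<alpha> unfolding n_def by (simp add: c.hroot(2)[OF that])
 have Xpos: "X \<alpha> \<alpha> > 0" if "\<alpha> : ?R" for \<alpha>
 proof -
  have "n \<alpha> \<alpha> * n \<alpha> \<alpha> <= X \<alpha> \<alpha>"
   unfolding X_def by (rule member_le_sum[OF that _ c.finite_roots]) simp
  thus ?thesis using naa[OF that] by simp
 qed
 have fin: "finite ((%\<alpha>. X \<alpha> \<alpha>) ` ?R)" "(%\<alpha>. X \<alpha> \<alpha>) ` ?R ~= {}" using c.finite_roots ne by simp_all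
 obtain \<theta> where \<theta>: "\<theta> : ?R" "X \<theta> \<theta> = Min ((%\<alpha>. X \<alpha> \<alpha>) ` ?R)" using Min_in[OF fin] by (elim imageE) simp
 have min: "X \<theta> \<theta> <= X \<alpha> \<alpha>" if "\<alpha> : ?R" for \<alpha>
  unfolding \<theta>(2) by (rule Min_le[OF fin(1)]) (rule imageI[OF that])
 have small: "\<bar>n \<alpha> \<theta>\<bar> <= 1" if \<alpha>: "\<alpha> : ?R" "\<alpha> ~= \<theta>" "\<alpha> ~= c.neg \<theta>" for \<alpha>
 proof (rule ccontr)
  assume big: "~ \<bar>n \<alpha> \<theta>\<bar> <= 1"
  let ?m = "n \<alpha> \<theta>" and ?n = "n \<theta> \<alpha>" and ?K = "X \<theta> \<theta>" and ?L = "X \<alpha> \<alpha>"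
  have nm: "?n * ?K = ?m * ?L" using Xn[OF \<theta>(1) \<alpha>(1)] Xn[OF \<alpha>(1) \<theta>(1)] Xsym[of \<alpha> \<theta>] by simp
  have K: "?K > 0" "?K <= ?L" using Xpos[OF \<theta>(1)] min[OF \<alpha>(1)] by auto
  have mn: "?m * ?n >= 4"
  proof (cases "?m >= 2")
   case True
   hence "?m * ?K <= ?n * ?K" unfolding nm using K by (intro mult_left_mono) auto
   hence "?m <= ?n" using K(1) by simp
   thus ?thesis using True mult_mono[of 2 ?m 2 ?n] by simp
  next
   case False
   hence m2: "?m <= -2" using big by auto
   hence "?n * ?K <= ?m * ?K" unfolding nm using K by (intro mult_left_mono_neg) auto
   hence "?n <= ?m" using K(1) by simp
   thus ?thesis using m2 mult_mono[of 2 "- ?m" 2 "- ?n"] by simp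
  qed
  \<comment> \<open>\<open>W\<close> is the Killing square of \<open>2 h\<^sub>\<theta> - m h\<^sub>\<alpha>\<close> and not positive; so this vector vanishes and the roots are proportional.\<close>
  define W where "W = (SUM \<gamma>:?R. (2 * n \<gamma> \<theta> - ?m * n \<gamma> \<alpha>) * (2 * n \<gamma> \<theta> - ?m * n \<gamma> \<alpha>))"
  have "W = (SUM \<gamma>:?R. 4 * (n \<gamma> \<theta> * n \<gamma> \<theta>) - 4 * ?m * (n \<gamma> \<theta> * n \<gamma> \<alpha>) + ?m * ?m * (n \<gamma> \<alpha> * n \<gamma> \<alpha>))"
   unfolding W_def by (rule sum.cong[OF refl]) (simp add: algebra_simps)
  also have "... = 4 * ?K - 4 * ?m * X \<theta> \<alpha> + ?m * ?m * ?L"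
   unfolding X_def sum.distrib sum_subtractf sum_distrib_left ..
  also have "... = 4 * ?K - 2 * ?m * (2 * X \<theta> \<alpha>) + ?m * (?m * ?L)" by (simp add: algebra_simps)
  also have "... = (4 - ?m * ?n) * ?K"
   unfolding Xn[OF \<theta>(1) \<alpha>(1)] nm[symmetric] by (simp add: algebra_simps)
  finally have "W <= 0" using mn K(1) by (simp add: mult_nonpos_nonneg)
  moreover have "W >= 0" unfolding W_def by (rule sum_nonneg) simp
  ultimately have "W = 0" by simp
  hence eq: "2 * n \<gamma> \<theta> = ?m * n \<gamma> \<alpha>" if "\<gamma> : ?R" for \<gamma>
   using sum_nonneg_eq_0_iff[OF c.finite_roots, of "%\<gamma>. (2 * n \<gamma> \<theta> - ?m * n \<gamma> \<alpha>) * (2 * n \<gamma> \<theta> - ?m * n \<gamma> \<alpha>)"] that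
   unfolding W_def by simp
  have tH: "2 *. c.hroot \<theta> : H" "of_int ?m *. c.hroot \<alpha> : H"
   by (rule lie.subspace_scale[OF c.NH(1) c.hroot(1)[OF \<theta>(1)]], rule lie.subspace_scale[OF c.NH(1) c.hroot(1)[OF \<alpha>(1)]])
  have "2 *. c.hroot \<theta> - of_int ?m *. c.hroot \<alpha> = 0"
  proof (rule c.roots_separate_H[OF lie.subspace_diff[OF c.NH(1) tH]])
   fix \<gamma> assume \<gamma>: "\<gamma> : ?R"
   have nH: "(- of_int ?m) *. c.hroot \<alpha> : H" by (rule lie.subspace_scale[OF c.NH(1) c.hroot(1)[OF \<alpha>(1)]])
   have "\<gamma> (2 *. c.hroot \<theta> - of_int ?m *. c.hroot \<alpha>) = \<gamma> (2 *. c.hroot \<theta> + (- of_int ?m) *. c.hroot \<alpha>)"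
    by simp
   also have "... = \<gamma> (2 *. c.hroot \<theta>) + \<gamma> ((- of_int ?m) *. c.hroot \<alpha>)"
    by (rule c.root_add[OF c.roots_dual[OF \<gamma>] tH(1) nH])
   also have "... = 2 * of_int (n \<gamma> \<theta>) - of_int ?m * of_int (n \<gamma> \<alpha>)"
    unfolding c.root_scale[OF c.roots_dual[OF \<gamma>] c.hroot(1)[OF \<theta>(1)]]
     c.root_scale[OF c.roots_dual[OF \<gamma>] c.hroot(1)[OF \<alpha>(1)]] n[OF \<theta>(1) \<gamma>] n[OF \<alpha>(1) \<gamma>] by simp
   also have "... = of_int (2 * n \<gamma> \<theta> - ?m * n \<gamma> \<alpha>)" by simp
   finally show "\<gamma> (2 *. c.hroot \<theta> - of_int ?m *. c.hroot \<alpha>) = 0" using eq[OF \<gamma>] by simp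
  qed
  hence heq: "2 *. c.hroot \<theta> = of_int ?m *. c.hroot \<alpha>" by simp
  have "\<theta> x = (of_int ?m * of_int ?L / (2 * of_int ?K)) * \<alpha> x" if x: "x : H" for x
  proof -
   have "2 * c.\<kappa> (c.hroot \<theta>) x = c.\<kappa> (2 *. c.hroot \<theta>) x" by (simp add: killing_UNIV)
   also have "... = of_int ?m * c.\<kappa> (c.hroot \<alpha>) x" unfolding heq by (simp add: killing_UNIV)
   finally have 1: "2 * c.\<kappa> (c.hroot \<theta>) x = of_int ?m * c.\<kappa> (c.hroot \<alpha>) x" .
   have "\<theta> x * of_int ?K * 2 = 2 * (2 * c.\<kappa> (c.hroot \<theta>) x)"
    unfolding c.\<kappa>_hroot[OF \<theta>(1) x] kX[OF \<theta>(1,1)] by simp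
   also have "... = of_int ?m * (2 * c.\<kappa> (c.hroot \<alpha>) x)" unfolding 1 by simp
   also have "... = of_int ?m * (\<alpha> x * of_int ?L)"
    unfolding c.\<kappa>_hroot[OF \<alpha>(1) x] kX[OF \<alpha>(1,1)] ..
   finally have "\<theta> x * of_int ?K * 2 = of_int ?m * (\<alpha> x * of_int ?L)" .
   thus ?thesis using K(1) by (simp add: field_simps)
  qed
  from c.proportional_roots[OF \<alpha>(1) \<theta>(1) this] consider "\<theta> = \<alpha>" | "\<theta> = c.neg \<alpha>" by blast
  thus False
  proof cases
   case 1
   thus False using \<alpha>(2) by simp
  next
   case 2
   hence "\<alpha> = c.neg \<theta>" by simp
   thus False using \<alpha>(3) by simp
  qed
 qed
 obtain e where e: "e : c.RS \<theta>" "e ~= 0" using c.root_vector[OF \<theta>(1)] by blast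
 obtain f where f: "f : c.RS (c.neg \<theta>)" "sl2 e (c.hroot \<theta>) f" "c.\<kappa> e f ~= 0" using c.triple[OF \<theta>(1) e] by blast
 have f0: "f ~= 0" using f(3) by auto
 let ?h = "c.hroot \<theta>"
 note hH = c.hroot(1)[OF \<theta>(1)] and h2 = c.hroot(2)[OF \<theta>(1)]
 have vals: "\<beta> = \<theta> | \<beta> = c.neg \<theta> | \<beta> ?h : {-1,0,1}" if \<beta>: "\<beta> : dual_space H" "c.RS \<beta> ~= {0}" for \<beta>
 proof -
  consider "\<beta> = (%_. 0)" | "\<beta> : ?R" using c.weights_dichotomy[OF \<beta>] by blast
  thus ?thesis
  proof cases
   case 2
   show ?thesis
   proof (cases "\<beta> = \<theta> | \<beta> = c.neg \<theta>")
    case False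
    hence "\<bar>n \<beta> \<theta>\<bar> <= 1" using small[OF 2] by blast
    hence "n \<beta> \<theta> = -1 | n \<beta> \<theta> = 0 | n \<beta> \<theta> = 1" by auto
    thus ?thesis using n[OF \<theta>(1) 2] by auto
   qed blast
  qed simp
 qed
 have "long_triple e ?h f"
  unfolding long_triple_def
 proof (intro conjI allI impI)
  show "sl2 e ?h f" by (rule f(2))
  show "e ~= 0" by (rule e(2))
  have "(UN \<alpha>:dual_space H. c.RS \<alpha>) \<subseteq> lie.span (UN c:{-2,-1,0,1,2}. {v. ad ?h v = c *. v})"
  proof
   fix v assume "v : (UN \<alpha>:dual_space H. c.RS \<alpha>)"
   then obtain \<beta> where \<beta>: "\<beta> : dual_space H" "v : c.RS \<beta>" by blast
   show "v : lie.span (UN c:{-2,-1,0,1,2}. {v. ad ?h v = c *. v})"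
   proof (cases "v = 0")
    case True
    thus ?thesis by (simp add: lie.span_zero)
   next
    case False
    hence "c.RS \<beta> ~= {0}" using \<beta>(2) by blast
    hence "\<beta> ?h : {-2,-1,0,1,2}" using vals[OF \<beta>(1)] h2 by auto
    thus ?thesis using c.RSD[OF \<beta>(2) hH] by (intro lie.span_base) blast
   qed
  qed
  hence "lie.span (UN \<alpha>:dual_space H. c.RS \<alpha>) \<subseteq> lie.span (UN c:{-2,-1,0,1,2}. {v. ad ?h v = c *. v})"
   by (rule lie.span_minimal) simp
  thus "UNIV \<subseteq> lie.span (UN c:{-2,-1,0,1,2}. {v. ad ?h v = c *. v})" using c.spanning by blast
  fix v
  show "EX a. v = a *. e" if v: "ad ?h v = 2 *. v"
  proof (rule c.RS_one_dim[OF \<theta>(1) e], rule c.eigenvector_in_root_space[OF hH UNIV_I v c.roots_dual[OF \<theta>(1)]])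
   fix \<beta> assume \<beta>: "\<beta> : dual_space H" "c.RS \<beta> ~= {0}" "\<beta> ?h = 2"
   show "\<beta> = \<theta>" using vals[OF \<beta>(1,2)] \<beta>(3) h2 by auto
  qed
  show "EX a. v = a *. f" if v: "ad ?h v = (- 2) *. v"
  proof (rule c.RS_one_dim[OF c.neg_root[OF \<theta>(1)] f(1) f0],
    rule c.eigenvector_in_root_space[OF hH UNIV_I v c.roots_dual[OF c.neg_root[OF \<theta>(1)]]])
   fix \<beta> assume \<beta>: "\<beta> : dual_space H" "c.RS \<beta> ~= {0}" "\<beta> ?h = - 2"
   show "\<beta> = c.neg \<theta>" using vals[OF \<beta>(1,2)] \<beta>(3) h2 by auto
  qed
 qed
 thus thesis using that[OF hH h2 c.roots_dual[OF \<theta>(1)] e(1) f(1)] by blast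
qed

lemma span_triple:
 "v : lie.span {a, b, c} \<longleftrightarrow> (EX x y z. v = x *. a + y *. b + z *. (c :: 'g::complex_lie_algebra))"
proof
 assume "v : lie.span {a, b, c}"
 then obtain x where "v - x *. a : lie.span {b, c}" using lie.span_breakdown_eq by blast
 then obtain y z where "v - x *. a = y *. b + z *. c" using span_pair by blast
 hence "v = x *. a + y *. b + z *. c" by (simp add: algebra_simps)
 thus "EX x y z. v = x *. a + y *. b + z *. c" by blast
next
 have "a : lie.span {a, b, c}" "b : lie.span {a, b, c}" "c : lie.span {a, b, c}" by (simp_all add: lie.span_base)
 hence "x *. a + y *. b + z *. c : lie.span {a, b, c}" for x y z
  by (intro lie.span_add lie.span_scale)
 moreover assume "EX x y z. v = x *. a + y *. b + z *. c"
 ultimately show "v : lie.span {a, b, c}" by blast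
qed

section \<open>The Lie algebra of type \<open>G\<^sub>2\<close> relative to a frame\<close>

locale g2 =
 fixes h0 h1 :: "'g::complex_lie_algebra" and E :: "int \<times> int => 'g"
 assumes simple: "simple_lie (UNIV :: 'g set)" and nd: "killing_nondeg (UNIV :: 'g set)"
  and frame: "g2_frame h0 h1 E" and cartan_span: "cartan_subalgebra UNIV (lie.span {h0, h1})"
begin

abbreviation "HH \<equiv> lie.span {h0, h1}"

sublocale cartan_pair "UNIV :: 'g set" "lie.span {h0, h1}"
 by unfold_locales (rule nd, rule cartan_span)

definition hr :: "int \<times> int => 'g" where
 "hr r = of_int (co0 r) *. h0 + of_int (co1 r) *. h1"

lemma frameD:
 assumes "r : g2_roots"
 shows "E r ~= 0" "ad h0 (E r) = of_int (pair0 r) *. E r" "ad h1 (E r) = of_int (pair1 r) *. E r"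
  "ad (E r) (E (rneg r)) = hr r"
 using frame assms unfolding g2_frame_def hr_def by blast+

lemma frame_span: "UNIV \<subseteq> lie.span ({h0, h1} \<union> E ` g2_roots)"
 using frame unfolding g2_frame_def by blast

lemma EE_nonzero: "r : g2_roots ==> s : g2_roots ==> radd r s : g2_roots ==> ad (E r) (E s) ~= 0"
 using frame unfolding g2_frame_def by blast

lemma h_in: "h0 : HH" "h1 : HH" by (simp_all add: lie.span_base)

lemma comb_in: "x *. h0 + y *. h1 : HH" using span_pair by blast

lemma hr_in: "hr r : HH" unfolding hr_def by (rule comb_in)

lemma comb_E:
 assumes "r : g2_roots"
 shows "ad (x *. h0 + y *. h1) (E r) = (x * of_int (pair0 r) + y * of_int (pair1 r)) *. E r"
 using frameD[OF assms] by (simp add: bracket_simps scale_simps)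

lemma hr_E: "s : g2_roots ==> ad (hr r) (E s) = of_int (cartan_int r s) *. E s"
 unfolding hr_def comb_E cartan_int_def by simp

definition al :: "int \<times> int => 'g => complex" where
 "al r x = (if x : HH then THE c. ad x (E r) = c *. E r else 0)"

lemma al_comb:
 assumes r: "r : g2_roots"
 shows "al r (x *. h0 + y *. h1) = x * of_int (pair0 r) + y * of_int (pair1 r)"
proof -
 have "(THE c. ad (x *. h0 + y *. h1) (E r) = c *. E r) = x * of_int (pair0 r) + y * of_int (pair1 r)"
  unfolding comb_E[OF r] using frameD(1)[OF r] by (intro the_equality) auto
 thus ?thesis unfolding al_def using comb_in by simp
qed

lemma al_E: "r : g2_roots ==> x : HH ==> ad x (E r) = al r x *. E r"
 using al_comb comb_E span_pair by metis

lemma al_dual: "r : g2_roots ==> al r : dual_space HH"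
proof -
 assume r: "r : g2_roots"
 have u: "a = b" if "a *. E r = b *. E r" for a b
  using lie.scale_right_imp_eq[OF frameD(1)[OF r] that] .
 have "al r (x + y) = al r x + al r y" if "x : HH" "y : HH" for x y
  by (rule u) (simp only: al_E[OF r lie.span_add[OF that], symmetric] bracket_add_left al_E[OF r] that scaleC_add_left)
 moreover have "al r (c *. x) = c * al r x" if "x : HH" for x c
  by (rule u) (simp only: al_E[OF r lie.span_scale[OF that], symmetric] bracket_scaleC_left al_E[OF r] that scaleC_scaleC)
 moreover have "al r x = 0" if "x ~: HH" for x using that unfolding al_def by simp
 ultimately show ?thesis unfolding dual_space_def by blast
qed

lemma E_RS: "r : g2_roots ==> E r : RS (al r)"
 unfolding root_space_def using al_E by blast

lemma al_h: "r : g2_roots ==> al r h0 = of_int (pair0 r)" "r : g2_roots ==> al r h1 = of_int (pair1 r)"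
 using al_comb[of r 1 0] al_comb[of r 0 1] by simp_all

lemma al_hr: "s : g2_roots ==> al s (hr r) = of_int (cartan_int r s)"
 unfolding hr_def al_comb cartan_int_def by simp

lemma al_root: "r : g2_roots ==> al r : roots UNIV HH"
proof -
 assume r: "r : g2_roots"
 have "al r (hr r) ~= 0" using al_hr[OF r] g2_basic r by simp
 thus ?thesis by (rule rootI[OF al_dual[OF r] E_RS[OF r] frameD(1)[OF r] hr_in])
qed

lemma al_inj: "r : g2_roots ==> s : g2_roots ==> al r = al s ==> r = s"
 using al_h[of r] al_h[of s] g2_pairs_separate by (metis of_int_eq_iff)

lemma al_neg: "r : g2_roots ==> al (rneg r) = neg (al r)"
proof -
 assume r: "r : g2_roots"
 hence nr: "rneg r : g2_roots" using g2_basic by blast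
 have p: "pair0 (rneg r) = - pair0 r" "pair1 (rneg r) = - pair1 r" by (simp_all add: pair0_def pair1_def rneg_def)
 show ?thesis
 proof (rule dual_space_eqI[OF al_dual[OF nr] dual_space_uminus[OF al_dual[OF r]]])
  fix h assume "h : HH"
  then obtain x y where h: "h = x *. h0 + y *. h1" using span_pair by blast
  show "al (rneg r) h = - al r h" unfolding h al_comb[OF nr] al_comb[OF r] p by simp
 qed
qed

text \<open>Components of an element along \<open>H\<close> and the root vectors; \<open>(0, 0)\<close> stands for the zero weight.\<close>

lemma component:
 assumes U: "lie.subspace U" "!!h u. h : HH ==> u : U ==> ad h u : U"
  and z: "z : HH" and mem: "z + (SUM r:g2_roots. x r *. E r) : U"
 shows "z : U" "r : g2_roots ==> x r *. E r : U"
proof -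
 let ?F = "insert (0, 0) g2_roots"
 let ?v = "%r. if r = (0, 0) then z else x r *. E r"
 let ?wt = "%r h. if r = (0, 0) then 0 else al r h"
 have fin: "finite g2_roots" by (simp add: g2_roots_def)
 have z0: "(0, 0) ~: g2_roots" using g2_basic by blast
 have "(SUM r:?F. ?v r) = z + (SUM r:g2_roots. ?v r)" using fin z0 by simp
 also have "(SUM r:g2_roots. ?v r) = (SUM r:g2_roots. x r *. E r)" using z0 by (intro sum.cong) auto
 finally have s: "(SUM r:?F. ?v r) : U" using mem by simp
 have *: "?v r : U" if r: "r : ?F" for r
 proof (rule joint_component[where wt = ?wt and H = HH and F = ?F and v = ?v, OF _ _ _ U s r])
  fix r s assume rs: "r : ?F" "s : ?F" "r ~= s"
  define q0 where "q0 t = (if t = (0, 0) then 0 else pair0 t)" for t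
  define q1 where "q1 t = (if t = (0, 0) then 0 else pair1 t)" for t
  have w: "?wt t h0 = of_int (q0 t)" "?wt t h1 = of_int (q1 t)" if "t : ?F" for t
   using that al_h[of t] unfolding q0_def q1_def by auto
  have nz: "pair0 t ~= 0 | pair1 t ~= 0" if "t : g2_roots" for t using g2_pairs_nonzero that by blast
  have "q0 r ~= q0 s | q1 r ~= q1 s"
  proof (cases "r = (0, 0) | s = (0, 0)")
   case True
   thus ?thesis using rs nz[of r] nz[of s] z0 unfolding q0_def q1_def by auto
  next
   case False
   hence "r : g2_roots" "s : g2_roots" using rs by auto
   hence "pair0 r ~= pair0 s | pair1 r ~= pair1 s" using g2_pairs_separate rs(3) by blast
   thus ?thesis using False unfolding q0_def q1_def by simp
  qed
  hence "?wt r h0 ~= ?wt s h0 | ?wt r h1 ~= ?wt s h1"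
   unfolding w[OF rs(1)] w[OF rs(2)] of_int_eq_iff .
  thus "EX h:HH. ?wt r h ~= ?wt s h" using h_in by blast
 next
  fix r h assume "r : ?F" "h : HH"
  thus "ad h (?v r) = ?wt r h *. ?v r"
   using abelian[of h z] z al_E[of r h] by (auto simp: bracket_scaleC_right scaleC_scaleC mult.commute)
 qed (use fin in simp)
 from *[of "(0, 0)"] show "z : U" by simp
 from *[of r] z0 show "r : g2_roots ==> x r *. E r : U" by (cases "r = (0, 0)") simp_all
qed

lemma E_inj: "inj_on E g2_roots"
proof (rule inj_onI)
 fix r s assume rs: "r : g2_roots" "s : g2_roots" "E r = E s"
 have "al r h = al s h" if "h : HH" for h
 proof (rule lie.scale_right_imp_eq[OF frameD(1)[OF rs(1)]])
  show "al r h *. E r = al s h *. E r"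
   by (rule trans[OF al_E[OF rs(1) that, symmetric]]) (simp only: rs(3) al_E[OF rs(2) that])
 qed
 hence "al r = al s" by (rule dual_space_eqI[OF al_dual[OF rs(1)] al_dual[OF rs(2)]])
 thus "r = s" by (rule al_inj[OF rs(1,2)])
qed

lemma expand: "EX z:HH. EX x. v = z + (SUM r:g2_roots. x r *. E r)"
proof -
 have "v : lie.span (HH \<union> E ` g2_roots)"
  using frame_span lie.span_mono[of "{h0, h1} \<union> E ` g2_roots" "HH \<union> E ` g2_roots"] h_in by blast
 then obtain z u where zu: "v = z + u" "z : lie.span HH" "u : lie.span (E ` g2_roots)"
  unfolding lie.span_Un by blast
 have fin: "finite (E ` g2_roots)" by (simp add: g2_roots_def)
 obtain k where k: "u = (SUM b:E ` g2_roots. k b *. b)" using zu(3) lie.span_finite[OF fin] by blast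
 have "u = (SUM r:g2_roots. k (E r) *. E r)" unfolding k by (rule sum.reindex[OF E_inj, unfolded o_def])
 moreover have "z : HH" using zu(2) by (simp add: lie.span_span)
 ultimately show ?thesis using zu(1) by (intro bexI[of _ z] exI[of _ "%r. k (E r)"]) simp_all
qed

lemma root_cases:
 assumes "\<beta> : roots UNIV HH" shows "EX r:g2_roots. \<beta> = al r"
proof (rule ccontr)
 assume no: "~ ?thesis"
 obtain v where v: "v : RS \<beta>" "v ~= 0" using root_vector[OF assms] by blast
 obtain z x where zx: "z : HH" "v = z + (SUM r:g2_roots. x r *. E r)" using expand by blast
 have st: "ad h u : RS \<beta>" if "h : HH" "u : RS \<beta>" for h u
  using RSD[OF that(2,1)] lie.subspace_scale[OF RS_sub that(2)] by simp
 have m: "z + (SUM r:g2_roots. x r *. E r) : RS \<beta>" using v(1) zx(2) by simp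
 have zR: "z : RS \<beta>" by (rule component(1)[OF RS_sub _ zx(1) m]) (rule st)
 obtain h where h: "h : HH" "\<beta> h ~= 0" using root_nonzero[OF assms] by blast
 have "\<beta> h *. z = 0" using RSD[OF zR h(1)] abelian[OF h(1) zx(1)] by simp
 hence "z = 0" using h(2) by simp
 moreover have xz: "x r *. E r = 0" if r: "r : g2_roots" for r
 proof (rule ccontr)
  assume nz: "x r *. E r ~= 0"
  have xr: "x r *. E r : RS \<beta>" by (rule component(2)[OF RS_sub _ zx(1) m r]) (rule st)
  have "\<beta> h = al r h" if h: "h : HH" for h
  proof (rule lie.scale_right_imp_eq[OF nz])
   show "\<beta> h *. (x r *. E r) = al r h *. (x r *. E r)"
    unfolding RSD[OF xr h, symmetric] bracket_scaleC_right al_E[OF r h]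
    by (simp add: scaleC_scaleC mult.commute)
  qed
  hence "\<beta> = al r" by (rule dual_space_eqI[OF roots_dual[OF assms] al_dual[OF r]])
  thus False using no r by blast
 qed
 moreover have "(SUM r:g2_roots. x r *. E r) = 0" by (rule sum.neutral) (use xz in blast)
 ultimately show False using v(2) zx(2) by (simp del: lie.scale_eq_0_iff)
qed

lemma roots_eq: "roots UNIV HH = al ` g2_roots"
 using root_cases al_root by blast

lemma RS_al: "r : g2_roots ==> x : RS (al r) ==> EX c. x = c *. E r"
 using RS_one_dim[OF al_root E_RS frameD(1)] by blast

lemma triple_E: "r : g2_roots ==> sl2 (E r) (hr r) (E (rneg r))"
proof -
 assume r: "r : g2_roots"
 have b: "rneg r : g2_roots" "cartan_int r r = 2" using g2_basic r by auto
 have c: "cartan_int r (rneg r) = - cartan_int r r"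
  by (simp add: cartan_int_def pair0_def pair1_def rneg_def algebra_simps)
 show ?thesis by unfold_locales (use hr_E[OF r] hr_E[OF b(1)] b(2) c frameD(4)[OF r] in simp_all)
qed

lemma hroot_al: "r : g2_roots ==> hroot (al r) = hr r"
proof -
 assume r: "r : g2_roots"
 have nr: "rneg r : g2_roots" using g2_basic r by blast
 have f: "E (rneg r) : RS (neg (al r))" using E_RS[OF nr] al_neg[OF r] by simp
 show ?thesis
 proof (rule hroot_eqI[OF al_root[OF r] hr_in, symmetric])
  show "al r (hr r) = 2" using al_hr[OF r] g2_basic r by simp
  fix x assume "x : HH"
  thus "\<kappa> (hr r) x = \<kappa> (E r) (E (rneg r)) * al r x"
   using bracket_opposite(2)[OF E_RS[OF r] f] frameD(4)[OF r] by (simp add: mult.commute)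
 qed
qed

lemma EE_zero:
 assumes r: "r : g2_roots" and s: "s : g2_roots" and rs: "radd r s ~: g2_roots" "radd r s ~= (0, 0)"
 shows "ad (E r) (E s) = 0"
proof (rule ccontr)
 assume nz: "ad (E r) (E s) ~= 0"
 let ?\<gamma> = "%h. 1 * al r h + 1 * al s h"
 have d: "?\<gamma> : dual_space HH" by (rule dual_space_combine[OF al_dual[OF r] al_dual[OF s]])
 have "ad (E r) (E s) : RS ?\<gamma>" by (rule RS_bracket'[OF E_RS[OF r] E_RS[OF s]]) simp
 hence "RS ?\<gamma> ~= {0}" using nz by blast
 then consider "?\<gamma> = (%_. 0)" | t where "t : g2_roots" "?\<gamma> = al t"
  using weights_dichotomy[OF d] root_cases by blast
 thus False
 proof cases
  case 1
  hence "al r h0 + al s h0 = 0" "al r h1 + al s h1 = 0" by (simp_all add: fun_eq_iff)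
  hence "of_int (pair0 r + pair0 s) = (of_int 0 :: complex)" "of_int (pair1 r + pair1 s) = (of_int 0 :: complex)"
   using al_h r s by simp_all
  hence "pair0 r + pair0 s = 0" "pair1 r + pair1 s = 0" unfolding of_int_eq_iff .
  hence "radd r s = (0, 0)" unfolding pair0_def pair1_def radd_def by auto
  thus False using rs(2) by blast
 next
  case 2
  from fun_cong[OF 2(2), of h0] fun_cong[OF 2(2), of h1]
  have "of_int (pair0 r + pair0 s) = (of_int (pair0 t) :: complex)" "of_int (pair1 r + pair1 s) = (of_int (pair1 t) :: complex)"
   using al_h r s 2(1) by simp_all
  hence "pair0 r + pair0 s = pair0 t" "pair1 r + pair1 s = pair1 t" unfolding of_int_eq_iff .
  hence "fst t = fst (radd r s)" "snd t = snd (radd r s)" unfolding pair0_def pair1_def radd_def by auto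
  hence "radd r s = t" by (simp add: prod_eq_iff)
  thus False using rs(1) 2(1) by blast
 qed
qed

lemma E_nilpotent: "r : g2_roots ==> ad_nilpotent (E r)"
proof (rule ad_nilpotent_spanning[OF frame_span])
 assume r: "r : g2_roots"
 fix v assume "v : {h0, h1} \<union> E ` g2_roots"
 then consider "v : HH" | s where "s : g2_roots" "v = E s" using h_in by blast
 hence "EX c. ad (hr r) v = c *. v"
 proof cases
  case 1
  hence "ad (hr r) v = 0 *. v" using abelian[OF hr_in] by simp
  thus ?thesis ..
 next
  case 2
  show ?thesis unfolding 2(2) using hr_E[OF 2(1)] ..
 qed
 thus "EX k. (ad (E r) ^^ k) v = 0" using sl2.e_nilpotent[OF triple_E[OF r]] by blast
qed

lemma hr_simple: "hr (1, 0) = h0" "hr (0, 1) = h1"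
 by (simp_all add: hr_def co0_def co1_def sqlen_def)

lemma nil_generated_g2: "nil_generated (UNIV :: 'g set)"
 unfolding nil_generated_def
proof (intro allI impI)
 fix S :: "'g set" assume S: "subalgebra S & (ALL x. ad_nilpotent x --> x : S)"
 hence sub: "lie.subspace S" unfolding subalgebra_def by blast
 have ES: "E r : S" if "r : g2_roots" for r using S E_nilpotent[OF that] by blast
 have hS: "hr r : S" if r: "r : g2_roots" for r
 proof -
  have "ad (E r) (E (rneg r)) : S" using S ES[OF r] ES[of "rneg r"] g2_basic r unfolding subalgebra_def by blast
  thus ?thesis using frameD(4)[OF r] by simp
 qed
 have "(1, 0) : g2_roots" "(0, 1) : g2_roots" by (simp_all add: g2_roots_def)
 hence "h0 : S" "h1 : S" using hS hr_simple by metis+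
 hence "lie.span ({h0, h1} \<union> E ` g2_roots) \<subseteq> S" using ES by (intro lie.span_minimal[OF _ sub]) auto
 thus "S = UNIV" using frame_span by blast
qed

lemma long_triple_E:
 assumes r: "r : g2_roots" and long: "sqlen r = 3"
 shows "long_triple (E r) (hr r) (E (rneg r))"
 unfolding long_triple_def
proof (intro conjI allI impI)
 have nr: "rneg r : g2_roots" using g2_basic r by blast
 show "sl2 (E r) (hr r) (E (rneg r))" by (rule triple_E[OF r])
 show "E r ~= 0" by (rule frameD(1)[OF r])
 have vals: "s = r | s = rneg r | cartan_int r s = -1 | cartan_int r s = 0 | cartan_int r s = 1" if "s : g2_roots" for s
  using g2_long_pairs r long that by fastforce
 have rr: "cartan_int r r = 2" "cartan_int r (rneg r) = - 2"
  using g2_basic r by (auto simp: cartan_int_def pair0_def pair1_def rneg_def algebra_simps)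
 have "{h0, h1} \<union> E ` g2_roots \<subseteq> lie.span (UN c:{-2,-1,0,1,2}. {v. ad (hr r) v = c *. v})"
 proof
  fix v assume "v : {h0, h1} \<union> E ` g2_roots"
  then consider "v : HH" | s where "s : g2_roots" "v = E s" using h_in by blast
  hence "v : (UN c:{-2,-1,0,1,2}. {v. ad (hr r) v = c *. v})"
  proof cases
   case 1
   hence "ad (hr r) v = 0 *. v" using abelian[OF hr_in] by simp
   thus ?thesis by blast
  next
   case 2
   have "of_int (cartan_int r s) : ({-2,-1,0,1,2} :: complex set)" using vals[OF 2(1)] rr by auto
   thus ?thesis using hr_E[OF 2(1)] 2(2) by blast
  qed
  thus "v : lie.span (UN c:{-2,-1,0,1,2}. {v. ad (hr r) v = c *. v})" by (rule lie.span_base)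
 qed
 hence "lie.span ({h0, h1} \<union> E ` g2_roots) \<subseteq> lie.span (UN c:{-2,-1,0,1,2}. {v. ad (hr r) v = c *. v})"
  by (rule lie.span_minimal) simp
 thus "UNIV \<subseteq> lie.span (UN c:{-2,-1,0,1,2}. {v. ad (hr r) v = c *. v})" using frame_span by blast
 have uniq: "\<beta> = al t" if \<beta>: "\<beta> : dual_space HH" "RS \<beta> ~= {0}" "\<beta> (hr r) = of_int k"
  and t: "k = 2 & t = r | k = - 2 & t = rneg r" for \<beta> k t
 proof -
  have "\<beta> ~= (%_. 0)" using \<beta>(3) t by auto
  then obtain s where s: "s : g2_roots" "\<beta> = al s" using weights_dichotomy[OF \<beta>(1,2)] root_cases by blast
  have "cartan_int r s = k" using \<beta>(3) al_hr[OF s(1)] s(2) by simp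
  hence "s = t" using t vals[OF s(1)] rr by auto
  thus ?thesis using s(2) by simp
 qed
 fix v
 show "EX c. v = c *. E r" if v: "ad (hr r) v = 2 *. v"
  by (rule RS_al[OF r], rule eigenvector_in_root_space[OF hr_in UNIV_I v al_dual[OF r]])
   (rule uniq[where k = 2], auto)
 show "EX c. v = c *. E (rneg r)" if v: "ad (hr r) v = (-2) *. v"
  by (rule RS_al[OF nr], rule eigenvector_in_root_space[OF hr_in UNIV_I v al_dual[OF nr]])
   (rule uniq[where k = "-2"], auto)
qed

definition slr :: "int \<times> int => 'g set" where
 "slr r = lie.span {E r, hr r, E (rneg r)}"

lemma orth_span:
 assumes r: "r : g2_roots" and s: "s : g2_roots" and orth: "cartan_int r s = 0" and z: "z : HH"
 shows "EX p q. z = p *. hr r + q *. hr s"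
proof -
 obtain x y where xy: "z = x *. h0 + y *. h1" using z span_pair by blast
 let ?d = "of_int (co0 r * co1 s - co1 r * co0 s) :: complex"
 have "co0 r * co1 s - co1 r * co0 s ~= 0" using g2_orthogonal r s orth by blast
 hence d0: "?d ~= 0" unfolding of_int_eq_0_iff .
 let ?p = "(x * of_int (co1 s) - y * of_int (co0 s)) / ?d"
 let ?q = "(of_int (co0 r) * y - of_int (co1 r) * x) / ?d"
 have "?p * of_int (co0 r) + ?q * of_int (co0 s) = x" "?p * of_int (co1 r) + ?q * of_int (co1 s) = y"
  using d0 by (simp_all add: add_divide_distrib[symmetric] divide_eq_eq) (simp_all add: algebra_simps)
 moreover have "?p *. hr r + ?q *. hr s
   = (?p * of_int (co0 r) + ?q * of_int (co0 s)) *. h0 + (?p * of_int (co1 r) + ?q * of_int (co1 s)) *. h1"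
  unfolding hr_def by (simp add: scale_simps add_ac)
 ultimately have "z = ?p *. hr r + ?q *. hr s" using xy by simp
 thus ?thesis by blast
qed

lemma orth_commute:
 assumes r: "r : g2_roots" and s: "s : g2_roots" and orth: "cartan_int r s = 0"
 shows "ad (E r) (E s) = 0" "ad (hr r) (E s) = 0" "ad (E r) (hr s) = 0"
proof -
 show "ad (E r) (E s) = 0" using EE_zero[OF r s] g2_orthogonal r s orth by blast
 show "ad (hr r) (E s) = 0" using hr_E[OF s] orth by simp
 have "cartan_int s r = 0" using g2_orthogonal r s orth by blast
 hence "ad (hr s) (E r) = 0" using hr_E[OF r] by simp
 thus "ad (E r) (hr s) = 0" using bracket_anti[of "E r" "hr s"] by simp
qed

lemma cartan_int_neg: "cartan_int (rneg r) s = - cartan_int r s" "cartan_int r (rneg s) = - cartan_int r s"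
 if "r : g2_roots" "s : g2_roots"
 using g2_basic that by (auto simp: cartan_int_def pair0_def pair1_def rneg_def algebra_simps)

lemma centralizer_slr_sub:
 assumes r: "r : g2_roots" and s: "s : g2_roots" and orth: "cartan_int r s = 0"
  and v: "ad (E r) v = 0" "ad (E (rneg r)) v = 0"
 shows "v : slr s"
proof -
 have ns: "rneg s : g2_roots" "rneg s ~= s" using g2_basic s by auto
 have hv: "ad (hr r) v = 0" unfolding frameD(4)[OF r, symmetric] ad_bracket v by simp
 obtain z x where zx: "z : HH" "v = z + (SUM t:g2_roots. x t *. E t)" using expand by blast
 let ?U = "{v. ad (hr r) v = 0 *. v}"
 have Us: "lie.subspace ?U" using eigenspace_subspace[OF lie.subspace_UNIV, of "hr r" 0] by simp
 have Ust: "ad h u : ?U" if "h : HH" "u : ?U" for h u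
  using ad_derivation[of "hr r" h u] abelian[OF hr_in that(1)] that(2) by simp
 have x0: "x t = 0" if t: "t : g2_roots" "t ~= s" "t ~= rneg s" for t
 proof -
  have "x t *. E t : ?U" by (rule component(2)[OF Us Ust zx(1) _ t(1)]) (use hv zx(2) in simp_all)
  hence "(x t * of_int (cartan_int r t)) *. E t = 0"
   using hr_E[OF t(1)] by (simp add: bracket_scaleC_right scaleC_scaleC)
  moreover have "cartan_int r t ~= 0" using g2_orthogonal r s orth t by blast
  ultimately show ?thesis using frameD(1)[OF t(1)] by simp
 qed
 have "(SUM t:g2_roots. x t *. E t) = (SUM t:{s, rneg s}. x t *. E t)"
  using x0 s ns by (intro sum.mono_neutral_right) (auto simp: g2_roots_def)
 hence veq: "v = z + (x s *. E s + x (rneg s) *. E (rneg s))" using zx(2) ns by simp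
 have "ad (E r) (E (rneg s)) = 0"
  using orth_commute(1)[OF r ns(1)] cartan_int_neg(2)[OF r s] orth by simp
 hence "ad (E r) z = 0"
  using v(1) orth_commute(1)[OF r s orth] unfolding veq by (simp add: bracket_simps)
 hence az: "ad z (E r) = 0" using bracket_anti[of z "E r"] by simp
 obtain p q where pq: "z = p *. hr r + q *. hr s" using orth_span[OF r s orth zx(1)] by blast
 have "cartan_int s r = 0" "cartan_int r r = 2" using g2_orthogonal g2_basic r s orth by blast+
 hence "(p * 2) *. E r = 0" using az unfolding pq by (simp add: bracket_simps hr_E[OF r] scaleC_scaleC)
 hence "p = 0" using frameD(1)[OF r] by simp
 hence "v = q *. hr s + (x s *. E s + x (rneg s) *. E (rneg s))" using veq pq by simp
 thus ?thesis unfolding slr_def by (auto intro!: lie.span_add lie.span_scale intro: lie.span_base)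
qed

lemma slr_comb: "v : slr r \<longleftrightarrow> (EX x y z. v = x *. E r + y *. hr r + z *. E (rneg r))"
 unfolding slr_def by (rule span_triple)


text \<open>Conjugacy of Cartan subalgebras. After moving a long triple of the given Cartan subalgebra to the
 standard one, the kernel of the long root lies in the short \<open>sl\<^sub>2\<close> orthogonal to it and is spanned by
 a semisimple element there.\<close>

theorem cartan_conj:
 assumes C: "cartan_subalgebra UNIV (H' :: 'g set)"
 shows "EX \<phi>:nil_group. \<phi> ` H' = HH"
proof -
 interpret c: cartan_pair "UNIV :: 'g set" H' by unfold_locales (rule nd, rule C)
 have "roots UNIV H' ~= {}"
 proof
  assume "roots UNIV H' = {}"
  hence "UNIV \<subseteq> lie.span H'" using c.span_H_roots by simp
  hence "H' = UNIV" using c.NH(1) lie.span_eq_iff by blast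
  thus False using c.abelian simple unfolding simple_lie_def abelian_lie_def by blast
 qed
 from long_triple_of_cartan[OF nd C this] obtain \<theta> h e f where t: "h : H'" "\<theta> h = 2" "\<theta> : dual_space H'" "e : c.RS \<theta>" "f : c.RS (%x. - \<theta> x)"
  "long_triple e h f"
  by this
 \<comment> \<open>a long simple root and a short root orthogonal to it\<close>
 define r :: "int \<times> int" where "r = (0, 1)"
 define s :: "int \<times> int" where "s = (2, 1)"
 have rs: "r : g2_roots" "s : g2_roots" "cartan_int r s = 0" "sqlen r = 3"
  by (simp_all add: r_def s_def g2_defs)
 have nrs: "rneg r : g2_roots" "rneg s : g2_roots" "cartan_int s r = 0" "cartan_int s s = 2"
  using g2_basic g2_orthogonal rs by blast+
 obtain \<phi> c where \<phi>: "\<phi> : nil_group" "c ~= 0" "\<phi> e = c *. E r" "\<phi> h = hr r" "\<phi> f = (1 / c) *. E (rneg r)"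
  using long_triple_conj[OF simple nil_generated_g2 nd t(6) long_triple_E[OF rs(1,4)]] by blast
 note a\<phi> = nil_group_aut[OF simple \<phi>(1)]
 note d\<phi> = lie_autD[OF a\<phi>]
 \<comment> \<open>Otherwise \<open>H'\<close> would be the line of \<open>h\<close>, but the preimage of \<open>hr s\<close> normalizes that line.\<close>
 have "EX y:H'. y ~= 0 & \<theta> y = 0"
 proof (rule ccontr)
  assume no: "~ ?thesis"
  have line: "EX k. y = k *. h" if y: "y : H'" for y
  proof -
   let ?k = "- (\<theta> y / 2)"
   have kH: "?k *. h : H'" by (rule lie.subspace_scale[OF c.NH(1) t(1)])
   have "\<theta> (y + ?k *. h) = \<theta> y + \<theta> (?k *. h)" by (rule c.root_add[OF t(3) y kH])
   also have "\<theta> (?k *. h) = ?k * \<theta> h" by (rule c.root_scale[OF t(3,1)])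
   finally have "\<theta> (y + ?k *. h) = 0" using t(2) by simp
   hence "y + ?k *. h = 0" using no lie.subspace_add[OF c.NH(1) y kH] by blast
   hence "y = (\<theta> y / 2) *. h" by (simp add: scale_simps)
   thus ?thesis by blast
  qed
  obtain u where u: "\<phi> u = hr s" using d\<phi>(2) by (metis bij_pointE)
  have "ad u y : H'" if y: "y : H'" for y
  proof -
   obtain k where k: "y = k *. h" using line[OF y] by blast
   have "\<phi> (ad u y) = 0"
    unfolding k d\<phi>(3) d\<phi>(4) u \<phi>(4) bracket_scaleC_right abelian[OF hr_in hr_in] by simp
   thus ?thesis using d\<phi>(6) lie.subspace_0[OF c.NH(1)] by simp
  qed
  hence "u : H'" using C unfolding cartan_subalgebra_def by blast
  then obtain k where "u = k *. h" using line by blast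
  hence "hr s = k *. hr r" using u \<phi>(4) d\<phi>(4) by simp
  hence "ad (hr s) (E s) = 0" using orth_commute(2)[OF rs(1-3)] by (simp add: bracket_scaleC_left)
  thus False using hr_E[OF rs(2)] nrs(4) frameD(1)[OF rs(2)] by simp
 qed
 then obtain y where y: "y : H'" "y ~= 0" "\<theta> y = 0" by blast
 have ye: "ad e y = 0" "ad f y = 0"
  using c.RSD[OF t(4) y(1)] c.RSD[OF t(5) y(1)] y(3) bracket_anti[of e y] bracket_anti[of f y] by simp_all
 have "c *. ad (E r) (\<phi> y) = 0" "(1 / c) *. ad (E (rneg r)) (\<phi> y) = 0"
  using d\<phi>(3)[of e y] d\<phi>(3)[of f y] ye d\<phi>(6)[of 0] unfolding \<phi>(3,5) by (simp_all add: bracket_scaleC_left)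
 hence "ad (E r) (\<phi> y) = 0" "ad (E (rneg r)) (\<phi> y) = 0" using \<phi>(2) by simp_all
 hence "\<phi> y : slr s" by (rule centralizer_slr_sub[OF rs(1-3)])
 then obtain a b d where abd: "\<phi> y = a *. E s + b *. hr s + d *. E (rneg s)" using slr_comb by blast
 have diag: "diagonalizable_on UNIV (\<phi> y)"
  unfolding diagonalizable_on_def
 proof -
  have "UNIV = \<phi> ` UNIV" using d\<phi>(2) by (simp add: bij_is_surj)
  also have "... \<subseteq> \<phi> ` lie.span {w : UNIV. EX c. ad y w = c *. w}"
   using c.diagonalizable[OF y(1)] unfolding diagonalizable_on_def by (rule image_mono)
  also have "... = lie.span (\<phi> ` {w : UNIV. EX c. ad y w = c *. w})" by (rule lie_aut_span[OF a\<phi>])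
  also have "... \<subseteq> lie.span {w : UNIV. EX c. ad (\<phi> y) w = c *. w}"
  proof (rule lie.span_mono, rule image_subsetI)
   fix w assume "w : {w : UNIV. EX c. ad y w = c *. w}"
   then obtain c where "ad y w = c *. w" by blast
   hence "ad (\<phi> y) (\<phi> w) = c *. \<phi> w" using d\<phi>(3)[of y w] d\<phi>(4)[of c w] by simp
   thus "\<phi> w : {w : UNIV. EX c. ad (\<phi> y) w = c *. w}" by blast
  qed
  finally show "UNIV \<subseteq> lie.span {w : UNIV. EX c. ad (\<phi> y) w = c *. w}" .
 qed
 have y0: "\<phi> y ~= 0" using y(2) d\<phi>(6) by simp
 obtain \<psi> k where \<psi>: "\<psi> : nil_group" "k ~= 0" "\<psi> (\<phi> y) = k *. hr s"
  "!!w. ad (E s) w = 0 & ad (E (rneg s)) w = 0 ==> \<psi> w = w"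
  using sl2.semisimple_conj[OF triple_E[OF rs(2)] nd frameD(1)[OF rs(2)] E_nilpotent[OF rs(2)]
    E_nilpotent[OF nrs(2)] abd y0 diag] by blast
 have "cartan_int (rneg s) r = 0" using cartan_int_neg(1)[OF rs(2,1)] nrs(3) by simp
 hence fix_r: "\<psi> (hr r) = hr r"
  using \<psi>(4) orth_commute(3)[OF rs(2,1) nrs(3)] orth_commute(3)[OF nrs(2) rs(1)] by blast
 let ?\<chi> = "\<psi> \<circ> \<phi>"
 have G: "?\<chi> : nil_group" by (rule nil_group_comp[OF \<psi>(1) \<phi>(1)])
 note d\<chi> = lie_autD[OF nil_group_aut[OF simple G]]
 have \<chi>h: "?\<chi> h = hr r" "?\<chi> y = k *. hr s" using \<phi>(4) fix_r \<psi>(3) by simp_all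
 have "?\<chi> ` H' = HH"
 proof
  show "?\<chi> ` H' \<subseteq> HH"
  proof (rule image_subsetI)
   fix x assume x: "x : H'"
   have 1: "ad (?\<chi> x) (hr r) = 0"
    unfolding \<chi>h(1)[symmetric] d\<chi>(3)[symmetric] c.abelian[OF x t(1)] using d\<chi>(6)[of 0] by simp
   have "ad (?\<chi> x) (k *. hr s) = 0"
    unfolding \<chi>h(2)[symmetric] d\<chi>(3)[symmetric] c.abelian[OF x y(1)] using d\<chi>(6)[of 0] by simp
   hence 2: "ad (?\<chi> x) (hr s) = 0" using \<psi>(2) by (simp add: bracket_scaleC_right)
   have "ad (?\<chi> x) z : HH" if z: "z : HH" for z
   proof -
    obtain p q where "z = p *. hr r + q *. hr s" using orth_span[OF rs(1-3) z] by blast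
    hence "ad (?\<chi> x) z = 0" using 1 2 by (simp add: bracket_add_right bracket_scaleC_right del: o_apply)
    thus ?thesis by (simp add: lie.span_zero)
   qed
   thus "?\<chi> x : HH" using cartan_span unfolding cartan_subalgebra_def by blast
  qed
  show "HH \<subseteq> ?\<chi> ` H'"
  proof
   fix z assume z: "z : HH"
   obtain p q where pq: "z = p *. hr r + q *. hr s" using orth_span[OF rs(1-3) z] by blast
   have "?\<chi> (p *. h + (q / k) *. y) = z"
    unfolding d\<chi>(5) d\<chi>(4) \<chi>h pq using \<psi>(2) by (simp add: scaleC_scaleC)
   moreover have "p *. h + (q / k) *. y : H'"
    using t(1) y(1) c.NH(1) by (intro lie.subspace_add lie.subspace_scale)
   ultimately show "z : ?\<chi> ` H'" by blast
  qed
 qed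
 thus ?thesis using G by blast
qed

lemma frame_of_cartan:
 assumes C: "cartan_subalgebra UNIV (H' :: 'g set)"
 shows "EX h0' h1' E'. g2 h0' h1' E' & lie.span {h0', h1'} = H'"
proof -
 obtain \<phi> where \<phi>: "\<phi> : nil_group" "\<phi> ` H' = HH" using cartan_conj[OF C] by blast
 note a = nil_group_aut[OF simple \<phi>(1)]
 note d = lie_autD[OF a]
 let ?\<psi> = "inv \<phi>"
 have a': "lie_aut ?\<psi>" by (rule lie_aut_inv[OF a])
 have "lie.span {?\<psi> h0, ?\<psi> h1} = ?\<psi> ` HH" using lie_aut_span[OF a', of "{h0, h1}"] by simp
 also have "... = ?\<psi> ` \<phi> ` H'" using \<phi>(2) by simp
 also have "... = H'" using d(2) by (simp add: bij_is_inj image_comp)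
 finally have sp: "lie.span {?\<psi> h0, ?\<psi> h1} = H'" .
 have "g2 (?\<psi> h0) (?\<psi> h1) (%r. ?\<psi> (E r))"
  by unfold_locales (rule simple, rule nd, rule g2_frame_aut[OF frame a'], use C sp in simp)
 thus ?thesis using sp by blast
qed

end

section \<open>Subalgebras isomorphic to \<open>sl\<^sub>2\<close>\<close>

text \<open>The Killing square is a sum of squares of integers, one of which is not zero.\<close>

lemma killing_integral_nonzero:
 assumes L: "subalgebra L"
  and sp: "L \<subseteq> lie.span S" "S \<subseteq> L" "!!v. v : S ==> EX k::int. ad h v = of_int k *. v"
  and nz: "v : L" "ad h v ~= 0"
 shows "killing_form L h h ~= 0"
proof
 assume z: "killing_form L h h = 0"
 note N = subalgebraD[OF L]
 obtain B where B: "B \<subseteq> S" "lie.independent B" "lie.span B = L" "finite B"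
  by (rule obtain_basis[OF N(1) sp(2,1)])
 have "ALL b:B. EX k::int. ad h b = of_int k *. b" using B(1) sp(3) by blast
 then obtain k :: "'a => int" where k: "ALL b:B. ad h b = of_int (k b) *. b" by (rule bchoice[THEN exE])
 have "killing_form L h h = (SUM b:B. of_int (k b) * of_int (k b))"
  unfolding killing_form_def
  by (rule trace_on_eigenbasis[OF N(1) B(2,3) lin_ad_ad]) (simp add: k bracket_scaleC_right scaleC_scaleC)
 hence "of_int (SUM b:B. k b * k b) = (0::complex)" using z by simp
 hence s0: "(SUM b:B. k b * k b) = 0" by (simp only: of_int_eq_0_iff)
 have "k b = 0" if "b : B" for b
  using s0 sum_nonneg_eq_0_iff[OF B(4), of "%b. k b * k b"] that by simp
 hence "ad h b = 0" if "b : B" for b using k that by simp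
 moreover have "v : lie.span B" unfolding B(3) by (rule nz(1))
 ultimately have "ad h v = 0" by (rule lin_eq_on_span[OF lin_ad lin_zero])
 thus False using nz(2) by simp
qed

lemma bracket_span_mono: "A \<subseteq> B ==> bracket_span A A \<subseteq> bracket_span B B"
 unfolding bracket_span_def by (rule lie.span_mono) blast

context sl2
begin

abbreviation "slh \<equiv> lie.span {e, h, f}"

lemma slh_in: "e : slh" "h : slh" "f : slh" by (simp_all add: lie.span_base)

lemma slh_subalgebra: "subalgebra slh"
 unfolding subalgebra_def
proof (intro conjI ballI)
 show "lie.subspace slh" by simp
 fix u v assume "u : slh" "v : slh"
 then obtain x y z a b c where uv: "u = x *. e + y *. h + z *. f" "v = a *. e + b *. h + c *. f"
  unfolding span_triple by auto
 show "ad u v : slh" unfolding uv comb_bracket span_triple by blast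
qed

lemma slh_minimal:
 assumes "lie.subspace I" "e : I" "h : I" "f : I" shows "slh \<subseteq> I"
 by (rule lie.span_minimal) (use assms in auto)

lemma slh_perfect: "slh \<subseteq> bracket_span slh slh"
proof (rule slh_minimal)
 show "lie.subspace (bracket_span slh slh)" unfolding bracket_span_def by simp
 have m: "ad u v : bracket_span slh slh" if "u : slh" "v : slh" for u v
  unfolding bracket_span_def by (rule lie.span_base) (use that in blast)
 have "ad ((1/2) *. h) e = e" "ad ((-1/2) *. h) f = f"
  by (simp_all add: bracket_scaleC_left bracket_minus_left he hf scaleC_scaleC)
 thus "e : bracket_span slh slh" "f : bracket_span slh slh"
  using m[of "(1/2) *. h" e] m[of "(-1/2) *. h" f] slh_in lie.span_scale[OF slh_in(2)] by metis+
 show "h : bracket_span slh slh" using m[OF slh_in(1,3)] ef by simp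
qed

context
 assumes e0: "e ~= 0"
begin

lemma slh_nonsolvable:
 assumes "slh \<subseteq> I" shows "~ solvable_lie I"
proof
 assume "solvable_lie I"
 then obtain n where n: "((%D. bracket_span D D) ^^ n) I = {0}" unfolding solvable_lie_def by blast
 have "slh \<subseteq> ((%D. bracket_span D D) ^^ k) I" for k
 proof (induction k)
  case (Suc k)
  have "bracket_span slh slh \<subseteq> bracket_span (((%D. bracket_span D D) ^^ k) I) (((%D. bracket_span D D) ^^ k) I)"
   by (rule bracket_span_mono[OF Suc.IH])
  thus ?case using slh_perfect by simp
 qed (use assms in simp)
 thus False using n slh_in(1) e0 by blast
qed

text \<open>Applying \<open>ad e\<close> at most twice to a nonzero element produces a nonzero multiple of \<open>e\<close>.\<close>

lemma slh_ideal:
 assumes I: "lie.subspace I" "!!x v. x : slh ==> v : I ==> ad x v : I" and v: "v : I" "v : slh" "v ~= 0"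
 shows "slh \<subseteq> I"
proof -
 obtain x y z where c: "v = x *. e + y *. h + z *. f" using v(2) span_triple by blast
 have ev: "ad e v = (- 2 * y) *. e + z *. h"
  unfolding c by (simp add: bracket_simps ef scale_simps bracket_anti[of e h] he mult.commute)
 have eev: "ad e (ad e v) = (- 2 * z) *. e"
  unfolding ev by (simp add: bracket_simps scale_simps bracket_anti[of e h] he mult.commute)
 have e1: "ad e v : I" by (rule I(2)[OF slh_in(1) v(1)])
 have e2: "ad e (ad e v) : I" by (rule I(2)[OF slh_in(1) e1])
 have sc: "e : I" if "k *. e : I" "k ~= 0" for k
  using lie.subspace_scale[OF I(1) that(1), of "1 / k"] that(2) by (simp add: scaleC_scaleC)
 have "e : I"
 proof (cases "z = 0")
  case False
  thus ?thesis using sc[of "- 2 * z"] e2 eev by simp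
 next
  case z: True
  show ?thesis
  proof (cases "y = 0")
   case False
   thus ?thesis using sc[of "- 2 * y"] e1 ev z by simp
  next
   case True
   thus ?thesis using sc[of x] v c z by auto
  qed
 qed
 hence "ad f e : I" by (rule I(2)[OF slh_in(3)])
 hence hI: "h : I" using fe lie.subspace_neg[OF I(1), of "- h"] by simp
 hence "ad f h : I" by (rule I(2)[OF slh_in(3)])
 hence "2 *. f : I" using hf bracket_anti[of f h] by simp
 hence "f : I" using lie.subspace_scale[OF I(1), of "2 *. f" "1/2"] by (simp add: scaleC_scaleC)
 thus ?thesis using slh_minimal[OF I(1) \<open>e : I\<close> hI] by blast
qed

lemma slh_simple: "simple_lie slh"
 unfolding simple_lie_def
proof (intro conjI allI impI)
 show "subalgebra slh" by (rule slh_subalgebra)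
 have "ad h e ~= 0" using he e0 by simp
 thus "~ abelian_lie slh" unfolding abelian_lie_def using slh_in by blast
 fix I assume I: "lie_ideal slh I"
 hence Is: "lie.subspace I" "I \<subseteq> slh" "!!x v. x : slh ==> v : I ==> ad x v : I"
  unfolding lie_ideal_def by auto
 show "I = {0} | I = slh"
 proof (cases "I \<subseteq> {0}")
  case True
  thus ?thesis using lie.subspace_0[OF Is(1)] by blast
 next
  case False
  then obtain v where v: "v : I" "v ~= 0" by blast
  have "slh \<subseteq> I" by (rule slh_ideal[OF Is(1) Is(3) v(1) _ v(2)]) (use Is(2) v(1) in auto)
  thus ?thesis using Is(2) by blast
 qed
qed

lemma slh_semisimple: "semisimple_lie slh"
 unfolding semisimple_lie_def
 using slh_simple slh_nonsolvable unfolding simple_lie_def by blast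

lemma slh_nondeg: "killing_nondeg slh"
 by (rule killing_nondeg_simple[OF slh_simple slh_in(2,1) e0 he]) simp

lemma triple_basis: "lie.independent {e, h, f}" "e ~= h" "e ~= f" "h ~= f"
proof -
 have 1: "e ~: lie.span {h, f}"
 proof
  assume "e : lie.span {h, f}"
  then obtain y z where "e = y *. h + z *. f" using span_pair by blast
  hence "(-1) *. e + y *. h + z *. f = 0" by (simp add: add.assoc)
  thus False using comb_eq_0(1)[OF e0] by fastforce
 qed
 have 2: "h ~: lie.span {f}"
 proof
  assume "h : lie.span {f}"
  then obtain z where "h = z *. f" unfolding lie.span_singleton by auto
  hence "0 *. e + (-1) *. h + z *. f = 0" by simp
  thus False using comb_eq_0(2)[OF e0] by fastforce
 qed
 have 3: "f ~= 0" using ef 2 lie.span_zero by auto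
 hence i: "lie.independent {f}" by simp
 show d: "e ~= h" "e ~= f" "h ~= f" using 1 2 lie.span_base[of _ "{h, f}"] lie.span_base[of _ "{f}"] by auto
 show "lie.independent {e, h, f}"
  using i 1 2 d by (simp add: lie.independent_insert)
qed

lemma killing_slh: "killing_form slh h h = 8"
proof -
 let ?c = "%b. if b = e then 4 else if b = h then 0 else (4 :: complex)"
 have "trace_on slh (%z. ad h (ad h z)) = (SUM b:{e, h, f}. ?c b)"
  by (rule trace_on_eigenbasis[OF lie.subspace_span triple_basis(1) refl lin_ad_ad])
   (auto simp: he hf bracket_scaleC_right bracket_minus_right scaleC_scaleC bracket_self)
 thus ?thesis unfolding killing_form_def using triple_basis by simp
qed

lemma slh_eqI:
 assumes a: "lie.subspace a" "e : a" "h : a" "f : a" "lie.dim a <= 3"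
 shows "slh = a"
proof
 show "slh \<subseteq> a" by (rule slh_minimal[OF a(1-4)])
 have "card {e, h, f} = 3" using triple_basis by simp
 thus "a \<subseteq> slh" using fin.card_ge_dim_independent[of "{e, h, f}" a] a triple_basis by simp
qed

lemma dim_slh: "lie.dim slh <= 3"
proof -
 have "lie.dim slh <= card {e, h, f}" by (rule lie.dim_le_card) auto
 also have "... = 3" using triple_basis by simp
 finally show ?thesis .
qed

text \<open>Every coroot belongs to an \<open>sl\<^sub>2\<close>-triple spanning the whole algebra, on which it has the eigenvalues
 \<open>2, 0, -2\<close>; so its Killing square is 8, and the normalized form is a quarter of the Killing form.\<close>

lemma slh_normalized: "normalized_form slh (%x y. killing_form slh x y / 4)"
 unfolding normalized_form_def
proof (intro conjI allI impI)
 note N = subalgebraD[OF slh_subalgebra]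
 show "invariant_form slh (%x y. killing_form slh x y / 4)"
  unfolding invariant_form_def
  by (intro conjI ballI allI)
   (simp_all add: killing_bilinear(1,4)[OF slh_subalgebra] add_divide_distrib killing_sym[OF N(1) N(3) N(3)]
    killing_invariant[OF N(1) N(3) N(3) N(3)])
 fix H c assume Hc: "cartan_subalgebra slh H & short_coroot slh H c"
 interpret c: cartan_pair slh H by unfold_locales (use slh_nondeg Hc in simp_all)
 obtain \<alpha> where \<alpha>: "\<alpha> : roots slh H" "c = coroot slh H \<alpha>" using Hc unfolding short_coroot_def by blast
 have ch: "c = c.hroot \<alpha>" using \<alpha> c.coroot_eq by simp
 obtain e' where e': "e' : c.RS \<alpha>" "e' ~= 0" using c.root_vector[OF \<alpha>(1)] by blast
 obtain f' where f': "f' : c.RS (c.neg \<alpha>)" "sl2 e' (c.hroot \<alpha>) f'" by (rule c.triple[OF \<alpha>(1) e'])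
 interpret s: sl2 e' "c.hroot \<alpha>" f' by (rule f'(2))
 have "s.slh = slh"
  by (rule s.slh_eqI[OF e'(2) N(1) c.RSL[OF e'(1)] c.HL[OF c.hroot(1)[OF \<alpha>(1)]] c.RSL[OF f'(1)] dim_slh])
 thus "killing_form slh c c / 4 = 2" using s.killing_slh[OF e'(2)] ch by simp
qed

end

text \<open>The value at \<open>h\<close> determines an invariant form, so that forms can be compared at coroots only.\<close>

lemma invariant_form_value:
 assumes B: "invariant_form slh B"
 shows "B (x *. e + y *. h + z *. f) (a *. e + b *. h + c *. f) = (y * b + (x * c + z * a) / 2) * B h h"
proof -
 have add: "B (u + v) w = B u w + B v w" if "u : slh" "v : slh" "w : slh" for u v w
  using B that unfolding invariant_form_def by blast
 have sc: "B (k *. u) w = k * B u w" if "u : slh" "w : slh" for k u w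
  using B that unfolding invariant_form_def by blast
 have sym: "B u w = B w u" if "u : slh" "w : slh" for u w
  using B that unfolding invariant_form_def by blast
 have inv: "B (ad u v) w = B u (ad v w)" if "u : slh" "v : slh" "w : slh" for u v w
  using B that unfolding invariant_form_def by blast
 note I = slh_in lie.span_scale lie.span_add
 have sc': "B w (k *. u) = k * B w u" if "u : slh" "w : slh" for k u w
  using sc[OF that] sym[OF lie.span_scale[OF that(1)] that(2)] sym[OF that] by simp
 have add': "B w (u + v) = B w u + B w v" if "u : slh" "v : slh" "w : slh" for u v w
  using add[OF that] sym[OF lie.span_add[OF that(1,2)] that(3)] sym[OF that(1,3)] sym[OF that(2,3)] by simp
 have z: "B w 0 = 0" if "w : slh" for w using sc'[OF that that, of 0] by simp
 have ng: "B w (- u) = - B w u" if "u : slh" "w : slh" for u w using sc'[OF that, of "-1"] by simp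
 have he0: "B h e = 0"
  using inv[OF slh_in(1,3,1)] sym[OF slh_in(1,2)] unfolding ef fe ng[OF slh_in(2,1)] by simp
 have hf0: "B h f = 0" using inv[OF slh_in(1,3,3)] unfolding ef bracket_self z[OF slh_in(1)] .
 have ee: "B e e = 0" using inv[OF slh_in(2,1,1)] unfolding he bracket_self z[OF slh_in(2)] sc[OF slh_in(1,1)] by simp
 have ff: "B f f = 0" using inv[OF slh_in(2,3,3)] unfolding hf bracket_self z[OF slh_in(2)] sc[OF slh_in(3,3)] by simp
 have fh: "ad f h = 2 *. f" using hf bracket_anti[of f h] by simp
 have ef2: "B e f = B h h / 2" using inv[OF slh_in(1,3,2)] unfolding ef fh sc'[OF slh_in(3,1)] by simp
 show ?thesis
  by (simp add: add add' sc sc' I he0 hf0 ee ff ef2 sym[OF slh_in(1,2)] sym[OF slh_in(3,2)] sym[OF slh_in(3,1)] algebra_simps)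
qed

text \<open>With respect to the Cartan subalgebra \<open>\<complex> h\<close> the simple root is the form \<open>k h \<mapsto> 2 k\<close>.\<close>

lemma slh_type_A1:
 assumes e0: "e ~= 0" shows "of_type slh type_A1"
proof -
 let ?H = "lie.span {h}"
 have h0: "h ~= 0" using triple_basis(1)[OF e0] lie.dependent_zero[of "{e, h, f}"] by auto
 have line: "v : ?H \<longleftrightarrow> (EX k. v = k *. h)" for v unfolding lie.span_singleton by auto
 have ab: "ad u v = 0" if "u : ?H" "v : ?H" for u v
  using that unfolding line by (auto simp: bracket_simps)
 have "bracket_span ?H ?H = {0}"
 proof -
  have "{ad x y |x y. x : ?H & y : ?H} \<subseteq> {0}" using ab by blast
  hence "bracket_span ?H ?H \<subseteq> lie.span {0}" unfolding bracket_span_def by (rule lie.span_mono)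
  thus ?thesis using lie.span_zero[of "{ad x y |x y. x : ?H & y : ?H}"] unfolding bracket_span_def by auto
 qed
 hence nil: "nilpotent_lie ?H" unfolding nilpotent_lie_def by (intro exI[of _ 1]) simp
 have sub: "?H \<subseteq> slh" by (rule lie.span_mono) simp
 have norm: "v : ?H" if v: "v : slh" "ad v h : ?H" for v
 proof -
  obtain x y z where c: "v = x *. e + y *. h + z *. f" using v(1) span_triple by blast
  obtain k where k: "ad v h = k *. h" using v(2) line by blast
  have "ad v h = (- 2 * x) *. e + 0 *. h + (2 * z) *. f"
   unfolding c by (simp add: bracket_simps bracket_anti[of e h] bracket_anti[of f h] he hf scaleC_scaleC mult.commute)
  hence "(- 2 * x) *. e + (- k) *. h + (2 * z) *. f = 0" using k by simp
  from comb_eq_0[OF e0 this] have "x = 0" "z = 0" by auto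
  thus ?thesis using c line by auto
 qed
 have C: "cartan_subalgebra slh ?H"
  unfolding cartan_subalgebra_def
 proof (intro conjI sub nil)
  show "subalgebra ?H" unfolding subalgebra_def using ab by (simp add: lie.span_zero)
  show "{x : slh. ALL y:?H. ad x y : ?H} = ?H"
  proof (intro set_eqI iffI)
   fix x assume x: "x : {x : slh. ALL y:?H. ad x y : ?H}"
   have "h : ?H" by (simp add: lie.span_base)
   hence "ad x h : ?H" using x by blast
   thus "x : ?H" by (rule norm[rotated]) (use x in blast)
  next
   fix x assume x: "x : ?H"
   hence "ad x y : ?H" if "y : ?H" for y using ab[OF x that] by (simp add: lie.span_zero)
   thus "x : {x : slh. ALL y:?H. ad x y : ?H}" using x sub by blast
  qed
 qed
 interpret c: cartan_pair slh ?H by unfold_locales (rule slh_nondeg[OF e0], rule C)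
 define \<gamma> where "\<gamma> x = (if x : ?H then 2 * (THE k. x = k *. h) else 0)" for x
 have \<gamma>k: "\<gamma> (k *. h) = 2 * k" for k
 proof -
  have "(THE j. k *. h = j *. h) = k" using h0 by (intro the_equality) auto
  thus ?thesis unfolding \<gamma>_def using line by auto
 qed
 have \<gamma>: "\<gamma> : dual_space ?H"
  unfolding dual_space_def
 proof (intro CollectI conjI ballI allI impI)
  fix x y assume "x : ?H" "y : ?H"
  then obtain j k where jk: "x = j *. h" "y = k *. h" using line by blast
  show "\<gamma> (x + y) = \<gamma> x + \<gamma> y" unfolding jk scaleC_add_left[symmetric] \<gamma>k by simp
 next
  fix c x assume "x : ?H"
  then obtain j where j: "x = j *. h" using line by blast
  show "\<gamma> (c *. x) = c * \<gamma> x" unfolding j scaleC_scaleC \<gamma>k by simp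
 qed (simp add: \<gamma>_def)
 have hH: "h : ?H" by (simp add: lie.span_base)
 have \<gamma>h: "\<gamma> h = 2" using \<gamma>k[of 1] by simp
 have eR: "e : c.RS \<gamma>"
  unfolding root_space_def using slh_in(1) line \<gamma>k by (auto simp: bracket_scaleC_left he scaleC_scaleC mult.commute)
 have root: "\<gamma> : roots slh ?H" by (rule c.rootI[OF \<gamma> eR e0 hH]) (simp add: \<gamma>h)
 have all: "\<alpha> = \<gamma> | \<alpha> = c.neg \<gamma>" if \<alpha>: "\<alpha> : roots slh ?H" for \<alpha>
 proof (rule c.proportional_roots[OF root \<alpha>])
  fix x assume "x : ?H"
  then obtain k where k: "x = k *. h" using line by blast
  show "\<alpha> x = (\<alpha> h / 2) * \<gamma> x" unfolding k c.root_scale[OF c.roots_dual[OF \<alpha>] hH] \<gamma>k by simp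
 qed
 have len: "length type_A1 = 1" by (simp add: type_A1_def)
 have ss: "simple_system slh ?H 1 (%_. \<gamma>)"
  unfolding simple_system_def
 proof (intro conjI allI impI ballI)
  show "\<gamma> : roots slh ?H" by (rule root)
  fix c :: "nat => complex" and i :: nat assume c: "ALL x:?H. (\<Sum>i<1. c i * \<gamma> x) = 0" and i: "i < 1"
  show "c i = 0" using bspec[OF c hH] \<gamma>h i by simp
 next
  fix \<alpha> assume "\<alpha> : roots slh ?H"
  thus "EX k::nat => nat. (ALL x:?H. \<alpha> x = (\<Sum>i<1. of_nat (k i) * \<gamma> x)) | (ALL x:?H. \<alpha> x = - (\<Sum>i<1. of_nat (k i) * \<gamma> x))"
   using all by (intro exI[of _ "%_. 1"]) auto
 qed
 have "\<gamma> (coroot slh ?H \<gamma>) = 2" using c.coroot_eq[OF root] c.hroot(2)[OF root] by simp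
 thus ?thesis unfolding of_type_def len
  by (intro conjI slh_semisimple[OF e0] exI[of _ ?H] exI[of _ "%_. \<gamma>"] C ss) (simp add: type_A1_def)
qed

end

lemma slh_reductive:
 assumes "sl2 e h (f :: 'g::complex_lie_algebra)" "diagonalizable_on UNIV h"
 shows "reductive_in (lie.span {e, h, f})"
 unfolding reductive_in_def
proof (intro conjI allI impI)
 interpret sl2 e h f by (rule assms(1))
 show "subalgebra slh" by (rule slh_subalgebra)
 fix V assume V: "lie.subspace V & (ALL x:slh. ALL v:V. ad x v : V)"
 hence st: "!!v. v : V ==> ad e v : V" "!!v. v : V ==> ad h v : V" "!!v. v : V ==> ad f v : V"
  using slh_in by blast+
 obtain W where W: "lie.subspace W" "ALL w:W. ad e w : W & ad h w : W & ad f w : W" "direct_sum UNIV V W"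
  using complement[OF assms(2) conjunct1[OF V] st] by blast
 have "ad x w : W" if x: "x : slh" and w: "w : W" for x w
 proof -
  obtain a b c where abc: "x = a *. e + b *. h + c *. f" using x span_triple by blast
  show ?thesis unfolding abc bracket_add_left bracket_scaleC_left
   using W(1,2) w by (intro lie.subspace_add lie.subspace_scale) auto
 qed
 thus "EX W. lie.subspace W & (ALL x:slh. ALL w:W. ad x w : W) & direct_sum UNIV V W" using W by blast
qed

section \<open>Root lengths and the index\<close>

lemma g2_norm: "ALL r:g2_roots. sqlen r * (SUM s:g2_roots. cartan_int r s * cartan_int r s) = 48"
 by code_simp

context g2
begin

text \<open>Short roots have squared length 1 and long ones 3; the Killing square of a coroot is inversely proportional.\<close>

lemma \<kappa>_hr:
 assumes r: "r : g2_roots"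
 shows "of_int (sqlen r) * \<kappa> (hr r) (hr r) = 48"
proof -
 have inj: "inj_on al g2_roots" by (rule inj_onI) (rule al_inj)
 have "\<kappa> (hr r) (hr r) = (SUM s:g2_roots. al s (hr r) * al s (hr r))"
  unfolding \<kappa>_roots[OF hr_in hr_in] roots_eq sum.reindex[OF inj] by (simp add: o_def)
 also have "... = of_int (SUM s:g2_roots. cartan_int r s * cartan_int r s)"
  unfolding of_int_sum by (rule sum.cong[OF refl]) (simp add: al_hr)
 finally have "of_int (sqlen r) * \<kappa> (hr r) (hr r) = of_int (sqlen r * (SUM s:g2_roots. cartan_int r s * cartan_int r s))"
  by simp
 also have "... = of_int 48" using g2_norm r by simp
 finally show ?thesis by simp
qed

lemma \<kappa>_hr_values:
 assumes r: "r : g2_roots"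
 shows "sqlen r = 3 ==> \<kappa> (hr r) (hr r) = 16" "sqlen r = 1 ==> \<kappa> (hr r) (hr r) = 48"
 using \<kappa>_hr[OF r] by simp_all

lemma root_sq_length_al:
 assumes r: "r : g2_roots"
 shows "root_sq_length UNIV HH (al r) = of_int (sqlen r) / 12"
proof -
 let ?t = "(of_int (sqlen r) / 24) *. hr r"
 have hk: "2 * \<kappa> (hr r) x = al r x * \<kappa> (hr r) (hr r)" if "x : HH" for x
  using \<kappa>_hroot[OF al_root[OF r] that] unfolding hroot_al[OF r] .
 have t: "?t : HH" by (rule lie.span_scale[OF hr_in])
 have tk: "\<kappa> ?t x = al r x" if "x : HH" for x
 proof -
  have "\<kappa> ?t x = of_int (sqlen r) / 48 * (2 * \<kappa> (hr r) x)" by (simp add: killing_UNIV)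
  also have "... = al r x / 48 * (of_int (sqlen r) * \<kappa> (hr r) (hr r))" unfolding hk[OF that] by simp
  finally show ?thesis unfolding \<kappa>_hr[OF r] by simp
 qed
 have "(THE t. t : HH & (ALL x:HH. \<kappa> t x = al r x)) = ?t"
 proof (rule the_equality)
  fix t assume "t : HH & (ALL x:HH. \<kappa> t x = al r x)"
  thus "t = ?t" using \<kappa>_H_unique[of t ?t] t tk by simp
 qed (use t tk in blast)
 moreover have "\<kappa> ?t ?t = of_int (sqlen r) / 12"
  unfolding tk[OF t] root_scale[OF al_dual[OF r] hr_in] al_hr[OF r] using g2_basic r by simp
 ultimately show ?thesis unfolding root_sq_length_def Let_def
  by (metis Re_complex_of_real of_real_divide of_real_numeral of_real_of_int_eq)
qed

lemma long_root_iff: "long_root UNIV HH \<alpha> \<longleftrightarrow> (EX r:g2_roots. sqlen r = 3 & \<alpha> = al r)"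
proof
 assume L: "long_root UNIV HH \<alpha>"
 then obtain r where r: "r : g2_roots" "\<alpha> = al r" unfolding long_root_def using root_cases by blast
 have q: "(0, 1) : g2_roots" "sqlen (0, 1) = 3" by (simp_all add: g2_roots_def sqlen_def)
 have "root_sq_length UNIV HH (al (0, 1)) <= root_sq_length UNIV HH \<alpha>"
  using L al_root[OF q(1)] unfolding long_root_def by blast
 hence "sqlen r >= 3" unfolding r(2) root_sq_length_al[OF r(1)] root_sq_length_al[OF q(1)] q(2) by simp
 moreover have "sqlen r = 1 | sqlen r = 3" using g2_basic r(1) by blast
 ultimately have "sqlen r = 3" by auto
 thus "EX r:g2_roots. sqlen r = 3 & \<alpha> = al r" using r by blast
next
 assume "EX r:g2_roots. sqlen r = 3 & \<alpha> = al r"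
 then obtain r where r: "r : g2_roots" "sqlen r = 3" "\<alpha> = al r" by blast
 have "root_sq_length UNIV HH \<beta> <= root_sq_length UNIV HH (al r)" if "\<beta> : roots UNIV HH" for \<beta>
 proof -
  obtain t where t: "t : g2_roots" "\<beta> = al t" using root_cases[OF \<open>\<beta> : roots UNIV HH\<close>] by blast
  have "sqlen t <= 3" using bspec[OF g2_basic t(1)] by auto
  thus ?thesis unfolding t(2) root_sq_length_al[OF t(1)] root_sq_length_al[OF r(1)] r(2) by simp
 qed
 thus "long_root UNIV HH \<alpha>" unfolding long_root_def r(3) using al_root[OF r(1)] by blast
qed

lemma short_root_iff: "short_root UNIV HH \<alpha> \<longleftrightarrow> (EX r:g2_roots. sqlen r = 1 & \<alpha> = al r)"
proof
 assume L: "short_root UNIV HH \<alpha>"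
 then obtain r where r: "r : g2_roots" "\<alpha> = al r" unfolding short_root_def using root_cases by blast
 have q: "(1, 0) : g2_roots" "sqlen (1, 0) = 1" by (simp_all add: g2_roots_def sqlen_def)
 have "root_sq_length UNIV HH \<alpha> <= root_sq_length UNIV HH (al (1, 0))"
  using L al_root[OF q(1)] unfolding short_root_def by blast
 hence "sqlen r <= 1" unfolding r(2) root_sq_length_al[OF r(1)] root_sq_length_al[OF q(1)] q(2) by simp
 moreover have "sqlen r = 1 | sqlen r = 3" using g2_basic r(1) by blast
 ultimately have "sqlen r = 1" by auto
 thus "EX r:g2_roots. sqlen r = 1 & \<alpha> = al r" using r by blast
next
 assume "EX r:g2_roots. sqlen r = 1 & \<alpha> = al r"
 then obtain r where r: "r : g2_roots" "sqlen r = 1" "\<alpha> = al r" by blast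
 have "root_sq_length UNIV HH (al r) <= root_sq_length UNIV HH \<beta>" if "\<beta> : roots UNIV HH" for \<beta>
 proof -
  obtain t where t: "t : g2_roots" "\<beta> = al t" using root_cases[OF \<open>\<beta> : roots UNIV HH\<close>] by blast
  have "1 <= sqlen t" using bspec[OF g2_basic t(1)] by auto
  thus ?thesis unfolding t(2) root_sq_length_al[OF t(1)] root_sq_length_al[OF r(1)] r(2) by simp
 qed
 thus "short_root UNIV HH \<alpha>" unfolding short_root_def r(3) using al_root[OF r(1)] by blast
qed

text \<open>Short coroots are the coroots of long roots.\<close>

lemma short_coroot_value:
 assumes "short_coroot UNIV HH c" shows "\<kappa> c c = 16"
proof -
 obtain \<alpha> where \<alpha>: "\<alpha> : roots UNIV HH" "c = coroot UNIV HH \<alpha>" using assms unfolding short_coroot_def by blast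
 obtain r where r: "r : g2_roots" "\<alpha> = al r" using root_cases[OF \<alpha>(1)] by blast
 have c: "c = hr r" using \<alpha>(2) coroot_eq[OF \<alpha>(1)] hroot_al[OF r(1)] r(2) by simp
 have q: "(0, 1) : g2_roots" "sqlen (0, 1) = 3" by (simp_all add: g2_roots_def sqlen_def)
 have "hr (0, 1) : coroot UNIV HH ` roots UNIV HH"
  using coroot_eq[OF al_root[OF q(1)]] hroot_al[OF q(1)] al_root[OF q(1)] by (intro image_eqI) simp_all
 hence "Re (\<kappa> c c) <= Re (\<kappa> (hr (0, 1)) (hr (0, 1)))" using assms unfolding short_coroot_def by blast
 hence "Re (\<kappa> (hr r) (hr r)) <= 16" unfolding c \<kappa>_hr_values(1)[OF q] by simp
 hence "sqlen r ~= 1" using \<kappa>_hr_values(2)[OF r(1)] by auto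
 hence "sqlen r = 3" using g2_basic r(1) by blast
 thus ?thesis unfolding c by (rule \<kappa>_hr_values(1)[OF r(1)])
qed

lemma normalized_UNIV: "normalized_form (UNIV :: 'g set) (%x y. \<kappa> x y / 8)"
 unfolding normalized_form_def
proof (intro conjI allI impI)
 show "invariant_form (UNIV :: 'g set) (%x y. \<kappa> x y / 8)"
  unfolding invariant_form_def
  by (intro conjI ballI allI, simp_all add: killing_UNIV add_divide_distrib killing_UNIV_inv, rule killing_UNIV_sym)
 fix H c assume Hc: "cartan_subalgebra (UNIV :: 'g set) H & short_coroot UNIV H c"
 obtain h0' h1' E' where f: "g2 h0' h1' E'" "lie.span {h0', h1'} = H" using frame_of_cartan[OF conjunct1[OF Hc]] by blast
 show "\<kappa> c c / 8 = 2" using g2.short_coroot_value[OF f(1)] Hc unfolding f(2) by simp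
qed

text \<open>The normalized forms are \<open>\<kappa> / 8\<close> on \<open>\<gg>\<close> and a quarter of the Killing form on the subalgebra. At the
 coroot they take the values \<open>16 i / 8\<close> and \<open>8 / 4\<close>.\<close>

lemma slr_index:
 assumes r: "r : g2_roots" and i: "\<kappa> (hr r) (hr r) = 16 * i"
 shows "has_index (slr r) i"
proof -
 interpret s: sl2 "E r" "hr r" "E (rneg r)" by (rule triple_E[OF r])
 note e0 = frameD(1)[OF r]
 let ?B = "%x y. \<kappa> x y / 8" and ?C = "%x y. killing_form s.slh x y / 4"
 have nB: "invariant_form s.slh ?B"
  using normalized_UNIV unfolding normalized_form_def invariant_form_def by blast
 have nC: "invariant_form s.slh ?C" using s.slh_normalized[OF e0] unfolding normalized_form_def by blast
 have "?B u v = i * ?C u v" if uv: "u : s.slh" "v : s.slh" for u v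
 proof -
  obtain x y z a b c where c: "u = x *. E r + y *. hr r + z *. E (rneg r)" "v = a *. E r + b *. hr r + c *. E (rneg r)"
   using uv unfolding span_triple by auto
  show ?thesis unfolding c s.invariant_form_value[OF nB] s.invariant_form_value[OF nC] i s.killing_slh[OF e0] by simp
 qed
 thus ?thesis unfolding has_index_def slr_def
  using s.slh_simple[OF e0] normalized_UNIV s.slh_normalized[OF e0] by blast
qed

section \<open>The orthogonal pair of \<open>sl\<^sub>2\<close>-subalgebras\<close>

lemma slr_facts:
 assumes r: "r : g2_roots"
 shows "subalgebra (slr r)" "semisimple_lie (slr r)" "of_type (slr r) type_A1" "slr r ~= {0}"
  "reductive_in (slr r)" "E r : slr r" "hr r : slr r" "E (rneg r) : slr r"
  "!!I. slr r \<subseteq> I ==> ~ solvable_lie I"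
proof -
 interpret s: sl2 "E r" "hr r" "E (rneg r)" by (rule triple_E[OF r])
 note e0 = frameD(1)[OF r]
 show "subalgebra (slr r)" unfolding slr_def by (rule s.slh_subalgebra)
 show "semisimple_lie (slr r)" unfolding slr_def by (rule s.slh_semisimple[OF e0])
 show "of_type (slr r) type_A1" unfolding slr_def by (rule s.slh_type_A1[OF e0])
 show in_slr: "E r : slr r" "hr r : slr r" "E (rneg r) : slr r" unfolding slr_def by (rule s.slh_in)+
 show "slr r ~= {0}" using e0 in_slr(1) by blast
 show "reductive_in (slr r)" unfolding slr_def by (rule slh_reductive[OF triple_E[OF r] diagonalizable[OF hr_in]])
 show "!!I. slr r \<subseteq> I ==> ~ solvable_lie I" unfolding slr_def by (rule s.slh_nonsolvable[OF e0])
qed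

lemma slr_minimal: "lie.subspace I ==> E r : I ==> hr r : I ==> E (rneg r) : I ==> slr r \<subseteq> I"
 unfolding slr_def by (rule lie.span_minimal) auto

lemma slr_commute:
 assumes r: "r : g2_roots" and s: "s : g2_roots" and orth: "cartan_int r s = 0" and u: "u : slr r" and v: "v : slr s"
 shows "ad u v = 0"
proof -
 have n: "rneg r : g2_roots" "rneg s : g2_roots" using g2_basic r s by blast+
 have o: "cartan_int r (rneg s) = 0" "cartan_int (rneg r) s = 0" "cartan_int (rneg r) (rneg s) = 0"
  using cartan_int_neg[OF r s] cartan_int_neg[OF r n(2)] orth by simp_all
 obtain x y z where c: "u = x *. E r + y *. hr r + z *. E (rneg r)" using u slr_comb by blast
 obtain a b d where d: "v = a *. E s + b *. hr s + d *. E (rneg s)" using v slr_comb by blast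
 show ?thesis unfolding c d
  by (simp add: bracket_simps orth_commute[OF r s orth] orth_commute[OF r n(2) o(1)]
    orth_commute[OF n(1) s o(2)] orth_commute[OF n o(3)] abelian[OF hr_in hr_in])
qed

lemma centralizer_slr:
 assumes r: "r : g2_roots" and s: "s : g2_roots" and orth: "cartan_int r s = 0"
 shows "centralizer (slr r) = slr s"
proof
 show "centralizer (slr r) \<subseteq> slr s"
 proof
  fix v assume v: "v : centralizer (slr r)"
  hence "ad v (E r) = 0" "ad v (E (rneg r)) = 0" unfolding centralizer_def using slr_facts(6,8)[OF r] by blast+
  thus "v : slr s" using centralizer_slr_sub[OF r s orth] bracket_anti[of "E r" v] bracket_anti[of "E (rneg r)" v] by simp
 qed
 show "slr s \<subseteq> centralizer (slr r)"
 proof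
  fix v assume v: "v : slr s"
  have "ad v u = 0" if "u : slr r" for u using slr_commute[OF r s orth that v] bracket_anti[of v u] by simp
  thus "v : centralizer (slr r)" unfolding centralizer_def by blast
 qed
qed

lemma slr_dual_pair:
 assumes r: "r : g2_roots" and s: "s : g2_roots" and orth: "cartan_int r s = 0"
 shows "semisimple_dual_pair (slr r) (slr s)"
proof -
 have "cartan_int s r = 0" using g2_orthogonal r s orth by blast
 thus ?thesis unfolding semisimple_dual_pair_def dual_pair_def
  using centralizer_slr[OF r s orth] centralizer_slr[OF s r] slr_facts(2,5)[OF r] slr_facts(2,5)[OF s] by simp
qed

end

section \<open>Closed sets of roots\<close>

text \<open>The list has one entry for every unordered pair of roots whose sum is a root.\<close>

definition g2_sums :: "((int \<times> int) \<times> (int \<times> int) \<times> (int \<times> int)) list" where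
 "g2_sums = [((1,0),(0,1),(1,1)), ((1,0),(1,1),(2,1)), ((1,0),(2,1),(3,1)), ((1,0),(-1,-1),(0,-1)),
   ((1,0),(-2,-1),(-1,-1)), ((1,0),(-3,-1),(-2,-1)), ((0,1),(3,1),(3,2)), ((0,1),(-1,-1),(-1,0)),
   ((0,1),(-3,-2),(-3,-1)), ((1,1),(2,1),(3,2)), ((1,1),(-1,0),(0,1)), ((1,1),(0,-1),(1,0)),
   ((1,1),(-2,-1),(-1,0)), ((1,1),(-3,-2),(-2,-1)), ((2,1),(-1,0),(1,1)), ((2,1),(-1,-1),(1,0)),
   ((2,1),(-3,-1),(-1,0)), ((2,1),(-3,-2),(-1,-1)), ((3,1),(-1,0),(2,1)), ((3,1),(-2,-1),(1,0)),
   ((3,1),(-3,-2),(0,-1)), ((3,2),(0,-1),(3,1)), ((3,2),(-1,-1),(2,1)), ((3,2),(-2,-1),(1,1)),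
   ((3,2),(-3,-1),(0,1)), ((-1,0),(0,-1),(-1,-1)), ((-1,0),(-1,-1),(-2,-1)), ((-1,0),(-2,-1),(-3,-1)),
   ((0,-1),(-3,-1),(-3,-2)), ((-1,-1),(-2,-1),(-3,-2))]"

lemma g2_sums: "ALL (r, s, t) : set g2_sums. r : g2_roots & s : g2_roots & t : g2_roots & radd r s = t"
 by code_simp

lemma closed_sums:
 assumes "ALL r:g2_roots. ALL s:g2_roots. P r --> P s --> radd r s : g2_roots --> P (radd r s)"
 shows "ALL (r, s, t) : set g2_sums. P r --> P s --> P t"
 using assms g2_sums by fastforce

text \<open>The functionals \<open>(a, b)\<close> tried are one for each of the twelve Weyl chambers, taking the value 1 on both simple
 roots of the chamber. That one of them is positive on \<open>P\<close> is a propositional fact about the twelve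
 statements \<open>P r\<close>.\<close>

lemma g2_halfspace:
 fixes P :: "int \<times> int => bool"
 assumes closed: "ALL r:g2_roots. ALL s:g2_roots. P r --> P s --> radd r s : g2_roots --> P (radd r s)"
  and anti: "ALL r:g2_roots. P r --> ~ P (rneg r)"
 shows "EX a b. ALL r:g2_roots. P r --> 0 < a * fst r + b * snd r"
proof (rule ccontr)
 assume no: "~ ?thesis"
 have n: "~ (ALL r:g2_roots. P r --> 0 < a * fst r + b * snd r)" for a b using no by blast
 have A: "~ (P (1,0) & P (-1,0))" "~ (P (0,1) & P (0,-1))" "~ (P (1,1) & P (-1,-1))" "~ (P (2,1) & P (-2,-1))"
  "~ (P (3,1) & P (-3,-1))" "~ (P (3,2) & P (-3,-2))"
  using anti unfolding g2_roots_def by (simp_all add: rneg_def)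
 note C = closed_sums[OF closed, unfolded g2_sums_def list.set ball_simps split]
 show False
  using A C n[of 1 1, unfolded g2_roots_def, simplified] n[of "-1" 4, unfolded g2_roots_def, simplified]
   n[of "-2" 5, unfolded g2_roots_def, simplified] n[of "-3" 5, unfolded g2_roots_def, simplified]
   n[of "-3" 4, unfolded g2_roots_def, simplified] n[of "-2" 1, unfolded g2_roots_def, simplified]
   n[of "-1" "-1", unfolded g2_roots_def, simplified] n[of 1 "-4", unfolded g2_roots_def, simplified]
   n[of 2 "-5", unfolded g2_roots_def, simplified] n[of 3 "-5", unfolded g2_roots_def, simplified]
   n[of 3 "-4", unfolded g2_roots_def, simplified] n[of 2 "-1", unfolded g2_roots_def, simplified]
  by satx
qed

text \<open>The closed symmetric sets are those of type \<open>\<emptyset>, A\<^sub>1, A\<^sub>1 \<times> A\<^sub>1, A\<^sub>2, G\<^sub>2\<close>. The last two contain all long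
 roots and share one alternative.\<close>

lemma g2_symmetric_closed:
 fixes P :: "int \<times> int => bool"
 assumes closed: "ALL r:g2_roots. ALL s:g2_roots. P r --> P s --> radd r s : g2_roots --> P (radd r s)"
  and symm: "ALL r:g2_roots. P r --> P (rneg r)"
 shows "(EX r:g2_roots. ALL t:g2_roots. P t --> t = r | t = rneg r) |
  (EX r:g2_roots. EX s:g2_roots. sqlen r = 3 & cartan_int r s = 0 & P r & P s &
    (ALL t:g2_roots. P t --> t = r | t = rneg r | t = s | t = rneg s)) |
  (ALL t:g2_roots. sqlen t = 3 --> P t)" (is "?A | ?B | ?C")
proof -
 have sy1: "P (rneg r) = P r" if "r : g2_roots" for r using symm that g2_basic by metis
 have sy: "P (-1,0) = P (1,0)" "P (0,-1) = P (0,1)" "P (-1,-1) = P (1,1)" "P (-2,-1) = P (2,1)"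
  "P (-3,-1) = P (3,1)" "P (-3,-2) = P (3,2)"
  using sy1[of "(1,0)"] sy1[of "(0,1)"] sy1[of "(1,1)"] sy1[of "(2,1)"] sy1[of "(3,1)"] sy1[of "(3,2)"]
  by (simp_all add: rneg_def g2_roots_def)
 have dich: "(~ P (0,1) & ~ P (1,1) & ~ P (2,1) & ~ P (3,1) & ~ P (3,2)) |
   (~ P (1,0) & ~ P (1,1) & ~ P (2,1) & ~ P (3,1) & ~ P (3,2)) |
   (~ P (1,0) & ~ P (0,1) & ~ P (2,1) & ~ P (3,1) & ~ P (3,2)) |
   (~ P (1,0) & ~ P (0,1) & ~ P (1,1) & ~ P (3,1) & ~ P (3,2)) |
   (~ P (1,0) & ~ P (0,1) & ~ P (1,1) & ~ P (2,1) & ~ P (3,2)) |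
   (~ P (1,0) & ~ P (0,1) & ~ P (1,1) & ~ P (2,1) & ~ P (3,1)) |
   (P (0,1) & P (2,1) & ~ P (1,0) & ~ P (1,1) & ~ P (3,1) & ~ P (3,2)) |
   (P (3,1) & P (1,1) & ~ P (1,0) & ~ P (0,1) & ~ P (2,1) & ~ P (3,2)) |
   (P (3,2) & P (1,0) & ~ P (0,1) & ~ P (1,1) & ~ P (2,1) & ~ P (3,1)) |
   (P (0,1) & P (3,1) & P (3,2))"
  using closed_sums[OF closed, unfolded g2_sums_def list.set ball_simps split] sy by satx
 have A: ?A if "t : g2_roots" "ALL t':g2_roots. P t' --> t' = t | t' = rneg t" for t using that by blast
 have B: ?B if "t : g2_roots" "s : g2_roots" "sqlen t = 3 & cartan_int t s = 0" "P t" "P s"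
  "ALL t':g2_roots. P t' --> t' = t | t' = rneg t | t' = s | t' = rneg s" for t s using that by blast
 from dich show ?thesis
 proof (elim disjE)
  assume "~ P (0,1) & ~ P (1,1) & ~ P (2,1) & ~ P (3,1) & ~ P (3,2)"
  hence "ALL t':g2_roots. P t' --> t' = (1,0) | t' = rneg (1,0)"
   unfolding g2_roots_def by (simp add: rneg_def sy)
  thus ?thesis using A[of "(1,0)"] by (simp add: g2_roots_def)
 next
  assume "~ P (1,0) & ~ P (1,1) & ~ P (2,1) & ~ P (3,1) & ~ P (3,2)"
  hence "ALL t':g2_roots. P t' --> t' = (0,1) | t' = rneg (0,1)"
   unfolding g2_roots_def by (simp add: rneg_def sy)
  thus ?thesis using A[of "(0,1)"] by (simp add: g2_roots_def)
 next
  assume "~ P (1,0) & ~ P (0,1) & ~ P (2,1) & ~ P (3,1) & ~ P (3,2)"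
  hence "ALL t':g2_roots. P t' --> t' = (1,1) | t' = rneg (1,1)"
   unfolding g2_roots_def by (simp add: rneg_def sy)
  thus ?thesis using A[of "(1,1)"] by (simp add: g2_roots_def)
 next
  assume "~ P (1,0) & ~ P (0,1) & ~ P (1,1) & ~ P (3,1) & ~ P (3,2)"
  hence "ALL t':g2_roots. P t' --> t' = (2,1) | t' = rneg (2,1)"
   unfolding g2_roots_def by (simp add: rneg_def sy)
  thus ?thesis using A[of "(2,1)"] by (simp add: g2_roots_def)
 next
  assume "~ P (1,0) & ~ P (0,1) & ~ P (1,1) & ~ P (2,1) & ~ P (3,2)"
  hence "ALL t':g2_roots. P t' --> t' = (3,1) | t' = rneg (3,1)"
   unfolding g2_roots_def by (simp add: rneg_def sy)
  thus ?thesis using A[of "(3,1)"] by (simp add: g2_roots_def)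
 next
  assume "~ P (1,0) & ~ P (0,1) & ~ P (1,1) & ~ P (2,1) & ~ P (3,1)"
  hence "ALL t':g2_roots. P t' --> t' = (3,2) | t' = rneg (3,2)"
   unfolding g2_roots_def by (simp add: rneg_def sy)
  thus ?thesis using A[of "(3,2)"] by (simp add: g2_roots_def)
 next
  assume "P (0,1) & P (2,1) & ~ P (1,0) & ~ P (1,1) & ~ P (3,1) & ~ P (3,2)"
  moreover from this have "ALL t':g2_roots. P t' --> t' = (0,1) | t' = rneg (0,1) | t' = (2,1) | t' = rneg (2,1)"
   unfolding g2_roots_def by (simp add: rneg_def sy)
  moreover have "(0,1) : g2_roots" "(2,1) : g2_roots" "sqlen (0,1) = 3 & cartan_int (0,1) (2,1) = 0" by (simp_all add: g2_defs)
  ultimately show ?thesis using B[of "(0,1)" "(2,1)"] by blast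
 next
  assume "P (3,1) & P (1,1) & ~ P (1,0) & ~ P (0,1) & ~ P (2,1) & ~ P (3,2)"
  moreover from this have "ALL t':g2_roots. P t' --> t' = (3,1) | t' = rneg (3,1) | t' = (1,1) | t' = rneg (1,1)"
   unfolding g2_roots_def by (simp add: rneg_def sy)
  moreover have "(3,1) : g2_roots" "(1,1) : g2_roots" "sqlen (3,1) = 3 & cartan_int (3,1) (1,1) = 0" by (simp_all add: g2_defs)
  ultimately show ?thesis using B[of "(3,1)" "(1,1)"] by blast
 next
  assume "P (3,2) & P (1,0) & ~ P (0,1) & ~ P (1,1) & ~ P (2,1) & ~ P (3,1)"
  moreover from this have "ALL t':g2_roots. P t' --> t' = (3,2) | t' = rneg (3,2) | t' = (1,0) | t' = rneg (1,0)"
   unfolding g2_roots_def by (simp add: rneg_def sy)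
  moreover have "(3,2) : g2_roots" "(1,0) : g2_roots" "sqlen (3,2) = 3 & cartan_int (3,2) (1,0) = 0" by (simp_all add: g2_defs)
  ultimately show ?thesis using B[of "(3,2)" "(1,0)"] by blast
 next
  assume "P (0,1) & P (3,1) & P (3,2)"
  hence ?C unfolding g2_roots_def by (simp add: sqlen_def sy)
  thus ?thesis by blast
 qed
qed

lemma bracket_span_sub:
 assumes "!!x y. x : A ==> y : B ==> ad x y : U" "lie.subspace U"
 shows "bracket_span (lie.span A) (lie.span B) \<subseteq> U"
 unfolding bracket_span_def
proof (rule lie.span_minimal[OF _ assms(2)], clarify)
 fix x y assume xy: "x : lie.span A" "y : lie.span B"
 have 1: "ad a y : U" if "a : A" for a
  by (rule lin_span_stable[OF lin_ad _ assms(2) xy(2)]) (rule assms(1)[OF that])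
 show "ad x y : U" by (rule lin_span_stable[OF lin_ad_right _ assms(2) xy(1)]) (rule 1)
qed

section \<open>Subalgebras normalized by a Cartan subalgebra\<close>

context g2
begin

lemma E_bracket:
 assumes r: "r : g2_roots" "s : g2_roots" "radd r s : g2_roots"
 obtains c where "c ~= 0" "ad (E r) (E s) = c *. E (radd r s)"
proof -
 have "al (radd r s) h = al r h + al s h" if "h : HH" for h
 proof -
  obtain x y where h: "h = x *. h0 + y *. h1" using \<open>h : HH\<close> span_pair by blast
  show ?thesis unfolding h al_comb[OF r(1)] al_comb[OF r(2)] al_comb[OF r(3)]
   by (simp add: pair0_def pair1_def radd_def algebra_simps)
 qed
 hence "ad (E r) (E s) : RS (al (radd r s))"
  by (rule RS_bracket'[OF E_RS[OF r(1)] E_RS[OF r(2)]])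
 then obtain c where c: "ad (E r) (E s) = c *. E (radd r s)" using RS_al[OF r(3)] by blast
 hence "c ~= 0" using EE_nonzero[OF r] by auto
 thus thesis using c that by blast
qed

lemma E_scale: "lie.subspace U ==> c *. E r : U ==> c ~= 0 ==> E r : U"
 using lie.subspace_scale[of U "c *. E r" "1 / c"] by (simp add: scaleC_scaleC)

text \<open>For reasons of weight \<open>E r\<close> can only pair nontrivially with the component of \<open>y\<close> along \<open>-r\<close>. The form may be
 that of \<open>\<gg>\<close> or that of a subalgebra normalized by the Cartan subalgebra.\<close>

lemma opposite_root:
 assumes L: "subalgebra L" "!!h x. h : HH ==> x : L ==> ad h x : L"
  and U: "lie.subspace U" "!!h u. h : HH ==> u : U ==> ad h u : U" "U \<subseteq> L"
  and r: "r : g2_roots" "E r : U" and y: "y : U" "killing_form L (E r) y ~= 0"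
 shows "E (rneg r) : U"
proof (rule ccontr)
 assume nr: "E (rneg r) ~: U"
 note N = subalgebraD[OF L(1)]
 have rL: "E r : L" using r(2) U(3) by blast
 obtain z x where zx: "z : HH" "y = z + (SUM t:g2_roots. x t *. E t)" using expand by blast
 have m: "z + (SUM t:g2_roots. x t *. E t) : U" using y(1) zx(2) by simp
 have zU: "z : U" by (rule component(1)[OF U(1) _ zx(1) m]) (rule U(2))
 have xU: "x t *. E t : U" if "t : g2_roots" for t by (rule component(2)[OF U(1) _ zx(1) m that]) (rule U(2))
 have orth: "killing_form L (E r) v = 0" if v: "v : L" "ad h v = c *. v" and h: "h : HH" "al r h + c ~= 0" for v h c
 proof -
  have nh: "normalizes h L" using L(2) h(1) by blast
  have "killing_form L (ad (E r) h) v = killing_form L (E r) (ad h v)"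
   by (rule killing_invariant[OF N(1) N(3)[OF rL] nh N(3)[OF v(1)]])
  moreover have "ad (E r) h = (- al r h) *. E r" using al_E[OF r(1) h(1)] bracket_anti[of "E r" h] by simp
  ultimately have e: "(- al r h) * killing_form L (E r) v = c * killing_form L (E r) v"
   unfolding v(2) by (simp only: killing_bilinear(4,8)[OF L(1) rL v(1) v(1)] killing_bilinear(4,8)[OF L(1) v(1) v(1) rL])
  have "(al r h + c) * killing_form L (E r) v = 0" unfolding distrib_right e[symmetric] by simp
  thus ?thesis using h(2) by simp
 qed
 let ?S = "insert z ((%t. x t *. E t) ` g2_roots)"
 have zero: "killing_form L (E r) v = 0" if v: "v : ?S" for v
 proof -
  consider "v = z" | t where "t : g2_roots" "v = x t *. E t" using v by blast
  thus ?thesis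
  proof cases
   case 1
   have "al r (hr r) + 0 ~= 0" using al_hr[OF r(1), of r] bspec[OF g2_basic r(1)] by simp
   moreover have "ad (hr r) z = 0 *. z" using abelian[OF hr_in zx(1)] by simp
   ultimately show ?thesis unfolding 1 using orth hr_in zU U(3) by blast
  next
   case 2
   have nrr: "rneg r : g2_roots" using g2_basic r(1) by blast
   show ?thesis
   proof (cases "t = rneg r")
    case True
    hence "x t = 0" using E_scale[OF U(1)] xU[OF 2(1)] nr by blast
    thus ?thesis using 2(2) N(1) by simp
   next
    case False
    have "EX h:HH. al r h + al t h ~= 0"
    proof (rule ccontr)
     assume "~ ?thesis"
     hence "al t h = neg (al r) h" if "h : HH" for h using that by (metis add.commute add_eq_0_iff)
     hence "al t = neg (al r)"
      by (rule dual_space_eqI[OF al_dual[OF 2(1)] dual_space_uminus[OF al_dual[OF r(1)]]])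
     thus False using al_neg[OF r(1)] al_inj[OF 2(1) nrr] False by simp
    qed
    then obtain h where h: "h : HH" "al r h + al t h ~= 0" by blast
    have "ad h v = al t h *. v"
     unfolding 2(2) bracket_scaleC_right al_E[OF 2(1) h(1)] by (simp add: scaleC_scaleC mult.commute)
    thus ?thesis using orth[OF _ _ h] xU[OF 2(1)] U(3) 2(2) by blast
   qed
  qed
 qed
 have "y : lie.span ?S"
  unfolding zx(2) by (intro lie.span_add lie.span_sum lie.span_base) auto
 hence "killing_form L (E r) y = 0"
  by (rule killing_zero_subspace[OF L(1) rL, rotated 2]) (use zU xU U(3) zero in auto)
 thus False using y(2) by simp
qed

lemma component_zero:
 assumes z: "z : HH" "z + (SUM t:g2_roots. x t *. E t) = 0" and r: "r : g2_roots"
 shows "z = 0" "x r = 0"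
proof -
 have m: "z + (SUM t:g2_roots. x t *. E t) : {0}" using z(2) by simp
 have "z : {0}" by (rule component(1)[OF lie.subspace_single_0 _ z(1) m]) simp
 thus "z = 0" by simp
 have "x r *. E r : {0}" by (rule component(2)[OF lie.subspace_single_0 _ z(1) m r]) simp
 thus "x r = 0" using frameD(1)[OF r] by simp
qed

lemma independent_roots:
 assumes S: "S \<subseteq> g2_roots"
 shows "lie.independent (insert h1 (E ` S))" "card (insert h1 (E ` S)) = Suc (card S)"
proof -
 have fin: "finite g2_roots" "finite S" using S by (auto simp: g2_roots_def intro: finite_subset)
 have q: "(0, 1) : g2_roots" "pair1 (0, 1) = 2" by (simp_all add: g2_roots_def pair1_def)
 have h10: "h1 ~= 0" using frameD(3)[OF q(1)] frameD(1)[OF q(1)] q(2) by auto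
 have h1E: "h1 ~: E ` S"
 proof
  assume "h1 : E ` S"
  then obtain t where t: "t : g2_roots" "h1 = E t" using S by blast
  have "ad (hr t) (E t) = 0" using abelian[OF hr_in h_in(2)] t(2) by simp
  thus False using hr_E[OF t(1)] frameD(1)[OF t(1)] bspec[OF g2_basic t(1)] by simp
 qed
 have inj: "inj_on E S" by (rule inj_on_subset[OF E_inj S])
 show "card (insert h1 (E ` S)) = Suc (card S)" using h1E fin card_image[OF inj] by simp
 show "lie.independent (insert h1 (E ` S))"
 proof (rule lie.independent_if_scalars_zero)
  show "finite (insert h1 (E ` S))" using fin by simp
  fix f x assume s: "(SUM x:insert h1 (E ` S). f x *. x) = 0" and x: "x : insert h1 (E ` S)"
  let ?x = "%t. if t : S then f (E t) else 0"
  have "(SUM x:insert h1 (E ` S). f x *. x) = f h1 *. h1 + (SUM t:S. f (E t) *. E t)"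
   using h1E fin sum.reindex[OF inj, of "%x. f x *. x"] by (simp add: o_def)
  also have "(SUM t:S. f (E t) *. E t) = (SUM t:S. ?x t *. E t)" by (rule sum.cong) auto
  also have "... = (SUM t:g2_roots. ?x t *. E t)" by (rule sum.mono_neutral_left[OF fin(1) S]) auto
  finally have e: "f h1 *. h1 + (SUM t:g2_roots. ?x t *. E t) = 0" using s by simp
  note c = component_zero[OF lie.span_scale[OF h_in(2)] e]
  show "f x = 0"
  proof (cases "x = h1")
   case True
   thus ?thesis using c(1)[OF q(1)] h10 by simp
  next
   case False
   then obtain t where t: "t : S" "x = E t" using x by blast
   thus ?thesis using c(2)[of t] S by auto
  qed
 qed
qed

context
 fixes m :: "'g set"
 assumes M: "subalgebra m" and st: "ALL h:HH. ALL x:m. ad h x : m" and ss: "semisimple_lie m"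
begin

lemma reg_stable: "h : HH ==> x : m ==> ad h x : m" using st by blast

lemma reg_components:
 assumes "y : m"
 obtains z x where "z : HH" "z : m" "y = z + (SUM t:g2_roots. x t *. E t)" "!!t. t : g2_roots ==> x t ~= 0 ==> E t : m"
proof -
 note N = subalgebraD[OF M]
 obtain z x where zx: "z : HH" "y = z + (SUM t:g2_roots. x t *. E t)" using expand by blast
 have mm: "z + (SUM t:g2_roots. x t *. E t) : m" using assms zx(2) by simp
 have "z : m" by (rule component(1)[OF N(1) _ zx(1) mm]) (rule reg_stable)
 moreover have "E t : m" if t: "t : g2_roots" "x t ~= 0" for t
 proof (rule E_scale[OF N(1) _ t(2)])
  show "x t *. E t : m" by (rule component(2)[OF N(1) _ zx(1) mm t(1)]) (rule reg_stable)
 qed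
 ultimately show thesis using zx that by blast
qed

lemma reg_span: "m \<subseteq> lie.span ((m \<inter> HH) \<union> (m \<inter> E ` g2_roots))"
proof
 fix y assume "y : m"
 then obtain z x where zx: "z : HH" "z : m" "y = z + (SUM t:g2_roots. x t *. E t)" "!!t. t : g2_roots ==> x t ~= 0 ==> E t : m"
  by (rule reg_components) blast
 have "x t *. E t : lie.span ((m \<inter> HH) \<union> (m \<inter> E ` g2_roots))" if "t : g2_roots" for t
 proof (cases "x t = 0")
  case True
  thus ?thesis by (simp add: lie.span_zero)
 next
  case False
  thus ?thesis using zx(4)[OF that] that by (intro lie.span_scale lie.span_base) blast
 qed
 thus "y : lie.span ((m \<inter> HH) \<union> (m \<inter> E ` g2_roots))"
  unfolding zx(3) using zx(1,2) by (intro lie.span_add lie.span_sum) (auto intro: lie.span_base)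
qed

lemma reg_killing_nonzero:
 assumes r: "r : g2_roots" "E r : m"
 shows "killing_form m (hr r) (hr r) ~= 0"
proof (rule killing_integral_nonzero[OF M reg_span _ _ r(2)])
 show "m \<inter> HH \<union> m \<inter> E ` g2_roots \<subseteq> m" by blast
 show "ad (hr r) (E r) ~= 0" using hr_E[OF r(1)] frameD(1)[OF r(1)] bspec[OF g2_basic r(1)] by simp
 fix v assume "v : m \<inter> HH \<union> m \<inter> E ` g2_roots"
 then consider "v : HH" | s where "s : g2_roots" "v = E s" by blast
 thus "EX k::int. ad (hr r) v = of_int k *. v"
 proof cases
  case 1
  thus ?thesis using abelian[OF hr_in] by (intro exI[of _ 0]) simp
 next
  case 2
  show ?thesis unfolding 2(2) using hr_E[OF 2(1)] by blast
 qed
qed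

text \<open>The radical \<open>R\<close> of the Killing form of \<open>m\<close> is an ideal stable under the Cartan subalgebra. It cannot contain root
 vectors of opposite roots, because \<open>\<kappa>(h, h) > 0\<close> for their bracket \<open>h\<close>. So its roots lie in a half plane,
 and the derived series climbs in height: \<open>R\<close> is solvable, hence zero.\<close>

theorem reg_nondeg: "killing_nondeg m"
proof -
 note N = subalgebraD[OF M]
 define R where "R = {x : m. ALL y:m. killing_form m x y = 0}"
 have Rm: "R \<subseteq> m" unfolding R_def by blast
 have RI: "x : R" if "x : m" "!!y. y : m ==> killing_form m x y = 0" for x using that unfolding R_def by blast
 have RD: "killing_form m x y = 0" if "x : R" "y : m" for x y using that unfolding R_def by blast
 have Rs: "lie.subspace R"
 proof (rule lie.subspaceI)
  show "0 : R" by (rule RI) (use N(1) lie.subspace_0[OF N(1)] in simp_all)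
  fix x y assume xy: "x : R" "y : R"
  hence xym: "x : m" "y : m" using Rm by auto
  show "x + y : R"
   by (rule RI[OF lie.subspace_add[OF N(1) xym]]) (use killing_bilinear(1)[OF M xym] RD xy in simp)
 next
  fix c x assume x: "x : R"
  hence xm: "x : m" using Rm by auto
  show "c *. x : R"
   by (rule RI[OF lie.subspace_scale[OF N(1) xm]]) (use killing_bilinear(4)[OF M xm xm] RD x in simp)
 qed
 have Rn: "ad n x : R" if n: "normalizes n m" and x: "x : R" for n x
 proof -
  have xm: "x : m" using x Rm by blast
  have "ad x n : R"
  proof (rule RI)
   have "ad n x : m" using n xm by blast
   thus "ad x n : m" using bracket_anti[of x n] lie.subspace_neg[OF N(1)] by simp
   fix y assume y: "y : m"
   have "killing_form m (ad x n) y = killing_form m x (ad n y)"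
    by (rule killing_invariant[OF N(1) N(3)[OF xm] n N(3)[OF y]])
   thus "killing_form m (ad x n) y = 0" using RD[OF x] n y by simp
  qed
  thus ?thesis using bracket_anti[of n x] lie.subspace_neg[OF Rs] by simp
 qed
 have Rst: "ad h x : R" if "h : HH" "x : R" for h x by (rule Rn) (use st that in auto)
 have ideal: "lie_ideal m R" unfolding lie_ideal_def using Rs Rm Rn N(3) by blast
 have closed: "ALL r:g2_roots. ALL s:g2_roots. E r : R --> E s : R --> radd r s : g2_roots --> E (radd r s) : R"
 proof (intro ballI impI)
  fix r s assume rs: "r : g2_roots" "s : g2_roots" "E r : R" "E s : R" "radd r s : g2_roots"
  obtain c where c: "c ~= 0" "ad (E r) (E s) = c *. E (radd r s)" by (rule E_bracket[OF rs(1,2,5)])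
  have "ad (E r) (E s) : R" by (rule Rn[OF N(3) rs(4)]) (use rs(3) Rm in blast)
  thus "E (radd r s) : R" using E_scale[OF Rs _ c(1)] c(2) by simp
 qed
 have anti: "ALL r:g2_roots. E r : R --> ~ E (rneg r) : R"
 proof (intro ballI impI notI)
  fix r assume r: "r : g2_roots" "E r : R" "E (rneg r) : R"
  have "ad (E r) (E (rneg r)) : R" by (rule Rn[OF N(3) r(3)]) (use r(2) Rm in blast)
  hence "hr r : R" using frameD(4)[OF r(1)] by simp
  hence "killing_form m (hr r) (hr r) = 0" using RD Rm by blast
  thus False using reg_killing_nonzero[OF r(1)] r(2) Rm by blast
 qed
 obtain a b where ab: "ALL r:g2_roots. E r : R --> 0 < a * fst r + b * snd r"
  using g2_halfspace[of "%r. E r : R", OF closed anti] by blast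
 define ht where "ht t = a * fst t + b * snd t" for t
 define F where "F k = lie.span (E ` {t : g2_roots. k <= ht t})" for k :: int
 have Fs: "lie.subspace (F k)" for k unfolding F_def by simp
 have EF: "E t : F k" if "t : g2_roots" "k <= ht t" for t k
  unfolding F_def by (rule lie.span_base) (use that in blast)
 have EE: "ad (E s) (E t) : F (k + 1)" if s: "s : g2_roots" "k <= ht s" and t: "t : g2_roots" "k <= ht t" and k: "1 <= k" for s t k
 proof (cases "radd s t : g2_roots")
  case True
  obtain c where c: "ad (E s) (E t) = c *. E (radd s t)" by (rule E_bracket[OF s(1) t(1) True])
  have "ht (radd s t) = ht s + ht t" by (simp add: ht_def radd_def algebra_simps)
  thus ?thesis unfolding c using EF[OF True] s(2) t(2) k by (intro lie.subspace_scale[OF Fs]) simp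
 next
  case False
  have "radd s t ~= (0, 0)"
  proof
   assume "radd s t = (0, 0)"
   moreover have "ht (radd s t) = ht s + ht t" by (simp add: ht_def radd_def algebra_simps)
   ultimately show False using s(2) t(2) k by (simp add: ht_def)
  qed
  hence "ad (E s) (E t) = 0" by (rule EE_zero[OF s(1) t(1) False])
  thus ?thesis using lie.subspace_0[OF Fs] by simp
 qed
 have FF: "bracket_span (F k) (F k) \<subseteq> F (k + 1)" if "1 <= k" for k
  unfolding F_def[of k] by (rule bracket_span_sub[OF _ Fs]) (use EE that in blast)
 have RF: "R \<subseteq> lie.span (HH \<union> E ` {t : g2_roots. 1 <= ht t})"
 proof
  fix y assume y: "y : R"
  obtain z x where zx: "z : HH" "y = z + (SUM t:g2_roots. x t *. E t)" using expand by blast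
  have mm: "z + (SUM t:g2_roots. x t *. E t) : R" using y zx(2) by simp
  have "x t *. E t : lie.span (HH \<union> E ` {t : g2_roots. 1 <= ht t})" if t: "t : g2_roots" for t
  proof (cases "x t = 0")
   case True
   thus ?thesis by (simp add: lie.span_zero)
  next
   case False
   have "x t *. E t : R" by (rule component(2)[OF Rs _ zx(1) mm t]) (rule Rst)
   hence "E t : R" by (rule E_scale[OF Rs _ False])
   hence "1 <= ht t" using ab t unfolding ht_def by force
   thus ?thesis using t by (intro lie.span_scale lie.span_base) blast
  qed
  thus "y : lie.span (HH \<union> E ` {t : g2_roots. 1 <= ht t})"
   unfolding zx(2) using zx(1) by (intro lie.span_add lie.span_sum) (auto intro: lie.span_base)
 qed
 have HE: "ad h (E t) : F 1" if "h : HH" "t : g2_roots" "1 <= ht t" for h t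
  unfolding al_E[OF that(2,1)] by (rule lie.subspace_scale[OF Fs EF[OF that(2,3)]])
 have F12: "F 2 \<subseteq> F 1" unfolding F_def by (rule lie.span_mono) auto
 have R1: "bracket_span R R \<subseteq> F 1"
 proof -
  let ?A = "HH \<union> E ` {t : g2_roots. 1 <= ht t}"
  have "bracket_span R R \<subseteq> bracket_span (lie.span ?A) (lie.span ?A)" by (rule bracket_span_mono[OF RF])
  also have "... \<subseteq> F 1"
  proof (rule bracket_span_sub[OF _ Fs])
   fix x y assume "x : ?A" "y : ?A"
   then consider "x : HH" "y : HH" | t where "x : HH" "t : g2_roots" "1 <= ht t" "y = E t"
    | t where "y : HH" "t : g2_roots" "1 <= ht t" "x = E t"
    | s t where "s : g2_roots" "1 <= ht s" "x = E s" "t : g2_roots" "1 <= ht t" "y = E t" by blast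
   thus "ad x y : F 1"
   proof cases
    case 1
    thus ?thesis using abelian lie.subspace_0[OF Fs] by simp
   next
    case 2
    thus ?thesis using HE by simp
   next
    case 3
    thus ?thesis using HE[OF 3(1-3)] bracket_anti[of x y] lie.subspace_neg[OF Fs] by simp
   next
    case 4
    thus ?thesis using EE[of s 1 t] F12 by auto
   qed
  qed
  finally show ?thesis .
 qed
 have D: "((%D. bracket_span D D) ^^ Suc j) R \<subseteq> F (1 + int j)" for j
 proof (induction j)
  case 0
  thus ?case using R1 by simp
 next
  case (Suc j)
  have "((%D. bracket_span D D) ^^ Suc (Suc j)) R \<subseteq> bracket_span (F (1 + int j)) (F (1 + int j))"
   using bracket_span_mono[OF Suc.IH] by simp
  also have "... \<subseteq> F (1 + int (Suc j))" using FF[of "1 + int j"] by (simp add: add.commute add.left_commute)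
  finally show ?case .
 qed
 \<comment> \<open>an upper bound for the heights\<close>
 define K where "K = (SUM t:g2_roots. \<bar>ht t\<bar>)"
 have "F (1 + K) = {0}"
 proof -
  have fin: "finite g2_roots" by (simp add: g2_roots_def)
  have "ht t <= K" if "t : g2_roots" for t
  proof -
   have "\<bar>ht t\<bar> <= K" unfolding K_def by (rule member_le_sum[OF that _ fin]) simp
   thus ?thesis by linarith
  qed
  hence e: "{t : g2_roots. 1 + K <= ht t} = {}" by force
  show ?thesis unfolding F_def e by simp
 qed
 moreover have "K >= 0" unfolding K_def by (rule sum_nonneg) simp
 ultimately have "((%D. bracket_span D D) ^^ Suc (nat K)) R \<subseteq> {0}" using D[of "nat K"] by simp
 moreover have "0 : ((%D. bracket_span D D) ^^ Suc (nat K)) R" by (simp add: bracket_span_def lie.span_zero)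
 ultimately have "solvable_lie R" unfolding solvable_lie_def by blast
 hence "R = {0}" using ss ideal unfolding semisimple_lie_def by blast
 thus ?thesis unfolding killing_nondeg_def using M RI by blast
qed

lemma reg_symmetric:
 assumes r: "r : g2_roots" "E r : m"
 shows "E (rneg r) : m" "hr r : m"
proof -
 note N = subalgebraD[OF M]
 obtain y where y: "y : m" "killing_form m (E r) y ~= 0"
  using reg_nondeg r(2) frameD(1)[OF r(1)] unfolding killing_nondeg_def by blast
 show n: "E (rneg r) : m" by (rule opposite_root[OF M _ N(1) _ subset_refl r y]) (erule (1) reg_stable)+
 show "hr r : m" unfolding frameD(4)[OF r(1), symmetric] by (rule N(2)[OF r(2) n])
qed

text \<open>Such an element is central in \<open>m\<close>.\<close>

lemma reg_separate:
 assumes z: "z : m" "z : HH" and k: "!!t. t : g2_roots ==> E t : m ==> al t z = 0"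
 shows "z = 0"
proof (rule killing_center[OF reg_nondeg z(1)])
 fix y assume "y : m"
 then obtain w x where zx: "w : HH" "w : m" "y = w + (SUM t:g2_roots. x t *. E t)" "!!t. t : g2_roots ==> x t ~= 0 ==> E t : m"
  by (rule reg_components) blast
 have "x t *. ad z (E t) = 0" if t: "t : g2_roots" for t
 proof (cases "x t = 0")
  case False
  thus ?thesis using k[OF t zx(4)[OF t False]] al_E[OF t z(2)] by simp
 qed simp
 hence "(SUM t:g2_roots. x t *. ad z (E t)) = 0" by (intro sum.neutral) blast
 thus "ad z y = 0"
  unfolding zx(3) bracket_add_right bracket_sum_right bracket_scaleC_right abelian[OF z(2) zx(1)] by simp
qed

end

end

section \<open>Regular subalgebras of type \<open>A\<^sub>1 \<oplus> A\<^sub>1\<close>\<close>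

text \<open>Reflections show that \<open>\<plusminus>\<gamma>\<^sub>0, \<plusminus>\<gamma>\<^sub>1\<close> are the only roots. The two coroots are commuting independent elements,
 which excludes subalgebras of rank one; the bound on the dimension excludes the types \<open>A\<^sub>2\<close> and \<open>G\<^sub>2\<close>.\<close>

lemma A1_A1_structure:
 assumes nd: "killing_nondeg (m :: 'g::complex_lie_algebra set)" and ty: "of_type m type_A1_A1"
 shows "lie.dim m <= 6" and "EX u:m. EX v:m. ad u v = 0 & (ALL x y. x *. u + y *. v = 0 --> x = 0 & y = 0)"
proof -
 have len: "length type_A1_A1 = 2" by (simp add: type_A1_A1_def)
 obtain H \<gamma> where C: "cartan_subalgebra m H" and ss: "simple_system m H 2 \<gamma>"
  and A: "!!i j. i < 2 ==> j < 2 ==> \<gamma> i (coroot m H (\<gamma> j)) = of_int (type_A1_A1 ! i ! j)"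
  using ty unfolding of_type_def len by blast
 define a where "a = \<gamma> 0"
 define b where "b = \<gamma> 1"
 have ab: "a : roots m H" "b : roots m H" using ss unfolding simple_system_def a_def b_def by auto
 interpret c: cartan_pair m H by unfold_locales (rule nd, rule C)
 define u where "u = c.hroot a"
 define v where "v = c.hroot b"
 have uv: "u : H" "v : H" unfolding u_def v_def by (rule c.hroot(1)[OF ab(1)], rule c.hroot(1)[OF ab(2)])
 have au: "a u = 2" and bv: "b v = 2" unfolding u_def v_def by (rule c.hroot(2)[OF ab(1)], rule c.hroot(2)[OF ab(2)])
 have av: "a v = 0" using A[of 0 1] unfolding a_def[symmetric] b_def[symmetric] One_nat_def[symmetric] c.coroot_eq[OF ab(2)] v_def[symmetric]
  by (simp add: type_A1_A1_def)
 have bu: "b u = 0" using A[of 1 0] unfolding a_def[symmetric] b_def[symmetric] One_nat_def[symmetric] c.coroot_eq[OF ab(1)] u_def[symmetric]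
  by (simp add: type_A1_A1_def)
 have comb: "EX k l::nat. EX \<epsilon>. (\<epsilon> = 1 | \<epsilon> = - 1) & (ALL x:H. \<alpha> x = \<epsilon> * (of_nat k * a x + of_nat l * b x))"
  if \<alpha>: "\<alpha> : roots m H" for \<alpha>
 proof -
  have s: "(\<Sum>i<2. of_nat (k i) * \<gamma> i x) = of_nat (k 0) * a x + of_nat (k 1) * b x" for k :: "nat => nat" and x
   by (simp add: numeral_2_eq_2 a_def b_def)
  obtain k :: "nat => nat" where "(ALL x:H. \<alpha> x = of_nat (k 0) * a x + of_nat (k 1) * b x) |
    (ALL x:H. \<alpha> x = - (of_nat (k 0) * a x + of_nat (k 1) * b x))"
   using ss \<alpha> unfolding simple_system_def s by blast
  hence "(ALL x:H. \<alpha> x = 1 * (of_nat (k 0) * a x + of_nat (k 1) * b x)) |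
    (ALL x:H. \<alpha> x = (- 1) * (of_nat (k 0) * a x + of_nat (k 1) * b x))" by simp
  thus ?thesis by blast
 qed
 \<comment> \<open>A root involving both simple roots would be reflected to a combination with mixed signs.\<close>
 have all: "\<alpha> = a | \<alpha> = c.neg a | \<alpha> = b | \<alpha> = c.neg b" if \<alpha>: "\<alpha> : roots m H" for \<alpha>
 proof -
  obtain k l :: nat and \<epsilon> where kl: "\<epsilon> = 1 | \<epsilon> = - 1" "ALL x:H. \<alpha> x = \<epsilon> * (of_nat k * a x + of_nat l * b x)"
   using comb[OF \<alpha>] by blast
  let ?\<beta> = "%x. \<alpha> x - \<alpha> (c.hroot b) * b x"
  have \<beta>: "?\<beta> : roots m H" by (rule c.reflection[OF ab(2) \<alpha>])
  obtain k' l' :: nat and \<epsilon>' where kl': "\<epsilon>' = 1 | \<epsilon>' = - 1" "ALL x:H. ?\<beta> x = \<epsilon>' * (of_nat k' * a x + of_nat l' * b x)"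
   using comb[OF \<beta>] by blast
  have 1: "\<alpha> u = \<epsilon> * (2 * of_nat k)" "\<alpha> v = \<epsilon> * (2 * of_nat l)"
   using bspec[OF kl(2) uv(1)] bspec[OF kl(2) uv(2)] au av bu bv by simp_all
  have "\<alpha> u = \<epsilon>' * (2 * of_nat k')" "- \<alpha> v = \<epsilon>' * (2 * of_nat l')"
   using bspec[OF kl'(2) uv(1)] bspec[OF kl'(2) uv(2)] au av bu bv unfolding v_def[symmetric] by simp_all
  hence 2: "\<epsilon> * of_nat k = \<epsilon>' * of_nat k'" "- (\<epsilon> * of_nat l) = \<epsilon>' * of_nat l'" unfolding 1 by simp_all
  have kl0: "k = 0 | l = 0"
  proof (rule ccontr)
   assume nz: "~ (k = 0 | l = 0)"
   have sgn: "x = y" if "\<delta> * of_nat x = \<epsilon>' * of_nat y" "x > 0" "\<delta> = 1 | \<delta> = - 1" for \<delta> :: complex and x y :: nat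
   proof -
    have "cmod (of_nat x) = cmod (of_nat y)" using that(1,3) kl'(1) by (metis mult_minus_left mult_1 norm_minus_cancel)
    thus ?thesis by simp
   qed
   have "k = k'" using sgn[OF 2(1)] nz kl(1) by simp
   hence e: "\<epsilon> = \<epsilon>'" using 2(1) nz by simp
   have "of_nat (l + l') = (0 :: complex)" using 2(2) kl(1) unfolding e by (auto simp: add_eq_0_iff)
   hence "l + l' = 0" by (simp only: of_nat_eq_0_iff)
   thus False using nz by simp
  qed
  show ?thesis
  proof (cases "k = 0")
   case True
   have "\<alpha> = b | \<alpha> = c.neg b"
    by (rule c.proportional_roots[OF ab(2) \<alpha>, of "\<epsilon> * of_nat l"]) (use kl(2) True in simp)
   thus ?thesis by blast
  next
   case False
   hence "l = 0" using kl0 by blast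
   have "\<alpha> = a | \<alpha> = c.neg a"
    by (rule c.proportional_roots[OF ab(1) \<alpha>, of "\<epsilon> * of_nat k"]) (use kl(2) \<open>l = 0\<close> in simp)
   thus ?thesis by blast
  qed
 qed
 have indep: "x = 0 & y = 0" if z: "x *. u + y *. v = 0" for x y
 proof -
  have xy: "x *. u : H" "y *. v : H" by (rule lie.subspace_scale[OF c.NH(1) uv(1)], rule lie.subspace_scale[OF c.NH(1) uv(2)])
  have val: "\<alpha> (x *. u + y *. v) = x * \<alpha> u + y * \<alpha> v" if "\<alpha> : roots m H" for \<alpha>
   unfolding c.root_add[OF c.roots_dual[OF that] xy] c.root_scale[OF c.roots_dual[OF that] uv(1)]
    c.root_scale[OF c.roots_dual[OF that] uv(2)] ..
  have z0: "\<alpha> 0 = 0" if "\<alpha> : roots m H" for \<alpha> using c.root_scale[OF c.roots_dual[OF that] uv(1), of 0] by simp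
  show ?thesis using val[OF ab(1)] val[OF ab(2)] z0[OF ab(1)] z0[OF ab(2)] au av bu bv unfolding z by simp
 qed
 thus "EX u:m. EX v:m. ad u v = 0 & (ALL x y. x *. u + y *. v = 0 --> x = 0 & y = 0)"
  using c.HL[OF uv(1)] c.HL[OF uv(2)] c.abelian[OF uv] by blast
 obtain ea where ea: "ea : c.RS a" "ea ~= 0" using c.root_vector[OF ab(1)] by blast
 obtain fa where fa: "fa : c.RS (c.neg a)" "fa ~= 0" using c.root_vector[OF c.neg_root[OF ab(1)]] by blast
 obtain eb where eb: "eb : c.RS b" "eb ~= 0" using c.root_vector[OF ab(2)] by blast
 obtain fb where fb: "fb : c.RS (c.neg b)" "fb ~= 0" using c.root_vector[OF c.neg_root[OF ab(2)]] by blast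
 let ?B = "set [u, v, ea, fa, eb, fb]"
 have Bin: "x : lie.span ?B" if "x : ?B" for x using that by (rule lie.span_base)
 have "H \<subseteq> lie.span ?B"
 proof
  fix h assume h: "h : H"
  let ?h = "h + ((- (a h / 2)) *. u + (- (b h / 2)) *. v)"
  have xy: "(- (a h / 2)) *. u : H" "(- (b h / 2)) *. v : H" by (rule lie.subspace_scale[OF c.NH(1) uv(1)], rule lie.subspace_scale[OF c.NH(1) uv(2)])
  have s: "(- (a h / 2)) *. u + (- (b h / 2)) *. v : H" by (rule lie.subspace_add[OF c.NH(1) xy])
  have val: "\<alpha> ?h = \<alpha> h - a h / 2 * \<alpha> u - b h / 2 * \<alpha> v" if "\<alpha> : roots m H" for \<alpha>
   unfolding c.root_add[OF c.roots_dual[OF that] h s] c.root_add[OF c.roots_dual[OF that] xy]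
    c.root_scale[OF c.roots_dual[OF that] uv(1)] c.root_scale[OF c.roots_dual[OF that] uv(2)] by simp
  have vab: "a ?h = 0" "b ?h = 0" unfolding val[OF ab(1)] val[OF ab(2)] au av bu bv by simp_all
  have z0: "?h = 0"
  proof (rule c.roots_separate_H[OF lie.subspace_add[OF c.NH(1) h s]])
   fix \<alpha> assume "\<alpha> : roots m H"
   thus "\<alpha> ?h = 0" using all vab by fastforce
  qed
  have "h = ?h + ((a h / 2) *. u + (b h / 2) *. v)" by simp
  hence "h = (a h / 2) *. u + (b h / 2) *. v" unfolding z0 by simp
  moreover have "(a h / 2) *. u + (b h / 2) *. v : lie.span ?B"
   by (intro lie.span_add lie.span_scale Bin) simp_all
  ultimately show "h : lie.span ?B" by simp
 qed
 moreover have "c.RS \<alpha> \<subseteq> lie.span ?B" if \<alpha>: "\<alpha> : roots m H" for \<alpha>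
 proof -
  have line: "c.RS \<alpha> \<subseteq> lie.span ?B" if ee: "e : c.RS \<alpha>" "e ~= 0" "e : ?B" for e
  proof
   fix x assume "x : c.RS \<alpha>"
   then obtain k where "x = k *. e" using c.RS_one_dim[OF \<alpha> ee(1,2)] by blast
   thus "x : lie.span ?B" using lie.span_scale[OF Bin[OF ee(3)]] by simp
  qed
  have mem: "ea : ?B" "fa : ?B" "eb : ?B" "fb : ?B" by simp_all
  from all[OF \<alpha>] show ?thesis
  proof (elim disjE)
   assume "\<alpha> = a" thus ?thesis using line[of ea] ea mem(1) by simp
  next
   assume "\<alpha> = c.neg a" thus ?thesis using line[of fa] fa mem(2) by simp
  next
   assume "\<alpha> = b" thus ?thesis using line[of eb] eb mem(3) by simp
  next
   assume "\<alpha> = c.neg b" thus ?thesis using line[of fb] fb mem(4) by simp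
  qed
 qed
 ultimately have "lie.span (H \<union> (UN \<alpha>:roots m H. c.RS \<alpha>)) \<subseteq> lie.span ?B"
  by (intro lie.span_minimal) auto
 hence "m \<subseteq> lie.span ?B" using c.span_H_roots by blast
 hence "lie.dim m <= card ?B" by (rule lie.dim_le_card) simp
 also have "card ?B <= 6" using card_length[of "[u, v, ea, fa, eb, fb]"] by simp
 finally show "lie.dim m <= 6" .
qed

lemma (in sl2) commuting_proportional:
 assumes e0: "e ~= 0" and u: "u : lie.span {e, h, f}" and v: "v : lie.span {e, h, f}" "ad u v = 0"
  and indep: "!!x y. x *. u + y *. v = 0 ==> x = 0 & y = 0"
 shows False
proof -
 obtain x y z where c: "u = x *. e + y *. h + z *. f" using u span_triple by blast
 obtain a b d where d: "v = a *. e + b *. h + d *. f" using v(1) span_triple by blast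
 have "(2 * (y * a - x * b)) *. e + (x * d - z * a) *. h + (2 * (z * b - y * d)) *. f = 0"
  using v(2) unfolding c d comb_bracket .
 from comb_eq_0[OF e0 this] have eqs: "y * a = x * b" "x * d = z * a" "z * b = y * d" by auto
 have lc: "p *. u + (- q) *. v = (p * x - q * a) *. e + (p * y - q * b) *. h + (p * z - q * d) *. f" for p q
  unfolding c d by (simp add: scale_simps algebra_simps)
 have "a *. u + (- x) *. v = 0" unfolding lc using eqs by (simp add: mult.commute)
 hence a: "a = 0" using indep by blast
 have "b *. u + (- y) *. v = 0" unfolding lc using eqs by (simp add: mult.commute)
 hence b: "b = 0" using indep by blast
 have "d *. u + (- z) *. v = 0" unfolding lc using eqs by (simp add: mult.commute)
 hence "d = 0" using indep by blast
 hence "0 *. u + 1 *. v = 0" unfolding d using a b by simp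
 from indep[OF this] show False by simp
qed

context g2
begin

definition slsum :: "int \<times> int => int \<times> int => 'g set" where
 "slsum r s = {a + b | a b. a : slr r & b : slr s}"

lemma slr_subspace: "lie.subspace (slr r)" unfolding slr_def by simp

lemma slsum_subspace: "lie.subspace (slsum r s)"
 unfolding slsum_def by (rule lie.subspace_sums[OF slr_subspace slr_subspace])

lemma slsum_sup: "slr r \<subseteq> slsum r s" "slr s \<subseteq> slsum r s"
 unfolding slsum_def by (rule sums_superset[OF slr_subspace slr_subspace])+

theorem reg_A1_A1:
 assumes reg: "regular_A1_A1 HH m"
 shows "EX r:g2_roots. EX s:g2_roots. sqlen r = 3 & cartan_int r s = 0 & m = slsum r s"
proof -
 have M: "subalgebra m" and st: "ALL h:HH. ALL x:m. ad h x : m"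
  and ty: "of_type m type_A1_A1"
  using reg unfolding regular_A1_A1_def regular_wrt_def by blast+
 have ss: "semisimple_lie m" using ty unfolding of_type_def by blast
 note N = subalgebraD[OF M]
 note nd = reg_nondeg[OF M st ss]
 note sym = reg_symmetric[OF M st ss]
 note sep = reg_separate[OF M st ss]
 note comps = reg_components[OF M st ss]
 note str = A1_A1_structure[OF nd ty]
 have closed: "ALL r:g2_roots. ALL s:g2_roots. E r : m --> E s : m --> radd r s : g2_roots --> E (radd r s) : m"
 proof (intro ballI impI)
  fix r s assume rs: "r : g2_roots" "s : g2_roots" "E r : m" "E s : m" "radd r s : g2_roots"
  obtain c where c: "c ~= 0" "ad (E r) (E s) = c *. E (radd r s)" by (rule E_bracket[OF rs(1,2,5)])
  show "E (radd r s) : m" using E_scale[OF N(1) _ c(1)] N(2)[OF rs(3,4)] c(2) by simp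
 qed
 have symm: "ALL r:g2_roots. E r : m --> E (rneg r) : m" using sym(1) by blast
 note trich = g2_symmetric_closed[of "%r. E r : m", OF closed symm]
 then consider (line) r where "r : g2_roots" "ALL t:g2_roots. E t : m --> t = r | t = rneg r"
  | (orth) r s where "r : g2_roots" "s : g2_roots" "sqlen r = 3" "cartan_int r s = 0" "E r : m" "E s : m"
    "ALL t:g2_roots. E t : m --> t = r | t = rneg r | t = s | t = rneg s"
  | (long) "ALL t:g2_roots. sqlen t = 3 --> E t : m" by blast
 thus ?thesis
 proof cases
  case line
  have nr: "rneg r : g2_roots" using g2_basic line(1) by blast
  have "z : slr r" if z: "z : m" "z : HH" for z
  proof (cases "EX t:g2_roots. E t : m")
   case True
   then obtain t where t: "t : g2_roots" "E t : m" by blast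
   have rm: "E r : m"
   proof (cases "t = r")
    case False
    hence "t = rneg r" using line(2) t by blast
    thus ?thesis using sym(1)[OF t] bspec[OF g2_basic line(1)] by simp
   qed (use t in simp)
   let ?z = "z + (- (al r z / 2)) *. hr r"
   have hH: "(- (al r z / 2)) *. hr r : HH" by (rule lie.span_scale[OF hr_in])
   have "?z = 0"
   proof (rule sep)
    show "?z : m" by (rule lie.subspace_add[OF N(1) z(1) lie.subspace_scale[OF N(1) sym(2)[OF line(1) rm]]])
    show "?z : HH" by (rule lie.span_add[OF z(2) hH])
    have r0: "al r ?z = 0"
     unfolding root_add[OF al_dual[OF line(1)] z(2) hH] root_scale[OF al_dual[OF line(1)] hr_in] al_hr[OF line(1)]
     using bspec[OF g2_basic line(1)] by simp
    fix t assume "t : g2_roots" "E t : m"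
    hence "t = r | t = rneg r" using line(2) by blast
    thus "al t ?z = 0" using r0 al_neg[OF line(1)] by auto
   qed
   hence "z = (al r z / 2) *. hr r" by (simp add: add_eq_0_iff)
   thus ?thesis using lie.subspace_scale[OF slr_subspace slr_facts(7)[OF line(1)]] by metis
  next
   case False
   hence "z = 0" using sep[OF z] by blast
   thus ?thesis using lie.subspace_0[OF slr_subspace] by simp
  qed note Hin = this
  have "m \<subseteq> slr r"
  proof
   fix y assume "y : m"
   then obtain z x where zx: "z : HH" "z : m" "y = z + (SUM t:g2_roots. x t *. E t)"
    "!!t. t : g2_roots ==> x t ~= 0 ==> E t : m" by (rule comps) blast
   have "x t *. E t : slr r" if t: "t : g2_roots" for t
   proof (cases "x t = 0")
    case True
    thus ?thesis using lie.subspace_0[OF slr_subspace] by simp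
   next
    case False
    hence "t = r | t = rneg r" using zx(4)[OF t] line(2) t by blast
    hence "E t : slr r" using slr_facts(6,8)[OF line(1)] by blast
    thus ?thesis by (rule lie.subspace_scale[OF slr_subspace])
   qed
   hence "(SUM t:g2_roots. x t *. E t) : slr r" by (rule lie.subspace_sum[OF slr_subspace])
   thus "y : slr r" unfolding zx(3) by (rule lie.subspace_add[OF slr_subspace Hin[OF zx(2,1)]])
  qed
  then obtain u v where uv: "u : slr r" "v : slr r" "ad u v = 0" "ALL x y. x *. u + y *. v = 0 --> x = 0 & y = 0"
   using str(2) by blast
  have False
   by (rule sl2.commuting_proportional[OF triple_E[OF line(1)] frameD(1)[OF line(1)] uv(1)[unfolded slr_def]
      uv(2)[unfolded slr_def] uv(3)]) (use uv(4) in blast)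
  thus ?thesis ..
 next
  case orth
  have sub: "slr r \<subseteq> m" "slr s \<subseteq> m"
   using slr_minimal[OF N(1)] sym[OF orth(1,5)] sym[OF orth(2,6)] orth(5,6) by blast+
  have "slsum r s \<subseteq> m" unfolding slsum_def using sub lie.subspace_add[OF N(1)] by blast
  moreover have "m \<subseteq> slsum r s"
  proof
   fix y assume "y : m"
   then obtain z x where zx: "z : HH" "z : m" "y = z + (SUM t:g2_roots. x t *. E t)"
    "!!t. t : g2_roots ==> x t ~= 0 ==> E t : m" by (rule comps) blast
   obtain p q where pq: "z = p *. hr r + q *. hr s" using orth_span[OF orth(1,2,4) zx(1)] by blast
   have h: "hr r : slsum r s" "hr s : slsum r s" using slr_facts(7)[OF orth(1)] slr_facts(7)[OF orth(2)] slsum_sup by blast+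
   have "x t *. E t : slsum r s" if t: "t : g2_roots" for t
   proof (cases "x t = 0")
    case True
    thus ?thesis using lie.subspace_0[OF slsum_subspace] by simp
   next
    case False
    hence "t = r | t = rneg r | t = s | t = rneg s" using zx(4)[OF t] orth(7) t by blast
    hence "E t : slsum r s" using slr_facts(6,8)[OF orth(1)] slr_facts(6,8)[OF orth(2)] slsum_sup by blast
    thus ?thesis by (rule lie.subspace_scale[OF slsum_subspace])
   qed
   hence "(SUM t:g2_roots. x t *. E t) : slsum r s" by (rule lie.subspace_sum[OF slsum_subspace])
   moreover have "z : slsum r s"
    unfolding pq by (intro lie.subspace_add[OF slsum_subspace] lie.subspace_scale[OF slsum_subspace] h)
   ultimately show "y : slsum r s" unfolding zx(3) by (intro lie.subspace_add[OF slsum_subspace])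
  qed
  ultimately show ?thesis using orth by blast
 next
  case long
  let ?S = "set [(0,1),(3,1),(3,2),(0,-1),(-3,-1),(-3,-2)] :: (int \<times> int) set"
  have S: "?S \<subseteq> g2_roots" by (auto simp: g2_roots_def)
  have Sm: "E ` ?S \<subseteq> m" using long S by (auto simp: sqlen_def)
  have "(0, 1) : g2_roots" by (simp add: g2_roots_def)
  hence "h1 : m" using sym(2)[of "(0,1)"] long hr_simple(2) by (simp add: sqlen_def)
  hence "insert h1 (E ` ?S) \<subseteq> m" using Sm by blast
  from fin.independent_card_le_dim[OF this independent_roots(1)[OF S]] independent_roots(2)[OF S]
  have "Suc (card ?S) <= lie.dim m" by simp
  moreover have "card ?S = 6" by simp
  ultimately show ?thesis using str(1) by simp
 qed
qed

context
 fixes r s assumes r: "r : g2_roots" and s: "s : g2_roots" and orth: "cartan_int r s = 0"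
begin

lemma orth': "cartan_int s r = 0" using g2_orthogonal r s orth by blast

lemma slsum_bracket:
 assumes "a : slr r" "b : slr s" "a' : slr r" "b' : slr s"
 shows "ad (a + b) (a' + b') = ad a a' + ad b b'"
 using slr_commute[OF r s orth assms(1,4)] slr_commute[OF s r orth' assms(2,3)] by (simp add: bracket_simps)

lemma slsum_subalgebra: "subalgebra (slsum r s)"
 unfolding subalgebra_def
proof (intro conjI ballI slsum_subspace)
 fix x y assume "x : slsum r s" "y : slsum r s"
 then obtain a b a' b' where c: "x = a + b" "y = a' + b'" "a : slr r" "b : slr s" "a' : slr r" "b' : slr s"
  unfolding slsum_def by blast
 have "ad a a' : slr r" "ad b b' : slr s"
  using c(3-6) slr_facts(1)[OF r] slr_facts(1)[OF s] unfolding subalgebra_def by blast+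
 thus "ad x y : slsum r s" unfolding c(1,2) slsum_bracket[OF c(3-6)] slsum_def by blast
qed

lemma slsum_HH: "HH \<subseteq> slsum r s"
proof
 fix z assume "z : HH"
 then obtain p q where "z = p *. hr r + q *. hr s" using orth_span[OF r s orth] by blast
 moreover have "p *. hr r : slr r" "q *. hr s : slr s"
  by (rule lie.subspace_scale[OF slr_subspace slr_facts(7)[OF r]], rule lie.subspace_scale[OF slr_subspace slr_facts(7)[OF s]])
 ultimately show "z : slsum r s" unfolding slsum_def by blast
qed

lemma slr_center:
 assumes a: "a : slr p" "a ~= 0" and p: "p : g2_roots"
 obtains u where "u : slr p" "ad u a ~= 0"
proof -
 interpret t: sl2 "E p" "hr p" "E (rneg p)" by (rule triple_E[OF p])
 have nd: "killing_nondeg (slr p)" unfolding slr_def by (rule t.slh_nondeg[OF frameD(1)[OF p]])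
 have "EX u:slr p. ad a u ~= 0" using killing_center[OF nd a(1)] a(2) by blast
 then obtain u where "u : slr p" "ad a u ~= 0" by blast
 thus thesis using that[of u] bracket_anti[of u a] by simp
qed

lemma slr_ideal_absorb:
 assumes I: "lie.subspace I" "!!x v. x : slr p ==> v : I ==> ad x v : I" and v: "v : I" "v : slr p" "v ~= 0"
  and p: "p : g2_roots"
 shows "slr p \<subseteq> I"
 using sl2.slh_ideal[OF triple_E[OF p] frameD(1)[OF p] I(1) _ v(1) _ v(3)] I(2) v(2) unfolding slr_def by blast

lemma slsum_semisimple: "semisimple_lie (slsum r s)"
 unfolding semisimple_lie_def
proof (intro conjI allI impI slsum_subalgebra)
 fix I assume I: "lie_ideal (slsum r s) I & solvable_lie I"
 hence Is: "lie.subspace I" "I \<subseteq> slsum r s" "!!x v. x : slsum r s ==> v : I ==> ad x v : I"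
  unfolding lie_ideal_def by auto
 have no: "~ slr r \<subseteq> I" "~ slr s \<subseteq> I" using I slr_facts(9)[OF r] slr_facts(9)[OF s] by blast+
 have st: "ad x v : I" if "x : slr r | x : slr s" "v : I" for x v using Is(3) that slsum_sup by blast
 have "v = 0" if v: "v : I" for v
 proof -
  obtain a b where ab: "v = a + b" "a : slr r" "b : slr s" using Is(2) v unfolding slsum_def by blast
  have a0: "a = 0"
  proof (rule ccontr)
   assume "a ~= 0"
   then obtain u where u: "u : slr r" "ad u a ~= 0" by (rule slr_center[OF ab(2) _ r])
   have "ad u v = ad u a" unfolding ab(1) bracket_add_right slr_commute[OF r s orth u(1) ab(3)] by simp
   hence 1: "ad u a : I" using st[OF _ v] u(1) by metis
   have 2: "ad u a : slr r" using slr_facts(1)[OF r] u(1) ab(2) unfolding subalgebra_def by blast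
   have "slr r \<subseteq> I" by (rule slr_ideal_absorb[OF Is(1) _ 1 2 u(2) r]) (use st in blast)
   thus False using no(1) by blast
  qed
  show "v = 0"
  proof (rule ccontr)
   assume "v ~= 0"
   hence "slr s \<subseteq> I" using a0 ab by (intro slr_ideal_absorb[OF Is(1) _ v _ _ s]) (use st in auto)
   thus False using no(2) by blast
  qed
 qed
 thus "I = {0}" using lie.subspace_0[OF Is(1)] by blast
qed

text \<open>If \<open>t\<close> is orthogonal to neither \<open>r\<close> nor \<open>s\<close>, bracketing with both coroots puts \<open>E t\<close> in both summands.\<close>

lemma slsum_root:
 assumes t: "t : g2_roots" "E t : slsum r s"
 shows "t = r | t = rneg r | t = s | t = rneg s"
proof (rule ccontr)
 assume no: "~ ?thesis"
 hence nz: "cartan_int r t ~= 0" "cartan_int s t ~= 0" using g2_orthogonal r s orth orth' t(1) by blast+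
 obtain a b where ab: "E t = a + b" "a : slr r" "b : slr s" using t(2) unfolding slsum_def by blast
 have hs: "hr r : slr r" "hr s : slr s" by (rule slr_facts(7)[OF r], rule slr_facts(7)[OF s])
 have "ad (hr r) (E t) = ad (hr r) a" "ad (hr s) (E t) = ad (hr s) b"
  unfolding ab(1) bracket_add_right slr_commute[OF r s orth hs(1) ab(3)] slr_commute[OF s r orth' hs(2) ab(2)] by simp_all
 moreover have "ad (hr r) a : slr r" "ad (hr s) b : slr s"
  using slr_facts(1)[OF r] slr_facts(1)[OF s] hs ab(2,3) unfolding subalgebra_def by blast+
 ultimately have "of_int (cartan_int r t) *. E t : slr r" "of_int (cartan_int s t) *. E t : slr s"
  using hr_E[OF t(1)] by metis+
 hence 1: "E t : slr r" and 2: "E t : slr s" using nz by (auto intro: E_scale[OF slr_subspace])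
 have "ad (hr s) (E t) = 0" by (rule slr_commute[OF s r orth' hs(2) 1])
 thus False using hr_E[OF t(1)] nz(2) frameD(1)[OF t(1)] by simp
qed

lemma slsum_type: "of_type (slsum r s) type_A1_A1"
proof -
 let ?m = "slsum r s"
 have stable: "ALL h:HH. ALL x:?m. ad h x : ?m"
  using slsum_subalgebra slsum_HH unfolding subalgebra_def by blast
 have nd: "killing_nondeg ?m" by (rule reg_nondeg[OF slsum_subalgebra stable slsum_semisimple])
 have C: "cartan_subalgebra ?m HH"
  using cartan_span slsum_HH unfolding cartan_subalgebra_def by blast
 interpret c: cartan_pair ?m HH by unfold_locales (rule nd, rule C)
 have rootm: "al p : roots ?m HH" if p: "p : g2_roots" "E p : ?m" for p
 proof -
  have "E p : c.RS (al p)" using E_RS[OF p(1)] p(2) unfolding root_space_def by blast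
  moreover have "al p (hr p) ~= 0" using al_hr[OF p(1)] bspec[OF g2_basic p(1)] by simp
  ultimately show ?thesis by (intro c.rootI[OF al_dual[OF p(1)] _ frameD(1)[OF p(1)] hr_in])
 qed
 have inm: "E r : ?m" "E s : ?m" using slr_facts(6)[OF r] slr_facts(6)[OF s] slsum_sup by blast+
 have rm: "al r : roots ?m HH" "al s : roots ?m HH" by (rule rootm[OF r inm(1)], rule rootm[OF s inm(2)])
 have all: "\<alpha> = al r | \<alpha> = neg (al r) | \<alpha> = al s | \<alpha> = neg (al s)" if \<alpha>: "\<alpha> : roots ?m HH" for \<alpha>
 proof -
  obtain v where v: "v : c.RS \<alpha>" "v ~= 0" using c.root_vector[OF \<alpha>] by blast
  obtain h where h: "h : HH" "\<alpha> h ~= 0" using c.root_nonzero[OF \<alpha>] by blast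
  have vR: "v : RS \<alpha>" using v(1) unfolding root_space_def by blast
  have "\<alpha> : roots UNIV HH" by (rule rootI[OF c.roots_dual[OF \<alpha>] vR v(2) h])
  then obtain t where t: "t : g2_roots" "\<alpha> = al t" using root_cases by blast
  obtain k where k: "v = k *. E t" using RS_al[OF t(1)] vR t(2) by blast
  hence "k ~= 0" using v(2) by auto
  hence "E t : ?m" using E_scale[OF slsum_subspace] c.RSL[OF v(1)] k by blast
  thus ?thesis using slsum_root[OF t(1)] t(2) al_neg[OF r] al_neg[OF s] by auto
 qed
 have co: "coroot ?m HH (al p) = hr p" if p: "p : g2_roots" "al p : roots ?m HH" "E p : ?m" for p
 proof -
  have e: "E p : c.RS (al p)" using E_RS[OF p(1)] p(3) unfolding root_space_def by blast
  have np: "rneg p : g2_roots" using g2_basic p(1) by blast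
  obtain f where f: "f : c.RS (c.neg (al p))" "sl2 (E p) (c.hroot (al p)) f" by (rule c.triple[OF p(2) e frameD(1)[OF p(1)]])
  have "f : RS (al (rneg p))" using f(1) unfolding al_neg[OF p(1)] root_space_def by blast
  then obtain k where k: "f = k *. E (rneg p)" using RS_al[OF np] by blast
  hence hk: "c.hroot (al p) = k *. hr p"
   using sl2.ef[OF f(2)] frameD(4)[OF p(1)] by (simp add: bracket_scaleC_right)
  have "k * 2 = 2" using c.hroot(2)[OF p(2)] unfolding hk root_scale[OF al_dual[OF p(1)] hr_in] al_hr[OF p(1)]
   using bspec[OF g2_basic p(1)] by simp
  thus ?thesis using c.coroot_eq[OF p(2)] hk by simp
 qed
 have cos: "coroot ?m HH (al r) = hr r" "coroot ?m HH (al s) = hr s" using co r s rm inm by blast+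
 have vals: "al r (hr r) = 2" "al s (hr s) = 2" "al r (hr s) = 0" "al s (hr r) = 0"
  using al_hr[OF r] al_hr[OF s] bspec[OF g2_basic r] bspec[OF g2_basic s] orth orth' by simp_all
 define \<gamma> where "\<gamma> i = (if i = 0 then al r else al s)" for i :: nat
 have len: "length type_A1_A1 = 2" by (simp add: type_A1_A1_def)
 have sum2: "(\<Sum>i<2. g i) = g 0 + (g 1 :: complex)" for g :: "nat => complex" by (simp add: numeral_2_eq_2)
 have ss: "simple_system ?m HH 2 \<gamma>"
  unfolding simple_system_def sum2
 proof (intro conjI allI impI ballI)
  show "\<gamma> i : roots ?m HH" for i using rm unfolding \<gamma>_def by simp
  fix c :: "nat => complex" and i :: nat assume c: "ALL x:HH. c 0 * \<gamma> 0 x + c 1 * \<gamma> 1 x = 0" and i: "i < 2"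
  have "c 0 = 0" "c 1 = 0" using bspec[OF c hr_in, of r] bspec[OF c hr_in, of s] vals unfolding \<gamma>_def by simp_all
  moreover have "i = 0 | i = 1" using i by auto
  ultimately show "c i = 0" by blast
 next
  fix \<alpha> assume "\<alpha> : roots ?m HH"
  from all[OF this] show "EX k::nat => nat. (ALL x:HH. \<alpha> x = of_nat (k 0) * \<gamma> 0 x + of_nat (k 1) * \<gamma> 1 x) |
    (ALL x:HH. \<alpha> x = - (of_nat (k 0) * \<gamma> 0 x + of_nat (k 1) * \<gamma> 1 x))"
  proof (elim disjE)
   show ?thesis if "\<alpha> = al r" using that by (intro exI[of _ "%i. if i = 0 then 1 else 0"]) (simp add: \<gamma>_def)
   show ?thesis if "\<alpha> = neg (al r)" using that by (intro exI[of _ "%i. if i = 0 then 1 else 0"]) (simp add: \<gamma>_def)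
   show ?thesis if "\<alpha> = al s" using that by (intro exI[of _ "%i. if i = 0 then 0 else 1"]) (simp add: \<gamma>_def)
   show ?thesis if "\<alpha> = neg (al s)" using that by (intro exI[of _ "%i. if i = 0 then 0 else 1"]) (simp add: \<gamma>_def)
  qed
 qed
 have "\<gamma> i (coroot ?m HH (\<gamma> j)) = of_int (type_A1_A1 ! i ! j)" if "i < 2" "j < 2" for i j
 proof -
  have "i = 0 | i = 1" "j = 0 | j = 1" using that by auto
  thus ?thesis using vals unfolding \<gamma>_def by (auto simp: cos type_A1_A1_def)
 qed
 thus ?thesis unfolding of_type_def len using slsum_semisimple C ss by blast
qed

lemma slsum_regular: "regular_A1_A1 HH (slsum r s)"
proof -
 have C: "cartan_subalgebra (slsum r s) HH"
  using cartan_span slsum_HH unfolding cartan_subalgebra_def by blast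
 have "lie.independent {h0, h1}" "h0 ~= h1"
 proof -
  let ?S = "{} :: (int \<times> int) set"
  have p: "pair0 (1,0) = 2" "pair1 (1,0) = -1" "(1,0) : g2_roots" by (simp_all add: g2_defs)
  have q: "pair0 (2,1) = 1" "pair1 (2,1) = 0" "(2,1) : g2_roots" by (simp_all add: g2_defs)
  have nos: "h0 ~= k *. h1" for k
  proof
   assume e: "h0 = k *. h1"
   have "al (2,1) (k *. h1) = k * al (2,1) h1" by (rule root_scale[OF al_dual[OF q(3)] h_in(2)])
   hence "al (2,1) h0 = k * al (2,1) h1" unfolding e[symmetric] .
   thus False using al_h[OF q(3)] q by simp
  qed
  hence "h0 ~: lie.span {h1}" unfolding lie.span_singleton by auto
  moreover have "h1 ~= 0" using al_h(2)[OF p(3)] p root_scale[OF al_dual[OF p(3)] h_in(2), of 0] by auto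
  moreover show "h0 ~= h1" using nos[of 1] by simp
  ultimately show "lie.independent {h0, h1}" by (simp add: lie.independent_insert)
 qed
 hence "lie.dim HH = 2" using lie.dim_span_eq_card_independent[of "{h0, h1}"] by simp
 hence "has_rank (slsum r s) 2" unfolding has_rank_def using C by blast
 moreover have "regular_wrt HH (slsum r s)"
  unfolding regular_wrt_def using cartan_span slsum_subalgebra slsum_HH unfolding subalgebra_def by blast
 ultimately show ?thesis unfolding regular_A1_A1_def using slsum_type by blast
qed

lemma slsum_direct: "direct_sum (slsum r s) (slr r) (slr s)"
proof -
 have "v = 0" if v: "v : slr r" "v : slr s" for v
 proof (rule ccontr)
  assume "v ~= 0"
  then obtain u where u: "u : slr r" "ad u v ~= 0" by (rule slr_center[OF v(1) _ r])
  thus False using slr_commute[OF r s orth u(1) v(2)] by simp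
 qed
 thus ?thesis unfolding direct_sum_def slsum_def using lie.subspace_0[OF slr_subspace] by blast
qed

lemma slr_ideals: "lie_ideal (slsum r s) (slr r)" "lie_ideal (slsum r s) (slr s)"
proof -
 have "ad x y : slr r" if xy: "x : slsum r s" "y : slr r" for x y
 proof -
  obtain a b where ab: "x = a + b" "a : slr r" "b : slr s" using xy(1) unfolding slsum_def by blast
  have "ad x y = ad a y" unfolding ab(1) bracket_add_left slr_commute[OF s r orth' ab(3) xy(2)] by simp
  thus ?thesis using slr_facts(1)[OF r] ab(2) xy(2) unfolding subalgebra_def by simp
 qed
 thus "lie_ideal (slsum r s) (slr r)" unfolding lie_ideal_def using slr_subspace slsum_sup by blast
 have "ad x y : slr s" if xy: "x : slsum r s" "y : slr s" for x y
 proof -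
  obtain a b where ab: "x = a + b" "a : slr r" "b : slr s" using xy(1) unfolding slsum_def by blast
  have "ad x y = ad b y" unfolding ab(1) bracket_add_left slr_commute[OF r s orth ab(2) xy(2)] by simp
  thus ?thesis using slr_facts(1)[OF s] ab(3) xy(2) unfolding subalgebra_def by simp
 qed
 thus "lie_ideal (slsum r s) (slr s)" unfolding lie_ideal_def using slr_subspace slsum_sup by blast
qed

end

lemma root_spaces_pm_al:
 assumes p: "p : g2_roots"
 shows "root_spaces_pm HH (al p) \<subseteq> slr p" "E p : root_spaces_pm HH (al p)" "E (rneg p) : root_spaces_pm HH (al p)"
proof -
 have np: "rneg p : g2_roots" using g2_basic p by blast
 have e: "root_spaces_pm HH (al p) = RS (al p) \<union> RS (al (rneg p))" unfolding root_spaces_pm_def al_neg[OF p] ..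
 show "E p : root_spaces_pm HH (al p)" "E (rneg p) : root_spaces_pm HH (al p)" unfolding e using E_RS[OF p] E_RS[OF np] by blast+
 show "root_spaces_pm HH (al p) \<subseteq> slr p"
 proof
  fix x assume "x : root_spaces_pm HH (al p)"
  hence "EX k. x = k *. E p | x = k *. E (rneg p)" unfolding e using RS_al[OF p] RS_al[OF np] by blast
  thus "x : slr p" using lie.subspace_scale[OF slr_subspace] slr_facts(6,8)[OF p] by blast
 qed
qed

lemma ideal_generated_slr:
 assumes p: "p : g2_roots" and I: "lie_ideal m (slr p)"
 shows "ideal_generated m (root_spaces_pm HH (al p)) = slr p"
proof
 show "ideal_generated m (root_spaces_pm HH (al p)) \<subseteq> slr p"
  unfolding ideal_generated_def using I root_spaces_pm_al(1)[OF p] by blast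
 show "slr p \<subseteq> ideal_generated m (root_spaces_pm HH (al p))"
  unfolding ideal_generated_def
 proof (rule Inter_greatest)
  fix J assume "J : {J. lie_ideal m J & root_spaces_pm HH (al p) \<subseteq> J}"
  hence J: "lie_ideal m J" "root_spaces_pm HH (al p) \<subseteq> J" by auto
  have e: "E p : J" "E (rneg p) : J" using root_spaces_pm_al(2,3)[OF p] J(2) by blast+
  have "E p : m" using slr_facts(6)[OF p] I unfolding lie_ideal_def by blast
  hence "ad (E p) (E (rneg p)) : J" using J(1) e(2) unfolding lie_ideal_def by blast
  thus "slr p \<subseteq> J" using slr_minimal[OF _ e(1) _ e(2)] J(1) frameD(4)[OF p] unfolding lie_ideal_def by simp
 qed
qed

lemma slr_neg:
 assumes p: "p : g2_roots" shows "slr (rneg p) = slr p"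
proof -
 have b: "rneg p : g2_roots" "rneg (rneg p) = p" "co0 (rneg p) = - co0 p" "co1 (rneg p) = - co1 p"
  using bspec[OF g2_basic p] by auto
 have h: "hr (rneg p) = - hr p" unfolding hr_def b by (simp add: scale_simps)
 have 1: "slr (rneg p) \<subseteq> slr p"
  by (rule slr_minimal[OF slr_subspace])
   (use slr_facts(6-8)[OF p] b(2) h lie.subspace_neg[OF slr_subspace] in simp_all)
 have 2: "slr p \<subseteq> slr (rneg p)"
 proof (rule slr_minimal[OF slr_subspace])
  show "E p : slr (rneg p)" "E (rneg p) : slr (rneg p)" using slr_facts(6,8)[OF b(1)] b(2) by simp_all
  show "hr p : slr (rneg p)" using lie.subspace_neg[OF slr_subspace slr_facts(7)[OF b(1)]] h by simp
 qed
 show ?thesis using 1 2 by blast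
qed

end

section \<open>Cartan subalgebras through commuting semisimple elements\<close>

lemma diagonalizable_scale:
 assumes "diagonalizable_on UNIV (x :: 'g::complex_lie_algebra)"
 shows "diagonalizable_on UNIV (k *. x)"
proof -
 have "{w : UNIV. EX c. ad x w = c *. w} \<subseteq> {w : UNIV. EX c. ad (k *. x) w = c *. w}"
 proof
  fix w assume "w : {w : UNIV. EX c. ad x w = c *. w}"
  then obtain c where "ad x w = c *. w" by blast
  hence "ad (k *. x) w = (k * c) *. w" by (simp add: bracket_scaleC_left scaleC_scaleC)
  thus "w : {w : UNIV. EX c. ad (k *. x) w = c *. w}" by blast
 qed
 thus ?thesis using assms lie.span_mono unfolding diagonalizable_on_def by blast
qed

lemma diagonalizable_add:
 assumes nd: "killing_nondeg (UNIV :: 'g::complex_lie_algebra set)"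
  and x: "diagonalizable_on UNIV (x :: 'g)" and y: "diagonalizable_on UNIV y" and xy: "ad x y = 0"
 shows "diagonalizable_on UNIV (x + y)"
proof -
 let ?T = "{w : UNIV. EX c. ad (x + y) w = c *. w}"
 have "{w : UNIV. EX c. ad x w = c *. w} \<subseteq> lie.span ?T"
 proof
  fix w assume "w : {w : UNIV. EX c. ad x w = c *. w}"
  then obtain c where c: "ad x w = c *. w" by blast
  let ?V = "{v : UNIV. ad x v = c *. v}"
  have V: "lie.subspace ?V" by (rule eigenspace_subspace[OF lie.subspace_UNIV])
  have st: "ad y v : ?V" if "v : ?V" for v
   using ad_derivation[of x y v] that xy by (simp add: bracket_scaleC_right)
  have "w : lie.span {u : ?V. EX d. gen_eig (ad y) d u}"
   by (rule gen_eig_span[OF lin_ad V]) (use c st in auto)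
  moreover have "{u : ?V. EX d. gen_eig (ad y) d u} \<subseteq> ?T"
  proof
   fix u assume "u : {u : ?V. EX d. gen_eig (ad y) d u}"
   then obtain d where u: "ad x u = c *. u" "gen_eig (ad y) d u" by blast
   have "ad y u = d *. u" by (rule diagonalizable_gen_eig[OF nd UNIV_I y UNIV_I u(2)])
   hence "ad (x + y) u = (c + d) *. u" using u(1) by (simp add: bracket_add_left scaleC_add_left)
   thus "u : ?T" by blast
  qed
  ultimately show "w : lie.span ?T" using lie.span_mono by blast
 qed
 hence "lie.span {w : UNIV. EX c. ad x w = c *. w} \<subseteq> lie.span ?T" by (rule lie.span_minimal) simp
 thus ?thesis using x unfolding diagonalizable_on_def by blast
qed

text \<open>A toral subspace of maximal dimension through \<open>s\<close> and \<open>t\<close> is a Cartan subalgebra; adjoining to a toral subspace a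
 commuting semisimple element leaves it toral.\<close>

theorem toral_extension:
 assumes nd: "killing_nondeg (UNIV :: 'g::complex_lie_algebra set)"
  and s: "diagonalizable_on UNIV (s :: 'g)" and t: "diagonalizable_on UNIV t" and st: "ad s t = 0"
 shows "EX T. cartan_subalgebra UNIV T & s : T & t : T"
proof -
 define P where "P T \<longleftrightarrow> lie.subspace T & (ALL x:T. ALL y:T. ad x y = 0) & (ALL x:T. diagonalizable_on UNIV x)" for T :: "'g set"
 have ext: "P (lie.span (insert u T))" if T: "P T" and u: "diagonalizable_on UNIV u" "ALL x:T. ad u x = 0" for T u
 proof -
  have Ts: "lie.subspace T" and ab: "!!x y. x : T ==> y : T ==> ad x y = 0" and dg: "!!x. x : T ==> diagonalizable_on UNIV x"
   using T unfolding P_def by auto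
  have sp: "lie.span T = T" using Ts by (simp add: lie.span_eq_iff)
  have dec: "EX w:T. EX k. x = w + k *. u" if x: "x : lie.span (insert u T)" for x
  proof -
   obtain k where k: "x - k *. u : T" using x lie.span_breakdown_eq[of x u T] sp by auto
   have "x = (x - k *. u) + k *. u" by simp
   thus ?thesis using k by blast
  qed
  have ux: "ad u x = 0" "ad x u = 0" if "x : T" for x using u(2) that bracket_anti[of x u] by simp_all
  show ?thesis
   unfolding P_def
  proof (intro conjI ballI)
   show "lie.subspace (lie.span (insert u T))" by simp
   fix x assume x: "x : lie.span (insert u T)"
   obtain w k where w: "w : T" "x = w + k *. u" using dec[OF x] by blast
   show "diagonalizable_on UNIV x"
    unfolding w(2) by (rule diagonalizable_add[OF nd dg[OF w(1)] diagonalizable_scale[OF u(1)]])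
     (simp add: bracket_scaleC_right ux[OF w(1)])
   fix y assume y: "y : lie.span (insert u T)"
   obtain w' k' where w': "w' : T" "y = w' + k' *. u" using dec[OF y] by blast
   show "ad x y = 0" unfolding w(2) w'(2)
    by (simp add: bracket_simps ux[OF w(1)] ux[OF w'(1)] ab[OF w(1) w'(1)])
  qed
 qed
 have "diagonalizable_on UNIV (0 *. s)" by (rule diagonalizable_scale[OF s])
 hence P0: "P {0}" unfolding P_def by simp
 have P1: "P (lie.span (insert s {0}))" by (rule ext[OF P0 s]) simp
 let ?T2 = "lie.span (insert t (lie.span (insert s {0})))"
 have "ad t x = 0" if x: "x : lie.span (insert s {0})" for x
 proof -
  obtain k where "x - k *. s : lie.span {0}" using x lie.span_breakdown_eq[of x s "{0}"] by blast
  hence "x = k *. s" by simp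
  thus ?thesis using st bracket_anti[of t s] by (simp add: bracket_scaleC_right)
 qed
 hence P2: "P ?T2" by (intro ext[OF P1 t]) blast
 have s2: "s : ?T2" by (rule lie.span_base, rule insertI2, rule lie.span_base) simp
 have t2: "t : ?T2" by (simp add: lie.span_base)
 have "EX T. (P T & s : T & t : T) & (ALL T'. P T' & s : T' & t : T' --> lie.dim T' <= lie.dim T)"
 proof (rule ex_has_greatest_nat)
  show "P ?T2 & s : ?T2 & t : ?T2" using P2 s2 t2 by blast
  show "ALL T. P T & s : T & t : T --> lie.dim T < Suc (lie.dim (UNIV :: 'g set))"
   by (intro allI impI) (simp only: less_Suc_eq_le fin.dim_subset[OF subset_UNIV])
 qed
 then obtain T where T: "P T" "s : T" "t : T"
  and mx: "!!T'. P T' ==> s : T' ==> t : T' ==> lie.dim T' <= lie.dim T" by blast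
 have Ts: "lie.subspace T" and ab: "!!x y. x : T ==> y : T ==> ad x y = 0" and dg: "!!x. x : T ==> diagonalizable_on UNIV x"
  using T unfolding P_def by auto
 have "cartan_subalgebra UNIV T"
 proof (rule maximal_toral_cartan[OF nd Ts subset_UNIV ab dg])
  fix u :: 'g assume u: "diagonalizable_on UNIV u" "!!x. x : T ==> ad u x = 0"
  let ?T' = "lie.span (insert u T)"
  have P': "P ?T'" by (rule ext[OF T(1) u(1)]) (use u(2) in blast)
  have sub: "T \<subseteq> ?T'" by (rule order_trans[OF subset_insertI lie.span_superset])
  have "lie.dim ?T' <= lie.dim T" by (rule mx[OF P']) (use sub T in auto)
  hence "T = ?T'" by (intro fin.subspace_dim_equal[OF Ts lie.subspace_span sub]) simp
  thus "u : T" using lie.span_base[of u "insert u T"] by simp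
 qed
 thus ?thesis using T by blast
qed

section \<open>Members of a dual pair\<close>

text \<open>Reductivity gives \<open>\<gg> = [b, \<gg>] + W\<close> with \<open>W\<close> centralizing \<open>b\<close>, and the centralizer of \<open>b\<close> is orthogonal to
 \<open>[b, \<gg>]\<close>.\<close>

lemma centralizer_killing_nondeg:
 assumes nd: "killing_nondeg (UNIV :: 'g::complex_lie_algebra set)" and red: "reductive_in (b :: 'g set)"
  and x: "x : centralizer b" "!!y. y : centralizer b ==> killing_form UNIV x y = 0"
 shows "x = 0"
proof -
 let ?G = "{ad y z |y z. y : b}"
 let ?V = "lie.span ?G"
 have "ALL y:b. ALL v:?V. ad y v : ?V" by (auto intro: lie.span_base)
 then obtain W where W: "lie.subspace W" "ALL y:b. ALL w:W. ad y w : W" "direct_sum UNIV ?V W"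
  using red lie.subspace_span[of ?G] unfolding reductive_in_def by blast
 have Wc: "W \<subseteq> centralizer b"
 proof
  fix w assume w: "w : W"
  have "ad w y = 0" if y: "y : b" for y
  proof -
   have "ad y w : ?V" by (rule lie.span_base) (use y in blast)
   hence "ad y w = 0" using W(2,3) y w unfolding direct_sum_def by blast
   thus ?thesis using bracket_anti[of w y] by simp
  qed
  thus "w : centralizer b" unfolding centralizer_def by blast
 qed
 have kV: "killing_form UNIV x v = 0" if v: "v : ?V" for v
 proof (rule killing_zero_subspace[OF subalgebra_UNIV UNIV_I subset_UNIV _ v])
  fix u assume "u : ?G"
  then obtain y z where yz: "u = ad y z" "y : b" by blast
  have "ad x y = 0" using x(1) yz(2) unfolding centralizer_def by blast
  thus "killing_form UNIV x u = 0" unfolding yz(1) using killing_UNIV_inv[of x y z] by simp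
 qed
 have "killing_form UNIV x g = 0" for g
 proof -
  have "g : {v + w |v w. v : ?V & w : W}" using W(3) unfolding direct_sum_def by blast
  then obtain v w where vw: "g = v + w" "v : ?V" "w : W" by blast
  have "killing_form UNIV x w = 0" using x(2) Wc vw(3) by blast
  thus ?thesis unfolding vw(1) killing_UNIV using kV[OF vw(2)] by simp
 qed
 thus ?thesis using nd unfolding killing_nondeg_def by blast
qed

lemma centralizer_subspace: "lie.subspace (centralizer b)"
 unfolding centralizer_def by (rule lie.subspaceI) (simp_all add: bracket_simps)

text \<open>The centralizer contains the Jordan parts of its elements. If the semisimple parts all vanished, the Killing form
 would vanish on it by polarization.\<close>

lemma centralizer_semisimple_element:
 assumes nd: "killing_nondeg (UNIV :: 'g::complex_lie_algebra set)" and red: "reductive_in (b :: 'g set)"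
  and ne: "centralizer b ~= {0}"
 shows "EX s:centralizer b. s ~= 0 & diagonalizable_on UNIV s"
proof (rule ccontr)
 assume no: "~ ?thesis"
 have nil: "ad_nilpotent_on UNIV x" if x: "x : centralizer b" for x
 proof -
  obtain s where s: "!!c v. v : UNIV ==> gen_eig (ad x) c v ==> ad s v = c *. v"
   using jordan_part[OF nd UNIV_I, of x] by blast
  have "ad s y = 0" if "y : b" for y
  proof -
   have "ad x y = 0 *. y" using x that unfolding centralizer_def by simp
   thus ?thesis using s[OF UNIV_I gen_eig_eigenvector] by fastforce
  qed
  hence "s : centralizer b" unfolding centralizer_def by blast
  moreover have "diagonalizable_on UNIV s" by (rule jordan_part_diagonalizable[OF subalgebra_UNIV UNIV_I s])
  ultimately have "s = 0" using no by blast
  thus ?thesis using nilpotent_part[OF nd UNIV_I UNIV_I s] by simp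
 qed
 have "x = 0" if x: "x : centralizer b" for x
 proof (rule centralizer_killing_nondeg[OF nd red x])
  fix y assume y: "y : centralizer b"
  show "killing_form UNIV x y = 0"
   by (rule killing_nilpotent_sum[OF subalgebra_UNIV UNIV_I UNIV_I nil[OF x] nil[OF y]
      nil[OF lie.subspace_add[OF centralizer_subspace x y]]])
 qed
 thus False using ne lie.subspace_0[OF centralizer_subspace] by blast
qed

lemma lie_aut_centralizer:
 assumes "lie_aut \<phi>" shows "\<phi> ` centralizer S = centralizer (\<phi> ` S)"
proof -
 note d = lie_autD[OF assms]
 show ?thesis
 proof
  show "\<phi> ` centralizer S \<subseteq> centralizer (\<phi> ` S)"
   unfolding centralizer_def using d(3,6) by (auto simp: d(3)[symmetric])
  show "centralizer (\<phi> ` S) \<subseteq> \<phi> ` centralizer S"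
  proof
   fix y assume y: "y : centralizer (\<phi> ` S)"
   obtain x where x: "y = \<phi> x" using d(2) by (metis bij_pointE)
   have "\<phi> (ad x s) = 0" if "s : S" for s using y that unfolding x centralizer_def d(3) by blast
   thus "y : \<phi> ` centralizer S" unfolding x centralizer_def using d(6) by blast
  qed
 qed
qed

context g2
begin

lemma reg_root:
 assumes M: "subalgebra m" and st: "ALL h:HH. ALL x:m. ad h x : m" and ss: "semisimple_lie m" and ne: "m ~= {0}"
 shows "EX r:g2_roots. E r : m"
proof (rule ccontr)
 assume no: "~ ?thesis"
 have "y = 0" if y: "y : m" for y
 proof -
  obtain z x where zx: "z : HH" "z : m" "y = z + (SUM t:g2_roots. x t *. E t)" "!!t. t : g2_roots ==> x t ~= 0 ==> E t : m"
   by (rule reg_components[OF M st ss y]) blast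
  have "x t *. E t = 0" if "t : g2_roots" for t using zx(4)[OF that] no that by auto
  hence "(SUM t:g2_roots. x t *. E t) = 0" by (intro sum.neutral) blast
  moreover have "z = 0" by (rule reg_separate[OF M st ss zx(2,1)]) (use no in blast)
  ultimately show ?thesis using zx(3) by simp
 qed
 thus False using ne lie.subspace_0[OF subalgebraD(1)[OF M]] by blast
qed

text \<open>Semisimple elements of the two members span a Cartan subalgebra that normalizes both.\<close>

theorem dual_pair_frame:
 assumes dp: "semisimple_dual_pair (a :: 'g set) b" and ne: "a ~= {0}" "b ~= {0}"
 shows "EX h0' h1' E' r s. g2 h0' h1' E' & r : g2_roots & s : g2_roots & cartan_int r s = 0 &
  a = g2.slr h0' h1' E' r & b = g2.slr h0' h1' E' s"
proof -
 have ab: "a = centralizer b" "b = centralizer a" and red: "reductive_in a" "reductive_in b"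
  and ss: "semisimple_lie a" "semisimple_lie b"
  using dp unfolding semisimple_dual_pair_def dual_pair_def by blast+
 have A: "subalgebra a" "subalgebra b" using ss unfolding semisimple_lie_def by blast+
 note N = subalgebraD[OF A(1)] and N' = subalgebraD[OF A(2)]
 have comm: "ad x y = 0" "ad y x = 0" if "x : a" "y : b" for x y
  using that ab(1) bracket_anti[of y x] unfolding centralizer_def by auto
 obtain s where s: "s : a" "s ~= 0" "diagonalizable_on UNIV s"
  using centralizer_semisimple_element[OF nd red(2)] ne(1) unfolding ab(1)[symmetric] by blast
 obtain t where t: "t : b" "t ~= 0" "diagonalizable_on UNIV t"
  using centralizer_semisimple_element[OF nd red(1)] ne(2) unfolding ab(2)[symmetric] by blast
 have "a \<inter> b = {0}"
 proof -
  let ?I = "a \<inter> b"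
  have "lie_ideal a ?I" unfolding lie_ideal_def
   using lie.subspace_inter[OF N(1) N'(1)] comm(1) lie.subspace_0[OF N(1)] lie.subspace_0[OF N'(1)] by auto
  moreover have "solvable_lie ?I"
  proof -
   have "{ad x y |x y. x : ?I & y : ?I} \<subseteq> {0}" using comm(1) by blast
   hence "bracket_span ?I ?I \<subseteq> lie.span {0}" unfolding bracket_span_def by (rule lie.span_mono)
   moreover have "0 : bracket_span ?I ?I" unfolding bracket_span_def by (rule lie.span_zero)
   ultimately have "bracket_span ?I ?I = {0}" by auto
   thus ?thesis unfolding solvable_lie_def by (intro exI[of _ 1]) simp
  qed
  ultimately show ?thesis using ss(1) unfolding semisimple_lie_def by blast
 qed
 hence "k *. t ~= s" for k using s(1,2) lie.subspace_scale[OF N'(1) t(1)] by blast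
 hence "s ~: lie.span {t}" "s ~= t" unfolding lie.span_singleton using scaleC_one[of t] by (blast, metis)
 hence ind: "lie.independent {s, t}" "card {s, t} = 2" using t(2) by (simp_all add: lie.independent_insert)
 obtain T where T: "cartan_subalgebra UNIV T" "s : T" "t : T" using toral_extension[OF nd s(3) t(3) comm(1)[OF s(1) t(1)]] by blast
 obtain h0' h1' E' where f: "g2 h0' h1' E'" "lie.span {h0', h1'} = T" using frame_of_cartan[OF T(1)] by blast
 interpret f: g2 h0' h1' E' by (rule f(1))
 have "lie.dim T <= card {h0', h1'}" by (rule lie.dim_le_card) (use f(2) in auto)
 also have "... <= 2" by (rule order_trans[OF card_insert_le_m1]) auto
 finally have "lie.dim T <= card {s, t}" using ind(2) by simp
 hence Tst: "T \<subseteq> lie.span {s, t}" using fin.card_ge_dim_independent[OF _ ind(1)] T(2,3) by blast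
 have sta: "ALL h:f.HH. ALL x:a. ad h x : a"
 proof (intro ballI)
  fix h x assume h: "h : f.HH" and x: "x : a"
  obtain p q where "h = p *. s + q *. t" using h Tst f(2) span_pair by blast
  hence "ad h x = p *. ad s x" using comm(2)[OF x t(1)] by (simp add: bracket_simps)
  thus "ad h x : a" using lie.subspace_scale[OF N(1) N(2)[OF s(1) x]] by simp
 qed
 have stb: "ALL h:f.HH. ALL x:b. ad h x : b"
 proof (intro ballI)
  fix h x assume h: "h : f.HH" and x: "x : b"
  obtain p q where "h = p *. s + q *. t" using h Tst f(2) span_pair by blast
  hence "ad h x = q *. ad t x" using comm(1)[OF s(1) x] by (simp add: bracket_simps)
  thus "ad h x : b" using lie.subspace_scale[OF N'(1) N'(2)[OF t(1) x]] by simp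
 qed
 obtain r where r: "r : g2_roots" "E' r : a" using f.reg_root[OF A(1) sta ss(1) ne(1)] by blast
 obtain q where q: "q : g2_roots" "E' q : b" using f.reg_root[OF A(2) stb ss(2) ne(2)] by blast
 note rs = f.reg_symmetric[OF A(1) sta ss(1) r] and qs = f.reg_symmetric[OF A(2) stb ss(2) q]
 have "ad (f.hr r) (E' q) = 0" by (rule comm(1)[OF rs(2) q(2)])
 hence o: "cartan_int r q = 0" using f.hr_E[OF q(1)] f.frameD(1)[OF q(1)] by simp
 have o': "cartan_int q r = 0" using g2_orthogonal r(1) q(1) o by blast
 have 1: "f.slr r \<subseteq> a" by (rule f.slr_minimal[OF N(1) r(2) rs(2,1)])
 have 2: "f.slr q \<subseteq> b" by (rule f.slr_minimal[OF N'(1) q(2) qs(2,1)])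
 have "a \<subseteq> centralizer (f.slr q)" using 2 comm(1) unfolding centralizer_def by blast
 hence a: "a = f.slr r" using 1 f.centralizer_slr[OF q(1) r(1) o'] by blast
 have "b \<subseteq> centralizer (f.slr r)" using 1 comm(2) unfolding centralizer_def by blast
 hence "b = f.slr q" using 2 f.centralizer_slr[OF r(1) q(1) o] by blast
 thus ?thesis using f(1) r(1) q(1) o a by blast
qed

text \<open>It suffices to conjugate the long triples, because the other members are the centralizers.\<close>

theorem slr_conj:
 assumes g: "g2 h0' h1' (E' :: int \<times> int => 'g)"
  and r: "r : g2_roots" "sqlen r = 3" and s: "s : g2_roots" "cartan_int r s = 0"
  and r': "r' : g2_roots" "sqlen r' = 3" and s': "s' : g2_roots" "cartan_int r' s' = 0"
 shows "EX \<phi>:adjoint_group. lie_aut \<phi> & \<phi> ` g2.slr h0' h1' E' r' = slr r & \<phi> ` g2.slr h0' h1' E' s' = slr s"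
proof -
 interpret g: g2 h0' h1' E' by (rule g)
 obtain \<phi> c where \<phi>: "\<phi> : nil_group" "c ~= 0" "\<phi> (E' r') = c *. E r" "\<phi> (g.hr r') = hr r"
   "\<phi> (E' (rneg r')) = (1 / c) *. E (rneg r)"
  using long_triple_conj[OF simple nil_generated_g2 nd g.long_triple_E[OF r'] long_triple_E[OF r]] by blast
 note a = nil_group_aut[OF simple \<phi>(1)]
 have "\<phi> ` g.slr r' = lie.span {c *. E r, hr r, (1 / c) *. E (rneg r)}"
  unfolding g.slr_def lie_aut_span[OF a] using \<phi>(3-5) by simp
 also have "... = slr r"
 proof
  show "lie.span {c *. E r, hr r, (1 / c) *. E (rneg r)} \<subseteq> slr r"
   by (rule lie.span_minimal[OF _ slr_subspace]) (use slr_facts(6-8)[OF r(1)] lie.subspace_scale[OF slr_subspace] in auto)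
  show "slr r \<subseteq> lie.span {c *. E r, hr r, (1 / c) *. E (rneg r)}"
  proof (rule slr_minimal[OF lie.subspace_span])
   show "E r : lie.span {c *. E r, hr r, (1 / c) *. E (rneg r)}"
    by (rule E_scale[OF lie.subspace_span _ \<phi>(2)]) (simp add: lie.span_base)
   show "hr r : lie.span {c *. E r, hr r, (1 / c) *. E (rneg r)}" by (simp add: lie.span_base)
   show "E (rneg r) : lie.span {c *. E r, hr r, (1 / c) *. E (rneg r)}"
    by (rule E_scale[OF lie.subspace_span, of "1 / c"]) (use \<phi>(2) in \<open>simp_all add: lie.span_base\<close>)
  qed
 qed
 finally have 1: "\<phi> ` g.slr r' = slr r" .
 have "\<phi> ` g.slr s' = slr s"
  unfolding g.centralizer_slr[OF r'(1) s', symmetric] lie_aut_centralizer[OF a] 1 by (rule centralizer_slr[OF r(1) s])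
 thus ?thesis using 1 a nil_group_adjoint[OF \<phi>(1)] by blast
qed

lemma slsum_conj:
 assumes "lie_aut \<phi>" "\<phi> ` A = slr r" "\<phi> ` B = slr s"
 shows "\<phi> ` {a + b | a b. a : A & b : B} = slsum r s"
proof
 note d = lie_autD[OF assms(1)]
 show "\<phi> ` {a + b | a b. a : A & b : B} \<subseteq> slsum r s"
  unfolding slsum_def using d(5) assms(2,3) by blast
 show "slsum r s \<subseteq> \<phi> ` {a + b | a b. a : A & b : B}"
 proof
  fix y assume "y : slsum r s"
  then obtain a b where ab: "y = a + b" "a : slr r" "b : slr s" unfolding slsum_def by blast
  then obtain x z where xz: "x : A" "a = \<phi> x" "z : B" "b = \<phi> z" using assms(2,3) by blast
  have "y = \<phi> (x + z)" using ab(1) xz d(5) by simp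
  thus "y : \<phi> ` {a + b | a b. a : A & b : B}" using xz(1,3) by blast
 qed
qed

lemma regular_frame:
 assumes "regular_A1_A1 H (m :: 'g set)"
 shows "EX h0' h1' E' r s. g2 h0' h1' E' & lie.span {h0', h1'} = H & r : g2_roots & s : g2_roots &
  sqlen r = 3 & cartan_int r s = 0 & m = g2.slsum h0' h1' E' r s"
proof -
 have "cartan_subalgebra UNIV H" using assms unfolding regular_A1_A1_def regular_wrt_def by blast
 then obtain h0' h1' E' where f: "g2 h0' h1' E'" "lie.span {h0', h1'} = H" using frame_of_cartan by blast
 interpret f: g2 h0' h1' E' by (rule f(1))
 have "regular_A1_A1 f.HH m" using assms f(2) by simp
 from f.reg_A1_A1[OF this] show ?thesis using f by blast
qed

lemma long_short_exists:
 assumes r: "r : g2_roots" "sqlen r = 3" and s: "s : g2_roots" "cartan_int r s = 0"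
 shows "long_short_ideals HH (slsum r s) (slr r) (slr s)"
proof -
 have s1: "sqlen s = 1" using g2_orthogonal r s by fastforce
 have "root_spaces_pm HH (al r) \<subseteq> slsum r s" "root_spaces_pm HH (al s) \<subseteq> slsum r s"
  using root_spaces_pm_al(1)[OF r(1)] root_spaces_pm_al(1)[OF s(1)] slsum_sup by blast+
 moreover have "long_root UNIV HH (al r)" using long_root_iff r by blast
 moreover have "short_root UNIV HH (al s)" using short_root_iff s(1) s1 by blast
 ultimately show ?thesis
  unfolding long_short_ideals_def
  using slsum_regular[OF r(1) s] ideal_generated_slr[OF r(1) slr_ideals(1)[OF r(1) s]]
   ideal_generated_slr[OF s(1) slr_ideals(2)[OF r(1) s]] by metis
qed

lemma long_short_unique:
 assumes ls: "long_short_ideals HH m A B"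
 shows "EX r s. r : g2_roots & s : g2_roots & sqlen r = 3 & cartan_int r s = 0 & m = slsum r s & A = slr r & B = slr s"
proof -
 obtain \<alpha> \<beta> where \<alpha>: "long_root UNIV HH \<alpha>" "root_spaces_pm HH \<alpha> \<subseteq> m" "A = ideal_generated m (root_spaces_pm HH \<alpha>)"
  and \<beta>: "short_root UNIV HH \<beta>" "root_spaces_pm HH \<beta> \<subseteq> m" "B = ideal_generated m (root_spaces_pm HH \<beta>)"
  and reg: "regular_A1_A1 HH m"
  using ls unfolding long_short_ideals_def by blast
 obtain r s where rs: "r : g2_roots" "s : g2_roots" "sqlen r = 3" "cartan_int r s = 0" "m = slsum r s"
  using reg_A1_A1[OF reg] by blast
 obtain p where p: "p : g2_roots" "sqlen p = 3" "\<alpha> = al p" using \<alpha>(1) long_root_iff by blast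
 obtain q where q: "q : g2_roots" "sqlen q = 1" "\<beta> = al q" using \<beta>(1) short_root_iff by blast
 have s1: "sqlen s = 1" using g2_orthogonal rs by fastforce
 have len: "sqlen (rneg r) = 3" "sqlen (rneg s) = 1" using bspec[OF g2_basic rs(1)] bspec[OF g2_basic rs(2)] rs(3) s1 by simp_all
 have "E p : slsum r s" using \<alpha>(2) root_spaces_pm_al(2)[OF p(1)] p(3) rs(5) by blast
 hence pr: "p = r | p = rneg r" using slsum_root[OF rs(1,2,4) p(1)] p(2) s1 len by auto
 have "E q : slsum r s" using \<beta>(2) root_spaces_pm_al(2)[OF q(1)] q(3) rs(5) by blast
 hence qs: "q = s | q = rneg s" using slsum_root[OF rs(1,2,4) q(1)] q(2) rs(3) len by auto
 have sl: "slr p = slr r" "slr q = slr s" using pr qs slr_neg[OF rs(1)] slr_neg[OF rs(2)] by auto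
 have "A = slr r"
  unfolding \<alpha>(3) p(3) sl(1)[symmetric] by (rule ideal_generated_slr[OF p(1)]) (use slr_ideals(1)[OF rs(1,2,4)] sl(1) rs(5) in simp)
 moreover have "B = slr s"
  unfolding \<beta>(3) q(3) sl(2)[symmetric] by (rule ideal_generated_slr[OF q(1)]) (use slr_ideals(2)[OF rs(1,2,4)] sl(2) rs(5) in simp)
 ultimately show ?thesis using rs by blast
qed

lemma pair_properties:
 assumes r: "r : g2_roots" "sqlen r = 3" and s: "s : g2_roots" "cartan_int r s = 0"
 shows "direct_sum (slsum r s) (slr r) (slr s) & of_type (slr r) type_A1 & has_index (slr r) 1 &
  of_type (slr s) type_A1 & has_index (slr s) 3 & semisimple_dual_pair (slr r) (slr s) & slr r ~= {0} & slr s ~= {0} &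
  (ALL \<aa> \<bb>. semisimple_dual_pair \<aa> \<bb> & \<aa> ~= {0} & \<bb> ~= {0} -->
    (EX \<phi>:adjoint_group. (\<phi> ` \<aa> = slr r & \<phi> ` \<bb> = slr s) | (\<phi> ` \<aa> = slr s & \<phi> ` \<bb> = slr r)))"
proof (intro conjI allI impI)
 have s1: "sqlen s = 1" using g2_orthogonal r s by fastforce
 show "direct_sum (slsum r s) (slr r) (slr s)" by (rule slsum_direct[OF r(1) s])
 show "of_type (slr r) type_A1" "of_type (slr s) type_A1" by (rule slr_facts(3)[OF r(1)], rule slr_facts(3)[OF s(1)])
 show "has_index (slr r) 1" by (rule slr_index[OF r(1)]) (simp add: \<kappa>_hr_values(1)[OF r])
 show "has_index (slr s) 3" by (rule slr_index[OF s(1)]) (simp add: \<kappa>_hr_values(2)[OF s(1) s1])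
 show "semisimple_dual_pair (slr r) (slr s)" by (rule slr_dual_pair[OF r(1) s])
 show "slr r ~= {0}" "slr s ~= {0}" by (rule slr_facts(4)[OF r(1)], rule slr_facts(4)[OF s(1)])
 fix a b :: "'g set" assume ab: "semisimple_dual_pair a b & a ~= {0} & b ~= {0}"
 then obtain h0' h1' E' p q where f: "g2 h0' h1' E'" "p : g2_roots" "q : g2_roots" "cartan_int p q = 0"
  "a = g2.slr h0' h1' E' p" "b = g2.slr h0' h1' E' q" using dual_pair_frame[of a b] by blast
 have o: "cartan_int q p = 0" "sqlen p + sqlen q = 4" using g2_orthogonal f(2-4) by blast+
 have "sqlen p = 3 | sqlen q = 3" using bspec[OF g2_basic f(2)] o(2) by auto
 thus "EX \<phi>:adjoint_group. (\<phi> ` a = slr r & \<phi> ` b = slr s) | (\<phi> ` a = slr s & \<phi> ` b = slr r)"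
 proof
  assume "sqlen p = 3"
  from slr_conj[OF f(1) r s f(2) this f(3,4)] show ?thesis unfolding f(5,6) by blast
 next
  assume "sqlen q = 3"
  from slr_conj[OF f(1) r s f(3) this f(2) o(1)] show ?thesis unfolding f(5,6) by blast
 qed
qed

end

theorem mainTheorem1:
  assumes "simple_lie (UNIV :: 'g::complex_lie_algebra set)"
    and "of_type (UNIV :: 'g set) type_G2"
  shows "(\<exists>H (\<mm> :: 'g set). regular_A1_A1 H \<mm>) \<and>
    (\<forall>H H' (\<mm> :: 'g set) \<mm>'. regular_A1_A1 H \<mm> \<and> regular_A1_A1 H' \<mm>' \<longrightarrow>
       (\<exists>\<phi>\<in>adjoint_group. \<phi> ` \<mm>' = \<mm>)) \<and>
    (\<forall>H (\<mm> :: 'g set). regular_A1_A1 H \<mm> \<longrightarrow>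
       (\<exists>A1 A1t. long_short_ideals H \<mm> A1 A1t)) \<and>
    (\<forall>H (\<mm> :: 'g set) A1 A1t. long_short_ideals H \<mm> A1 A1t \<longrightarrow>
       direct_sum \<mm> A1 A1t \<and>
       of_type A1 type_A1 \<and> has_index A1 1 \<and>
       of_type A1t type_A1 \<and> has_index A1t 3 \<and>
       semisimple_dual_pair A1 A1t \<and> A1 \<noteq> {0} \<and> A1t \<noteq> {0} \<and>
       (\<forall>\<aa> \<bb>. semisimple_dual_pair \<aa> \<bb> \<and> \<aa> \<noteq> {0} \<and> \<bb> \<noteq> {0} \<longrightarrow>
          (\<exists>\<phi>\<in>adjoint_group.
             (\<phi> ` \<aa> = A1 \<and> \<phi> ` \<bb> = A1t) \<or> (\<phi> ` \<aa> = A1t \<and> \<phi> ` \<bb> = A1))))"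
proof -
 note nd = g2_frame_exists(1)[OF assms]
 obtain h0 h1 :: 'g and E where fr: "g2_frame h0 h1 E" "cartan_subalgebra UNIV (lie.span {h0, h1})"
  using g2_frame_exists(2)[OF assms] by blast
 interpret g2 h0 h1 E by unfold_locales (rule assms(1), rule nd, rule fr(1), rule fr(2))
 have ex: "EX H (\<mm> :: 'g set). regular_A1_A1 H \<mm>"
 proof -
  have "(0, 1) : g2_roots" "(2, 1) : g2_roots" "cartan_int (0, 1) (2, 1) = 0" by (simp_all add: g2_defs)
  from slsum_regular[OF this] show ?thesis by blast
 qed
 have conj: "EX \<phi>:adjoint_group. \<phi> ` m' = m" if m: "regular_A1_A1 H m" "regular_A1_A1 H' m'" for H H' m m' :: "'g set"
 proof -
  from regular_frame[OF m(1)] obtain k0 k1 F r s where f: "g2 k0 k1 F" "r : g2_roots" "s : g2_roots"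
   "sqlen r = 3" "cartan_int r s = 0" "m = g2.slsum k0 k1 F r s" by blast
  from regular_frame[OF m(2)] obtain k0' k1' F' r' s' where f': "g2 k0' k1' F'" "r' : g2_roots" "s' : g2_roots"
   "sqlen r' = 3" "cartan_int r' s' = 0" "m' = g2.slsum k0' k1' F' r' s'" by blast
  from g2.slr_conj[OF f(1) f'(1) f(2,4,3,5) f'(2,4,3,5)] obtain \<phi> where \<phi>: "\<phi> : adjoint_group" "lie_aut \<phi>"
   "\<phi> ` g2.slr k0' k1' F' r' = g2.slr k0 k1 F r" "\<phi> ` g2.slr k0' k1' F' s' = g2.slr k0 k1 F s" by blast
  have "\<phi> ` m' = m" unfolding f(6) f'(6) g2.slsum_def[OF f'(1)] by (rule g2.slsum_conj[OF f(1) \<phi>(2-4)])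
  thus ?thesis using \<phi>(1) by blast
 qed
 have ideals: "EX A1 A1t. long_short_ideals H m A1 A1t" if m: "regular_A1_A1 H m" for H m :: "'g set"
 proof -
  from regular_frame[OF m] obtain k0 k1 F r s where f: "g2 k0 k1 F" "lie.span {k0, k1} = H" "r : g2_roots" "s : g2_roots"
   "sqlen r = 3" "cartan_int r s = 0" "m = g2.slsum k0 k1 F r s" by blast
  from g2.long_short_exists[OF f(1,3,5,4,6)] show ?thesis unfolding f(2) f(7)[symmetric] by blast
 qed
 have frame: "EX k0 k1 F r s. g2 k0 k1 F & r : g2_roots & s : g2_roots & sqlen r = 3 & cartan_int r s = 0 &
   m = g2.slsum k0 k1 F r s & A = g2.slr k0 k1 F r & B = g2.slr k0 k1 F s"
  if ls: "long_short_ideals H m A B" for H m A B :: "'g set"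
 proof -
  have "regular_A1_A1 H m" using ls unfolding long_short_ideals_def by blast
  from regular_frame[OF this] obtain k0 k1 F where f: "g2 k0 k1 F" "lie.span {k0, k1} = H" by blast
  show ?thesis using g2.long_short_unique[OF f(1), unfolded f(2), OF ls] f(1) by blast
 qed
 have pairs: "direct_sum m A B & of_type A type_A1 & has_index A 1 & of_type B type_A1 & has_index B 3 &
   semisimple_dual_pair A B & A ~= {0} & B ~= {0} &
   (ALL \<aa> \<bb>. semisimple_dual_pair \<aa> \<bb> & \<aa> ~= {0} & \<bb> ~= {0} -->
    (EX \<phi>:adjoint_group. (\<phi> ` \<aa> = A & \<phi> ` \<bb> = B) | (\<phi> ` \<aa> = B & \<phi> ` \<bb> = A)))"
  if ls: "long_short_ideals H m A B" for H m A B :: "'g set"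
 proof -
  from frame[OF ls] obtain k0 k1 F r s where f: "g2 k0 k1 F" "r : g2_roots" "s : g2_roots" "sqlen r = 3"
   "cartan_int r s = 0" "m = g2.slsum k0 k1 F r s" "A = g2.slr k0 k1 F r" "B = g2.slr k0 k1 F s" by blast
  show ?thesis using g2.pair_properties[OF f(1,2,4,3,5)] unfolding f(6-8) .
 qed
 show ?thesis
  using ex conj ideals pairs by (intro conjI allI impI ex) (erule conjE, erule (1) conj, erule ideals, (drule pairs, blast)+)
qed

end
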